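(* Let $n=2m$ be an even positive integer, let $1\le k\le m$ be such that either $k=m$ or $k$ is odd, and let $\mathcal Fl^{n-k,k}_D$ be the $(n-k,k)$ Springer fiber of type $D$. There exists a homeomorphism $\mathcal S^{n-k,k}_D\cong\mathcal Fl^{n-k,k}_D$, where $\mathcal S^{n-k,k}_D=\bigcup_{a\in\mathbb B^{n-k,k}}S_a\subseteq(\mathbb S^2)^m$ is the $(n-k,k)$ topological Springer fiber of type $D$, such that the image of $S_a$ is an irreducible component of $\mathcal Fl^{n-k,k}_D$ for every $a\in\mathbb B^{n-k,k}$.
   Context: Springer fiber of type $D$: let $\beta_D$ be a nondegenerate symmetric bilinear form on $\mathbb C^n$, $n=2m$, and let $x$ be a nilpotent endomorphism of $\mathbb C^n$ with two Jordan blocks of sizes $n-k$ and $k$ satisfying $\beta_D(xv,w)=-\beta_D(v,xw)$ for all $v,w$. (Such $x$ exists exactly when $k=m$ or $k$ is odd.) Then $\mathcal Fl^{n-k,k}_D$ is the projective variety of all flags $\{0\}=F_0\subsetneq F_1\subsetneq\dots\subsetneq F_m$ of subspaces of $\mathbb C^n$ with $\dim F_i=i$, $F_m$ isotropic for $\beta_D$ (i.e. $\beta_D$ vanishes on $F_m\times F_m$), and $xF_i\subseteq F_{i-1}$ for $i=1,\dots,m$. Up to isomorphism it depends only on $(n-k,k)$. As a topological space it carries the classical (Euclidean) topology; irreducible components are taken in the Zariski topology. Cup diagrams: take a rectangle in the plane with $m$ vertices labelled $1,\dots,m$ from left to right on its upper horizontal edge. A cup diagram is a non-intersecting diagram inside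 the rectangle obtained by attaching lower semicircles (cups), each joining two vertices, and vertical line segments (rays), each joining a vertex to the lower horizontal edge, so that every vertex is joined to exactly one endpoint of a cup or ray. In addition, any cup or ray which can be connected to the right edge of the rectangle by a path inside the rectangle not intersecting any other part of the diagram may (but need not) be decorated with a single dot. Diagrams are considered equal if their cups and rays are incident with the same vertices and the dots are distributed in the same way. $\mathbb B^{n-k,k}$ is the set of cup diagrams on $m$ vertices with exactly $\lfloor k/2\rfloor$ cups. Let $\mathbb S^2\subseteq\mathbb R^3$ be the unit sphere, $p=(0,0,1)$, $q=(1,0,0)$. For $a\in\mathbb B^{n-k,k}$, $S_a\subseteq(\mathbb S^2)^m$ is the set of all $(x_1,\dots,x_m)$ with: $x_i=-x_j$ if $i,j$ are connected by an undotted cup; $x_i=x_j$ if $i,j$ are connected by a dotted cup; $x_i=p$ if $i$ is connected to a dotted ray; $x_i=-p$ if $i$ is connected to an undotted ray which is the rightmost ray of $a$; $x_i=q$ if $i$ is connected to an undotted ray which is not the rightmost ray of $a$. *)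

theory Defs
  imports "HOL-Analysis.Analysis"
begin

section \<open>Flags and their two topologies\<close>

text \<open>Complex subspaces, spans and dimensions in \<open>complex ^ 'n\<close> are those of \<open>vec\<close>; the
  unqualified \<open>subspace\<close>, \<open>span\<close> and \<open>dim\<close> would refer to the underlying real vector space.\<close>

definition flags :: "nat \<Rightarrow> (nat \<Rightarrow> (complex ^ 'n) set) set" where
  "flags m = {F \<in> {0..m} \<rightarrow>\<^sub>E {V. vec.subspace V}.
     F 0 = {0} \<and> (\<forall>i<m. F i \<subset> F (Suc i)) \<and> (\<forall>i\<le>m. vec.dim (F i) = i)}"

definition frames :: "nat \<Rightarrow> (nat \<Rightarrow> complex ^ 'n) set" where
  "frames m = {v \<in> extensional {1..m}. inj_on v {1..m} \<and> vec.independent (v ` {1..m})}"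

definition flag_of :: "nat \<Rightarrow> (nat \<Rightarrow> complex ^ 'n) \<Rightarrow> nat \<Rightarrow> (complex ^ 'n) set" where
  "flag_of m v = (\<lambda>i\<in>{0..m}. vec.span (v ` {1..i}))"

definition frame_topology :: "nat \<Rightarrow> (nat \<Rightarrow> complex ^ 'n) topology" where
  "frame_topology m = subtopology (product_topology (\<lambda>_. euclidean) {1..m}) (frames m)"

text \<open>The classical topology: the quotient topology along the surjection \<open>flag_of m\<close> from the
  (noncompact) Stiefel manifold \<open>frames m\<close>.\<close>

definition flag_topology :: "nat \<Rightarrow> (nat \<Rightarrow> (complex ^ 'n) set) topology" where
  "flag_topology m = topology (\<lambda>U. U \<subseteq> flags m \<and>
     openin (frame_topology m) {v \<in> frames m. flag_of m v \<in> U})"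

lemma openin_flag_topology:
  fixes U :: "(nat \<Rightarrow> (complex ^ 'n) set) set"
  shows "openin (flag_topology m) U \<longleftrightarrow>
    U \<subseteq> flags m \<and> openin (frame_topology m) {v \<in> frames m. flag_of m v \<in> U}"
proof -
  let ?P = "\<lambda>U :: (nat \<Rightarrow> (complex ^ 'n) set) set. U \<subseteq> flags m \<and>
    openin (frame_topology m) {v \<in> frames m. flag_of m v \<in> U}"
  have "?P (S \<inter> T)" if "?P S" "?P T" for S T
  proof -
    have "{v \<in> frames m. flag_of m v \<in> S \<inter> T} =
        {v \<in> frames m. flag_of m v \<in> S} \<inter> {v \<in> frames m. flag_of m v \<in> T}"
      by auto
    then show ?thesis
      using that by auto
  qed
  moreover have "?P (\<Union>\<K>)" if "\<forall>K\<in>\<K>. ?P K" for \<K>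
  proof -
    have "{v \<in> frames m. flag_of m v \<in> \<Union>\<K>} = (\<Union>K\<in>\<K>. {v \<in> frames m. flag_of m v \<in> K})"
      by auto
    then show ?thesis
      using that by auto
  qed
  ultimately have "istopology ?P"
    unfolding istopology_def by blast
  then show ?thesis
    unfolding flag_topology_def by (simp only: topology_inverse')
qed

lemma flag_of_in_flags:
  assumes "v \<in> frames m"
  shows "flag_of m v \<in> flags m"
proof -
  have inj: "inj_on v {1..i}" and ind: "vec.independent (v ` {1..i})" if "i \<le> m" for i
  proof -
    have sub: "{1..i} \<subseteq> {1..m}" using that by auto
    have *: "inj_on v {1..m}" "vec.independent (v ` {1..m})"
      using assms unfolding frames_def by blast+
    show "inj_on v {1..i}"
      by (rule inj_on_subset[OF *(1) sub])
    show "vec.independent (v ` {1..i})"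
      by (rule vec.independent_mono[OF *(2) image_mono[OF sub]])
  qed
  have dim: "vec.dim (vec.span (v ` {1..i})) = i" if "i \<le> m" for i
    using vec.dim_span_eq_card_independent[OF ind[OF that]] card_image[OF inj[OF that]] by simp
  have "vec.span (v ` {1..i}) \<subset> vec.span (v ` {1..Suc i})" if "i < m" for i
  proof -
    have "vec.span (v ` {1..i}) \<subseteq> vec.span (v ` {1..Suc i})"
      by (intro vec.span_mono image_mono) auto
    moreover have "vec.dim (vec.span (v ` {1..i})) \<noteq> vec.dim (vec.span (v ` {1..Suc i}))"
      using that by (simp only: dim less_imp_le_nat Suc_leI)
    ultimately show ?thesis by (intro psubsetI notI) (simp_all only: simp_thms)
  qed
  with dim show ?thesis
    unfolding flags_def flag_of_def by (simp add: vec.subspace_span)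
qed

lemma topspace_frame_topology [simp]:
  "topspace (frame_topology m) = (frames m :: (nat \<Rightarrow> complex ^ 'n) set)"
proof -
  have "(frames m :: (nat \<Rightarrow> complex ^ 'n) set) \<subseteq> extensional {1..m}"
    unfolding frames_def by blast
  then show ?thesis
    by (simp add: frame_topology_def topspace_subtopology PiE_UNIV_domain PiE_def Int_absorb1
        del: One_nat_def)
qed

lemma topspace_flag_topology [simp]:
  "topspace (flag_topology m) = (flags m :: (nat \<Rightarrow> (complex ^ 'n) set) set)"
proof (rule subset_antisym)
  show "topspace (flag_topology m) \<subseteq> (flags m :: (nat \<Rightarrow> (complex ^ 'n) set) set)"
    using openin_topspace[of "flag_topology m"] unfolding openin_flag_topology by (rule conjunct1)
  have "{v \<in> frames m. flag_of m v \<in> flags m} =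
      topspace (frame_topology m :: (nat \<Rightarrow> complex ^ 'n) topology)"
    using flag_of_in_flags by auto
  then have "openin (frame_topology m)
      {v \<in> frames m. flag_of m v \<in> (flags m :: (nat \<Rightarrow> (complex ^ 'n) set) set)}"
    using openin_topspace[of "frame_topology m :: (nat \<Rightarrow> complex ^ 'n) topology"] by (rule ssubst)
  then have "openin (flag_topology m) (flags m :: (nat \<Rightarrow> (complex ^ 'n) set) set)"
    unfolding openin_flag_topology by blast
  then show "(flags m :: (nat \<Rightarrow> (complex ^ 'n) set) set) \<subseteq> topspace (flag_topology m)"
    by (rule openin_subset)
qed

text \<open>Pluecker coordinates: the \<open>length I\<close>-minors of the first \<open>length I\<close> vectors of a frame,
  for every list \<open>I\<close> of at most \<open>m\<close> rows.  The coordinates with \<open>length I = i\<close> are homogeneous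
  coordinates of the \<open>i\<close>-th subspace; lists that are unsorted or have repetitions only repeat
  coordinates up to sign, or add zeros.\<close>

definition plucker :: "nat \<Rightarrow> (nat \<Rightarrow> complex ^ 'n) \<Rightarrow> 'n list \<Rightarrow> complex" where
  "plucker m v I =
     (if length I \<le> m
      then \<Sum>\<sigma> | \<sigma> permutes {..<length I}.
             of_int (sign \<sigma>) * (\<Prod>i<length I. v (Suc (\<sigma> i)) $ (I ! i))
      else 0)"

inductive polynomial_map :: "(('a \<Rightarrow> complex) \<Rightarrow> complex) \<Rightarrow> bool" where
  coord: "polynomial_map (\<lambda>c. c i)"
| const: "polynomial_map (\<lambda>c. z)"
| add: "polynomial_map f \<Longrightarrow> polynomial_map g \<Longrightarrow> polynomial_map (\<lambda>c. f c + g c)"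
| mult: "polynomial_map f \<Longrightarrow> polynomial_map g \<Longrightarrow> polynomial_map (\<lambda>c. f c * g c)"

text \<open>The Zariski topology of the flag variety in its Pluecker embedding into a product of
  projective spaces.  A polynomial \<open>f\<close> need not be multihomogeneous here: as the frame of \<open>F\<close>
  varies, the homogeneous coordinates of the subspaces are rescaled independently, so \<open>f\<close>
  vanishes for every frame of \<open>F\<close> iff all multihomogeneous components of \<open>f\<close> vanish at \<open>F\<close>.\<close>

definition zariski_flag_topology :: "nat \<Rightarrow> (nat \<Rightarrow> (complex ^ 'n) set) topology" where
  "zariski_flag_topology m = topology_generated_by
     {{F \<in> flags m. \<exists>v\<in>frames m. flag_of m v = F \<and> f (plucker m v) \<noteq> 0} | f. polynomial_map f}"

definition irreducible_in :: "'a topology \<Rightarrow> 'a set \<Rightarrow> bool" where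
  "irreducible_in X S \<longleftrightarrow> S \<subseteq> topspace X \<and> S \<noteq> {} \<and>
     (\<forall>A B. closedin X A \<and> closedin X B \<and> S \<subseteq> A \<union> B \<longrightarrow> S \<subseteq> A \<or> S \<subseteq> B)"

definition irreducible_component_of :: "'a topology \<Rightarrow> 'a set \<Rightarrow> bool" where
  "irreducible_component_of X C \<longleftrightarrow>
     irreducible_in X C \<and> (\<forall>D. irreducible_in X D \<and> C \<subseteq> D \<longrightarrow> D = C)"


section \<open>The Springer fiber of type D\<close>

definition nondegenerate_symmetric_form :: "(complex ^ 'n \<Rightarrow> complex ^ 'n \<Rightarrow> complex) \<Rightarrow> bool" where
  "nondegenerate_symmetric_form \<beta> \<longleftrightarrow>
     (\<forall>v. Vector_Spaces.linear (*s) (*) (\<beta> v)) \<and>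
     (\<forall>w. Vector_Spaces.linear (*s) (*) (\<lambda>v. \<beta> v w)) \<and>
     (\<forall>v w. \<beta> v w = \<beta> w v) \<and>
     (\<forall>v. (\<forall>w. \<beta> v w = 0) \<longrightarrow> v = 0)"

text \<open>In the basis \<open>b 0, \<dots>, b (r + s - 1)\<close> the matrix of \<open>x\<close> consists of two Jordan blocks with
  eigenvalue \<open>0\<close>, of sizes \<open>r\<close> and \<open>s\<close>.\<close>

definition nilpotent_two_blocks :: "(complex ^ 'n \<Rightarrow> complex ^ 'n) \<Rightarrow> nat \<Rightarrow> nat \<Rightarrow> bool" where
  "nilpotent_two_blocks x r s \<longleftrightarrow> Vector_Spaces.linear (*s) (*s) x \<and>
     (\<exists>b. inj_on b {..<r + s} \<and> vec.independent (b ` {..<r + s}) \<and> vec.span (b ` {..<r + s}) = UNIV \<and>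
          (\<forall>i<r + s. x (b i) = (if i = 0 \<or> i = r then 0 else b (i - 1))))"

definition springer_fiber ::
  "nat \<Rightarrow> (complex ^ 'n \<Rightarrow> complex ^ 'n \<Rightarrow> complex) \<Rightarrow> (complex ^ 'n \<Rightarrow> complex ^ 'n) \<Rightarrow>
   (nat \<Rightarrow> (complex ^ 'n) set) set" where
  "springer_fiber m \<beta> x =
     {F \<in> flags m. (\<forall>v\<in>F m. \<forall>w\<in>F m. \<beta> v w = 0) \<and> (\<forall>i\<in>{1..m}. x ` F i \<subseteq> F (i - 1))}"


section \<open>Cup diagrams\<close>

text \<open>Diagrams are drawn in the complex plane: vertex \<open>i\<close> is the point \<open>i\<close> of the real axis, and
  the rectangle is high enough that no semicircle meets its lower edge.\<close>

datatype strand = is_Cup: Cup nat nat | Ray nat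

fun ends :: "strand \<Rightarrow> nat set" where
  "ends (Cup i j) = {i, j}"
| "ends (Ray i) = {i}"

fun curve :: "nat \<Rightarrow> strand \<Rightarrow> complex set" where
  "curve m (Cup i j) =
     {z. Im z \<le> 0 \<and> dist z (Complex ((real i + real j) / 2) 0) = (real j - real i) / 2}"
| "curve m (Ray i) = closed_segment (Complex (real i) 0) (Complex (real i) (- real m))"

definition rectangle :: "nat \<Rightarrow> complex set" where
  "rectangle m = {z. 0 \<le> Re z \<and> Re z \<le> real m + 1 \<and> - real m \<le> Im z \<and> Im z \<le> 0}"

text \<open>The strands of a diagram, and those among them that carry a dot.\<close>

record cup_diagram =
  strands :: "strand set"
  dotted :: "strand set"

definition right_accessible :: "nat \<Rightarrow> strand set \<Rightarrow> strand \<Rightarrow> bool" where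
  "right_accessible m A s \<longleftrightarrow>
     (\<exists>g. path g \<and> path_image g \<subseteq> rectangle m \<and>
          pathstart g \<in> curve m s \<and> Re (pathfinish g) = real m + 1 \<and>
          (\<forall>t \<in> A - {s}. path_image g \<inter> curve m t = {}))"

definition is_cup_diagram :: "nat \<Rightarrow> cup_diagram \<Rightarrow> bool" where
  "is_cup_diagram m a \<longleftrightarrow>
     (\<forall>s\<in>strands a. ends s \<subseteq> {1..m}) \<and>
     (\<forall>i j. Cup i j \<in> strands a \<longrightarrow> i < j) \<and>
     (\<forall>i\<in>{1..m}. \<exists>!s. s \<in> strands a \<and> i \<in> ends s) \<and>
     disjoint_family_on (curve m) (strands a) \<and>
     (\<forall>s\<in>dotted a. s \<in> strands a \<and> right_accessible m (strands a) s)"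

definition cup_diagrams :: "nat \<Rightarrow> nat \<Rightarrow> cup_diagram set" where
  "cup_diagrams m k = {a. is_cup_diagram m a \<and> card {s \<in> strands a. is_Cup s} = k div 2}"


section \<open>The topological Springer fiber\<close>

definition sphere_product :: "nat \<Rightarrow> (nat \<Rightarrow> real ^ 3) topology" where
  "sphere_product m = product_topology (\<lambda>_. top_of_set (sphere 0 1)) {1..m}"

definition pole_p :: "real ^ 3" where "pole_p = vector [0, 0, 1]"
definition pole_q :: "real ^ 3" where "pole_q = vector [1, 0, 0]"

definition sphere_component :: "nat \<Rightarrow> cup_diagram \<Rightarrow> (nat \<Rightarrow> real ^ 3) set" where
  "sphere_component m a =
     {x \<in> {1..m} \<rightarrow>\<^sub>E sphere 0 1.
        (\<forall>i j. Cup i j \<in> strands a \<longrightarrow> x i = (if Cup i j \<in> dotted a then x j else - x j)) \<and>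
        (\<forall>i. Ray i \<in> strands a \<longrightarrow>
           x i = (if Ray i \<in> dotted a then pole_p
                  else if \<forall>j. Ray j \<in> strands a \<longrightarrow> j \<le> i then - pole_p
                  else pole_q))}"

definition topological_springer_fiber :: "nat \<Rightarrow> nat \<Rightarrow> (nat \<Rightarrow> real ^ 3) set" where
  "topological_springer_fiber m k = (\<Union>a\<in>cup_diagrams m k. sphere_component m a)"

end

theory Submission
  imports Defs "Jordan_Normal_Form.Determinant"
begin

text \<open>The pair \<open>(\<beta>, x)\<close> is brought into a normal form in which vectors become finitely supported sequences
  \<open>w\<close> in \<open>complex ^ 2\<close>, \<open>x\<close> becomes the shift, and \<open>\<beta>\<close> an alternating sum.  A point of the sphere is a line in
  \<open>complex ^ 2\<close> with projection \<open>p\<close>; the operator \<open>Qop p = p \<circ> shift + (1 - p)\<close> commutes with the shift and has the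
  line as its kernel, so a point \<open>(x\<^sub>1, \<dots>, x\<^sub>m)\<close> gives the flag of the kernels of
  \<open>Qop p\<^sub>i \<circ> \<dots> \<circ> Qop p\<^sub>1\<close>, and every flag with \<open>x F\<^sub>i \<subseteq> F\<^sub>i\<^sub>-\<^sub>1\<close> arises from a unique point.  Since
  \<open>Qop (1 - p) \<circ> Qop p\<close> is the shift, adjacent antipodal points can be removed, and an induction that splits off
  such pairs shows that the top space is isotropic exactly if the point obeys a cup diagram.

  The components are Zariski closed because each strand imposes a closed condition on the flag: an incidence
  for undotted cups and rays, and for dotted cups an eigenvalue equation between minors, the operator being a
  lift of the one that multiplies odd positions by \<open>2\<close>.  They are irreducible because any two points are joined
  by a polynomial family of (oblique) projections obeying the diagram.\<close>

section \<open>Minors and Pluecker coordinates\<close>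

no_notation Matrix.vec_index (infixl "$" 100)
hide_const (open) Matrix.mat Matrix.vec Determinant.det Matrix.row Matrix.col Matrix.scalar_prod Matrix.dim_vec
hide_type (open) Matrix.vec Matrix.mat

text \<open>Sequences are kept infinite so that every \<open>Qop p\<close> is surjective, with an
  explicit right inverse; the finite space returns only through \<open>supported\<close>. Isotropy
  is proved for arbitrary rank one idempotents, not just orthogonal projections: a point of the
  sphere singles out one projection per line, but the orthogonal one involves complex conjugation,
  so polynomial families of flags have to leave this class. Reading the labels from left to right, a
  strand fixes the label of its right end by that of its left end; closedness and irreducibility
  both rest on this order. For a dotted cup invariance under the lift of \<open>theta\<close> is not
  enough: equal and complementary lines at its ends both give invariant spaces. The determinant
  separates them, being \<open>2 ^ Suc d\<close> in the first case and \<open>2 ^ d\<close> in the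
  second when \<open>d\<close> dotted cups precede; the factor 2 only has to differ from 0 and 1. No
  dimension theory enters: finitely many closed irreducible sets that cover the fiber are its
  components as soon as none contains another, and this is read off a generic point of each S_a
  together with the common number of cups.\<close>

definition minor :: "nat => (nat => 'i => complex) => 'i list => complex" where
  "minor n M I = (\<Sum>\<sigma> | \<sigma> permutes {..<n}. of_int (sign \<sigma>) * (\<Prod>i<n. M (\<sigma> i) (I ! i)))"

lemma plucker_eq_minor:
  "length I <= m ==> plucker m v I = minor (length I) (%c a. v (Suc c) $ a) I"
  by (simp add: plucker_def minor_def)

definition minor_mat :: "nat => (nat => 'i => complex) => 'i list => complex Matrix.mat" where
  "minor_mat n M I = Matrix.mat n n (\<lambda>(i, c). M c (I ! i))"

lemma minor_mat_carrier [simp]: "minor_mat n M I \<in> carrier_mat n n"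
  by (simp add: minor_mat_def)

lemma minor_det: "minor n M I = Determinant.det (minor_mat n M I)"
  unfolding minor_def Determinant.det_def minor_mat_def
  by (auto intro!: sum.cong prod.cong simp: atLeast0LessThan permutes_in_image[where S = "{..<n}", simplified])

text \<open>The matrix of the combined family factors through the matrix of the \<open>u b\<close>,
  so the coefficient determinant splits off. This is how minors change with the basis of a
  subspace.\<close>

lemma minor_lincomb:
  assumes "\<And>c a. c < n ==> M c a = (\<Sum>b<n. A c b * u b a)"
  shows "minor n M I = Determinant.det (Matrix.mat n n (\<lambda>(b, c). A c b)) * minor n u I"
proof -
  have "minor_mat n M I = minor_mat n u I * Matrix.mat n n (\<lambda>(b, c). A c b)"
    unfolding minor_mat_def
    by (rule eq_matI) (auto simp: assms times_mat_def scalar_prod_def atLeast0LessThan intro!: sum.cong)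
  then show ?thesis
    unfolding minor_det
    using det_mult[OF minor_mat_carrier, of "Matrix.mat n n (\<lambda>(b, c). A c b)" n u I]
    by simp
qed

lemma minor_diag: "minor n (%b a. \<mu> b * u b a) I = (\<Prod>b<n. \<mu> b) * minor n u I"
  unfolding minor_def
proof (subst sum_distrib_left, rule sum.cong[OF refl])
  fix \<sigma> assume "\<sigma> \<in> {\<sigma>. \<sigma> permutes {..<n}}"
  then have \<sigma>: "\<sigma> permutes {..<n}" by simp
  have "(\<Prod>i<n. \<mu> (\<sigma> i)) = (\<Prod>b<n. \<mu> b)"
    using prod.permute[OF \<sigma>, of \<mu>] by (simp add: o_def)
  then show "of_int (sign \<sigma>) * (\<Prod>i<n. \<mu> (\<sigma> i) * u (\<sigma> i) (I ! i)) =
        prod \<mu> {..<n} * (of_int (sign \<sigma>) * (\<Prod>i<n. u (\<sigma> i) (I ! i)))"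
    by (simp add: prod.distrib)
qed

text \<open>Laplace expansion along one row: the weights do not depend on the entry of that row.\<close>

definition minor_cofactor :: "nat => (nat => 'i => complex) => 'i list => nat => nat => complex" where
  "minor_cofactor n M J l c = cofactor (minor_mat n M J) l c"

lemma minor_update:
  assumes "length J = n" "l < n"
  shows "minor n M (J[l := a]) = (\<Sum>c<n. M c a * minor_cofactor n M J l c)"
proof -
  have "cofactor (minor_mat n M (J[l := a])) l c = cofactor (minor_mat n M J) l c" if "c < n" for c
  proof -
    have "mat_delete (minor_mat n M (J[l := a])) l c = mat_delete (minor_mat n M J) l c"
      unfolding mat_delete_def minor_mat_def using assms that by (auto intro!: eq_matI)
    then show ?thesis by (simp add: cofactor_def)
  qed
  moreover have "minor_mat n M (J[l := a]) $$ (l, c) = M c a" if "c < n" for c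
    using assms that by (simp add: minor_mat_def)
  ultimately show ?thesis
    unfolding minor_det laplace_expansion_row[OF minor_mat_carrier assms(2)] minor_cofactor_def
    by (intro sum.cong) auto
qed

lemma minor_cofactor_orthogonal:
  assumes "length J = n" "c < n" "b < n"
  shows "(\<Sum>l<n. minor_cofactor n M J l c * M b (J ! l)) = (if c = b then minor n M J else 0)"
proof -
  let ?A = "minor_mat n M J"
  have "(adj_mat ?A * ?A) $$ (c, b) = (Determinant.det ?A \<cdot>\<^sub>m 1\<^sub>m n) $$ (c, b)"
    using adj_mat(3)[OF minor_mat_carrier[of n M J]] by simp
  moreover have "(adj_mat ?A * ?A) $$ (c, b) = (\<Sum>l<n. minor_cofactor n M J l c * M b (J ! l))"
    using assms by (auto simp: times_mat_def scalar_prod_def adj_mat_def minor_cofactor_def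
        minor_mat_def atLeast0LessThan intro!: sum.cong)
  ultimately show ?thesis
    using assms by (auto simp: minor_det)
qed

text \<open>Cramer's rule without division. The weights on the right are minors, so membership in a
  subspace will become a polynomial condition on Pluecker coordinates.\<close>

lemma minor_cramer:
  assumes J: "length J = n" and u: "\<And>a. u a = (\<Sum>c<n. \<alpha> c * M c a)"
  shows "u a * minor n M J = (\<Sum>l<n. u (J ! l) * minor n M (J[l := a]))"
proof -
  let ?C = "minor_cofactor n M J"
  have "(\<Sum>l<n. u (J ! l) * minor n M (J[l := a])) = (\<Sum>l<n. \<Sum>c<n. M c a * (?C l c * u (J ! l)))"
    by (rule sum.cong[OF refl]) (simp add: minor_update[OF J] sum_distrib_left mult_ac)
  also have "\<dots> = (\<Sum>c<n. M c a * (\<Sum>l<n. ?C l c * u (J ! l)))"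
    by (subst sum.swap) (simp only: sum_distrib_left)
  also have "\<dots> = (\<Sum>c<n. M c a * (\<alpha> c * minor n M J))"
  proof (rule sum.cong[OF refl])
    fix c assume c: "c \<in> {..<n}"
    have "(\<Sum>l<n. ?C l c * u (J ! l)) = (\<Sum>l<n. \<Sum>b<n. \<alpha> b * (?C l c * M b (J ! l)))"
      by (rule sum.cong[OF refl]) (simp only: u sum_distrib_left mult.left_commute)
    also have "\<dots> = (\<Sum>b<n. \<alpha> b * (\<Sum>l<n. ?C l c * M b (J ! l)))"
      by (subst sum.swap) (simp only: sum_distrib_left)
    also have "\<dots> = (\<Sum>b<n. \<alpha> b * (if c = b then minor n M J else 0))"
      using c by (intro sum.cong refl) (simp add: minor_cofactor_orthogonal[OF J])
    also have "\<dots> = \<alpha> c * minor n M J"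
      using c by (simp add: if_distrib cong: if_cong)
    finally show "M c a * (\<Sum>l<n. ?C l c * u (J ! l)) = M c a * (\<alpha> c * minor n M J)" by simp
  qed
  also have "\<dots> = u a * minor n M J"
    unfolding u sum_distrib_right by (simp only: mult_ac)
  finally show ?thesis ..
qed

text \<open>Each minor on the right, expanded along its replaced row, combines the
  \<open>M c a\<close> with weights independent of \<open>a\<close>; dividing by the nonzero minor
  gives \<alpha>.\<close>

lemma minor_cramer_converse:
  assumes "length J = n" "minor n M J ~= 0"
    and "\<And>a. u a * minor n M J = (\<Sum>l<n. u (J ! l) * minor n M (J[l := a]))"
  shows "\<exists>\<alpha>. \<forall>a. u a = (\<Sum>c<n. \<alpha> c * M c a)"
proof (intro exI allI)
  fix a
  have "u a * minor n M J = (\<Sum>l<n. \<Sum>c<n. u (J ! l) * minor_cofactor n M J l c * M c a)"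
    unfolding assms(3)
    by (rule sum.cong[OF refl]) (simp add: minor_update[OF assms(1)] sum_distrib_left mult_ac)
  also have "\<dots> = (\<Sum>c<n. (\<Sum>l<n. u (J ! l) * minor_cofactor n M J l c) * M c a)"
    by (subst sum.swap) (simp add: sum_distrib_right)
  finally show "u a = (\<Sum>c<n. ((\<Sum>l<n. u (J ! l) * minor_cofactor n M J l c) / minor n M J) * M c a)"
    using assms(2) by (simp add: eq_divide_eq flip: sum_divide_distrib)
qed

text \<open>If all minors of size \<open>Suc n\<close> vanished, the cofactors along an added row
  would form a linear relation among the \<open>M c\<close>, and its last coefficient is the nonzero
  minor of size \<open>n\<close>.\<close>

lemma minor_nonzero_exists:
  assumes "\<And>\<alpha>. (\<And>a. (\<Sum>c<n. \<alpha> c * M c a) = 0) ==> \<forall>c<n. \<alpha> c = 0"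
  shows "\<exists>J. length J = n & minor n M J ~= 0"
  using assms
proof (induction n)
  case 0
  then show ?case by (simp add: minor_def)
next
  case (Suc n)
  have "\<forall>c<n. \<alpha> c = 0" if "\<And>a. (\<Sum>c<n. \<alpha> c * M c a) = 0" for \<alpha>
  proof -
    have "(\<Sum>c<n. (\<alpha>(n := 0)) c * M c a) = (\<Sum>c<n. \<alpha> c * M c a)" for a
      by (rule sum.cong) auto
    then have "\<forall>c<Suc n. (\<alpha>(n := 0)) c = 0"
      by (intro Suc.prems) (simp only: sum.lessThan_Suc that, simp)
    then show ?thesis by (metis fun_upd_other less_Suc_eq nat_neq_iff)
  qed
  then obtain J where J: "length J = n" "minor n M J ~= 0"
    using Suc.IH by blast
  show ?case
  proof (rule ccontr)
    assume neg: "\<not> ?thesis"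
    \<comment> \<open>The appended index is a placeholder: it is overwritten by every
      \<open>a\<close>, and the cofactors along its row do not see it.\<close>
    define J' where "J' = J @ [undefined]"
    have J': "length J' = Suc n" using J by (simp add: J'_def)
    have "(\<Sum>c<Suc n. minor_cofactor (Suc n) M J' n c * M c a) = 0" for a
    proof -
      have "minor (Suc n) M (J'[n := a]) = 0"
        using neg J' by auto
      then show ?thesis
        using minor_update[OF J' lessI, of M a] by (simp add: mult.commute)
    qed
    then have "minor_cofactor (Suc n) M J' n n = 0"
      by (rule Suc.prems[rule_format]) simp
    moreover have "mat_delete (minor_mat (Suc n) M J') n n = minor_mat n M J"
      unfolding mat_delete_def minor_mat_def J'_def using J by (auto intro!: eq_matI simp: nth_append)
    then have "minor_cofactor (Suc n) M J' n n = minor n M J"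
      by (simp add: minor_cofactor_def cofactor_def minor_det)
    ultimately show False using J by simp
  qed
qed

text \<open>A Cauchy--Binet expansion over arbitrary (not only increasing) index lists.\<close>

lemma minor_linear_image:
  fixes T :: "'j => 'i::finite => complex"
  assumes "\<And>c b. c < n ==> M' c b = (\<Sum>a\<in>UNIV. T b a * M c a)" and "length I = n"
  shows "minor n M' I = (\<Sum>J | length J = n. (\<Prod>l<n. T (I ! l) (J ! l)) * minor n M J)"
proof -
  have fin: "finite {J :: 'i list. length J = n}"
    using finite_lists_length_eq[of "UNIV :: 'i set" n] by simp
  have "(\<Prod>l<n. M' (\<sigma> l) (I ! l)) = (\<Sum>J | length J = n. \<Prod>l<n. T (I ! l) (J ! l) * M (\<sigma> l) (J ! l))"
    if "\<sigma> permutes {..<n}" for \<sigma>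
  proof -
    have "(\<Prod>l<n. M' (\<sigma> l) (I ! l)) = (\<Prod>l<n. \<Sum>a\<in>UNIV. T (I ! l) a * M (\<sigma> l) a)"
      using assms(1) permutes_in_image[OF that] by (intro prod.cong) auto
    also have "\<dots> = (\<Sum>g \<in> {..<n} \<rightarrow>\<^sub>E UNIV. \<Prod>l<n. T (I ! l) (g l) * M (\<sigma> l) (g l))"
      by (rule prod_sum_PiE) auto
    also have "\<dots> = (\<Sum>J | length J = n. \<Prod>l<n. T (I ! l) (J ! l) * M (\<sigma> l) (J ! l))"
    proof (rule sum.reindex_bij_witness[where i = "%J. \<lambda>l\<in>{..<n}. J ! l" and j = "%g. map g [0..<n]"])
      fix g :: "nat => 'i" assume g: "g \<in> {..<n} \<rightarrow>\<^sub>E UNIV"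
      show "(\<lambda>l\<in>{..<n}. map g [0..<n] ! l) = g"
        using g by (intro ext) (simp add: restrict_def PiE_def extensional_def)
      show "map g [0..<n] \<in> {J. length J = n}" by simp
      show "(\<Prod>l<n. T (I ! l) (map g [0..<n] ! l) * M (\<sigma> l) (map g [0..<n] ! l)) =
          (\<Prod>l<n. T (I ! l) (g l) * M (\<sigma> l) (g l))"
        by (intro prod.cong) simp_all
    next
      fix J :: "'i list" assume J: "J \<in> {J. length J = n}"
      then show "map (\<lambda>l\<in>{..<n}. J ! l) [0..<n] = J"
        by (intro nth_equalityI) simp_all
      show "(\<lambda>l\<in>{..<n}. J ! l) \<in> {..<n} \<rightarrow>\<^sub>E UNIV" by simp
    qed
    finally show ?thesis .
  qed
  note * = this
  have 1: "minor n M' I = (\<Sum>\<sigma> | \<sigma> permutes {..<n}. \<Sum>J | length J = n.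
      of_int (sign \<sigma>) * ((\<Prod>l<n. T (I ! l) (J ! l)) * (\<Prod>l<n. M (\<sigma> l) (J ! l))))"
    unfolding minor_def
  proof (rule sum.cong[OF refl])
    fix \<sigma> assume "\<sigma> \<in> {\<sigma>. \<sigma> permutes {..<n}}"
    then show "of_int (sign \<sigma>) * (\<Prod>l<n. M' (\<sigma> l) (I ! l)) = (\<Sum>J | length J = n.
      of_int (sign \<sigma>) * ((\<Prod>l<n. T (I ! l) (J ! l)) * (\<Prod>l<n. M (\<sigma> l) (J ! l))))"
      by (simp only: mem_Collect_eq * prod.distrib sum_distrib_left)
  qed
  have 2: "(\<Sum>\<sigma> | \<sigma> permutes {..<n}. \<Sum>J | length J = n.
      of_int (sign \<sigma>) * ((\<Prod>l<n. T (I ! l) (J ! l)) * (\<Prod>l<n. M (\<sigma> l) (J ! l)))) = (\<Sum>J | length J = n. \<Sum>\<sigma> | \<sigma> permutes {..<n}.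
      of_int (sign \<sigma>) * ((\<Prod>l<n. T (I ! l) (J ! l)) * (\<Prod>l<n. M (\<sigma> l) (J ! l))))"
    by (rule sum.swap)
  have 3: "(\<Sum>J | length J = n. \<Sum>\<sigma> | \<sigma> permutes {..<n}.
      of_int (sign \<sigma>) * ((\<Prod>l<n. T (I ! l) (J ! l)) * (\<Prod>l<n. M (\<sigma> l) (J ! l)))) =
      (\<Sum>J | length J = n. (\<Prod>l<n. T (I ! l) (J ! l)) * minor n M J)"
  proof (rule sum.cong[OF refl])
    fix J :: "'i list"
    show "(\<Sum>\<sigma> | \<sigma> permutes {..<n}. of_int (sign \<sigma>) * ((\<Prod>l<n. T (I ! l) (J ! l)) * (\<Prod>l<n. M (\<sigma> l) (J ! l)))) =
        (\<Prod>l<n. T (I ! l) (J ! l)) * minor n M J"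
      unfolding minor_def sum_distrib_left
      by (rule sum.cong[OF refl]) (rule mult.left_commute)
  qed
  show ?thesis unfolding 1 2 3 ..
qed

section \<open>Frames and the flags they span\<close>

lemma span_image_atLeastAtMost:
  fixes v :: "nat => complex ^ 'n"
  shows "vec.span (v ` {1..j}) = {u. \<exists>\<alpha>. u = (\<Sum>c<j. \<alpha> c *s v (Suc c))}"
proof (induction j)
  case 0
  then show ?case by simp
next
  case (Suc j)
  have "v ` {1..Suc j} = insert (v (Suc j)) (v ` {1..j})"
    by (simp add: atLeastAtMostSuc_conv)
  then have "vec.span (v ` {1..Suc j}) = {x. \<exists>k. x - k *s v (Suc j) \<in> vec.span (v ` {1..j})}"
    by (simp only: vec.span_insert)
  also have "\<dots> = {u. \<exists>\<alpha>. u = (\<Sum>c<Suc j. \<alpha> c *s v (Suc c))}"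
  proof (intro equalityI subsetI)
    fix u assume "u \<in> {x. \<exists>k. x - k *s v (Suc j) \<in> vec.span (v ` {1..j})}"
    then obtain k \<alpha> where "u - k *s v (Suc j) = (\<Sum>c<j. \<alpha> c *s v (Suc c))"
      unfolding Suc.IH by blast
    then have "u = (\<Sum>c<Suc j. (\<alpha>(j := k)) c *s v (Suc c))"
      by (simp add: algebra_simps)
    then show "u \<in> {u. \<exists>\<alpha>. u = (\<Sum>c<Suc j. \<alpha> c *s v (Suc c))}" by blast
  next
    fix u assume "u \<in> {u. \<exists>\<alpha>. u = (\<Sum>c<Suc j. \<alpha> c *s v (Suc c))}"
    then obtain \<alpha> where "u = (\<Sum>c<Suc j. \<alpha> c *s v (Suc c))" by blast
    then have "u - \<alpha> j *s v (Suc j) = (\<Sum>c<j. \<alpha> c *s v (Suc c))" by simp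
    then show "u \<in> {x. \<exists>k. x - k *s v (Suc j) \<in> vec.span (v ` {1..j})}"
      unfolding Suc.IH by blast
  qed
  finally show ?case .
qed

lemma frame_independent:
  fixes v :: "nat => complex ^ 'n"
  assumes "v \<in> frames m" "j <= m" "(\<Sum>c<j. \<alpha> c *s v (Suc c)) = 0" "c < j"
  shows "\<alpha> c = 0"
proof -
  have inj: "inj_on v {1..m}" and ind: "vec.independent (v ` {1..m})"
    using assms(1) unfolding frames_def by blast+
  have inj': "inj_on (%c. v (Suc c)) {..<j}"
  proof (rule inj_onI)
    fix c d assume cd: "c \<in> {..<j}" "d \<in> {..<j}" "v (Suc c) = v (Suc d)"
    then have "Suc c \<in> {1..m}" "Suc d \<in> {1..m}" using assms(2) by auto
    from inj_onD[OF inj cd(3) this] show "c = d" by simp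
  qed
  let ?h = "%c. v (Suc c)"
  let ?g = "the_inv_into {..<j} ?h"
  have g: "?g (v (Suc c)) = c" if "c < j" for c
    by (rule the_inv_into_f_f[OF inj']) (simp add: that)
  have "(\<Sum>w \<in> ?h ` {..<j}. \<alpha> (?g w) *s w) = (\<Sum>c<j. \<alpha> c *s v (Suc c))"
    by (subst sum.reindex[OF inj'], rule sum.cong) (simp_all add: g)
  then have 0: "(\<Sum>w \<in> ?h ` {..<j}. \<alpha> (?g w) *s w) = 0" using assms(3) by (rule trans)
  have sub: "?h ` {..<j} \<subseteq> v ` {1..m}" using assms(2) by (intro image_subsetI) auto
  have "\<alpha> (?g (v (Suc c))) = 0"
    by (rule vec.independentD[OF ind _ sub 0]) (use assms(4) in simp_all)
  then show ?thesis using g[OF assms(4)] by metis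
qed

lemma frame_minor_nonzero:
  fixes v :: "nat => complex ^ 'n"
  assumes "v \<in> frames m" "j <= m"
  shows "\<exists>J. length J = j & minor j (%c a. v (Suc c) $ a) J ~= 0"
proof (rule minor_nonzero_exists)
  fix \<alpha> :: "nat => complex"
  assume "\<And>a. (\<Sum>c<j. \<alpha> c * v (Suc c) $ a) = 0"
  then have "(\<Sum>c<j. \<alpha> c *s v (Suc c)) = 0" by (simp add: Finite_Cartesian_Product.vec_eq_iff sum_component)
  then show "\<forall>c<j. \<alpha> c = 0" using frame_independent[OF assms] by blast
qed

lemma flag_of_apply: "i <= m ==> flag_of m v i = vec.span (v ` {1..i})"
  by (simp add: flag_of_def)

text \<open>Picking for each \<open>i\<close> a vector of \<open>F i\<close> outside
  \<open>F (i - 1)\<close> yields independent vectors, and the dimension of \<open>F i\<close>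
  forces the first \<open>i\<close> of them to span it.\<close>

lemma flag_of_surj:
  fixes F :: "nat => (complex ^ 'n) set"
  assumes "F \<in> flags m"
  obtains v where "v \<in> frames m" "flag_of m v = F"
proof -
  from assms have ext: "F \<in> extensional {0..m}" and sub: "\<And>i. i <= m ==> vec.subspace (F i)" and F0: "F 0 = {0}"
    and psub: "\<And>i. i < m ==> F i \<subset> F (Suc i)" and dim: "\<And>i. i <= m ==> vec.dim (F i) = i"
    unfolding flags_def by (auto simp: PiE_iff)
  define v where "v = (\<lambda>i\<in>{1..m}. SOME w. w \<in> F i - F (i - 1))"
  have v: "v i \<in> F i" "v i \<notin> F (i - 1)" if "1 <= i" "i <= m" for i
  proof -
    have "\<exists>w. w \<in> F i - F (i - 1)" using psub[of "i - 1"] that by (cases i) auto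
    then have "(SOME w. w \<in> F i - F (i - 1)) \<in> F i - F (i - 1)" by (rule someI_ex)
    then show "v i \<in> F i" "v i \<notin> F (i - 1)" using that by (auto simp: v_def)
  qed
  have main: "inj_on v {1..i} & vec.independent (v ` {1..i}) & vec.span (v ` {1..i}) = F i" if "i <= m" for i
    using that
  proof (induction i)
    case 0
    then show ?case by (simp add: F0 vec.independent_empty)
  next
    case (Suc i)
    then have IH: "inj_on v {1..i}" "vec.independent (v ` {1..i})" "vec.span (v ` {1..i}) = F i" by auto
    have im: "v ` {1..Suc i} = insert (v (Suc i)) (v ` {1..i})"
      by (simp add: atLeastAtMostSuc_conv)
    have nin: "v (Suc i) \<notin> vec.span (v ` {1..i})" using v(2)[of "Suc i"] Suc.prems IH(3) by simp
    then have nin': "v (Suc i) \<notin> v ` {1..i}" using vec.span_base by blast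
    have inj: "inj_on v {1..Suc i}"
      using IH(1) nin' by (simp add: atLeastAtMostSuc_conv)
    have ind: "vec.independent (v ` {1..Suc i})"
      unfolding im using vec.independent_insertI[OF nin IH(2)] .
    have "F i \<subseteq> F (Suc i)" using psub[of i] Suc.prems by simp
    then have "v ` {1..i} \<subseteq> F (Suc i)"
      using vec.span_superset[of "v ` {1..i}"] unfolding IH(3) by (rule subset_trans[rotated])
    moreover have "v (Suc i) \<in> F (Suc i)" using v(1)[of "Suc i"] Suc.prems by simp
    ultimately have vF: "v ` {1..Suc i} \<subseteq> F (Suc i)" unfolding im by (simp only: insert_subset simp_thms)
    have "vec.dim (F (Suc i)) <= card (v ` {1..Suc i})"
      using card_image[OF inj] dim[OF Suc.prems] by simp
    then have "F (Suc i) \<subseteq> vec.span (v ` {1..Suc i})"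
      by (rule vec.card_ge_dim_independent[OF vF ind])
    then have "vec.span (v ` {1..Suc i}) = F (Suc i)"
      using vec.span_minimal[OF vF sub[OF Suc.prems]] by (rule subset_antisym[rotated])
    then show ?case using inj ind by (simp only: simp_thms)
  qed
  have "v \<in> extensional {1..m}" by (simp add: v_def)
  then have "v \<in> frames m"
    unfolding frames_def mem_Collect_eq using main[OF order_refl] by (simp only: simp_thms)
  moreover have "flag_of m v = F"
  proof
    fix i show "flag_of m v i = F i"
    proof (cases "i <= m")
      case True
      then show ?thesis using main[OF True] by (simp add: flag_of_def)
    next
      case False
      then show ?thesis using ext by (simp add: flag_of_def extensional_def)
    qed
  qed
  ultimately show ?thesis by (rule that)
qed

section \<open>Zariski closed conditions on flags\<close>

lemma polynomial_map_sum:
  "finite A ==> (\<And>x. x \<in> A ==> polynomial_map (f x)) ==> polynomial_map (%c. \<Sum>x\<in>A. f x c)"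
  by (induction A rule: finite_induct) (auto intro: polynomial_map.intros)

lemma polynomial_map_cmult: "polynomial_map f ==> polynomial_map (%c. z * f c)"
  by (intro polynomial_map.mult polynomial_map.const)

lemma polynomial_map_diff:
  "polynomial_map f ==> polynomial_map g ==> polynomial_map (%c. f c - g c)"
  using polynomial_map.add[OF _ polynomial_map_cmult[of g "-1"], of f] by simp

lemma topspace_zariski [simp]:
  "topspace (zariski_flag_topology m) = (flags m :: (nat => (complex ^ 'n) set) set)"
proof -
  have "F \<in> topspace (zariski_flag_topology m)" if F: "F \<in> flags m" for F :: "nat => (complex ^ 'n) set"
  proof -
    obtain v where v: "v \<in> frames m" "flag_of m v = F" by (rule flag_of_surj[OF F])
    let ?f = "\<lambda>c :: 'n list => complex. 1 :: complex"
    have "polynomial_map ?f" by (rule polynomial_map.const)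
    moreover have "F \<in> {F \<in> flags m. \<exists>v\<in>frames m. flag_of m v = F & ?f (plucker m v) ~= 0}"
      using F v by auto
    ultimately show ?thesis
      unfolding zariski_flag_topology_def topology_generated_by_topspace by blast
  qed
  then show ?thesis
    by (auto simp: zariski_flag_topology_def topology_generated_by_topspace)
qed

lemma closedin_zariski_zeros:
  assumes "polynomial_map f"
  shows "closedin (zariski_flag_topology m)
    {F \<in> flags m :: (nat => (complex ^ 'n) set) set. \<forall>v\<in>frames m. flag_of m v = F --> f (plucker m v) = 0}"
    (is "closedin _ ?Z")
proof -
  have "openin (zariski_flag_topology m) {F \<in> flags m. \<exists>v\<in>frames m. flag_of m v = F & f (plucker m v) ~= 0}"
    unfolding zariski_flag_topology_def using assms by (intro topology_generated_by_Basis) blast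
  moreover have "{F \<in> flags m. \<exists>v\<in>frames m. flag_of m v = F & f (plucker m v) ~= 0} = flags m - ?Z"
    by blast
  ultimately show ?thesis
    unfolding closedin_def by auto
qed

text \<open>Closed sets demand vanishing at all frames of a flag, while the equivalence for
  \<open>P\<close> is checked frame by frame; every flag has a frame, so the two agree. A nonempty
  index set keeps the intersection inside \<open>flags m\<close>.\<close>

lemma closedin_zariski_zeros_family:
  assumes "A ~= {}" "\<And>t. t \<in> A ==> polynomial_map (f t)"
    and "\<And>v. v \<in> frames m ==> P (flag_of m v) \<longleftrightarrow> (\<forall>t\<in>A. f t (plucker m v) = 0)"
  shows "closedin (zariski_flag_topology m) {F \<in> flags m :: (nat => (complex ^ 'n) set) set. P F}"
proof -
  have "P F \<longleftrightarrow> (\<forall>t\<in>A. \<forall>v\<in>frames m. flag_of m v = F --> f t (plucker m v) = 0)"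
    if "F \<in> flags m" for F
    using flag_of_surj[OF that] assms(3) by metis
  then have "{F \<in> flags m. P F} =
      (\<Inter>t\<in>A. {F \<in> flags m. \<forall>v\<in>frames m. flag_of m v = F --> f t (plucker m v) = 0})"
    using assms(1) by auto
  then show ?thesis
    using assms by (auto intro!: closedin_Inter closedin_zariski_zeros)
qed

text \<open>The target is a space of functions on any index type, because vectors over
  \<open>'n\<close> as well as sequences indexed by position and component occur as values.\<close>

definition linear_coeffs :: "(complex ^ 'n => 'i => complex) => bool" where
  "linear_coeffs g \<longleftrightarrow> (\<exists>L. \<forall>v b. g v b = (\<Sum>a\<in>UNIV. L b a * v $ a))"

lemma linear_coeffs_sum:
  assumes "linear_coeffs g"
  shows "g (\<Sum>c\<in>A. \<alpha> c *s v c) b = (\<Sum>c\<in>A. \<alpha> c * g (v c) b)"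
proof -
  obtain L where L0: "\<forall>v b. g v b = (\<Sum>a\<in>UNIV. L b a * v $ a)"
    using assms unfolding linear_coeffs_def by (rule exE)
  note L = L0[rule_format]
  have "g (\<Sum>c\<in>A. \<alpha> c *s v c) b = (\<Sum>a\<in>UNIV. \<Sum>c\<in>A. \<alpha> c * (L b a * v c $ a))"
    unfolding L by (intro sum.cong refl) (simp add: sum_distrib_left mult_ac)
  also have "\<dots> = (\<Sum>c\<in>A. \<alpha> c * g (v c) b)"
    by (subst sum.swap) (simp add: L sum_distrib_left)
  finally show ?thesis .
qed

text \<open>Cramer's relations hold for every list \<open>J\<close>, and one list with a nonzero
  minor suffices for the converse. Asking for all lists avoids choosing a chart, so the condition is
  globally polynomial.\<close>

lemma flag_of_member_iff:
  fixes v :: "nat => complex ^ 'n"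
  assumes v: "v \<in> frames m" and i: "i <= m"
  shows "u \<in> flag_of m v i \<longleftrightarrow> (\<forall>J b. length J = i -->
    u $ b * plucker m v J - (\<Sum>l<i. u $ (J ! l) * plucker m v (J[l := b])) = 0)"
proof -
  let ?M = "%c a. v (Suc c) $ a"
  have mem: "u \<in> flag_of m v i \<longleftrightarrow> (\<exists>\<alpha>. \<forall>a. u $ a = (\<Sum>c<i. \<alpha> c * ?M c a))"
    by (simp add: flag_of_apply[OF i] span_image_atLeastAtMost Finite_Cartesian_Product.vec_eq_iff sum_component del: One_nat_def)
  have pl: "u $ b * plucker m v J - (\<Sum>l<i. u $ (J ! l) * plucker m v (J[l := b])) = 0 \<longleftrightarrow>
      u $ b * minor i ?M J = (\<Sum>l<i. u $ (J ! l) * minor i ?M (J[l := b]))" if "length J = i" for J b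
    using that i by (simp add: plucker_eq_minor)
  obtain J0 where J0: "length J0 = i" "minor i ?M J0 ~= 0"
    using frame_minor_nonzero[OF v i] by blast
  show ?thesis
  proof
    assume "u \<in> flag_of m v i"
    then obtain \<alpha> where \<alpha>: "\<forall>a. u $ a = (\<Sum>c<i. \<alpha> c * ?M c a)" unfolding mem by (rule exE)
    show "\<forall>J b. length J = i -->
      u $ b * plucker m v J - (\<Sum>l<i. u $ (J ! l) * plucker m v (J[l := b])) = 0"
    proof (intro allI impI)
      fix J :: "'n list" and b assume J: "length J = i"
      show "u $ b * plucker m v J - (\<Sum>l<i. u $ (J ! l) * plucker m v (J[l := b])) = 0"
        unfolding pl[OF J] by (rule minor_cramer[OF J]) (rule \<alpha>[rule_format])
    qed
  next
    assume *: "\<forall>J b. length J = i -->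
      u $ b * plucker m v J - (\<Sum>l<i. u $ (J ! l) * plucker m v (J[l := b])) = 0"
    have "u $ b * minor i ?M J0 = (\<Sum>l<i. u $ (J0 ! l) * minor i ?M (J0[l := b]))" for b
      using *[rule_format, OF J0(1), of b] unfolding pl[OF J0(1)] .
    then show "u \<in> flag_of m v i" unfolding mem by (rule minor_cramer_converse[OF J0, of "($) u"])
  qed
qed

text \<open>The vectors with entries \<open>plucker m v (J[l := a])\<close> are contractions of the Pluecker vector of
  the \<open>j\<close>-th subspace; they span this subspace.\<close>

lemma flag_image_subset_iff:
  fixes v :: "nat => complex ^ 'n"
  assumes v: "v \<in> frames m" and i: "i <= m" and j: "j <= m"
    and g: "linear_coeffs (%u. ($) (g u))"
  shows "g ` flag_of m v j \<subseteq> flag_of m v i \<longleftrightarrow>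
    (\<forall>J l. length J = j --> l < j --> g (\<chi> a. plucker m v (J[l := a])) \<in> flag_of m v i)"
proof -
  let ?M = "%c a. v (Suc c) $ a"
  have mem: "u \<in> flag_of m v j \<longleftrightarrow> (\<exists>\<alpha>. u = (\<Sum>c<j. \<alpha> c *s v (Suc c)))" for u
    by (simp add: flag_of_apply[OF j] span_image_atLeastAtMost del: One_nat_def)
  have y: "(\<chi> a. plucker m v (J[l := a])) = (\<Sum>c<j. minor_cofactor j ?M J l c *s v (Suc c))"
    if "length J = j" "l < j" for J l
    using that j by (simp add: plucker_eq_minor minor_update Finite_Cartesian_Product.vec_eq_iff sum_component mult.commute)
  obtain J0 where J0: "length J0 = j" "minor j ?M J0 ~= 0"
    using frame_minor_nonzero[OF v j] by blast
  have sub: "vec.subspace (flag_of m v i)"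
    by (simp add: flag_of_apply[OF i] vec.subspace_span del: One_nat_def)
  show ?thesis
  proof
    assume L: "g ` flag_of m v j \<subseteq> flag_of m v i"
    show "\<forall>J l. length J = j --> l < j --> g (\<chi> a. plucker m v (J[l := a])) \<in> flag_of m v i"
    proof (intro allI impI)
      fix J :: "'n list" and l assume "length J = j" "l < j"
      then have "(\<chi> a. plucker m v (J[l := a])) \<in> flag_of m v j"
        unfolding mem using y by (intro exI) assumption
      then show "g (\<chi> a. plucker m v (J[l := a])) \<in> flag_of m v i" using L by (rule subsetD[OF _ imageI, rotated])
    qed
  next
    assume R: "\<forall>J l. length J = j --> l < j --> g (\<chi> a. plucker m v (J[l := a])) \<in> flag_of m v i"
    show "g ` flag_of m v j \<subseteq> flag_of m v i"
    proof (rule image_subsetI)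
      fix u assume u: "u \<in> flag_of m v j"
      let ?y = "%l. (\<chi> a. plucker m v (J0[l := a])) :: complex ^ 'n"
      let ?c = "%l. u $ (J0 ! l) / plucker m v J0"
      have nz: "plucker m v J0 ~= 0" using J0 j by (simp add: plucker_eq_minor)
      have "u $ a = (\<Sum>l<j. ?c l * plucker m v (J0[l := a]))" for a
      proof -
        have "u $ a * plucker m v J0 - (\<Sum>l<j. u $ (J0 ! l) * plucker m v (J0[l := a])) = 0"
          by (rule u[unfolded flag_of_member_iff[OF v j], rule_format, OF J0(1)])
        then have "u $ a = (\<Sum>l<j. u $ (J0 ! l) * plucker m v (J0[l := a])) / plucker m v J0"
          using nz by (simp add: eq_divide_eq)
        then show ?thesis by (simp only: sum_divide_distrib times_divide_eq_left)
      qed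
      note eq = this
      have u': "u = (\<Sum>l<j. ?c l *s ?y l)"
        by (subst Finite_Cartesian_Product.vec_eq_iff, rule allI)
          (simp only: sum_component vector_smult_component vec_lambda_beta, rule eq)
      have "g u = (\<Sum>l<j. ?c l *s g (?y l))"
      proof (subst Finite_Cartesian_Product.vec_eq_iff, rule allI)
        fix b
        show "g u $ b = (\<Sum>l<j. ?c l *s g (?y l)) $ b"
          by (subst arg_cong[OF u', of g]) (simp only: linear_coeffs_sum[OF g] sum_component vector_smult_component)
      qed
      also have "\<dots> \<in> flag_of m v i"
        using R J0(1) by (intro vec.subspace_sum[OF sub] vec.subspace_scale[OF sub]) simp
      finally show "g u \<in> flag_of m v i" .
    qed
  qed
qed

lemma closedin_zariski_incidence:
  fixes g :: "complex ^ 'n => complex ^ 'n"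
  assumes "i <= m" "j <= m" and g: "linear_coeffs (%u. ($) (g u))"
  shows "closedin (zariski_flag_topology m) {F \<in> flags m. g ` F j \<subseteq> F i}"
proof -
  obtain L where L0: "\<forall>u b. g u $ b = (\<Sum>a\<in>UNIV. L b a * u $ a)"
    using g unfolding linear_coeffs_def by (rule exE)
  note L = L0[rule_format]
  let ?A = "{(J :: 'n list, l, J' :: 'n list, b :: 'n). length J = j & l < j & length J' = i}"
  let ?y = "%J l c. \<chi> a. c (J[l := a])"
  let ?f = "\<lambda>(J, l, J', b) c. g (?y J l c) $ b * c J' - (\<Sum>l'<i. g (?y J l c) $ (J' ! l') * c (J'[l' := b]))"
  show ?thesis
  proof (cases "j = 0")
    \<comment> \<open>With \<open>j = 0\<close> no index \<open>l < j\<close> exists and the family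
      of equations would be empty; the inclusion then holds for every flag.\<close>
    case True
    have "g 0 = 0" by (simp add: Finite_Cartesian_Product.vec_eq_iff L)
    have F0: "F 0 = {0}" "0 \<in> F i" if F: "F \<in> flags m" for F :: "nat => (complex ^ 'n) set"
      using F assms(1) unfolding flags_def by (auto simp: PiE_iff intro!: vec.subspace_0)
    have "g ` F j \<subseteq> F i" if "F \<in> flags m" for F
      using True \<open>g 0 = 0\<close> F0[OF that] by simp
    then have "{F \<in> flags m. g ` F j \<subseteq> F i} = topspace (zariski_flag_topology m :: (nat => (complex ^ 'n) set) topology)"
      by auto
    then show ?thesis by (simp only: closedin_topspace)
  next
    case False
    then have ne: "(replicate j undefined, 0, replicate i undefined, undefined) \<in> ?A" by simp
    show ?thesis
    proof (rule closedin_zariski_zeros_family[of ?A ?f])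
      show "?A ~= {}" using ne by (rule ex_in_conv[THEN iffD1, OF exI])
      show "polynomial_map (?f t)" for t
      proof -
        obtain J l J' b where t: "t = (J, l, J', b)" by (rule prod_cases4)
        have p: "polynomial_map (%c. g (?y J l c) $ b)" for b
          unfolding L vec_lambda_beta
          by (rule polynomial_map_sum[OF finite_class.finite_UNIV], rule polynomial_map_cmult, rule polynomial_map.coord)
        show ?thesis
          unfolding t prod.case
          by (rule polynomial_map_diff, rule polynomial_map.mult[OF p polynomial_map.coord],
              rule polynomial_map_sum[OF finite_lessThan], rule polynomial_map.mult[OF p polynomial_map.coord])
      qed
    next
      fix v :: "nat => complex ^ 'n" assume v: "v \<in> frames m"
      show "g ` flag_of m v j \<subseteq> flag_of m v i \<longleftrightarrow> (\<forall>t\<in>?A. ?f t (plucker m v) = 0)"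
        unfolding flag_image_subset_iff[OF v assms] flag_of_member_iff[OF v assms(1)]
        by (simp only: Ball_def mem_Collect_eq split_paired_All prod.case) blast
    qed
  qed
qed

text \<open>By the Cauchy-Binet expansion both families of minors are linear in the Pluecker
  coordinates. The condition compares the \<open>j\<close>-th exterior powers of \<open>T\<close>
  and \<open>S\<close> on the \<open>j\<close>-th subspace, with ratio \<open>z\<close>.\<close>

lemma closedin_zariski_eigen:
  fixes S T :: "complex ^ 'n => 'i => complex"
  assumes j: "j <= m" and S: "linear_coeffs S" and T: "linear_coeffs T"
    and P: "\<And>v. v \<in> frames m ==> P (flag_of m v) \<longleftrightarrow>
      (\<forall>I. length I = j --> minor j (%c. T (v (Suc c))) I = z * minor j (%c. S (v (Suc c))) I)"
  shows "closedin (zariski_flag_topology m) {F \<in> flags m. P F}"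
proof -
  obtain LS where LS0: "\<forall>u b. S u b = (\<Sum>a\<in>UNIV. LS b a * u $ a)"
    using S unfolding linear_coeffs_def by (rule exE)
  note LS = LS0[rule_format]
  obtain LT where LT0: "\<forall>u b. T u b = (\<Sum>a\<in>UNIV. LT b a * u $ a)"
    using T unfolding linear_coeffs_def by (rule exE)
  note LT = LT0[rule_format]
  have fin: "finite {J :: 'n list. length J = j}"
    using finite_lists_length_eq[of "UNIV :: 'n set" j] by simp
  let ?A = "{I :: 'i list. length I = j}"
  let ?f = "%I c. (\<Sum>J | length J = j. (\<Prod>l<j. LT (I ! l) (J ! l)) * c J) -
     z * (\<Sum>J | length J = j. (\<Prod>l<j. LS (I ! l) (J ! l)) * c J)"
  show ?thesis
  proof (rule closedin_zariski_zeros_family[of ?A ?f])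
    have "replicate j undefined \<in> ?A" by simp
    then show "?A ~= {}" by blast
    show "polynomial_map (?f I)" for I
      by (rule polynomial_map_diff, rule polynomial_map_sum[OF fin], rule polynomial_map_cmult, rule polynomial_map.coord,
          rule polynomial_map_cmult, rule polynomial_map_sum[OF fin], rule polynomial_map_cmult, rule polynomial_map.coord)
    fix v :: "nat => complex ^ 'n" assume v: "v \<in> frames m"
    have pl: "plucker m v J = minor j (%c a. v (Suc c) $ a) J" if "length J = j" for J
      using plucker_eq_minor[of J m v] that j by simp
    have "minor j (%c. T (v (Suc c))) I = (\<Sum>J | length J = j. (\<Prod>l<j. LT (I ! l) (J ! l)) * plucker m v J)"
      "minor j (%c. S (v (Suc c))) I = (\<Sum>J | length J = j. (\<Prod>l<j. LS (I ! l) (J ! l)) * plucker m v J)"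
      if "length I = j" for I
    proof -
      have *: "(\<Sum>J | length J = j. f J * plucker m v J) =
          (\<Sum>J | length J = j. f J * minor j (%c a. v (Suc c) $ a) J)" for f
        by (rule sum.cong) (simp_all add: pl)
      show "minor j (%c. T (v (Suc c))) I = (\<Sum>J | length J = j. (\<Prod>l<j. LT (I ! l) (J ! l)) * plucker m v J)"
        unfolding * by (rule minor_linear_image[OF LT that])
      show "minor j (%c. S (v (Suc c))) I = (\<Sum>J | length J = j. (\<Prod>l<j. LS (I ! l) (J ! l)) * plucker m v J)"
        unfolding * by (rule minor_linear_image[OF LS that])
    qed
    then show "P (flag_of m v) \<longleftrightarrow> (\<forall>I\<in>?A. ?f I (plucker m v) = 0)"
      unfolding P[OF v] by (simp only: mem_Collect_eq Ball_def right_minus_eq cong: imp_cong)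
  qed
qed

section \<open>Combinatorics of cup diagrams\<close>

text \<open>The quadratic is the power of \<open>z\<close> with respect to the full circle. In this
  form lying inside, on or outside the circle becomes a sign, which algebra and the intermediate
  value theorem can handle.\<close>

lemma mem_curve_Cup:
  assumes "i < j"
  shows "z \<in> curve m (Cup i j) \<longleftrightarrow> Im z <= 0 & (Re z - real i) * (Re z - real j) + (Im z)\<^sup>2 = 0"
proof -
  let ?c = "(real i + real j) / 2" and ?r = "(real j - real i) / 2"
  have "dist z (Complex ?c 0) = ?r \<longleftrightarrow> (dist z (Complex ?c 0))\<^sup>2 = ?r\<^sup>2"
    using assms by (intro iffI) (auto simp: power2_eq_iff_nonneg)
  also have "(dist z (Complex ?c 0))\<^sup>2 = (Re z - ?c)\<^sup>2 + (Im z)\<^sup>2"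
    by (simp add: dist_norm cmod_power2)
  also have "(Re z - ?c)\<^sup>2 + (Im z)\<^sup>2 = ?r\<^sup>2 \<longleftrightarrow> (Re z - real i) * (Re z - real j) + (Im z)\<^sup>2 = 0"
    by (auto simp: power2_eq_square field_simps)
  finally show ?thesis by simp
qed

lemma mem_curve_Ray: "z \<in> curve m (Ray i) \<longleftrightarrow> Re z = real i & - real m <= Im z & Im z <= 0"
  by (auto simp: closed_segment_same_Re closed_segment_eq_real_ivl split: if_splits)

declare curve.simps [simp del]

lemma curve_Cup_Re:
  assumes "i < j" "z \<in> curve m (Cup i j)"
  shows "real i <= Re z" "Re z <= real j"
proof -
  have "(Re z - real i) * (Re z - real j) <= 0"
    using assms(2) unfolding mem_curve_Cup[OF assms(1)] by (smt (verit) zero_le_power2)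
  then show "real i <= Re z" "Re z <= real j"
    using assms(1) by (auto simp: mult_le_0_iff)
qed

text \<open>The difference of the two sides is affine in \<open>X\<close> and positive at both ends
  \<open>i'\<close> and \<open>j'\<close>; the identity \<open>eq\<close> is its interpolation
  between these ends.\<close>

lemma nested_quadratics:
  fixes i :: real
  assumes "i < i'" "i' < j'" "j' < j" "i' <= X" "X <= j'"
  shows "(X - i) * (X - j) < (X - i') * (X - j')"
proof -
  have eq: "(j' - i') * ((X - i') * (X - j') - (X - i) * (X - j)) =
      (j' - X) * ((i' - i) * (j - i')) + (X - i') * ((j' - i) * (j - j'))"
    by (simp add: algebra_simps)
  have 1: "0 < (i' - i) * (j - i')" "0 < (j' - i) * (j - j')" using assms by auto
  have "0 < (j' - X) * ((i' - i) * (j - i')) + (X - i') * ((j' - i) * (j - j'))"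
  proof (cases "X = j'")
    case True
    then have "0 < (X - i') * ((j' - i) * (j - j'))" using 1 assms by (intro mult_pos_pos) auto
    then show ?thesis using True by simp
  next
    case False
    then have "0 < (j' - X) * ((i' - i) * (j - i'))" using 1 assms by (intro mult_pos_pos) auto
    moreover have "0 <= (X - i') * ((j' - i) * (j - j'))" using 1 assms by (intro mult_nonneg_nonneg) auto
    ultimately show ?thesis by linarith
  qed
  then have "0 < (j' - i') * ((X - i') * (X - j') - (X - i) * (X - j))" by (simp only: eq)
  then show ?thesis using assms by (simp add: zero_less_mult_iff)
qed

text \<open>Planarity is replaced by order: disjointness of the curves becomes absence of crossings,
  and right accessibility becomes absence of rays to the right and of cups around an end. Strict
  inequalities suffice because strands share no vertex.\<close>

definition combinatorial_diagram :: "nat => cup_diagram => bool" where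
  "combinatorial_diagram m a \<longleftrightarrow>
     (\<forall>s\<in>strands a. ends s \<subseteq> {1..m}) &
     (\<forall>i j. Cup i j \<in> strands a --> i < j) &
     (\<forall>i\<in>{1..m}. \<exists>!s. s \<in> strands a & i \<in> ends s) &
     (\<forall>i j i' j'. Cup i j \<in> strands a --> Cup i' j' \<in> strands a --> \<not> (i < i' & i' < j & j < j')) &
     (\<forall>i j l. Cup i j \<in> strands a --> Ray l \<in> strands a --> \<not> (i < l & l < j)) &
     dotted a \<subseteq> strands a &
     (\<forall>s\<in>dotted a. \<forall>e\<in>ends s. (\<forall>l. Ray l \<in> strands a --> \<not> e < l) &
        (\<forall>i j. Cup i j \<in> strands a --> \<not> (i < e & e < j)))"

lemma combinatorial_diagramD:
  assumes "combinatorial_diagram m a"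
  shows "s \<in> strands a ==> e \<in> ends s ==> 1 <= e & e <= m"
    and "Cup i j \<in> strands a ==> i < j"
    and "s \<in> strands a ==> t \<in> strands a ==> e \<in> ends s ==> e \<in> ends t ==> s = t"
    and "1 <= e ==> e <= m ==> \<exists>s\<in>strands a. e \<in> ends s"
    and "Cup i j \<in> strands a ==> Cup i' j' \<in> strands a ==> i < i' ==> i' < j ==> j < j' ==> False"
    and "Cup i j \<in> strands a ==> Ray l \<in> strands a ==> i < l ==> l < j ==> False"
    and "s \<in> dotted a ==> s \<in> strands a"
    and "s \<in> dotted a ==> e \<in> ends s ==> Ray l \<in> strands a ==> e < l ==> False"
    and "s \<in> dotted a ==> e \<in> ends s ==> Cup i j \<in> strands a ==> i < e ==> e < j ==> False"
proof -
  note d = assms[unfolded combinatorial_diagram_def]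
  show 1: "s \<in> strands a ==> e \<in> ends s ==> 1 <= e & e <= m" for s e
    using d by (meson atLeastAtMost_iff subset_iff)
  show "Cup i j \<in> strands a ==> i < j" using d by blast
  show "s \<in> strands a ==> t \<in> strands a ==> e \<in> ends s ==> e \<in> ends t ==> s = t"
  proof -
    assume *: "s \<in> strands a" "t \<in> strands a" "e \<in> ends s" "e \<in> ends t"
    have U: "\<forall>i\<in>{1..m}. \<exists>!s. s \<in> strands a & i \<in> ends s" using d by (elim conjE)
    from * have "e \<in> {1..m}" using 1 by auto
    from bspec[OF U this] have "\<exists>w. \<forall>y. y \<in> strands a & e \<in> ends y --> y = w" unfolding Ex1_def by blast
    then show "s = t" using * by auto
  qed
  show "1 <= e ==> e <= m ==> \<exists>s\<in>strands a. e \<in> ends s"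
    using d by (meson atLeastAtMost_iff)
  show "Cup i j \<in> strands a ==> Cup i' j' \<in> strands a ==> i < i' ==> i' < j ==> j < j' ==> False" using d by blast
  show "Cup i j \<in> strands a ==> Ray l \<in> strands a ==> i < l ==> l < j ==> False" using d by blast
  show "s \<in> dotted a ==> s \<in> strands a" using d by blast
  show "s \<in> dotted a ==> e \<in> ends s ==> Ray l \<in> strands a ==> e < l ==> False" using d by blast
  show "s \<in> dotted a ==> e \<in> ends s ==> Cup i j \<in> strands a ==> i < e ==> e < j ==> False" using d by blast
qed

lemma crossing_cups_meet:
  assumes "i < i'" "i' < j" "j < j'"
  shows "curve m (Cup i j) \<inter> curve m (Cup i' j') ~= {}"
proof -
  define a b c d where "a = real i" and "b = real j" and "c = real i'" and "d = real j'"
  have o: "a < c" "c < b" "b < d" using assms by (auto simp: a_def b_def c_def d_def)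
  define D where "D = c + d - a - b"
  \<comment> \<open>The abscissa of the radical axis of the two circles, where the two quadratics
    agree.\<close>
  define X where "X = (c * d - a * b) / D"
  have D: "D > 0" using o by (simp add: D_def)
  have XD: "X * D = c * d - a * b" using D by (simp add: X_def)
  have "(X - a) * D = X * D - a * D" "(b - X) * D = b * D - X * D" by (simp_all add: left_diff_distrib)
  then have "(X - a) * D = (c - a) * (d - a)" "(b - X) * D = (b - c) * (d - b)"
    unfolding XD by (simp_all add: D_def algebra_simps)
  then have "0 < (X - a) * D" "0 < (b - X) * D" using o by auto
  then have Xab: "a < X" "X < b" using D by (auto simp: zero_less_mult_iff)
  define Y where "Y = - sqrt ((X - a) * (b - X))"
  have Y: "Y\<^sup>2 = (X - a) * (b - X)" "Y <= 0" using Xab by (auto simp: Y_def)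
  have 1: "(X - a) * (X - b) + Y\<^sup>2 = 0" unfolding Y by (simp add: algebra_simps)
  have "(X - c) * (X - d) - (X - a) * (X - b) = c * d - a * b - X * D"
    by (simp add: D_def algebra_simps)
  then have "(X - c) * (X - d) - (X - a) * (X - b) = 0" unfolding XD by simp
  then have 2: "(X - c) * (X - d) + Y\<^sup>2 = 0" using 1 by linarith
  have "Complex X Y \<in> curve m (Cup i j)" "Complex X Y \<in> curve m (Cup i' j')"
    using assms 1 2 Y(2) by (auto simp: mem_curve_Cup a_def b_def c_def d_def)
  then show ?thesis by blast
qed

lemma crossing_cup_ray_meet:
  assumes "i < l" "l < j" "j <= m"
  shows "curve m (Cup i j) \<inter> curve m (Ray l) ~= {}"
proof -
  define Y where "Y = - sqrt ((real l - real i) * (real j - real l))"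
  have Y: "Y\<^sup>2 = (real l - real i) * (real j - real l)" "Y <= 0" using assms by (auto simp: Y_def)
  have 1: "(real l - real i) * (real l - real j) + Y\<^sup>2 = 0" unfolding Y by (simp add: algebra_simps)
  \<comment> \<open>The semicircle stays within depth \<open>m\<close>, so that its point below
    vertex \<open>l\<close> still lies on the ray.\<close>
  have "(real l - real i) * (real j - real l) <= real m * real m"
    using assms by (intro mult_mono) auto
  then have "sqrt ((real l - real i) * (real j - real l)) <= real m"
    by (intro real_le_lsqrt) (auto simp: power2_eq_square)
  then have "- real m <= Y" by (simp add: Y_def)
  then have "Complex (real l) Y \<in> curve m (Cup i j)" "Complex (real l) Y \<in> curve m (Ray l)"
    using assms 1 Y(2) by (auto simp: mem_curve_Cup mem_curve_Ray)
  then show ?thesis by blast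
qed

lemma cup_curve_inside:
  assumes "i' < i" "i < j" "j < j'" "z \<in> curve m (Cup i j)"
  shows "(Re z - real i') * (Re z - real j') + (Im z)\<^sup>2 < 0"
proof -
  have "(Re z - real i') * (Re z - real j') < (Re z - real i) * (Re z - real j)"
    using assms curve_Cup_Re[OF assms(2,4)] by (intro nested_quadratics) auto
  then show ?thesis using assms(4) unfolding mem_curve_Cup[OF assms(2)] by linarith
qed

lemma path_real_ivt:
  assumes "path g" "continuous_on (path_image g) \<phi>" "\<phi> (pathstart g) <= c" "c <= \<phi> (pathfinish g)"
  shows "\<exists>z\<in>path_image g. \<phi> z = (c :: real)"
proof -
  have "continuous_on {0..1} (\<phi> \<circ> g)"
    using assms(1,2) unfolding path_def path_image_def by (intro continuous_on_compose)
  then obtain t where "0 <= t" "t <= 1" "\<phi> (g t) = c"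
    using IVT'[of "\<phi> \<circ> g" 0 c 1] assms(3,4) by (auto simp: pathstart_def pathfinish_def)
  then show ?thesis by (intro bexI[of _ "g t"]) (auto simp: path_image_def)
qed

text \<open>The intermediate value theorem takes the place of a separation theorem in the plane:
  along an access path \<open>Re\<close> would have to pass the abscissa of a ray further right, and
  the quadratic of an enclosing cup would have to change sign.\<close>

lemma cup_diagram_combinatorial:
  assumes "is_cup_diagram m a"
  shows "combinatorial_diagram m a"
proof -
  note d = assms[unfolded is_cup_diagram_def]
  have E: "1 <= e & e <= m" if "s \<in> strands a" "e \<in> ends s" for s e
    using d that by (meson atLeastAtMost_iff subset_iff)
  have lt: "i < j" if "Cup i j \<in> strands a" for i j using d that by blast
  have uniq: "s = t" if "s \<in> strands a" "t \<in> strands a" "e \<in> ends s" "e \<in> ends t" for s t e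
  proof -
    have U: "\<forall>i\<in>{1..m}. \<exists>!s. s \<in> strands a & i \<in> ends s" using d by (elim conjE)
    have "e \<in> {1..m}" using E that by auto
    from bspec[OF U this] have "\<exists>w. \<forall>y. y \<in> strands a & e \<in> ends y --> y = w" unfolding Ex1_def by blast
    then show "s = t" using that by auto
  qed
  have disj: "curve m s \<inter> curve m t = {}" if "s \<in> strands a" "t \<in> strands a" "s ~= t" for s t
    using d that unfolding disjoint_family_on_def by blast
  have cc: False if "Cup i j \<in> strands a" "Cup i' j' \<in> strands a" "i < i'" "i' < j" "j < j'" for i j i' j'
    using disj[OF that(1,2)] crossing_cups_meet[OF that(3,4,5)] that(3) by simp
  have cr: False if "Cup i j \<in> strands a" "Ray l \<in> strands a" "i < l" "l < j" for i j l
    using disj[OF that(1,2)] crossing_cup_ray_meet[OF that(3,4)] E[OF that(1), of j] by simp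
  have dr: False if s: "s \<in> dotted a" "e \<in> ends s" and l: "Ray l \<in> strands a" "e < l" for s e l
  proof -
    have S: "s \<in> strands a" and "right_accessible m (strands a) s" using d s by auto
    then obtain g where g: "path g" "path_image g \<subseteq> rectangle m" "pathstart g \<in> curve m s"
      "Re (pathfinish g) = real m + 1" "\<And>t. t \<in> strands a - {s} ==> path_image g \<inter> curve m t = {}"
      unfolding right_accessible_def by blast
    have ne: "Ray l ~= s" using s l by auto
    have "Re (pathstart g) <= real l"
    proof (cases s)
      case (Cup i j)
      then have ij: "i < j" using lt S by simp
      have "j < l"
      proof (rule ccontr)
        assume "\<not> j < l"
        moreover have "l ~= j" using uniq[OF S l(1), of j] Cup by auto
        ultimately show False using cr[of i j l] S l s(2) Cup ij by auto
      qed
      then show ?thesis using curve_Cup_Re(2)[OF ij, of "pathstart g" m] g(3) Cup by simp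
    next
      case (Ray i)
      then show ?thesis using g(3) s l by (auto simp: mem_curve_Ray)
    qed
    moreover have "real l <= Re (pathfinish g)" using E[OF l(1)] g(4) by simp
    moreover have "continuous_on (path_image g) Re" by (intro continuous_intros)
    ultimately have "\<exists>z\<in>path_image g. Re z = real l"
      by (intro path_real_ivt[OF g(1)])
    then obtain z where z: "z \<in> path_image g" "Re z = real l" ..
    then have "z \<in> curve m (Ray l)"
      using subsetD[OF g(2) z(1)] z(2) unfolding mem_curve_Ray rectangle_def by simp
    moreover have "path_image g \<inter> curve m (Ray l) = {}" by (rule g(5)) (use l(1) ne in simp)
    ultimately show False using z(1) unfolding disjoint_iff by (metis (no_types))
  qed
  have dc: False if s: "s \<in> dotted a" "e \<in> ends s" and l: "Cup i' j' \<in> strands a" "i' < e" "e < j'" for s e i' j'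
  proof -
    have S: "s \<in> strands a" and "right_accessible m (strands a) s" using d s by auto
    then obtain g where g: "path g" "path_image g \<subseteq> rectangle m" "pathstart g \<in> curve m s"
      "Re (pathfinish g) = real m + 1" "\<And>t. t \<in> strands a - {s} ==> path_image g \<inter> curve m t = {}"
      unfolding right_accessible_def by blast
    have ne: "Cup i' j' ~= s" using s l by auto
    let ?\<phi> = "%z. (Re z - real i') * (Re z - real j') + (Im z)\<^sup>2"
    \<comment> \<open>A ray cannot start under the cup, and a cup with an end there is nested in it,
      since crossings are excluded; so the path starts inside the disc.\<close>
    have "?\<phi> (pathstart g) <= 0"
    proof (cases s)
      case (Cup i j)
      then have ij: "i < j" using lt S by simp
      have C: "Cup i j \<in> strands a" using S Cup by simp
      have "x ~= i'" "x ~= j'" if "x = i \<or> x = j" for x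
        using uniq[OF C l(1), of x] ne that unfolding Cup by auto
      then have nej: "i ~= i'" "i ~= j'" "j ~= i'" "j ~= j'" by simp_all
      have e: "e = i \<or> e = j" using s(2) Cup by simp
      have 1: "i' < i"
      proof (rule ccontr)
        assume "\<not> i' < i"
        then have "i < i'" using nej by simp
        moreover from this have "e = j" using e l(2) by auto
        ultimately show False using cc[OF C l(1)] l(2,3) by simp
      qed
      have 2: "j < j'"
      proof (rule ccontr)
        assume "\<not> j < j'"
        then have "j' < j" using nej by simp
        moreover from this have "e = i" using e l(3) by auto
        ultimately show False using cc[OF l(1) C] l(2,3) by simp
      qed
      show ?thesis using cup_curve_inside[OF 1 ij 2 g(3)[unfolded Cup]] by (rule less_imp_le)
    next
      case (Ray i)
      then have "Ray e \<in> strands a" using S s(2) by simp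
      then show ?thesis using cr[OF l(1) _ l(2,3)] by blast
    qed
    moreover have "0 <= ?\<phi> (pathfinish g)"
      using E[OF l(1), of i'] E[OF l(1), of j'] g(4) by (intro add_nonneg_nonneg mult_nonneg_nonneg) auto
    moreover have "continuous_on (path_image g) ?\<phi>" by (intro continuous_intros)
    ultimately have "\<exists>z\<in>path_image g. ?\<phi> z = 0"
      by (intro path_real_ivt[OF g(1)])
    then obtain z where z: "z \<in> path_image g" "?\<phi> z = 0" ..
    then have "z \<in> curve m (Cup i' j')"
      using subsetD[OF g(2) z(1)] z(2) unfolding mem_curve_Cup[OF lt[OF l(1)]] rectangle_def by simp
    moreover have "path_image g \<inter> curve m (Cup i' j') = {}" by (rule g(5)) (use l(1) ne in simp)
    ultimately show False using z(1) unfolding disjoint_iff by (metis (no_types))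
  qed
  show ?thesis
    unfolding combinatorial_diagram_def
  proof (intro conjI)
    show "\<forall>s\<in>strands a. ends s \<subseteq> {1..m}" by (rule d[THEN conjunct1])
    show "\<forall>i j. Cup i j \<in> strands a --> i < j" by (rule d[THEN conjunct2, THEN conjunct1])
    show "\<forall>i\<in>{1..m}. \<exists>!s. s \<in> strands a & i \<in> ends s"
      by (rule d[THEN conjunct2, THEN conjunct2, THEN conjunct1])
    show "dotted a \<subseteq> strands a"
      using d[THEN conjunct2, THEN conjunct2, THEN conjunct2, THEN conjunct2] by blast
    show "\<forall>i j i' j'. Cup i j \<in> strands a --> Cup i' j' \<in> strands a --> \<not> (i < i' & i' < j & j < j')"
      by (intro allI impI notI, elim conjE) (rule cc)
    show "\<forall>i j l. Cup i j \<in> strands a --> Ray l \<in> strands a --> \<not> (i < l & l < j)"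
      by (intro allI impI notI, elim conjE) (rule cr)
    show "\<forall>s\<in>dotted a. \<forall>e\<in>ends s. (\<forall>l. Ray l \<in> strands a --> \<not> e < l) &
        (\<forall>i j. Cup i j \<in> strands a --> \<not> (i < e & e < j))"
    proof (intro ballI conjI allI impI notI)
      fix s e l assume "s \<in> dotted a" "e \<in> ends s" "Ray l \<in> strands a" "e < l"
      then show False by (rule dr)
    next
      fix s e i j assume "s \<in> dotted a" "e \<in> ends s" "Cup i j \<in> strands a" "i < e & e < j"
      then show False by (elim conjE) (rule dc)
    qed
  qed
qed

text \<open>Two cups that do not cross are side by side, hence separated by their abscissas, or
  nested, and then the quadratic of the outer one is negative on the inner one.\<close>

lemma combinatorial_curves_disjoint:
  assumes a: "combinatorial_diagram m a" and st: "s \<in> strands a" "t \<in> strands a" "s ~= t"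
  shows "curve m s \<inter> curve m t = {}"
proof -
  note D = combinatorial_diagramD[OF a]
  have cc: False if C: "Cup i j \<in> strands a" "Cup i' j' \<in> strands a" "i < i'"
    and z: "z \<in> curve m (Cup i j)" "z \<in> curve m (Cup i' j')" for i j i' j' z
  proof -
    have ij: "i < j" "i' < j'" using D(2) C by auto
    have ne: "i' ~= j" "j ~= j'" using D(3)[OF C(1,2), of j] C(3) by auto
    consider "j < i'" | "j' < j" using D(5)[OF C(1,2,3)] ne by (cases "j < i'"; cases "j' < j") auto
    then show False
    proof cases
      case 1
      then show ?thesis using curve_Cup_Re[OF ij(1) z(1)] curve_Cup_Re[OF ij(2) z(2)] by linarith
    next
      case 2
      then show ?thesis using cup_curve_inside[OF C(3) ij(2) 2 z(2)] z(1) unfolding mem_curve_Cup[OF ij(1)] by simp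
    qed
  qed
  have cr: False if C: "Cup i j \<in> strands a" "Ray l \<in> strands a"
    and z: "z \<in> curve m (Cup i j)" "z \<in> curve m (Ray l)" for i j l z
  proof -
    have ij: "i < j" using D(2) C by auto
    have "l ~= i" "l ~= j" using D(3)[OF C, of l] by auto
    moreover have "real i <= real l" "real l <= real j"
      using curve_Cup_Re[OF ij z(1)] z(2) unfolding mem_curve_Ray by auto
    ultimately show False using D(6)[OF C] by auto
  qed
  show ?thesis
  proof (rule ccontr)
    assume "\<not> ?thesis"
    then obtain z where z: "z \<in> curve m s" "z \<in> curve m t" by blast
    show False
    proof (cases s)
      case s: (Cup i j)
      show ?thesis
      proof (cases t)
        case t: (Cup i' j')
        have "i ~= i'" using D(3)[OF st(1,2), of i] s t st(3) by auto
        then show ?thesis using cc[of i j i' j' z] cc[of i' j' i j z] s t st z by (metis linorder_neqE_nat)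
      next
        case t: (Ray l)
        show ?thesis using cr[of i j l z] s t st z by simp
      qed
    next
      case s: (Ray l)
      show ?thesis
      proof (cases t)
        case t: (Cup i' j')
        show ?thesis using cr[of i' j' l z] s t st z by simp
      next
        case t: (Ray l')
        show ?thesis using s t st z by (auto simp: mem_curve_Ray)
      qed
    qed
  qed
qed

text \<open>The depth is at most \<open>j - i\<close>, which is less than \<open>m\<close>. This
  leaves the bottom edge to the rays, so that access paths can run along it.\<close>

lemma cup_curve_not_bottom:
  assumes "1 <= i" "i < j" "j <= m" "z \<in> curve m (Cup i j)"
  shows "Im z ~= - real m"
proof
  assume "Im z = - real m"
  then have "(real m)\<^sup>2 = (Re z - real i) * (real j - Re z)"
    using assms(4) unfolding mem_curve_Cup[OF assms(2)] by (auto simp: algebra_simps)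
  also have "\<dots> <= (real j - real i) * (real j - real i)"
    using curve_Cup_Re[OF assms(2,4)] by (intro mult_mono) auto
  also have "\<dots> < real m * real m"
    using assms by (intro mult_strict_mono) auto
  finally show False by (simp add: power2_eq_square)
qed

text \<open>The path goes straight down from the lowest point of the strand, if it is a cup, and
  then along the bottom edge to the right.\<close>

lemma combinatorial_right_accessible:
  assumes a: "combinatorial_diagram m a" and s: "s \<in> dotted a"
  shows "right_accessible m (strands a) s"
proof -
  note D = combinatorial_diagramD[OF a]
  have S: "s \<in> strands a" using D(7) s .
  have nb: "Im z ~= - real m" if "Cup i j \<in> strands a" "z \<in> curve m (Cup i j)" for i j z
    using cup_curve_not_bottom[OF _ D(2)[OF that(1)] _ that(2)] D(1)[OF that(1)] by simp
  have bottom: "closed_segment (Complex c (- real m)) (Complex (real m + 1) (- real m)) \<subseteq>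
      {z. Im z = - real m & c <= Re z & Re z <= real m + 1}" if "c <= real m + 1" for c
    using that by (auto simp: closed_segment_same_Im closed_segment_eq_real_ivl)
  show ?thesis
  proof (cases s)
    case (Ray l)
    have l: "1 <= l" "l <= m" using D(1)[OF S] Ray by auto
    let ?g = "linepath (Complex (real l) (- real m)) (Complex (real m + 1) (- real m))"
    have im: "path_image ?g \<subseteq> {z. Im z = - real m & real l <= Re z & Re z <= real m + 1}"
      using bottom[of "real l"] l by simp
    have "path_image ?g \<inter> curve m t = {}" if t: "t \<in> strands a - {s}" for t
    proof (cases t)
      case (Cup i j)
      then show ?thesis using im nb[of i j] t by blast
    next
      case t': (Ray l')
      have "\<not> l < l'" using D(8)[OF s, of l l'] Ray t t' by auto
      then have "l' < l" using t t' Ray by auto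
      then show ?thesis using im t' by (auto simp: mem_curve_Ray)
    qed
    then show ?thesis
      unfolding right_accessible_def using im l Ray
      by (intro exI[of _ ?g]) (auto simp: rectangle_def mem_curve_Ray)
  next
    case (Cup i j)
    have ij: "i < j" using D(2) S Cup by simp
    have b: "1 <= i" "j <= m" using D(1)[OF S] Cup by auto
    define c r where "c = (real i + real j) / 2" and "r = (real j - real i) / 2"
    have cr: "real i < c" "c < real j" "0 < r" "r < real m" "c <= real m + 1" using ij b by (auto simp: c_def r_def)
    let ?g1 = "linepath (Complex c (- r)) (Complex c (- real m))"
    let ?g2 = "linepath (Complex c (- real m)) (Complex (real m + 1) (- real m))"
    have im1: "path_image ?g1 \<subseteq> {z. Re z = c & - real m <= Im z & Im z <= - r}"
      using cr by (auto simp: closed_segment_same_Re closed_segment_eq_real_ivl split: if_splits)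
    have im2: "path_image ?g2 \<subseteq> {z. Im z = - real m & c <= Re z & Re z <= real m + 1}"
      using bottom[OF cr(5)] by simp
    have pim: "path_image (?g1 +++ ?g2) = path_image ?g1 \<union> path_image ?g2"
      by (rule path_image_join) simp
    have start: "Complex c (- r) \<in> curve m s"
    proof -
      have "(c - real i) * (c - real j) + (- r)\<^sup>2 = 0"
        unfolding c_def r_def power2_eq_square by (simp add: field_simps)
      then show ?thesis unfolding Cup mem_curve_Cup[OF ij] using cr(3) by simp
    qed
    have dj: "path_image (?g1 +++ ?g2) \<inter> curve m t = {}" if t: "t \<in> strands a - {s}" for t
    proof (cases t)
      case t': (Cup i' j')
      have ij': "i' < j'" using D(2) t t' by simp
      have ne: "i ~= i'" "i ~= j'" "j ~= i'" "j ~= j'"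
      proof -
        have "Cup i j \<in> strands a" "Cup i' j' \<in> strands a" "Cup i j ~= Cup i' j'" using S t t' Cup by auto
        then have "x ~= i'" "x ~= j'" if "x = i \<or> x = j" for x
          using D(3)[of "Cup i j" "Cup i' j'" x] that by auto
        then show "i ~= i'" "i ~= j'" "j ~= i'" "j ~= j'" by simp_all
      qed
      \<comment> \<open>A cup met by the vertical segment must have ends on both sides of it. It
        cannot surround an end of \<open>s\<close>, because \<open>s\<close> is dotted, so it is
        nested in \<open>s\<close> and lies strictly inside the disc that the segment
        avoids.\<close>
      have "z \<notin> curve m t" if z: "z \<in> path_image ?g1" for z
      proof
        assume zt: "z \<in> curve m t"
        have z': "Re z = c" "Im z <= - r" using subsetD[OF im1 z] by simp_all
        have Re': "real i' <= c" "c <= real j'" using curve_Cup_Re[OF ij', of z m] zt t' z' by simp_all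
        have "i < i'"
        proof (rule ccontr)
          assume "\<not> i < i'"
          then have "i' < i" using ne by simp
          moreover have "i < j'" using Re' cr by linarith
          ultimately show False using D(9)[OF s, of i i' j'] t t' Cup by simp
        qed
        moreover have "j' < j"
        proof (rule ccontr)
          assume "\<not> j' < j"
          then have "j < j'" using ne by simp
          moreover have "i' < j" using Re' cr by linarith
          ultimately show False using D(9)[OF s, of j i' j'] t t' Cup by simp
        qed
        ultimately have "(Re z - real i) * (Re z - real j) + (Im z)\<^sup>2 < 0"
          using cup_curve_inside[OF _ ij', of i j z m] zt t' by simp
        moreover have "(Re z - real i) * (Re z - real j) = - r\<^sup>2"
          unfolding z' by (simp add: c_def r_def power2_eq_square field_simps)
        moreover have "r\<^sup>2 <= (Im z)\<^sup>2"
        proof -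
          have "r\<^sup>2 <= (- Im z)\<^sup>2" using z'(2) cr(3) by (intro power_mono) auto
          then show ?thesis by simp
        qed
        ultimately show False by linarith
      qed
      moreover have "z \<notin> curve m t" if z: "z \<in> path_image ?g2" for z
      proof
        assume "z \<in> curve m t"
        then show False using nb[of i' j' z] t t' subsetD[OF im2 z] by simp
      qed
      ultimately show ?thesis unfolding pim by (intro equals0I) (elim IntE UnE; simp only: simp_thms)
    next
      case t': (Ray l')
      have "\<not> i < l'" using D(8)[OF s, of i l'] Cup t t' by auto
      then have "z \<notin> curve m t" if "c <= Re z" for z
        using that cr t' by (auto simp: mem_curve_Ray)
      moreover have "c <= Re z" if "z \<in> path_image (?g1 +++ ?g2)" for z
        using that subsetD[OF im1, of z] subsetD[OF im2, of z] unfolding pim by (elim UnE) simp_all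
      ultimately show ?thesis by (intro equals0I) (elim IntE, simp only: simp_thms)
    qed
    have rect: "path_image (?g1 +++ ?g2) \<subseteq> rectangle m"
    proof
      fix z assume "z \<in> path_image (?g1 +++ ?g2)"
      then consider "z \<in> path_image ?g1" | "z \<in> path_image ?g2" unfolding pim by (rule UnE)
      then show "z \<in> rectangle m"
      proof cases
        case 1
        show ?thesis using subsetD[OF im1 1] cr unfolding rectangle_def by simp
      next
        case 2
        show ?thesis using subsetD[OF im2 2] cr unfolding rectangle_def by simp
      qed
    qed
    show ?thesis
      unfolding right_accessible_def
    proof (intro exI[of _ "?g1 +++ ?g2"] conjI ballI)
      show "path (?g1 +++ ?g2)" "Re (pathfinish (?g1 +++ ?g2)) = real m + 1" by simp_all
      show "pathstart (?g1 +++ ?g2) \<in> curve m s" using start by simp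
      show "path_image (?g1 +++ ?g2) \<subseteq> rectangle m" by (rule rect)
      show "path_image (?g1 +++ ?g2) \<inter> curve m t = {}" if "t \<in> strands a - {s}" for t
        using that by (rule dj)
    qed
  qed
qed

lemma is_cup_diagram_iff: "is_cup_diagram m a \<longleftrightarrow> combinatorial_diagram m a"
proof
  assume "is_cup_diagram m a"
  then show "combinatorial_diagram m a" by (rule cup_diagram_combinatorial)
next
  assume a: "combinatorial_diagram m a"
  have "disjoint_family_on (curve m) (strands a)"
    using combinatorial_curves_disjoint[OF a] by (auto simp: disjoint_family_on_def)
  note c = a[unfolded combinatorial_diagram_def]
  show "is_cup_diagram m a"
    unfolding is_cup_diagram_def
  proof (intro conjI)
    show "\<forall>s\<in>strands a. ends s \<subseteq> {1..m}" by (rule c[THEN conjunct1])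
    show "\<forall>i j. Cup i j \<in> strands a --> i < j" by (rule c[THEN conjunct2, THEN conjunct1])
    show "\<forall>i\<in>{1..m}. \<exists>!s. s \<in> strands a & i \<in> ends s"
      by (rule c[THEN conjunct2, THEN conjunct2, THEN conjunct1])
    show "disjoint_family_on (curve m) (strands a)" by fact
    show "\<forall>s\<in>dotted a. s \<in> strands a & right_accessible m (strands a) s"
      using combinatorial_right_accessible[OF a] combinatorial_diagramD(7)[OF a] by simp
  qed
qed

lemma finite_strands:
  assumes "combinatorial_diagram m a"
  shows "finite (strands a)"
proof (rule finite_subset)
  show "strands a \<subseteq> (\<lambda>(i, j). Cup i j) ` ({..m} \<times> {..m}) \<union> Ray ` {..m}"
  proof
    fix s assume s: "s \<in> strands a"
    show "s \<in> (\<lambda>(i, j). Cup i j) ` ({..m} \<times> {..m}) \<union> Ray ` {..m}"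
      using combinatorial_diagramD(1)[OF assms s] by (cases s) auto
  qed
qed auto

lemma finite_cup_diagrams: "finite (cup_diagrams m k)"
proof (rule finite_subset)
  let ?U = "(\<lambda>(i, j). Cup i j) ` ({..m} \<times> {..m}) \<union> Ray ` {..m}"
  show "cup_diagrams m k \<subseteq> (\<lambda>(A, B). \<lparr>strands = A, dotted = B\<rparr>) ` (Pow ?U \<times> Pow ?U)"
  proof
    fix a assume "a \<in> cup_diagrams m k"
    then have a: "combinatorial_diagram m a" by (simp add: cup_diagrams_def is_cup_diagram_iff)
    have "s \<in> ?U" if "s \<in> strands a" for s
      using combinatorial_diagramD(1)[OF a that] by (cases s) auto
    then have "strands a \<in> Pow ?U" "dotted a \<in> Pow ?U"
      using combinatorial_diagramD(7)[OF a] by blast+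
    then show "a \<in> (\<lambda>(A, B). \<lparr>strands = A, dotted = B\<rparr>) ` (Pow ?U \<times> Pow ?U)"
      by (intro image_eqI[of _ _ "(strands a, dotted a)"]) simp_all
  qed
qed auto

text \<open>The values are parameters so that one definition serves both points of the sphere and
  matrices, where the antipode turns into the complementary projection.\<close>

definition labelled :: "('b => 'b) => 'b => 'b => 'b => cup_diagram => (nat => 'b) => bool" where
  "labelled ng p p' q a X \<longleftrightarrow>
     (\<forall>i j. Cup i j \<in> strands a --> X i = (if Cup i j \<in> dotted a then X j else ng (X j))) &
     (\<forall>i. Ray i \<in> strands a -->
        X i = (if Ray i \<in> dotted a then p else if \<forall>j. Ray j \<in> strands a --> j <= i then p' else q))"

lemma sphere_component_labelled:
  "sphere_component m a = {x \<in> {1..m} \<rightarrow>\<^sub>E sphere 0 1. labelled uminus pole_p (- pole_p) pole_q a x}"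
  by (simp add: sphere_component_def labelled_def)

section \<open>Building diagrams by inserting cups\<close>

fun map_strand :: "(nat => nat) => strand => strand" where
  "map_strand f (Cup i j) = Cup (f i) (f j)"
| "map_strand f (Ray i) = Ray (f i)"

lemma ends_map_strand: "ends (map_strand f s) = f ` ends s"
  by (cases s) auto

lemma is_Cup_map_strand [simp]: "is_Cup (map_strand f s) = is_Cup s"
  by (cases s) auto

text \<open>An undotted cup between neighbours crosses nothing. A dotted one is used only after all
  old vertices, where no ray lies to its right and no cup surrounds it.\<close>

definition insert_cup :: "cup_diagram => nat => bool => cup_diagram" where
  "insert_cup a i d = (let f = (%l. if l < i then l else l + 2) in
     \<lparr>strands = insert (Cup i (Suc i)) (map_strand f ` strands a),
      dotted = (if d then {Cup i (Suc i)} else {}) \<union> map_strand f ` dotted a\<rparr>)"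

context
  fixes a :: cup_diagram and m i :: nat and d :: bool and f :: "nat => nat"
  assumes a: "combinatorial_diagram m a" and i: "1 <= i" "i <= Suc m" and d: "d ==> i = Suc m"
  defines "f \<equiv> (%l. if l < i then l else l + 2)"
begin

lemma f_less: "f x < f y \<longleftrightarrow> x < y" by (auto simp: f_def)
lemma f_le: "f x <= f y \<longleftrightarrow> x <= y" by (auto simp: f_def)
lemma f_eq: "f x = f y \<longleftrightarrow> x = y" by (auto simp: f_def split: if_splits)
lemma f_ne: "f x ~= i" "f x ~= Suc i" "i ~= f x" "Suc i ~= f x" by (auto simp: f_def)
lemma f_range: "1 <= x ==> x <= m ==> 1 <= f x & f x <= m + 2" by (auto simp: f_def)

lemma f_surj:
  assumes "1 <= e" "e <= m + 2" "e ~= i" "e ~= Suc i"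
  obtains x where "1 <= x" "x <= m" "e = f x"
proof (cases "e < i")
  case True
  then show ?thesis using assms i by (intro that[of e]) (auto simp: f_def)
next
  case False
  then show ?thesis using assms i by (intro that[of "e - 2"]) (auto simp: f_def)
qed

lemma mem_strands_insert:
  "Cup x y \<in> strands (insert_cup a i d) \<longleftrightarrow> x = i & y = Suc i \<or> (\<exists>x' y'. x = f x' & y = f y' & Cup x' y' \<in> strands a)"
  "Ray x \<in> strands (insert_cup a i d) \<longleftrightarrow> (\<exists>x'. x = f x' & Ray x' \<in> strands a)"
proof -
  have s: "strands (insert_cup a i d) = insert (Cup i (Suc i)) (map_strand f ` strands a)"
    by (simp add: insert_cup_def f_def Let_def)
  have "map_strand f s = Cup x y \<longleftrightarrow> (\<exists>x' y'. x = f x' & y = f y' & s = Cup x' y')" for s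
    by (cases s) auto
  then have "Cup x y \<in> map_strand f ` strands a \<longleftrightarrow> (\<exists>x' y'. x = f x' & y = f y' & Cup x' y' \<in> strands a)"
    unfolding image_iff by (metis (no_types))
  then show "Cup x y \<in> strands (insert_cup a i d) \<longleftrightarrow> x = i & y = Suc i \<or> (\<exists>x' y'. x = f x' & y = f y' & Cup x' y' \<in> strands a)"
    unfolding s insert_iff strand.inject by (simp only:)
  have "map_strand f s = Ray x \<longleftrightarrow> (\<exists>x'. x = f x' & s = Ray x')" for s
    by (cases s) auto
  then have "Ray x \<in> map_strand f ` strands a \<longleftrightarrow> (\<exists>x'. x = f x' & Ray x' \<in> strands a)"
    unfolding image_iff by (metis (no_types))
  then show "Ray x \<in> strands (insert_cup a i d) \<longleftrightarrow> (\<exists>x'. x = f x' & Ray x' \<in> strands a)"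
    unfolding s insert_iff by simp
qed

lemma map_strand_eq: "map_strand f s = map_strand f t \<longleftrightarrow> s = t"
  by (cases s; cases t) (auto simp: f_eq)

lemma map_strand_ne: "map_strand f s ~= Cup i (Suc i)" "Cup i (Suc i) ~= map_strand f s"
  by (cases s; simp add: f_ne)+

lemma mem_dotted_insert:
  "map_strand f s \<in> dotted (insert_cup a i d) \<longleftrightarrow> s \<in> dotted a"
  "Cup i (Suc i) \<in> dotted (insert_cup a i d) \<longleftrightarrow> d"
  unfolding insert_cup_def Let_def f_def[symmetric]
  by (auto simp: map_strand_eq map_strand_ne)

lemma combinatorial_insert_cup: "combinatorial_diagram (m + 2) (insert_cup a i d)"
proof -
  note D = combinatorial_diagramD[OF a]
  let ?a = "insert_cup a i d"
  have s: "strands ?a = insert (Cup i (Suc i)) (map_strand f ` strands a)"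
    by (simp add: insert_cup_def f_def Let_def)
  have dt: "dotted ?a = (if d then {Cup i (Suc i)} else {}) \<union> map_strand f ` dotted a"
    by (simp add: insert_cup_def f_def Let_def)
  have fi: "f x < i \<or> Suc i < f x" for x by (auto simp: f_def)
  show ?thesis
    unfolding combinatorial_diagram_def
  proof (intro conjI)
    show "\<forall>s\<in>strands ?a. ends s \<subseteq> {1..m + 2}"
    proof
      fix t assume "t \<in> strands ?a"
      then consider "t = Cup i (Suc i)" | s' where "s' \<in> strands a" "t = map_strand f s'" unfolding s by blast
      then show "ends t \<subseteq> {1..m + 2}"
      proof cases
        case 2
        then show ?thesis using D(1)[OF 2(1)] f_range by (auto simp: ends_map_strand)
      qed (use i in auto)
    qed
    show "\<forall>x y. Cup x y \<in> strands ?a --> x < y"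
      unfolding mem_strands_insert using D(2) by (auto simp: f_less)
    show "\<forall>e\<in>{1..m + 2}. \<exists>!s. s \<in> strands ?a & e \<in> ends s"
    proof
      fix e assume e: "e \<in> {1..m + 2}"
      show "\<exists>!s. s \<in> strands ?a & e \<in> ends s"
      proof (cases "e = i \<or> e = Suc i")
        case True
        show ?thesis
        proof (rule ex1I[of _ "Cup i (Suc i)"])
          show "Cup i (Suc i) \<in> strands ?a & e \<in> ends (Cup i (Suc i))" using True unfolding s by auto
          have "e \<notin> ends (map_strand f s')" for s'
          proof
            assume "e \<in> ends (map_strand f s')"
            then obtain x where "e = f x" unfolding ends_map_strand by blast
            then show False using True f_ne[of x] by simp
          qed
          then show "t = Cup i (Suc i)" if "t \<in> strands ?a & e \<in> ends t" for t
            using that unfolding s by blast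
        qed
      next
        case False
        then obtain x where x: "1 <= x" "x <= m" "e = f x" using f_surj[of e] e by auto
        obtain t where t: "t \<in> strands a" "x \<in> ends t" using D(4)[OF x(1,2)] by blast
        show ?thesis
        proof (rule ex1I[of _ "map_strand f t"])
          show "map_strand f t \<in> strands ?a & e \<in> ends (map_strand f t)"
            using t x unfolding s by (auto simp: ends_map_strand)
          fix u assume u: "u \<in> strands ?a & e \<in> ends u"
          then have "u ~= Cup i (Suc i)" using False by auto
          then obtain u' where u': "u' \<in> strands a" "u = map_strand f u'" using u unfolding s by blast
          then have "x \<in> ends u'" using u x by (auto simp: ends_map_strand f_eq)
          then show "u = map_strand f t" using D(3)[OF u'(1) t(1) _ t(2)] u'(2) by simp
        qed
      qed
    qed
    show "\<forall>x y x' y'. Cup x y \<in> strands ?a --> Cup x' y' \<in> strands ?a --> \<not> (x < x' & x' < y & y < y')"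
    proof (intro allI impI notI)
      fix x y x' y' assume *: "Cup x y \<in> strands ?a" "Cup x' y' \<in> strands ?a" and lt: "x < x' & x' < y & y < y'"
      from * lt have "x ~= i" unfolding mem_strands_insert by (auto simp: f_ne)
      then obtain u w where u: "x = f u" "y = f w" "Cup u w \<in> strands a"
        using *(1) unfolding mem_strands_insert by blast
      have "x' ~= i" using lt fi[of w] u *(2) f_ne unfolding mem_strands_insert by auto
      then obtain u' w' where u': "x' = f u'" "y' = f w'" "Cup u' w' \<in> strands a"
        using *(2) unfolding mem_strands_insert by blast
      show False using D(5)[OF u(3) u'(3)] lt u u' by (simp add: f_less)
    qed
    show "\<forall>x y l. Cup x y \<in> strands ?a --> Ray l \<in> strands ?a --> \<not> (x < l & l < y)"
    proof (intro allI impI notI)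
      fix x y l assume *: "Cup x y \<in> strands ?a" "Ray l \<in> strands ?a" and lt: "x < l & l < y"
      obtain l' where l: "l = f l'" "Ray l' \<in> strands a" using *(2) unfolding mem_strands_insert by blast
      have "x ~= i" using * lt unfolding mem_strands_insert by (auto simp: f_ne)
      then obtain u w where u: "x = f u" "y = f w" "Cup u w \<in> strands a"
        using *(1) unfolding mem_strands_insert by blast
      show False using D(6)[OF u(3) l(2)] lt u l by (simp add: f_less)
    qed
    show "dotted ?a \<subseteq> strands ?a" unfolding s dt using D(7) by auto
    show "\<forall>t\<in>dotted ?a. \<forall>e\<in>ends t. (\<forall>l. Ray l \<in> strands ?a --> \<not> e < l) &
        (\<forall>x y. Cup x y \<in> strands ?a --> \<not> (x < e & e < y))"
    proof (intro ballI)
      fix t e assume t: "t \<in> dotted ?a" "e \<in> ends t"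
      show "(\<forall>l. Ray l \<in> strands ?a --> \<not> e < l) & (\<forall>x y. Cup x y \<in> strands ?a --> \<not> (x < e & e < y))"
      proof (cases "t = Cup i (Suc i)")
        case True
        then have "d" using t mem_dotted_insert(2) by simp
        then have im: "i = Suc m" by (rule d)
        have small: "f l < i" if "u \<in> strands a" "l \<in> ends u" for u l
          using D(1)[OF that] im by (simp add: f_def)
        have e: "e = i \<or> e = Suc i" using t True by simp
        have "\<not> e < l" if "Ray l \<in> strands ?a" for l
          using that small e unfolding mem_strands_insert by fastforce
        moreover have "\<not> (x < e & e < y)" if C: "Cup x y \<in> strands ?a" for x y
        proof (cases "x = i & y = Suc i")
          case False
          then obtain u w where u: "y = f w" "Cup u w \<in> strands a" using C unfolding mem_strands_insert by blast
          then show ?thesis using small[OF u(2), of w] e by auto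
        qed (use e in auto)
        ultimately show ?thesis by simp
      next
        case False
        then obtain t' where t': "t' \<in> dotted a" "t = map_strand f t'" using t unfolding dt by (auto split: if_splits)
        then obtain e' where e': "e' \<in> ends t'" "e = f e'" using t by (auto simp: ends_map_strand)
        have "\<not> e < l" if "Ray l \<in> strands ?a" for l
          using that D(8)[OF t'(1) e'(1)] e' unfolding mem_strands_insert by (auto simp: f_less)
        moreover have "\<not> (x < e & e < y)" if C: "Cup x y \<in> strands ?a" for x y
        proof (cases "x = i & y = Suc i")
          case False
          then obtain u w where u: "x = f u" "y = f w" "Cup u w \<in> strands a" using C unfolding mem_strands_insert by blast
          then show ?thesis using D(9)[OF t'(1) e'(1) u(3)] e' by (auto simp: f_less)
        qed (use e' fi[of e'] in auto)
        ultimately show ?thesis by simp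
      qed
    qed
  qed
qed

lemma card_cups_insert_cup:
  "card {s \<in> strands (insert_cup a i d). is_Cup s} = Suc (card {s \<in> strands a. is_Cup s})"
proof -
  have "{s \<in> strands (insert_cup a i d). is_Cup s} =
      insert (Cup i (Suc i)) (map_strand f ` {s \<in> strands a. is_Cup s})"
    by (auto simp: insert_cup_def f_def[symmetric] Let_def)
  moreover have "finite {s \<in> strands a. is_Cup s}" using finite_strands[OF a] by simp
  moreover have "card (map_strand f ` {s \<in> strands a. is_Cup s}) = card {s \<in> strands a. is_Cup s}"
    by (rule card_image) (auto simp: inj_on_def map_strand_eq)
  moreover have "Cup i (Suc i) \<notin> map_strand f ` {s \<in> strands a. is_Cup s}"
    using map_strand_ne(2) by blast
  ultimately show ?thesis by simp
qed

lemma labelled_insert_cup: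
  assumes X: "labelled ng p p' q a X" and X': "\<And>l. 1 <= l ==> l <= m ==> X' (f l) = X l"
    and Xi: "X' i = (if d then X' (Suc i) else ng (X' (Suc i)))"
  shows "labelled ng p p' q (insert_cup a i d) X'"
proof -
  note D = combinatorial_diagramD[OF a]
  have dC: "Cup (f u) (f w) \<in> dotted (insert_cup a i d) \<longleftrightarrow> Cup u w \<in> dotted a" for u w
    using mem_dotted_insert(1)[of "Cup u w"] by simp
  have dR: "Ray (f u) \<in> dotted (insert_cup a i d) \<longleftrightarrow> Ray u \<in> dotted a" for u
    using mem_dotted_insert(1)[of "Ray u"] by simp
  have "X' x = (if Cup x y \<in> dotted (insert_cup a i d) then X' y else ng (X' y))"
    if "Cup x y \<in> strands (insert_cup a i d)" for x y
  proof (cases "x = i & y = Suc i")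
    case True
    then show ?thesis using Xi mem_dotted_insert(2) by simp
  next
    case False
    then obtain u w where u: "x = f u" "y = f w" "Cup u w \<in> strands a"
      using \<open>Cup x y \<in> _\<close> unfolding mem_strands_insert by blast
    have "X' (f u) = X u" "X' (f w) = X w" using D(1)[OF u(3)] X' by simp_all
    moreover have "X u = (if Cup u w \<in> dotted a then X w else ng (X w))"
      using X u(3) unfolding labelled_def by blast
    ultimately show ?thesis unfolding u dC by simp
  qed
  moreover have "X' x = (if Ray x \<in> dotted (insert_cup a i d) then p
      else if \<forall>j. Ray j \<in> strands (insert_cup a i d) --> j <= x then p' else q)"
    if "Ray x \<in> strands (insert_cup a i d)" for x
  proof -
    obtain u where u: "x = f u" "Ray u \<in> strands a" using \<open>Ray x \<in> _\<close> unfolding mem_strands_insert by blast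
    have "X' (f u) = X u" using D(1)[OF u(2)] X' by simp
    moreover have "(\<forall>j. Ray j \<in> strands (insert_cup a i d) --> j <= f u) \<longleftrightarrow> (\<forall>j. Ray j \<in> strands a --> j <= u)"
      unfolding mem_strands_insert by (metis f_le)
    moreover have "X u = (if Ray u \<in> dotted a then p else if \<forall>j. Ray j \<in> strands a --> j <= u then p' else q)"
      using X u(2) unfolding labelled_def by blast
    ultimately show ?thesis unfolding u dR by simp
  qed
  ultimately show ?thesis unfolding labelled_def by blast
qed

end

text \<open>The labellings that arise when a diagram is built by inserting cups between adjacent new
  vertices; dotted cups are only inserted at the right end.\<close>

inductive good_word :: "nat => (real ^ 3) list => bool" where
  empty: "good_word 0 []"
| rays: "e = pole_p \<or> e = - pole_p ==> good_word 0 (replicate t pole_q @ [e])"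
| dotted: "good_word c xs ==> y \<in> sphere 0 1 ==> good_word (Suc c) (xs @ [y, y])"
| undotted: "good_word c (xs @ ys) ==> y \<in> sphere 0 1 ==> good_word (Suc c) (xs @ [y, - y] @ ys)"

lemma good_word_diagram:
  assumes "good_word c xs"
  shows "\<exists>a. combinatorial_diagram (length xs) a & card {s \<in> strands a. is_Cup s} = c &
    labelled uminus pole_p (- pole_p) pole_q a (%l. xs ! (l - 1))"
  using assms
proof (induction rule: good_word.induct)
  case empty
  show ?case
    by (intro exI[of _ "\<lparr>strands = {}, dotted = {}\<rparr>"]) (simp add: combinatorial_diagram_def labelled_def)
next
  case (rays e t)
  let ?a = "\<lparr>strands = Ray ` {1..Suc t}, dotted = (if e = pole_p then {Ray (Suc t)} else {})\<rparr>"
  have pp: "pole_p ~= - pole_p" by (simp add: pole_p_def Finite_Cartesian_Product.vec_eq_iff forall_3)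
  have "combinatorial_diagram (Suc t) ?a"
    unfolding combinatorial_diagram_def by (auto split: if_splits)
  moreover have "{s \<in> strands ?a. is_Cup s} = {}" by auto
  moreover have "labelled uminus pole_p (- pole_p) pole_q ?a (%l. (replicate t pole_q @ [e]) ! (l - 1))"
    unfolding labelled_def
  proof (intro conjI allI impI)
    fix i assume "Ray i \<in> strands ?a"
    then have i: "1 <= i" "i <= Suc t" by auto
    have last: "(\<forall>j. Ray j \<in> strands ?a --> j <= i) \<longleftrightarrow> i = Suc t"
    proof
      assume "\<forall>j. Ray j \<in> strands ?a --> j <= i"
      moreover have "Ray (Suc t) \<in> strands ?a" by simp
      ultimately show "i = Suc t" using i(2) by (simp only: le_antisym)
    qed auto
    show "(replicate t pole_q @ [e]) ! (i - 1) = (if Ray i \<in> dotted ?a then pole_p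
        else if \<forall>j. Ray j \<in> strands ?a --> j <= i then - pole_p else pole_q)"
      unfolding last using rays pp i by (auto simp: nth_append)
  qed auto
  ultimately show ?case by (intro exI[of _ ?a]) simp
next
  case (dotted c xs y)
  obtain a where a: "combinatorial_diagram (length xs) a & card {s \<in> strands a. is_Cup s} = c &
    labelled uminus pole_p (- pole_p) pole_q a (%l. xs ! (l - 1))" using dotted.IH by (rule exE)
  note a = a[THEN conjunct1] a[THEN conjunct2, THEN conjunct1] a[THEN conjunct2, THEN conjunct2]
  let ?a = "insert_cup a (Suc (length xs)) True"
  have "combinatorial_diagram (length xs + 2) ?a"
    by (rule combinatorial_insert_cup[OF a(1)]) simp_all
  moreover have "card {s \<in> strands ?a. is_Cup s} = Suc c"
    using card_cups_insert_cup[OF a(1), of "Suc (length xs)" True] a(2) by simp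
  moreover have "labelled uminus pole_p (- pole_p) pole_q ?a (%l. (xs @ [y, y]) ! (l - 1))"
    by (rule labelled_insert_cup[OF a(1) _ _ _ a(3)]) (auto simp: nth_append)
  ultimately show ?case by (intro exI[of _ ?a]) simp
next
  case (undotted c xs ys y)
  obtain a where a: "combinatorial_diagram (length (xs @ ys)) a & card {s \<in> strands a. is_Cup s} = c &
    labelled uminus pole_p (- pole_p) pole_q a (%l. (xs @ ys) ! (l - 1))" using undotted.IH by (rule exE)
  note a = a[THEN conjunct1] a[THEN conjunct2, THEN conjunct1] a[THEN conjunct2, THEN conjunct2]
  let ?a = "insert_cup a (Suc (length xs)) False"
  have "combinatorial_diagram (length (xs @ ys) + 2) ?a"
    by (rule combinatorial_insert_cup[OF a(1)]) simp_all
  moreover have "card {s \<in> strands ?a. is_Cup s} = Suc c"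
    using card_cups_insert_cup[OF a(1), of "Suc (length xs)" False] a(2) by simp
  moreover have "labelled uminus pole_p (- pole_p) pole_q ?a (%l. (xs @ [y, - y] @ ys) ! (l - 1))"
  proof (rule labelled_insert_cup[OF a(1) _ _ _ a(3)])
    fix l assume "1 <= l" "l <= length (xs @ ys)"
    show "(xs @ [y, - y] @ ys) ! ((if l < Suc (length xs) then l else l + 2) - 1) = (xs @ ys) ! (l - 1)"
    proof (cases "l < Suc (length xs)")
      case True
      then have "l - 1 < length xs" using \<open>1 <= l\<close> by linarith
      then show ?thesis using True by (simp add: nth_append)
    next
      case False
      then obtain r where "l = Suc (length xs) + r" by (metis le_Suc_ex not_less)
      then show ?thesis by (simp add: nth_append)
    qed
  qed (auto simp: nth_append)
  ultimately show ?case by (intro exI[of _ ?a]) (simp add: add.commute add.left_commute)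
qed

section \<open>Different diagrams have incomparable components\<close>

definition generic_point :: "nat => real ^ 3" where
  "generic_point j = vector [0, 1 / sqrt (1 + (real j)\<^sup>2), real j / sqrt (1 + (real j)\<^sup>2)]"

lemma generic_point_nth:
  "generic_point j $ 1 = 0" "generic_point j $ 2 = 1 / sqrt (1 + (real j)\<^sup>2)"
  "generic_point j $ 3 = real j / sqrt (1 + (real j)\<^sup>2)" "generic_point j $ 2 > 0"
proof -
  have "1 + (real j)\<^sup>2 > 0" by (rule add_pos_nonneg) simp_all
  then show "generic_point j $ 2 > 0" by (simp add: generic_point_def vector_3)
qed (simp_all add: generic_point_def vector_3)

lemma generic_point_sphere: "generic_point j \<in> sphere 0 1"
proof -
  have "1 + (real j)\<^sup>2 > 0" by (rule add_pos_nonneg) simp_all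
  then have "generic_point j \<bullet> generic_point j = 1"
    by (simp add: inner_vec_def sum_3 generic_point_nth power2_eq_square field_simps)
  then show ?thesis by (simp add: norm_eq_1)
qed

text \<open>All these points lie on an open half circle with positive second coordinate, so no two
  are antipodal, and the quotient of third by second coordinate recovers \<open>j\<close>.\<close>

lemma generic_point_inj:
  assumes "generic_point i = generic_point j \<or> generic_point i = - generic_point j"
  shows "i = j"
proof -
  have "generic_point i ~= - generic_point j"
  proof
    assume "generic_point i = - generic_point j"
    then have "generic_point i $ 2 = - generic_point j $ 2" by simp
    then show False using generic_point_nth(4)[of i] generic_point_nth(4)[of j] by linarith
  qed
  then have eq: "generic_point i = generic_point j" using assms by blast
  have r: "real l * generic_point l $ 2 = generic_point l $ 3" for l by (simp add: generic_point_nth)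
  have "real i * generic_point j $ 2 = real j * generic_point j $ 2" using r[of i] r[of j] eq by simp
  then show ?thesis using generic_point_nth(4)[of j] by simp
qed

lemma pole_nth: "pole_p $ 1 = 0" "pole_p $ 2 = 0" "pole_p $ 3 = 1" "pole_q $ 1 = 1" "pole_q $ 2 = 0" "pole_q $ 3 = 0"
  by (simp_all add: pole_p_def pole_q_def vector_3)

lemma pole_sphere: "pole_p \<in> sphere 0 1" "pole_q \<in> sphere 0 1"
  by (simp_all add: norm_eq_1 inner_vec_def sum_3 pole_nth)

lemma poles_distinct: "pole_p ~= - pole_p" "pole_p ~= pole_q" "- pole_p ~= pole_p" "pole_q ~= pole_p"
proof -
  have "pole_p $ 3 ~= (- pole_p) $ 3" "pole_p $ 3 ~= pole_q $ 3" by (simp_all add: pole_nth)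
  then show "pole_p ~= - pole_p" "pole_p ~= pole_q" "- pole_p ~= pole_p" "pole_q ~= pole_p" by metis+
qed

text \<open>A point of S_a with a different generic value on each cup remembers the diagram: rays
  carry poles, whose second coordinate vanishes, and coincidences up to sign reveal the cups. Hence
  every cup of \<open>a\<close> occurs in \<open>b\<close> with the same dot, and the equal number
  of cups excludes further ones.\<close>

lemma sphere_component_antichain:
  assumes a: "a \<in> cup_diagrams m k" and b: "b \<in> cup_diagrams m k"
    and sub: "sphere_component m a \<subseteq> sphere_component m b"
  shows "a = b"
proof -
  have ca: "combinatorial_diagram m a" and cb: "combinatorial_diagram m b"
    and card: "card {s \<in> strands a. is_Cup s} = card {s \<in> strands b. is_Cup s}"
    using a b by (auto simp: cup_diagrams_def is_cup_diagram_iff)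
  note A = combinatorial_diagramD[OF ca] and B = combinatorial_diagramD[OF cb]
  define st where "st l = (SOME s. s \<in> strands a & l \<in> ends s)" for l
  have st: "st l \<in> strands a" "l \<in> ends (st l)" if "1 <= l" "l <= m" for l
    using someI_ex[of "%s. s \<in> strands a & l \<in> ends s"] A(4)[OF that] unfolding st_def by blast+
  have st_eq: "st l = s" if "s \<in> strands a" "l \<in> ends s" for l s
    using A(3)[OF st(1) that(1) st(2) that(2)] A(1)[OF that] by blast
  define val where "val s l = (case s of Cup i j => if l = i & s \<notin> dotted a then - generic_point j else generic_point j
     | Ray i => if s \<in> dotted a then pole_p else if \<forall>j. Ray j \<in> strands a --> j <= i then - pole_p else pole_q)" for s l
  define X where "X = (\<lambda>l\<in>{1..m}. val (st l) l)"
  have X: "X l = val s l" if "s \<in> strands a" "l \<in> ends s" for l s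
    using st_eq[OF that] A(1)[OF that] by (simp add: X_def)
  have XC: "X i = (if Cup i j \<in> dotted a then generic_point j else - generic_point j)" "X j = generic_point j"
    if "Cup i j \<in> strands a" for i j
    using X[OF that, of i] X[OF that, of j] A(2)[OF that] by (auto simp: val_def)
  have XR: "X i = (if Ray i \<in> dotted a then pole_p else if \<forall>j. Ray j \<in> strands a --> j <= i then - pole_p else pole_q)"
    if "Ray i \<in> strands a" for i
    using X[OF that, of i] by (simp add: val_def)
  have "labelled uminus pole_p (- pole_p) pole_q a X"
    unfolding labelled_def using XC XR by simp
  moreover have "X l \<in> sphere 0 1" if "l \<in> {1..m}" for l
  proof -
    have l: "1 <= l" "l <= m" using that by auto
    show ?thesis
      using pole_sphere generic_point_sphere unfolding X[OF st[OF l]] by (cases "st l") (auto simp: val_def)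
  qed
  ultimately have "X \<in> sphere_component m a"
    unfolding sphere_component_labelled by (auto simp: X_def)
  then have "labelled uminus pole_p (- pole_p) pole_q b X"
    using sub unfolding sphere_component_labelled by blast
  then have bC: "\<And>i j. Cup i j \<in> strands b ==> X i = (if Cup i j \<in> dotted b then X j else - X j)"
    and bR: "\<And>i. Ray i \<in> strands b ==> X i = (if Ray i \<in> dotted b then pole_p
       else if \<forall>j. Ray j \<in> strands b --> j <= i then - pole_p else pole_q)"
    unfolding labelled_def by blast+
  have pole2: "X i $ 2 = 0" if "Ray i \<in> strands a \<or> Ray i \<in> strands b" for i
    using that XR[of i] bR[of i] by (auto simp: pole_nth)
  have cup2: "X l $ 2 ~= 0" if "Cup i j \<in> strands a" "l = i \<or> l = j" for i j l
    using XC[OF that(1)] that(2) generic_point_nth(4)[of j] by (auto split: if_splits)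
  have same: "t = Cup i j" if ij: "Cup i j \<in> strands a" and t: "t \<in> strands a" "l \<in> ends t"
    and eq: "X l = generic_point j \<or> X l = - generic_point j" for i j t l
  proof (cases t)
    case (Cup i' j')
    have "X l = generic_point j' \<or> X l = - generic_point j'"
      using XC[of i' j'] t Cup by (auto split: if_splits)
    then have "generic_point j = generic_point j' \<or> generic_point j = - generic_point j'"
      using eq by (metis minus_minus)
    then have "j = j'" by (rule generic_point_inj)
    then show ?thesis using A(3)[OF ij t(1), of j] Cup by simp
  next
    case (Ray r)
    then have "X l $ 2 = 0" using t pole2[of r] by simp
    then show ?thesis using eq generic_point_nth(4)[of j] by auto
  qed
  have cup_ab: "Cup i j \<in> strands b & (Cup i j \<in> dotted b \<longleftrightarrow> Cup i j \<in> dotted a)" if ij: "Cup i j \<in> strands a" for i j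
  proof -
    have "1 <= i" "i <= m" using A(1)[OF ij] by simp_all
    then obtain t where t: "t \<in> strands b" "i \<in> ends t" using B(4) by blast
    have Xi: "X i = generic_point j \<or> X i = - generic_point j" using XC[OF ij] by simp
    have ne: "generic_point j ~= - generic_point j"
    proof
      assume "generic_point j = - generic_point j"
      then have "generic_point j $ 2 = (- generic_point j) $ 2" by (rule arg_cong[of _ _ "%v. v $ 2"])
      then show False using generic_point_nth(4)[of j] by simp
    qed
    \<comment> \<open>A vertex whose value equals that at \<open>i\<close> up to sign lies on the
      same cup of \<open>a\<close>; so the cup of \<open>b\<close> at \<open>i\<close> can only join
      \<open>i\<close> and \<open>j\<close>.\<close>
    have other: "l = i \<or> l = j" if "X l = X i \<or> X l = - X i" "1 <= l" "l <= m" for l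
    proof -
      have "st l = Cup i j" using same[OF ij st[OF that(2,3)]] that(1) Xi by auto
      then show ?thesis using st(2)[OF that(2,3)] by simp
    qed
    have ltij: "i < j" using A(2)[OF ij] .
    show ?thesis
    proof (cases t)
      case (Ray r)
      then show ?thesis using pole2[of r] cup2[OF ij, of i] t by simp
    next
      case (Cup u w)
      have C: "Cup u w \<in> strands b" using t Cup by simp
      have uw: "u < w" "1 <= u" "u <= m" "1 <= w" "w <= m" using B(2)[OF C] B(1)[OF C] by auto
      have "X u = X w \<or> X u = - X w" using bC[OF C] by simp
      then have "u = i & w = j"
        using other[of u] other[of w] uw t(2) ltij unfolding Cup by auto
      then have C': "Cup i j \<in> strands b" using C by simp
      have "X i = (if Cup i j \<in> dotted b then X j else - X j)" using bC[OF C'] .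
      then show ?thesis using XC[OF ij] C' ne by (auto split: if_splits)
    qed
  qed
  have "{s \<in> strands a. is_Cup s} \<subseteq> {s \<in> strands b. is_Cup s}"
  proof
    fix s assume "s \<in> {s \<in> strands a. is_Cup s}"
    then show "s \<in> {s \<in> strands b. is_Cup s}" using cup_ab by (cases s) auto
  qed
  moreover have "finite {s \<in> strands b. is_Cup s}" using finite_strands[OF cb] by simp
  ultimately have cups: "{s \<in> strands a. is_Cup s} = {s \<in> strands b. is_Cup s}"
    using card by (intro card_subset_eq) simp_all
  have rays: "Ray i \<in> strands a \<longleftrightarrow> Ray i \<in> strands b" for i
  proof -
    have aux: "Ray i \<in> strands d" if R: "Ray i \<in> strands c" and c: "combinatorial_diagram m c" and d: "combinatorial_diagram m d"
      and cd: "{s \<in> strands c. is_Cup s} = {s \<in> strands d. is_Cup s}" for c d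
    proof -
      have "1 <= i" "i <= m" using combinatorial_diagramD(1)[OF c R] by simp_all
      then obtain t where t: "t \<in> strands d" "i \<in> ends t" using combinatorial_diagramD(4)[OF d] by blast
      show ?thesis
      proof (cases t)
        case (Cup u w)
        then have "t \<in> {s \<in> strands d. is_Cup s}" using t(1) by simp
        then have "t \<in> strands c" unfolding cd[symmetric] by simp
        then show ?thesis using combinatorial_diagramD(3)[OF c R, of t i] t(2) Cup by simp
      qed (use t in simp)
    qed
    show ?thesis using aux[OF _ ca cb cups] aux[OF _ cb ca cups[symmetric]] by blast
  qed
  have "strands a = strands b"
  proof (rule Set.set_eqI)
    fix s show "s \<in> strands a \<longleftrightarrow> s \<in> strands b"
    proof (cases s)
      case (Cup i j)
      then have "s \<in> strands a \<longleftrightarrow> s \<in> {s \<in> strands a. is_Cup s}" "s \<in> strands b \<longleftrightarrow> s \<in> {s \<in> strands b. is_Cup s}"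
        by simp_all
      then show ?thesis unfolding cups by (rule HOL.trans[OF _ HOL.sym])
    qed (use rays in simp)
  qed
  moreover have "dotted a = dotted b"
  proof (rule Set.set_eqI)
    fix s
    show "s \<in> dotted a \<longleftrightarrow> s \<in> dotted b"
    proof (cases "s \<in> strands a")
      case False
      then show ?thesis using A(7) B(7) \<open>strands a = strands b\<close> by blast
    next
      case True
      show ?thesis
      proof (cases s)
        case (Cup i j)
        then show ?thesis using cup_ab True by simp
      next
        case (Ray i)
        have Ra: "Ray i \<in> strands a" using True Ray by simp
        then have Rb: "Ray i \<in> strands b" using rays by simp
        have 1: "X i = pole_p \<longleftrightarrow> Ray i \<in> dotted a" using XR[OF Ra] poles_distinct by metis
        have 2: "X i = pole_p \<longleftrightarrow> Ray i \<in> dotted b" using bR[OF Rb] poles_distinct by metis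
        show ?thesis unfolding Ray using 1 2 by (rule HOL.trans[OF HOL.sym])
      qed
    qed
  qed
  ultimately show "a = b" by (intro cup_diagram.equality) simp_all
qed

section \<open>Operators on sequences of vectors\<close>

type_synonym cseq = "nat => complex ^ 2"

section \<open>Rank one idempotents in dimension two\<close>

lemma vec2_eq_iff: "a = b \<longleftrightarrow> a $ 1 = b $ 1 & a $ 2 = b $ 2" for a b :: "'a ^ 2"
  by (simp add: Finite_Cartesian_Product.vec_eq_iff forall_2)

lemma mat2_mult_nth:
  fixes p :: "complex ^ 2 ^ 2"
  shows "(p *v a) $ i = p $ i $ 1 * a $ 1 + p $ i $ 2 * a $ 2"
  by (simp add: matrix_vector_mult_def sum_2)

lemma mat2_mult_add: "p *v (a + b) = p *v a + p *v b" for p :: "complex ^ 2 ^ 2"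
  by (simp add: vec2_eq_iff mat2_mult_nth algebra_simps)

lemma mat2_mult_diff: "p *v (a - b) = p *v a - p *v b" for p :: "complex ^ 2 ^ 2"
  by (simp add: vec2_eq_iff mat2_mult_nth algebra_simps)

lemma mat2_mult_scale: "p *v (c *s a) = c *s (p *v a)" for p :: "complex ^ 2 ^ 2"
  by (simp add: vec2_eq_iff mat2_mult_nth algebra_simps)

lemma mat2_mult_zero [simp]: "p *v 0 = 0" for p :: "complex ^ 2 ^ 2"
  by (simp add: vec2_eq_iff mat2_mult_nth)

definition compl_proj :: "complex ^ 2 ^ 2 => complex ^ 2 ^ 2" where
  "compl_proj p = mat 1 - p"

lemma compl_proj_mult: "compl_proj p *v a = a - p *v a"
  by (simp add: compl_proj_def vec2_eq_iff mat2_mult_nth mat_def algebra_simps)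

lemma compl_proj_nth:
  "compl_proj p $ 1 $ 1 = 1 - p $ 1 $ 1" "compl_proj p $ 2 $ 2 = 1 - p $ 2 $ 2"
  "compl_proj p $ 1 $ 2 = - p $ 1 $ 2" "compl_proj p $ 2 $ 1 = - p $ 2 $ 1"
  by (simp_all add: compl_proj_def Finite_Cartesian_Product.mat_def)

text \<open>Trace one and determinant zero: by Cayley-Hamilton these are the idempotents of rank
  one, orthogonal or not. Polynomial equations are convenient for the families used later.\<close>

definition rank_one :: "complex ^ 2 ^ 2 => bool" where
  "rank_one p \<longleftrightarrow> p $ 1 $ 1 + p $ 2 $ 2 = 1 & p $ 1 $ 1 * p $ 2 $ 2 = p $ 1 $ 2 * p $ 2 $ 1"

lemma rank_oneD:
  assumes "rank_one p"
  shows "p $ 2 $ 2 = 1 - p $ 1 $ 1" "p $ 1 $ 2 * p $ 2 $ 1 = p $ 1 $ 1 * (1 - p $ 1 $ 1)"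
proof -
  show 1: "p $ 2 $ 2 = 1 - p $ 1 $ 1" using assms unfolding rank_one_def by (metis add_diff_cancel_left')
  show "p $ 1 $ 2 * p $ 2 $ 1 = p $ 1 $ 1 * (1 - p $ 1 $ 1)" using assms unfolding rank_one_def 1 by simp
qed

lemma rank_one_compl: "rank_one p ==> rank_one (compl_proj p)"
  unfolding rank_one_def compl_proj_nth by (auto simp: algebra_simps)

lemma compl_proj_compl [simp]: "compl_proj (compl_proj p) = p"
  by (simp add: compl_proj_def)

lemma rank_one_idem:
  assumes "rank_one p"
  shows "p *v (p *v a) = p *v a"
proof -
  let ?A = "p $ 1 $ 1" and ?B = "p $ 1 $ 2" and ?C = "p $ 2 $ 1"
  note r = rank_oneD[OF assms]
  have "?A * (?A * a $ 1 + ?B * a $ 2) + ?B * (?C * a $ 1 + (1 - ?A) * a $ 2)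
      = ?A * ?A * a $ 1 + (?B * ?C) * a $ 1 + ?B * a $ 2" by (simp add: algebra_simps)
  also have "\<dots> = ?A * a $ 1 + ?B * a $ 2" unfolding r(2) by (simp add: algebra_simps)
  finally have 1: "?A * (?A * a $ 1 + ?B * a $ 2) + ?B * (?C * a $ 1 + (1 - ?A) * a $ 2) = ?A * a $ 1 + ?B * a $ 2" .
  have "?C * (?A * a $ 1 + ?B * a $ 2) + (1 - ?A) * (?C * a $ 1 + (1 - ?A) * a $ 2)
      = ?C * a $ 1 + (?B * ?C) * a $ 2 + (1 - ?A) * (1 - ?A) * a $ 2" by (simp add: algebra_simps)
  also have "\<dots> = ?C * a $ 1 + (1 - ?A) * a $ 2" unfolding r(2) by (simp add: algebra_simps)
  finally have 2: "?C * (?A * a $ 1 + ?B * a $ 2) + (1 - ?A) * (?C * a $ 1 + (1 - ?A) * a $ 2) = ?C * a $ 1 + (1 - ?A) * a $ 2" .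
  show ?thesis using 1 2 by (simp only: vec2_eq_iff mat2_mult_nth r(1) simp_thms)
qed

text \<open>The images of \<open>p\<close> and \<open>1 - p\<close> meet only in 0, so the sum
  vanishes termwise. This is the basic device for reading off kernels of \<open>Qop\<close> and
  \<open>Aop\<close>.\<close>

lemma rank_one_split:
  assumes "rank_one p" "p *v a + (b - p *v b) = 0"
  shows "p *v a = 0" "b = p *v b"
proof -
  have "p *v (p *v a + (b - p *v b)) = p *v a"
    by (simp add: mat2_mult_add mat2_mult_diff rank_one_idem[OF assms(1)])
  then show "p *v a = 0" using assms(2) by simp
  then show "b = p *v b" using assms(2) by simp
qed

definition area :: "complex ^ 2 => complex ^ 2 => complex" where
  "area a b = a $ 1 * b $ 2 - a $ 2 * b $ 1"

lemma area_zero [simp]: "area 0 b = 0" "area a 0 = 0" by (simp_all add: area_def)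

lemma area_eq_0:
  assumes "area a b = 0" "b ~= 0"
  obtains c where "a = c *s b"
proof (cases "b $ 1 = 0")
  case True
  then have "b $ 2 ~= 0" using assms(2) by (simp add: vec2_eq_iff)
  then have "a = (a $ 2 / b $ 2) *s b" using assms(1) True by (simp add: vec2_eq_iff area_def)
  then show ?thesis by (rule that)
next
  case False
  then have "a = (a $ 1 / b $ 1) *s b" using assms(1) by (simp add: vec2_eq_iff area_def field_simps)
  then show ?thesis by (rule that)
qed

lemma rank_one_image_area:
  assumes "rank_one p"
  shows "area (p *v a) (p *v b) = 0"
proof -
  have "area (p *v a) (p *v b) = (p $ 1 $ 1 * p $ 2 $ 2 - p $ 1 $ 2 * p $ 2 $ 1) * area a b"
    by (simp add: area_def mat2_mult_nth algebra_simps)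
  then show ?thesis using assms by (simp add: rank_one_def)
qed

lemma rank_one_image_line:
  assumes "rank_one p" "p *v a = a" "p *v b = b" "b ~= 0"
  obtains c where "a = c *s b"
proof -
  have "area a b = 0" using rank_one_image_area[OF assms(1), of a b] assms(2,3) by simp
  then show ?thesis using assms(4) that by (rule area_eq_0)
qed

text \<open>The images of \<open>p\<close> and \<open>1 - p\<close> are lines, on which
  \<open>area\<close> vanishes; only the mixed terms survive.\<close>

lemma rank_one_area:
  assumes "rank_one p"
  shows "area (p *v a + (b - p *v b)) (p *v c + (d - p *v d)) = area (p *v a) (d - p *v d) + area (b - p *v b) (p *v c)"
proof -
  have *: "area (u + v) (w + x) = area u x + area v w + (area u w + area v x)" for u v w x
    by (simp add: area_def algebra_simps)
  have "area (p *v a) (p *v c) = 0" by (rule rank_one_image_area[OF assms])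
  moreover have "area (b - p *v b) (d - p *v d) = 0"
    using rank_one_image_area[OF rank_one_compl[OF assms], of b d] by (simp add: compl_proj_mult)
  ultimately show ?thesis unfolding * by simp
qed

lemma rank_one_image_nonzero:
  assumes "rank_one p"
  obtains u where "u ~= 0" "p *v u = u"
proof -
  have "\<exists>a. p *v a ~= 0"
  proof (rule ccontr)
    assume "\<not> ?thesis"
    then have "(p *v axis 1 1) $ 1 = 0" "(p *v axis 2 1) $ 2 = 0" by simp_all
    then show False using assms by (simp add: mat2_mult_nth axis_def rank_one_def)
  qed
  then obtain a where "p *v a ~= 0" ..
  then show ?thesis using rank_one_idem[OF assms] by (rule that)
qed

section \<open>The shift and the operators attached to a projection\<close>

definition shift :: "(nat => 'a) => nat => 'a" where "shift w = (%i. w (Suc i))"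

definition delta :: "nat => complex ^ 2 => cseq" where "delta n a = (%i. if i = n then a else 0)"

text \<open>With \<open>z\<close> acting by \<open>shift\<close>, \<open>Qop p\<close> is \<open>p z + (1 - p)\<close>.  Its right inverse \<open>Pop p\<close> is
  multiplication by \<open>p s + (1 - p)\<close>, where \<open>s\<close> is the formal inverse of \<open>z\<close>.\<close>

definition Qop :: "complex ^ 2 ^ 2 => cseq => cseq" where
  "Qop p w = (%i. p *v w (Suc i) + (w i - p *v w i))"

definition Pop :: "complex ^ 2 ^ 2 => cseq => cseq" where
  "Pop p w = (%i. (if i = 0 then 0 else p *v w (i - 1)) + (w i - p *v w i))"

definition linop :: "(cseq => cseq) => bool" where
  "linop K \<longleftrightarrow> (\<forall>\<alpha> v w. K (%i. \<alpha> *s v i + w i) = (%i. \<alpha> *s K v i + K w i))"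

lemma linopD: "linop K ==> K (%i. \<alpha> *s v i + w i) = (%i. \<alpha> *s K v i + K w i)"
  by (simp add: linop_def)

lemma linop_zero:
  assumes "linop K"
  shows "K (%_. 0) = (%_. 0)"
  using linopD[OF assms, of "-1" "%_. 0" "%_. 0"] by simp

lemma linop_scale: "linop K ==> K (%i. \<alpha> *s v i) = (%i. \<alpha> *s K v i)"
  using linopD[of K \<alpha> v "%_. 0"] linop_zero[of K] by simp

lemma linop_diff:
  assumes "linop K"
  shows "K (%i. w i - v i) = (%i. K w i - K v i)"
proof -
  have "(%i. w i - v i) = (%i. (-1) *s v i + w i)" by (simp add: vec2_eq_iff)
  then show ?thesis using linopD[OF assms, of "-1" v w] by (simp add: vec2_eq_iff)
qed

lemma linop_id: "linop (%w. w)" by (simp add: linop_def)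

lemma linop_comp: "linop K ==> linop L ==> linop (%w. K (L w))"
  by (simp add: linop_def)

lemma linop_shift: "linop shift" by (simp add: linop_def shift_def)

lemma linop_Qop: "linop (Qop p)"
  by (simp add: linop_def Qop_def mat2_mult_add mat2_mult_scale vec2_eq_iff algebra_simps)

lemma linop_Pop: "linop (Pop p)"
  by (auto simp: linop_def Pop_def mat2_mult_add mat2_mult_scale vec2_eq_iff algebra_simps)

lemma linop_fold: "linop (fold Qop ps)"
proof (induction ps)
  case Nil
  then show ?case by (simp add: linop_def)
next
  case (Cons p ps)
  then show ?case using linop_comp[OF Cons linop_Qop[of p]] by (simp add: comp_def)
qed

lemma Qop_Pop:
  assumes "rank_one p"
  shows "Qop p (Pop p w) = w"
proof
  fix i
  show "Qop p (Pop p w) i = w i"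
    by (cases i) (simp_all add: Qop_def Pop_def mat2_mult_add mat2_mult_diff rank_one_idem[OF assms])
qed

lemma Qop_eq_0:
  assumes "rank_one p" "Qop p w = (%_. 0)"
  shows "w = delta 0 (w 0)" "p *v w 0 = w 0"
proof -
  have *: "p *v w (Suc i) = 0" "w i = p *v w i" for i
    using rank_one_split[OF assms(1), of "w (Suc i)" "w i"] fun_cong[OF assms(2), of i] by (simp_all add: Qop_def)
  then show "p *v w 0 = w 0" by simp
  have "w i = 0" if "i ~= 0" for i
    using *(1)[of "i - 1"] *(2)[of i] that by (cases i) simp_all
  then show "w = delta 0 (w 0)" by (auto simp: delta_def)
qed

lemma Qop_delta: "p *v a = a ==> Qop p (delta 0 a) = (%_. 0)"
  by (auto simp: Qop_def delta_def)

lemma Qop_delta': "Qop p (delta 0 a) = delta 0 (a - p *v a)"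
  by (auto simp: Qop_def delta_def)

lemma shift_Qop: "shift (Qop p w) = Qop p (shift w)"
  by (simp add: shift_def Qop_def)

lemma shift_fold: "shift (fold Qop ps w) = fold Qop ps (shift w)"
  by (induction ps arbitrary: w) (simp_all add: shift_Qop)

lemma Qop_compl:
  assumes "rank_one p"
  shows "Qop (compl_proj p) (Qop p w) = shift w"
proof -
  have *: "p *v x - p *v x = 0" for x by simp
  show ?thesis
    by (simp add: fun_eq_iff Qop_def shift_def compl_proj_mult mat2_mult_add mat2_mult_diff rank_one_idem[OF assms])
qed

text \<open>This is \<open>p z^2 + (1 - p)\<close>, the square of \<open>Qop p\<close>: the
  contribution of a dotted cup, whose two ends carry the same projection.\<close>

definition Aop :: "complex ^ 2 ^ 2 => cseq => cseq" where
  "Aop p w = (%i. p *v w (Suc (Suc i)) + (w i - p *v w i))"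

lemma Qop_Qop:
  assumes "rank_one p"
  shows "Qop p (Qop p w) = Aop p w"
  by (simp add: fun_eq_iff Qop_def Aop_def mat2_mult_add mat2_mult_diff rank_one_idem[OF assms])

text \<open>Each factor \<open>Qop p\<close> shortens a sequence by at most one position, so a
  sequence killed by all factors has no entry beyond their number.\<close>

lemma fold_Qop_vanish:
  assumes "\<And>p. p \<in> set ps ==> rank_one p" "fold Qop ps w = (%_. 0)" "length ps <= i"
  shows "w i = 0"
  using assms
proof (induction ps arbitrary: w i)
  case Nil
  then show ?case by simp
next
  case (Cons p ps)
  have p: "rank_one p" using Cons.prems(1) by simp
  have z: "Qop p w j = 0" if "length ps <= j" for j
    using Cons.IH[of "Qop p w" j] Cons.prems that by simp
  obtain j where j: "i = Suc j" "length ps <= j" using Cons.prems(3) by (cases i) auto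
  have "p *v w (Suc j) = 0"
    using rank_one_split(1)[OF p, of "w (Suc j)" "w j"] z[OF j(2)] by (simp add: Qop_def)
  moreover have "w i = p *v w i"
    using rank_one_split(2)[OF p, of "w (Suc i)" "w i"] z[of i] j by (simp add: Qop_def)
  ultimately show ?case using j by simp
qed

section \<open>The bilinear forms in the normal form\<close>

definition altsum :: "('a => 'a => complex) => nat => (nat => 'a) => (nat => 'a) => complex" where
  "altsum f n a b = (\<Sum>i<n. (-1) ^ i * f (a (n - 1 - i)) (b i))"

lemma altsum_drop_last:
  assumes "\<And>x. f x (b n) = 0"
  shows "altsum f (Suc n) a b = altsum f n (%i. a (Suc i)) b"
proof -
  have "altsum f (Suc n) a b = (\<Sum>i<n. (-1) ^ i * f (a (n - i)) (b i))"
    by (simp add: altsum_def assms)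
  also have "\<dots> = altsum f n (%i. a (Suc i)) b"
    unfolding altsum_def by (rule sum.cong) (simp_all add: Suc_diff_Suc)
  finally show ?thesis .
qed

lemma altsum_drop_first:
  assumes "\<And>x. f (a n) x = 0"
  shows "altsum f (Suc n) a b = - altsum f n a (%i. b (Suc i))"
proof -
  have "altsum f (Suc n) a b = (\<Sum>i<n. (-1) ^ Suc i * f (a (n - Suc i)) (b (Suc i)))"
    unfolding altsum_def by (subst sum.lessThan_Suc_shift) (simp add: assms)
  also have "\<dots> = - altsum f n a (%i. b (Suc i))"
    unfolding altsum_def by (simp add: sum_negf)
  finally show ?thesis .
qed

text \<open>The two outer terms drop because the last entries vanish. Dropping the first one moves
  the index of the alternating sign by one, which causes the minus.\<close>

lemma altsum_shift:
  assumes "\<And>x. f x (b (Suc n)) = 0" "\<And>x. f (a (Suc n)) x = 0"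
  shows "altsum f (n + 2) a b = - altsum f n (shift a) (shift b)"
proof -
  have "altsum f (Suc (Suc n)) a b = - altsum f (Suc n) a (%i. b (Suc i))"
    by (rule altsum_drop_first) (rule assms(2))
  also have "altsum f (Suc n) a (%i. b (Suc i)) = altsum f n (%i. a (Suc i)) (%i. b (Suc i))"
    by (rule altsum_drop_last) (rule assms(1))
  finally show ?thesis by (simp add: shift_def)
qed

lemma altsum_delta:
  assumes "\<And>x. f 0 x = 0"
  shows "altsum f (Suc n) (%i. if i = 0 then a else 0) b = (-1) ^ n * f a (b n)"
proof -
  have "(\<Sum>i<n. (-1) ^ i * f (if n - i = 0 then a else 0) (b i)) = 0"
    by (rule sum.neutral) (simp add: assms)
  then show ?thesis by (simp add: altsum_def)
qed

definition supported :: "nat => nat => cseq => bool" where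
  "supported r k w \<longleftrightarrow> (\<forall>i\<ge>r. w i $ 1 = 0) & (\<forall>i\<ge>k. w i $ 2 = 0)"

text \<open>Two mutually orthogonal Jordan blocks of odd sizes. The sign \<epsilon> is carried along
  because each ray labelled by q removes two entries of the first block and flips it.\<close>

definition form_odd :: "complex => nat => nat => cseq => cseq => complex" where
  "form_odd \<epsilon> r k v w = \<epsilon> * altsum (*) r (%i. v i $ 1) (%i. w i $ 1) + altsum (*) k (%i. v i $ 2) (%i. w i $ 2)"

text \<open>Two self-orthogonal blocks of the same size, paired with each other by the alternating
  form \<open>area\<close>.\<close>

definition form_even :: "nat => cseq => cseq => complex" where
  "form_even n = altsum area n"

text \<open>The kernel is taken among all sequences. The support clause places it inside the
  finite-dimensional model, so that the second clause speaks about a subspace of the original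
  space.\<close>

definition isotropic :: "nat => nat => (cseq => cseq => complex) => (cseq => cseq) => bool" where
  "isotropic r k B K \<longleftrightarrow> (\<forall>w. K w = (%_. 0) --> supported r k w) &
     (\<forall>v w. K v = (%_. 0) --> K w = (%_. 0) --> B v w = 0)"

lemma form_odd_shift:
  assumes "supported (Suc r) (Suc k) v" "supported (Suc r) (Suc k) w"
  shows "form_odd \<epsilon> (r + 2) (k + 2) v w = - form_odd \<epsilon> r k (shift v) (shift w)"
proof -
  have "altsum (*) (r + 2) (%i. v i $ 1) (%i. w i $ 1) = - altsum (*) r (shift (%i. v i $ 1)) (shift (%i. w i $ 1))"
    "altsum (*) (k + 2) (%i. v i $ 2) (%i. w i $ 2) = - altsum (*) k (shift (%i. v i $ 2)) (shift (%i. w i $ 2))"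
    using assms by (intro altsum_shift; simp add: supported_def)+
  then show ?thesis by (simp add: form_odd_def shift_def)
qed

lemma form_even_shift:
  assumes "v (Suc n) = 0" "w (Suc n) = 0"
  shows "form_even (n + 2) v w = - form_even n (shift v) (shift w)"
  unfolding form_even_def using assms by (intro altsum_shift) simp_all

definition qmat :: "complex ^ 2 ^ 2" where "qmat = (\<chi> i j. if i = 1 & j = 1 then 1 else 0)"

lemma qmat_mult: "(qmat *v a) $ 1 = a $ 1" "(qmat *v a) $ 2 = 0"
  by (simp_all add: mat2_mult_nth qmat_def)

lemma Qop_qmat: "Qop qmat w i $ 1 = w (Suc i) $ 1" "Qop qmat w i $ 2 = w i $ 2"
  by (simp_all add: Qop_def qmat_mult)

text \<open>\<open>Qop qmat\<close> shifts the first component and leaves the second alone, so only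
  the first block loses its two outer terms.\<close>

lemma form_odd_qmat:
  assumes "supported (Suc r) k v" "supported (Suc r) k w"
  shows "form_odd \<epsilon> (r + 2) k v w = form_odd (- \<epsilon>) r k (Qop qmat v) (Qop qmat w)"
proof -
  have "altsum (*) (r + 2) (%i. v i $ 1) (%i. w i $ 1) = - altsum (*) r (shift (%i. v i $ 1)) (shift (%i. w i $ 1))"
    using assms by (intro altsum_shift; simp add: supported_def)
  then show ?thesis by (simp add: form_odd_def shift_def Qop_qmat)
qed

text \<open>For \<open>\<sigma> = 1\<close> and \<open>\<sigma> = -1\<close> these are the projections onto the two isotropic lines of the form
  \<open>a $ 1 * b $ 1 + a $ 2 * b $ 2\<close> along each other.\<close>

definition pmat :: "complex => complex ^ 2 ^ 2" where
  "pmat \<sigma> = (\<chi> i j. if i = j then 1 / 2 else if i = 1 then - \<i> * \<sigma> / 2 else \<i> * \<sigma> / 2)"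

lemma pmat_mult:
  "(pmat \<sigma> *v a) $ 1 = (a $ 1 - \<i> * \<sigma> * a $ 2) / 2" "(pmat \<sigma> *v a) $ 2 = (a $ 2 + \<i> * \<sigma> * a $ 1) / 2"
  by (simp_all add: mat2_mult_nth pmat_def field_simps)

lemma rank_one_pmat: "\<sigma> * \<sigma> = 1 ==> rank_one (pmat \<sigma>)"
proof -
  assume \<sigma>: "\<sigma> * \<sigma> = 1"
  have "\<i> * (\<sigma> * (\<i> * \<sigma>)) = - (\<sigma> * \<sigma>)" by (simp add: algebra_simps)
  then show ?thesis unfolding \<sigma> by (simp add: rank_one_def pmat_def mult.assoc)
qed

lemma rank_one_qmat: "rank_one qmat"
  by (simp add: rank_one_def qmat_def)

text \<open>Along the two isotropic lines the dot product is \<i> \<sigma> times a difference of two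
  mixed areas. \<open>Qop (pmat \<sigma>)\<close> shifts one of the lines against the other, so each
  mixed sum loses one outer term; the sign from one of the losses turns the symmetric pairing of
  length \<open>Suc n\<close> into the alternating one of length \<open>n\<close>.\<close>

lemma form_odd_pmat:
  assumes \<sigma>: "\<sigma> * \<sigma> = 1" and v: "Qop (pmat \<sigma>) v n = 0" and w: "Qop (pmat \<sigma>) w n = 0"
  shows "form_odd 1 (Suc n) (Suc n) v w = \<i> * \<sigma> * form_even n (Qop (pmat \<sigma>) v) (Qop (pmat \<sigma>) w)"
proof -
  note r = rank_one_pmat[OF \<sigma>]
  let ?p = "%a. pmat \<sigma> *v a" and ?p' = "%a. a - pmat \<sigma> *v a"
  let ?d = "\<lambda>a b :: complex ^ 2. a $ 1 * b $ 1 + a $ 2 * b $ 2"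
  have *: "?d a b = \<i> * \<sigma> * area (?p a) (?p' b) - \<i> * \<sigma> * area (?p' a) (?p b)" for a b
  proof -
    have "\<i> * \<sigma> * area (?p a) (?p' b) - \<i> * \<sigma> * area (?p' a) (?p b) = \<i> * \<sigma> * (area (?p a) b - area a (?p b))"
      by (simp add: area_def algebra_simps)
    also have "area (?p a) b - area a (?p b) = - (\<i> * \<sigma>) * ?d a b"
      by (simp add: area_def pmat_mult field_simps)
    also have "\<i> * \<sigma> * (- (\<i> * \<sigma>) * ?d a b) = (\<sigma> * \<sigma>) * ?d a b" by (simp add: algebra_simps)
    finally show ?thesis unfolding \<sigma> by simp
  qed
  have p'0: "?p' (v n) = 0" "?p' (w n) = 0"
    using rank_one_split(2)[OF r, of "v (Suc n)" "v n"] rank_one_split(2)[OF r, of "w (Suc n)" "w n"] v w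
    by (simp_all add: Qop_def)
  have "form_odd 1 (Suc n) (Suc n) v w = (\<Sum>i<Suc n. (-1) ^ i * ?d (v (n - i)) (w i))"
    by (simp add: form_odd_def altsum_def sum.distrib[symmetric] algebra_simps)
  also have "\<dots> = \<i> * \<sigma> * altsum area (Suc n) (%i. ?p (v i)) (%i. ?p' (w i)) - \<i> * \<sigma> * altsum area (Suc n) (%i. ?p' (v i)) (%i. ?p (w i))"
    unfolding * altsum_def sum_distrib_left sum_subtractf[symmetric] by (rule sum.cong) (simp_all add: algebra_simps)
  also have "altsum area (Suc n) (%i. ?p (v i)) (%i. ?p' (w i)) = altsum area n (%i. ?p (v (Suc i))) (%i. ?p' (w i))"
    by (rule altsum_drop_last) (simp add: p'0)
  also have "altsum area (Suc n) (%i. ?p' (v i)) (%i. ?p (w i)) = - altsum area n (%i. ?p' (v i)) (%i. ?p (w (Suc i)))"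
    by (rule altsum_drop_first) (simp add: p'0)
  also have "\<i> * \<sigma> * altsum area n (%i. ?p (v (Suc i))) (%i. ?p' (w i)) - \<i> * \<sigma> * - altsum area n (%i. ?p' (v i)) (%i. ?p (w (Suc i)))
      = \<i> * \<sigma> * form_even n (Qop (pmat \<sigma>) v) (Qop (pmat \<sigma>) w)"
    unfolding form_even_def altsum_def Qop_def rank_one_area[OF r]
    by (simp add: sum.distrib algebra_simps)
  finally show ?thesis .
qed

text \<open>Only areas between the parts in the images of \<open>p\<close> and \<open>1 - p\<close>
  occur. \<open>Aop p\<close> shifts one part by two against the other, so each mixed sum loses two
  terms at the same end and the signs cancel.\<close>

lemma form_even_Aop:
  assumes r: "rank_one p" and v: "Aop p v n = 0" "Aop p v (Suc n) = 0" and w: "Aop p w n = 0" "Aop p w (Suc n) = 0"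
  shows "form_even (n + 2) v w = form_even n (Aop p v) (Aop p w)"
proof -
  let ?p = "%a. p *v a" and ?p' = "%a. a - p *v a"
  have p'0: "?p' (v n) = 0" "?p' (v (Suc n)) = 0" "?p' (w n) = 0" "?p' (w (Suc n)) = 0"
    using rank_one_split(2)[OF r, of "v (Suc (Suc n))" "v n"] rank_one_split(2)[OF r, of "w (Suc (Suc n))" "w n"]
      rank_one_split(2)[OF r, of "v (Suc (Suc (Suc n)))" "v (Suc n)"] rank_one_split(2)[OF r, of "w (Suc (Suc (Suc n)))" "w (Suc n)"] v w
    by (simp_all add: Aop_def)
  have *: "area a b = area (?p a) (?p' b) + area (?p' a) (?p b)" for a b
    using rank_one_area[OF r, of a a b b] by simp
  have "form_even (n + 2) v w = altsum area (Suc (Suc n)) (%i. ?p (v i)) (%i. ?p' (w i)) + altsum area (Suc (Suc n)) (%i. ?p' (v i)) (%i. ?p (w i))"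
    unfolding form_even_def altsum_def sum.distrib[symmetric]
    by (rule sum.cong) (simp_all add: *[of "v _" "w _"] algebra_simps)
  also have "altsum area (Suc (Suc n)) (%i. ?p (v i)) (%i. ?p' (w i)) = altsum area (Suc n) (%i. ?p (v (Suc i))) (%i. ?p' (w i))"
    by (rule altsum_drop_last) (simp add: p'0)
  also have "\<dots> = altsum area n (%i. ?p (v (Suc (Suc i)))) (%i. ?p' (w i))"
    by (rule altsum_drop_last) (simp add: p'0)
  also have "altsum area (Suc (Suc n)) (%i. ?p' (v i)) (%i. ?p (w i)) = - altsum area (Suc n) (%i. ?p' (v i)) (%i. ?p (w (Suc i)))"
    by (rule altsum_drop_first) (simp add: p'0)
  also have "altsum area (Suc n) (%i. ?p' (v i)) (%i. ?p (w (Suc i))) = - altsum area n (%i. ?p' (v i)) (%i. ?p (w (Suc (Suc i))))"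
    by (rule altsum_drop_first) (simp add: p'0)
  also have "altsum area n (%i. ?p (v (Suc (Suc i)))) (%i. ?p' (w i)) + - (- altsum area n (%i. ?p' (v i)) (%i. ?p (w (Suc (Suc i)))))
      = form_even n (Aop p v) (Aop p w)"
    unfolding form_even_def altsum_def Aop_def rank_one_area[OF r]
    by (simp add: sum.distrib algebra_simps)
  finally show ?thesis .
qed

section \<open>Isotropic kernels after composition with one more operator\<close>

lemma isotropicD:
  assumes "isotropic r k B K"
  shows "K w = (%_. 0) ==> supported r k w" "K v = (%_. 0) ==> K w = (%_. 0) ==> B v w = 0"
  using assms unfolding isotropic_def by simp_all

lemma isotropic_odd_shift:
  assumes "isotropic r k (form_odd \<epsilon> r k) K"
  shows "isotropic (r + 2) (k + 2) (form_odd \<epsilon> (r + 2) (k + 2)) (%w. K (shift w))"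
proof -
  have s: "supported (Suc r) (Suc k) w" if "K (shift w) = (%_. 0)" for w
    using isotropicD(1)[OF assms that] unfolding supported_def shift_def by (metis Suc_le_D Suc_le_mono)
  show ?thesis
    unfolding isotropic_def
  proof (intro conjI allI impI)
    show "supported (r + 2) (k + 2) w" if "K (shift w) = (%_. 0)" for w
      using s[OF that] unfolding supported_def by simp
    show "form_odd \<epsilon> (r + 2) (k + 2) v w = 0" if "K (shift v) = (%_. 0)" "K (shift w) = (%_. 0)" for v w
      unfolding form_odd_shift[OF s[OF that(1)] s[OF that(2)]] using isotropicD(2)[OF assms that] by simp
  qed
qed

lemma supported_vanish: "supported n n w \<longleftrightarrow> (\<forall>i\<ge>n. w i = 0)"
  unfolding supported_def vec2_eq_iff by auto

lemma isotropic_even_shift: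
  assumes "isotropic n n (form_even n) K"
  shows "isotropic (n + 2) (n + 2) (form_even (n + 2)) (%w. K (shift w))"
proof -
  have s: "w i = 0" if "K (shift w) = (%_. 0)" "Suc n <= i" for w i
    using isotropicD(1)[OF assms that(1)] that(2) unfolding supported_vanish shift_def by (metis Suc_le_D Suc_le_mono)
  show ?thesis
    unfolding isotropic_def
  proof (intro conjI allI impI)
    show "supported (n + 2) (n + 2) w" if "K (shift w) = (%_. 0)" for w
      using s[OF that] unfolding supported_vanish by simp
    show "form_even (n + 2) v w = 0" if "K (shift v) = (%_. 0)" "K (shift w) = (%_. 0)" for v w
      using form_even_shift[of v n w] s[OF that(1)] s[OF that(2)] isotropicD(2)[OF assms that] by simp
  qed
qed

lemma isotropic_qmat:
  assumes "isotropic r k (form_odd (- \<epsilon>) r k) K"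
  shows "isotropic (r + 2) k (form_odd \<epsilon> (r + 2) k) (%w. K (Qop qmat w))"
proof -
  have s: "supported (Suc r) k w" if "K (Qop qmat w) = (%_. 0)" for w
    using isotropicD(1)[OF assms that] unfolding supported_def Qop_qmat by (metis Suc_le_D Suc_le_mono)
  show ?thesis
    unfolding isotropic_def
  proof (intro conjI allI impI)
    show "supported (r + 2) k w" if "K (Qop qmat w) = (%_. 0)" for w
      using s[OF that] unfolding supported_def by simp
    show "form_odd \<epsilon> (r + 2) k v w = 0" if "K (Qop qmat v) = (%_. 0)" "K (Qop qmat w) = (%_. 0)" for v w
      unfolding form_odd_qmat[OF s[OF that(1)] s[OF that(2)]] using isotropicD(2)[OF assms that] by simp
  qed
qed

lemma isotropic_pmat:
  assumes "isotropic n n (form_even n) K" and \<sigma>: "\<sigma> * \<sigma> = 1"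
  shows "isotropic (Suc n) (Suc n) (form_odd 1 (Suc n) (Suc n)) (%w. K (Qop (pmat \<sigma>) w))"
proof -
  have z: "Qop (pmat \<sigma>) w i = 0" if "K (Qop (pmat \<sigma>) w) = (%_. 0)" "n <= i" for w i
    using isotropicD(1)[OF assms(1) that(1)] that(2) unfolding supported_vanish by simp
  show ?thesis
    unfolding isotropic_def
  proof (intro conjI allI impI)
    fix w assume w: "K (Qop (pmat \<sigma>) w) = (%_. 0)"
    have "w (Suc i) = 0" if "n <= i" for i
      using rank_one_split[OF rank_one_pmat[OF \<sigma>], of "w (Suc i)" "w i"]
        rank_one_split[OF rank_one_pmat[OF \<sigma>], of "w (Suc (Suc i))" "w (Suc i)"]
        z[OF w that] z[OF w, of "Suc i"] that by (simp add: Qop_def)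
    then show "supported (Suc n) (Suc n) w" unfolding supported_vanish by (metis Suc_le_D Suc_le_mono)
  next
    show "form_odd 1 (Suc n) (Suc n) v w = 0"
      if "K (Qop (pmat \<sigma>) v) = (%_. 0)" "K (Qop (pmat \<sigma>) w) = (%_. 0)" for v w
      unfolding form_odd_pmat[OF \<sigma> z[OF that(1) order_refl] z[OF that(2) order_refl]]
      using isotropicD(2)[OF assms(1) that] by simp
  qed
qed

lemma isotropic_Aop:
  assumes "isotropic n n (form_even n) K" and p: "rank_one p"
  shows "isotropic (n + 2) (n + 2) (form_even (n + 2)) (%w. K (Aop p w))"
proof -
  have z: "Aop p w i = 0" if "K (Aop p w) = (%_. 0)" "n <= i" for w i
    using isotropicD(1)[OF assms(1) that(1)] that(2) unfolding supported_vanish by simp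
  show ?thesis
    unfolding isotropic_def
  proof (intro conjI allI impI)
    fix w assume w: "K (Aop p w) = (%_. 0)"
    have "w (Suc (Suc i)) = 0" if "n <= i" for i
      using rank_one_split[OF p, of "w (Suc (Suc i))" "w i"]
        rank_one_split[OF p, of "w (Suc (Suc (Suc (Suc i))))" "w (Suc (Suc i))"]
        z[OF w that] z[OF w, of "Suc (Suc i)"] that by (simp add: Aop_def)
    then show "supported (n + 2) (n + 2) w" unfolding supported_vanish by (metis Suc_le_D Suc_le_mono add_2_eq_Suc')
  next
    show "form_even (n + 2) v w = 0" if "K (Aop p v) = (%_. 0)" "K (Aop p w) = (%_. 0)" for v w
      using form_even_Aop[OF p, of v n w] z[OF that(1)] z[OF that(2)] isotropicD(2)[OF assms(1) that] by simp
  qed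
qed

section \<open>Skew nilpotent endomorphisms and correction of generators\<close>

locale skew_form =
  fixes \<beta> :: "complex ^ 'n => complex ^ 'n => complex" and x :: "complex ^ 'n => complex ^ 'n"
  assumes form: "nondegenerate_symmetric_form \<beta>"
    and lin: "Vector_Spaces.linear (*s) (*s) x"
    and skew: "\<beta> (x v) w = - \<beta> v (x w)"
begin

lemma form_add: "\<beta> (u + v) w = \<beta> u w + \<beta> v w" "\<beta> w (u + v) = \<beta> w u + \<beta> w v"
  and form_scale: "\<beta> (c *s v) w = c * \<beta> v w" "\<beta> w (c *s v) = c * \<beta> w v"
  and form_sym: "\<beta> v w = \<beta> w v"
proof -
  have l: "Vector_Spaces.linear (*s) (*) (\<beta> v)" "Vector_Spaces.linear (*s) (*) (%v. \<beta> v w)" for v w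
    using form unfolding nondegenerate_symmetric_form_def by simp_all
  show "\<beta> v w = \<beta> w v" using form unfolding nondegenerate_symmetric_form_def by simp
  show "\<beta> (u + v) w = \<beta> u w + \<beta> v w" "\<beta> w (u + v) = \<beta> w u + \<beta> w v"
    using Vector_Spaces.linear.axioms(3)[OF l(1)] Vector_Spaces.linear.axioms(3)[OF l(2)]
    unfolding module_hom_axioms_def module_hom_def by simp_all
  show "\<beta> (c *s v) w = c * \<beta> v w" "\<beta> w (c *s v) = c * \<beta> w v"
    using Vector_Spaces.linear.axioms(3)[OF l(1)] Vector_Spaces.linear.axioms(3)[OF l(2)]
    unfolding module_hom_axioms_def module_hom_def by simp_all
qed

lemma nondegenerate: "(\<And>w. \<beta> v w = 0) ==> v = 0"
  using form unfolding nondegenerate_symmetric_form_def by simp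

lemma form_zero [simp]: "\<beta> 0 w = 0" "\<beta> w 0 = 0"
  using form_scale(1)[of 0 0 w] form_sym[of w 0] by simp_all

lemma form_sum: "\<beta> (\<Sum>i\<in>A. f i) w = (\<Sum>i\<in>A. \<beta> (f i) w)"
  by (induction A rule: infinite_finite_induct) (simp_all add: form_add)

lemma x_add: "x (u + v) = x u + x v" and x_scale: "x (c *s v) = c *s x v"
  using Vector_Spaces.linear.axioms(3)[OF lin] unfolding module_hom_axioms_def module_hom_def by simp_all

lemma pow_add: "(x ^^ i) (u + v) = (x ^^ i) u + (x ^^ i) v"
  by (induction i) (simp_all add: x_add)

lemma pow_scale: "(x ^^ i) (c *s v) = c *s (x ^^ i) v"
  by (induction i) (simp_all add: x_scale)

lemma pow_zero [simp]: "(x ^^ i) 0 = 0"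
  using pow_scale[of i 0 0] by simp

lemma pow_pow: "(x ^^ i) ((x ^^ j) v) = (x ^^ (i + j)) v"
  by (simp add: funpow_add)

lemma pow_vanish: "(x ^^ n) v = 0 ==> n <= i ==> (x ^^ i) v = 0"
  using pow_pow[of "i - n" n v] by simp

lemma pow_skew: "\<beta> ((x ^^ i) v) w = (-1) ^ i * \<beta> v ((x ^^ i) w)"
proof (induction i arbitrary: v)
  case (Suc i)
  have "\<beta> ((x ^^ Suc i) v) w = \<beta> ((x ^^ i) (x v)) w" by (simp only: funpow_Suc_right comp_def)
  also have "\<dots> = (-1) ^ i * \<beta> (x v) ((x ^^ i) w)" by (rule Suc.IH)
  also have "\<dots> = (-1) ^ Suc i * \<beta> v ((x ^^ Suc i) w)" by (simp add: skew)
  finally show ?case .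
qed simp

lemma pow_form_sym: "\<beta> ((x ^^ i) v) w = (-1) ^ i * \<beta> ((x ^^ i) w) v"
  using pow_skew[of i v w] form_sym[of v "(x ^^ i) w"] by simp

lemma odd_vanish: "odd i ==> \<beta> ((x ^^ i) v) v = 0"
  using pow_form_sym[of i v v] by simp

text \<open>Successive corrections of \<open>u\<close> by multiples of \<open>x\<^sup>j g\<close>, \<open>j >= 1\<close>, kill all products
  \<open>\<beta> (x\<^sup>i u) u\<close> with \<open>i < N\<close>, from the top downwards.\<close>

lemma correct:
  assumes u: "(x ^^ Suc N) u = 0" and g: "(x ^^ Suc N) g = 0" and ne: "\<beta> ((x ^^ N) g) u ~= 0"
  shows "\<exists>c. let u' = u + (\<Sum>j=1..n. c j *s (x ^^ j) g) in
    (\<forall>i. i < N --> N <= i + n --> \<beta> ((x ^^ i) u') u' = 0) & \<beta> ((x ^^ N) u') u' = \<beta> ((x ^^ N) u) u"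
proof (induction n)
  case 0
  show ?case by (simp add: Let_def)
next
  case (Suc n)
  then obtain c where c: "let u' = u + (\<Sum>j=1..n. c j *s (x ^^ j) g) in
    (\<forall>i. i < N --> N <= i + n --> \<beta> ((x ^^ i) u') u' = 0) & \<beta> ((x ^^ N) u') u' = \<beta> ((x ^^ N) u) u" ..
  define u' where "u' = u + (\<Sum>j=1..n. c j *s (x ^^ j) g)"
  have c1: "\<And>i. i < N ==> N <= i + n ==> \<beta> ((x ^^ i) u') u' = 0"
    and c2: "\<beta> ((x ^^ N) u') u' = \<beta> ((x ^^ N) u) u"
    using c unfolding Let_def u'_def[symmetric] by simp_all
  have gg: "(x ^^ i) g = 0" if "N < i" for i using pow_vanish[OF g] that by simp
  have pairing: "\<beta> ((x ^^ N) g) ((x ^^ j) g) = 0" if "1 <= j" for j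
  proof -
    have "\<beta> ((x ^^ j) g) ((x ^^ N) g) = (-1) ^ j * \<beta> g ((x ^^ (j + N)) g)" by (simp add: pow_skew pow_pow)
    then show ?thesis using gg[of "j + N"] that form_sym by simp
  qed
  have gsum: "\<beta> ((x ^^ N) g) u' = \<beta> ((x ^^ N) g) u"
  proof -
    have "\<beta> (\<Sum>j=1..n. c j *s (x ^^ j) g) ((x ^^ N) g) = 0"
      unfolding form_sum by (rule sum.neutral) (use pairing form_sym in \<open>simp add: form_scale\<close>)
    then show ?thesis unfolding u'_def by (simp add: form_add form_sym[of "(x ^^ N) g" "sum _ _"])
  qed
  define c' where "c' t = u' + t *s (x ^^ Suc n) g" for t
  have expand: "\<beta> ((x ^^ i) (c' t)) (c' t) = \<beta> ((x ^^ i) u') u' +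
      t * ((1 + (-1) ^ i) * \<beta> ((x ^^ (i + Suc n)) g) u') + t * t * ((-1) ^ Suc n * \<beta> ((x ^^ (i + Suc n + Suc n)) g) g)" for i t
  proof -
    have 1: "\<beta> ((x ^^ i) u') ((x ^^ Suc n) g) = (-1) ^ i * \<beta> ((x ^^ (i + Suc n)) g) u'"
      using pow_form_sym[of i u' "(x ^^ Suc n) g"] by (simp only: pow_pow)
    have 2: "\<beta> ((x ^^ (i + Suc n)) g) ((x ^^ Suc n) g) = (-1) ^ Suc n * \<beta> ((x ^^ (i + Suc n + Suc n)) g) g"
    proof -
      have "\<beta> ((x ^^ Suc n) ((x ^^ (i + Suc n)) g)) g = (-1) ^ Suc n * \<beta> ((x ^^ (i + Suc n)) g) ((x ^^ Suc n) g)"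
        by (rule pow_skew)
      moreover have "(x ^^ Suc n) ((x ^^ (i + Suc n)) g) = (x ^^ (i + Suc n + Suc n)) g"
        by (simp only: pow_pow add.commute)
      moreover have "(-1 :: complex) ^ Suc n * ((-1) ^ Suc n * z) = z" for z
        by (simp add: mult.assoc[symmetric] power_mult_distrib[symmetric])
      ultimately show ?thesis by simp
    qed
    have "\<beta> ((x ^^ i) (c' t)) (c' t) = \<beta> ((x ^^ i) u') u' + t * \<beta> ((x ^^ i) u') ((x ^^ Suc n) g) +
       (t * \<beta> ((x ^^ (i + Suc n)) g) u' + t * t * \<beta> ((x ^^ (i + Suc n)) g) ((x ^^ Suc n) g))"
      unfolding c'_def pow_add pow_scale form_add form_scale pow_pow by (simp add: algebra_simps)
    then show ?thesis unfolding 1 2 by (simp add: algebra_simps)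
  qed
  have big: "\<beta> ((x ^^ i) (c' t)) (c' t) = \<beta> ((x ^^ i) u') u'" if "N < i + Suc n" for i t
    unfolding expand using gg[of "i + Suc n"] gg[of "i + Suc n + Suc n"] that by (simp del: funpow.simps)
  \<comment> \<open>At an odd index the value vanishes by skewness. At an even one the quadratic
    term contains \<open>x ^^ (N + Suc n)\<close> applied to \<open>g\<close>, which is 0, and the
    remaining equation for \<open>t\<close> is linear with leading coefficient
    \<open>2 * \<beta> ((x ^^ N) g) u\<close>.\<close>
  have "\<exists>t. N >= Suc n --> \<beta> ((x ^^ (N - Suc n)) (c' t)) (c' t) = 0"
  proof (cases "N >= Suc n & even (N - Suc n)")
    case True
    define i where "i = N - Suc n"
    have i: "i + Suc n = N" "even i" using True unfolding i_def by (simp_all only: le_add_diff_inverse2 simp_thms)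
    have "\<beta> ((x ^^ i) (c' t)) (c' t) = \<beta> ((x ^^ i) u') u' + t * (2 * \<beta> ((x ^^ N) g) u)" for t
      unfolding expand i(1) using gg[of "N + Suc n"] i(2) gsum by simp
    then have "\<beta> ((x ^^ i) (c' (- \<beta> ((x ^^ i) u') u' / (2 * \<beta> ((x ^^ N) g) u)))) (c' (- \<beta> ((x ^^ i) u') u' / (2 * \<beta> ((x ^^ N) g) u))) = 0"
      using ne by simp
    then show ?thesis unfolding i_def by blast
  next
    case False
    then show ?thesis using odd_vanish by blast
  qed
  then obtain t where t: "N >= Suc n ==> \<beta> ((x ^^ (N - Suc n)) (c' t)) (c' t) = 0" by blast
  have "c' t = u + (\<Sum>j=1..Suc n. (c(Suc n := t)) j *s (x ^^ j) g)"
  proof -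
    have "(\<Sum>j=1..n. (c(Suc n := t)) j *s (x ^^ j) g) = (\<Sum>j=1..n. c j *s (x ^^ j) g)"
      by (rule sum.cong) auto
    then show ?thesis unfolding c'_def u'_def by (simp add: add.assoc)
  qed
  moreover have "\<beta> ((x ^^ i) (c' t)) (c' t) = 0" if "i < N" "N <= i + Suc n" for i
  proof (cases "N = i + Suc n")
    case True
    then show ?thesis using t by simp
  next
    case False
    then show ?thesis using big[of i t] c1[of i] that by simp
  qed
  moreover have "\<beta> ((x ^^ N) (c' t)) (c' t) = \<beta> ((x ^^ N) u) u" using big[of N t] c2 by simp
  ultimately show ?case unfolding Let_def by (intro exI[of _ "c(Suc n := t)"]) metis
qed

lemma correct':
  assumes u: "(x ^^ Suc N) u = 0" and g: "(x ^^ Suc N) g = 0" and ne: "\<beta> ((x ^^ N) g) u ~= 0"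
  obtains c where "\<And>i. i < N ==> \<beta> ((x ^^ i) (u + (\<Sum>j=1..N. c j *s (x ^^ j) g))) (u + (\<Sum>j=1..N. c j *s (x ^^ j) g)) = 0"
    "\<beta> ((x ^^ N) (u + (\<Sum>j=1..N. c j *s (x ^^ j) g))) (u + (\<Sum>j=1..N. c j *s (x ^^ j) g)) = \<beta> ((x ^^ N) u) u"
proof -
  obtain c where c: "let u' = u + (\<Sum>j=1..N. c j *s (x ^^ j) g) in
    (\<forall>i. i < N --> N <= i + N --> \<beta> ((x ^^ i) u') u' = 0) & \<beta> ((x ^^ N) u') u' = \<beta> ((x ^^ N) u) u"
    using correct[OF assms, of N] ..
  show ?thesis by (rule that[of c]) (use c in \<open>simp_all add: Let_def\<close>)
qed

lemma pow_sum: "(x ^^ i) (\<Sum>j\<in>A. f j) = (\<Sum>j\<in>A. (x ^^ i) (f j))"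
  by (induction A rule: infinite_finite_induct) (simp_all add: pow_add)

end

section \<open>Points of the sphere as lines in complex dimension two\<close>

definition sphere_proj :: "real ^ 3 => complex ^ 2 ^ 2" where
  "sphere_proj x = (\<chi> i j. if i = 1 & j = 1 then of_real (1 + x $ 1) / 2
     else if i = 2 & j = 2 then of_real (1 - x $ 1) / 2
     else if i = 1 then cnj (Complex (x $ 2) (x $ 3)) / 2 else Complex (x $ 2) (x $ 3) / 2)"

lemma sphere_proj_nth:
  "sphere_proj x $ 1 $ 1 = of_real (1 + x $ 1) / 2" "sphere_proj x $ 2 $ 2 = of_real (1 - x $ 1) / 2"
  "sphere_proj x $ 1 $ 2 = cnj (Complex (x $ 2) (x $ 3)) / 2" "sphere_proj x $ 2 $ 1 = Complex (x $ 2) (x $ 3) / 2"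
  by (simp_all add: sphere_proj_def)

lemma mat2_eq_iff: "p = q \<longleftrightarrow> p $ 1 $ 1 = q $ 1 $ 1 & p $ 1 $ 2 = q $ 1 $ 2 & p $ 2 $ 1 = q $ 2 $ 1 & p $ 2 $ 2 = q $ 2 $ 2"
  for p q :: "'a ^ 2 ^ 2"
  by (simp add: vec2_eq_iff)

lemma sphere_proj_uminus: "sphere_proj (- x) = compl_proj (sphere_proj x)"
  by (simp add: mat2_eq_iff compl_proj_nth sphere_proj_nth complex_eq_iff field_simps)

lemma norm_eq_1_real3: "norm x = 1 \<longleftrightarrow> (x $ 1)\<^sup>2 + (x $ 2)\<^sup>2 + (x $ 3)\<^sup>2 = 1" for x :: "real ^ 3"
  by (simp add: norm_eq_1 inner_vec_def sum_3 power2_eq_square)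

text \<open>The matrix is half of the identity plus a traceless Hermitian matrix with entries from
  \<open>x\<close>; its determinant is a quarter of one minus the squared norm. The axes are
  arranged so that q gives \<open>qmat\<close> and the two poles give the isotropic lines.\<close>

lemma rank_one_sphere_proj:
  assumes "x \<in> sphere 0 1"
  shows "rank_one (sphere_proj x)"
proof -
  have "(x $ 1)\<^sup>2 + (x $ 2)\<^sup>2 + (x $ 3)\<^sup>2 = 1" using assms by (simp add: norm_eq_1_real3)
  then have "(1 + x $ 1) * (1 - x $ 1) = (x $ 2)\<^sup>2 + (x $ 3)\<^sup>2"
    by (simp add: power2_eq_square algebra_simps)
  moreover have "cnj (Complex u v) * Complex u v = of_real (u\<^sup>2 + v\<^sup>2)" for u v
    by (simp add: complex_eq_iff power2_eq_square)
  ultimately have "of_real (1 + x $ 1) * of_real (1 - x $ 1) = cnj (Complex (x $ 2) (x $ 3)) * Complex (x $ 2) (x $ 3)"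
    by (simp only: of_real_mult[symmetric])
  then have "of_real (1 + x $ 1) / 2 * (of_real (1 - x $ 1) / 2) = cnj (Complex (x $ 2) (x $ 3)) / 2 * (Complex (x $ 2) (x $ 3) / 2)"
    by (simp only: times_divide_times_eq)
  moreover have "complex_of_real (1 + x $ 1) / 2 + of_real (1 - x $ 1) / 2 = 1"
    by (simp add: field_simps)
  ultimately show ?thesis
    unfolding rank_one_def sphere_proj_nth by blast
qed

lemma sphere_proj_poles:
  "sphere_proj pole_q = qmat" "sphere_proj pole_p = pmat 1" "sphere_proj (- pole_p) = pmat (-1)"
  by (simp_all add: mat2_eq_iff sphere_proj_nth pole_nth qmat_def pmat_def complex_eq_iff)

text \<open>The Hopf map. Division by the squared norm makes it depend only on the line of a nonzero
  \<open>a\<close>, so it inverts the passage from a point to its line.\<close>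

definition hopf :: "complex ^ 2 => real ^ 3" where
  "hopf a = (let N = (cmod (a $ 1))\<^sup>2 + (cmod (a $ 2))\<^sup>2; z = 2 * cnj (a $ 1) * a $ 2 in
     vector [((cmod (a $ 1))\<^sup>2 - (cmod (a $ 2))\<^sup>2) / N, Re z / N, Im z / N])"

lemma hopf_nth:
  defines "N \<equiv> %a. (cmod (a $ 1))\<^sup>2 + (cmod (a $ 2))\<^sup>2"
  shows "hopf a $ 1 = ((cmod (a $ 1))\<^sup>2 - (cmod (a $ 2))\<^sup>2) / N a"
    "hopf a $ 2 = Re (2 * cnj (a $ 1) * a $ 2) / N a" "hopf a $ 3 = Im (2 * cnj (a $ 1) * a $ 2) / N a"
  by (simp_all add: hopf_def N_def Let_def vector_3)

lemma norm2_pos: "a ~= 0 ==> (cmod (a $ 1))\<^sup>2 + (cmod (a $ 2))\<^sup>2 > 0" for a :: "complex ^ 2"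
  by (auto simp: vec2_eq_iff intro: add_pos_nonneg add_nonneg_pos)

lemma hopf_sphere:
  assumes "a ~= 0"
  shows "hopf a \<in> sphere 0 1"
proof -
  define P R where "P = (cmod (a $ 1))\<^sup>2" and "R = (cmod (a $ 2))\<^sup>2"
  define z where "z = cnj (a $ 1) * a $ 2"
  have N: "P + R > 0" using norm2_pos[OF assms] by (simp add: P_def R_def)
  have "(Re z)\<^sup>2 + (Im z)\<^sup>2 = P * R"
    unfolding cmod_power2[symmetric] z_def P_def R_def by (simp add: norm_mult power_mult_distrib)
  moreover have h: "hopf a $ 1 = (P - R) / (P + R)" "hopf a $ 2 = 2 * Re z / (P + R)" "hopf a $ 3 = 2 * Im z / (P + R)"
    unfolding hopf_nth P_def R_def z_def by simp_all
  moreover have "(P - R)\<^sup>2 + (2 * Re z)\<^sup>2 + (2 * Im z)\<^sup>2 = (P - R)\<^sup>2 + 4 * ((Re z)\<^sup>2 + (Im z)\<^sup>2)"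
    by (simp add: power2_eq_square)
  ultimately have "(P - R)\<^sup>2 + (2 * Re z)\<^sup>2 + (2 * Im z)\<^sup>2 = (P + R)\<^sup>2"
    by (simp add: power2_eq_square algebra_simps)
  then have "(hopf a $ 1)\<^sup>2 + (hopf a $ 2)\<^sup>2 + (hopf a $ 3)\<^sup>2 = 1"
    unfolding h power_divide using N by (simp add: add_divide_distrib[symmetric])
  then show ?thesis by (simp add: norm_eq_1_real3)
qed

lemma sphere_proj_mult2:
  "2 * (sphere_proj y *v a) $ 1 = (1 + of_real (y $ 1)) * a $ 1 + cnj (Complex (y $ 2) (y $ 3)) * a $ 2"
  "2 * (sphere_proj y *v a) $ 2 = Complex (y $ 2) (y $ 3) * a $ 1 + (1 - of_real (y $ 1)) * a $ 2"
  by (simp_all add: mat2_mult_nth sphere_proj_nth field_simps)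

text \<open>The two eigenvector equations and their conjugates, multiplied by coordinates of
  \<open>a\<close>, become linear equations for the first coordinate of \<open>x\<close> and for the
  complex number formed by the other two.\<close>

lemma hopf_unique:
  assumes "sphere_proj x *v a = a" "a ~= 0"
  shows "x = hopf a"
proof -
  define P R where "P = (cmod (a $ 1))\<^sup>2" and "R = (cmod (a $ 2))\<^sup>2"
  define X Z where "X = complex_of_real (x $ 1)" and "Z = Complex (x $ 2) (x $ 3)"
  have N: "P + R > 0" using norm2_pos[OF assms(2)] by (simp add: P_def R_def)
  have PR: "a $ 1 * cnj (a $ 1) = of_real P" "a $ 2 * cnj (a $ 2) = of_real R"
    by (simp_all only: complex_norm_square[symmetric] P_def R_def of_real_power)
  have X: "cnj X = X" by (simp add: X_def)
  have "2 * (sphere_proj x *v a) $ 1 = (1 + X) * a $ 1 + cnj Z * a $ 2"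
    "2 * (sphere_proj x *v a) $ 2 = Z * a $ 1 + (1 - X) * a $ 2"
    unfolding X_def Z_def by (rule sphere_proj_mult2)+
  then have "2 * a $ 1 = (1 + X) * a $ 1 + cnj Z * a $ 2" "2 * a $ 2 = Z * a $ 1 + (1 - X) * a $ 2"
    unfolding assms(1) .
  then have e1: "cnj Z * a $ 2 = (1 - X) * a $ 1" and e2: "Z * a $ 1 = (1 + X) * a $ 2"
    by (simp_all add: algebra_simps)
  have e1': "Z * cnj (a $ 2) = (1 - X) * cnj (a $ 1)" using arg_cong[OF e1, of cnj] X by simp
  have e2': "cnj Z * cnj (a $ 1) = (1 + X) * cnj (a $ 2)" using arg_cong[OF e2, of cnj] X by simp
  have "(1 - X) * of_real P = (1 + X) * of_real R"
  proof -
    have "(1 - X) * of_real P = ((1 - X) * a $ 1) * cnj (a $ 1)" by (simp add: PR[symmetric] mult.assoc)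
    also have "\<dots> = (cnj Z * cnj (a $ 1)) * a $ 2" unfolding e1[symmetric] by (simp add: mult_ac)
    also have "\<dots> = (1 + X) * of_real R" unfolding e2' by (simp add: PR[symmetric] mult_ac)
    finally show ?thesis .
  qed
  then have "complex_of_real ((1 - x $ 1) * P) = of_real ((1 + x $ 1) * R)" by (simp add: X_def)
  then have "(1 - x $ 1) * P = (1 + x $ 1) * R" by (simp only: of_real_eq_iff)
  then have x1: "x $ 1 = (P - R) / (P + R)" using N by (simp add: field_simps)
  have "Z * of_real (P + R) = 2 * cnj (a $ 1) * a $ 2"
  proof -
    have "Z * of_real P = (Z * a $ 1) * cnj (a $ 1)" by (simp add: PR[symmetric] mult.assoc)
    moreover have "Z * of_real R = (Z * cnj (a $ 2)) * a $ 2" by (simp add: PR[symmetric] mult_ac)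
    ultimately have "Z * of_real (P + R) = (1 + X) * a $ 2 * cnj (a $ 1) + (1 - X) * cnj (a $ 1) * a $ 2"
      unfolding e1' e2 by (simp add: distrib_left)
    then show ?thesis by (simp add: algebra_simps)
  qed
  then have "Re (Z * of_real (P + R)) = Re (2 * cnj (a $ 1) * a $ 2)" "Im (Z * of_real (P + R)) = Im (2 * cnj (a $ 1) * a $ 2)"
    by simp_all
  then have "x $ 2 * (P + R) = Re (2 * cnj (a $ 1) * a $ 2)" "x $ 3 * (P + R) = Im (2 * cnj (a $ 1) * a $ 2)"
    by (simp_all add: Z_def)
  then have "x $ 2 = Re (2 * cnj (a $ 1) * a $ 2) / (P + R)" "x $ 3 = Im (2 * cnj (a $ 1) * a $ 2) / (P + R)"
    using N by (simp_all add: eq_divide_eq)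
  then show ?thesis
    using x1 unfolding Finite_Cartesian_Product.vec_eq_iff forall_3 hopf_nth P_def R_def by blast
qed

lemma hopf_proj:
  assumes "a ~= 0"
  shows "sphere_proj (hopf a) *v a = a"
proof -
  define P R where "P = (cmod (a $ 1))\<^sup>2" and "R = (cmod (a $ 2))\<^sup>2"
  define N where "N = complex_of_real (P + R)"
  have "P + R ~= 0" using norm2_pos[OF assms] unfolding P_def R_def by (rule less_imp_neq[symmetric])
  then have N: "N ~= 0" unfolding N_def by (simp only: of_real_eq_0_iff not_False_eq_True)
  have cN: "cnj N = N" by (simp add: N_def)
  define D where "D = complex_of_real P - of_real R"
  have ND: "N + D = 2 * of_real P" "N - D = 2 * of_real R" by (simp_all add: N_def D_def)
  have PR: "a $ 1 * cnj (a $ 1) = of_real P" "a $ 2 * cnj (a $ 2) = of_real R"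
    by (simp_all only: complex_norm_square[symmetric] P_def R_def of_real_power)
  have h1: "of_real (hopf a $ 1) = (of_real P - of_real R) / N"
    unfolding hopf_nth P_def R_def N_def by simp
  have h2: "Complex (hopf a $ 2) (hopf a $ 3) = 2 * cnj (a $ 1) * a $ 2 / N"
    unfolding hopf_nth N_def P_def[symmetric] R_def[symmetric] by (simp add: complex_eq_iff Re_divide_of_real Im_divide_of_real)
  have "((1 + D / N) * a $ 1 + cnj (2 * cnj (a $ 1) * a $ 2 / N) * a $ 2) * N = (N + D) * a $ 1 + 2 * a $ 1 * (a $ 2 * cnj (a $ 2))"
    using N by (simp add: cN field_simps)
  also have "\<dots> = 2 * a $ 1 * N" unfolding PR ND by (simp add: N_def algebra_simps)
  finally have 1: "(1 + D / N) * a $ 1 + cnj (2 * cnj (a $ 1) * a $ 2 / N) * a $ 2 = 2 * a $ 1"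
    using N by simp
  have "((2 * cnj (a $ 1) * a $ 2 / N) * a $ 1 + (1 - D / N) * a $ 2) * N = 2 * (a $ 1 * cnj (a $ 1)) * a $ 2 + (N - D) * a $ 2"
    using N by (simp add: field_simps)
  also have "\<dots> = 2 * a $ 2 * N" unfolding PR ND by (simp add: N_def algebra_simps)
  finally have 2: "(2 * cnj (a $ 1) * a $ 2 / N) * a $ 1 + (1 - D / N) * a $ 2 = 2 * a $ 2"
    using N by simp
  have "2 * (sphere_proj (hopf a) *v a) $ 1 = 2 * a $ 1"
    using 1 unfolding D_def h1[symmetric] h2[symmetric] sphere_proj_mult2 .
  moreover have "2 * (sphere_proj (hopf a) *v a) $ 2 = 2 * a $ 2"
    using 2 unfolding D_def h1[symmetric] h2[symmetric] sphere_proj_mult2 .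
  ultimately show ?thesis by (simp add: vec2_eq_iff)
qed

text \<open>An orthogonal projection is determined by one nonzero vector of its image; this fails
  for general rank one idempotents. All uniqueness of points comes from here.\<close>

lemma sphere_proj_eqI:
  "sphere_proj x *v a = a ==> sphere_proj y *v a = a ==> a ~= 0 ==> x = y"
  using hopf_unique by metis

lemma sphere_proj_kernel: "sphere_proj x *v a = 0 \<longleftrightarrow> sphere_proj (- x) *v a = a"
  by (simp add: sphere_proj_uminus compl_proj_mult)

lemma delta_self [simp]: "delta n a n = a"
  by (simp add: delta_def)

section \<open>Words without adjacent antipodal points\<close>

abbreviation Kop :: "(real ^ 3) list => cseq => cseq" where
  "Kop xs \<equiv> fold Qop (map sphere_proj xs)"

fun no_antipodal :: "(real ^ 3) list => bool" where
  "no_antipodal [] = True"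
| "no_antipodal [x] = True"
| "no_antipodal (x # y # xs) = (y ~= - x & no_antipodal (y # xs))"

lemma not_no_antipodal: "\<not> no_antipodal xs ==> \<exists>as y bs. xs = as @ [y, - y] @ bs"
proof (induction xs rule: no_antipodal.induct)
  case (3 x y xs)
  show ?case
  proof (cases "y = - x")
    case True
    then have "x # y # xs = [] @ [x, - x] @ xs" by simp
    then show ?thesis by blast
  next
    case False
    then obtain as w bs where "y # xs = as @ [w, - w] @ bs" using 3 by auto
    then have "x # y # xs = (x # as) @ [w, - w] @ bs" by simp
    then show ?thesis by blast
  qed
qed simp_all

text \<open>Lifting by \<open>Pop\<close> projects the top entry, on the line of \<open>y\<close>,
  to the line of \<open>x\<close>; it is lost only if these lines are orthogonal, that is if
  \<open>y = - x\<close>. The resulting sequence of maximal length generates the kernel under the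
  shift.\<close>

lemma kernel_cyclic:
  assumes "no_antipodal xs" "set xs \<subseteq> sphere 0 1" "xs ~= []"
  shows "\<exists>v. Kop xs v = (%_. 0) & v (length xs - 1) ~= 0 &
    sphere_proj (hd xs) *v v (length xs - 1) = v (length xs - 1)"
  using assms
proof (induction xs rule: no_antipodal.induct)
  case (2 x)
  then have r: "rank_one (sphere_proj x)" by (intro rank_one_sphere_proj) simp
  obtain u where "u ~= 0" "sphere_proj x *v u = u" by (rule rank_one_image_nonzero[OF r])
  then show ?case by (intro exI[of _ "delta 0 u"]) (simp add: Qop_delta delta_self)
next
  case (3 x y xs)
  then obtain v where v: "Kop (y # xs) v = (%_. 0)" "v (length xs) ~= 0" "sphere_proj y *v v (length xs) = v (length xs)"
    by auto
  have r: "rank_one (sphere_proj x)" and rs: "\<And>p. p \<in> set (map sphere_proj (y # xs)) ==> rank_one p"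
    using 3(3) by (auto intro!: rank_one_sphere_proj)
  have v0: "v (Suc (length xs)) = 0"
    by (rule fold_Qop_vanish[OF rs v(1)]) simp_all
  have top: "Pop (sphere_proj x) v (Suc (length xs)) = sphere_proj x *v v (length xs)"
    by (simp add: Pop_def v0)
  have "sphere_proj x *v v (length xs) ~= 0"
  proof
    assume "sphere_proj x *v v (length xs) = 0"
    then have "sphere_proj (- x) *v v (length xs) = v (length xs)" by (simp add: sphere_proj_kernel)
    then have "y = - x" using sphere_proj_eqI v(2,3) by blast
    then show False using 3(2) by simp
  qed
  then show ?case
    using v(1) top by (intro exI[of _ "Pop (sphere_proj x) v"]) (simp add: Qop_Pop[OF r] rank_one_idem[OF r])
qed simp

text \<open>The part of \<open>a\<close> off the line of \<open>x\<close> lies on the line of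
  \<open>- x\<close>, and by induction on the line of \<open>y\<close> as well. These lines differ,
  so that part is 0.\<close>

lemma kernel_delta0:
  assumes "no_antipodal xs" "set xs \<subseteq> sphere 0 1" "xs ~= []" "Kop xs (delta 0 a) = (%_. 0)"
  shows "sphere_proj (hd xs) *v a = a"
  using assms
proof (induction xs arbitrary: a rule: no_antipodal.induct)
  case (2 x)
  then have "delta 0 (a - sphere_proj x *v a) 0 = 0" by (simp add: Qop_delta')
  then show ?case by (simp add: delta_def)
next
  case (3 x y xs)
  have r: "rank_one (sphere_proj x)" using 3(3) by (auto intro!: rank_one_sphere_proj)
  let ?c = "a - sphere_proj x *v a"
  have "Kop (y # xs) (delta 0 ?c) = (%_. 0)" using 3(5) by (simp add: Qop_delta')
  then have "sphere_proj y *v ?c = ?c" using 3(1)[of ?c] 3(2,3) by simp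
  moreover have "sphere_proj (- x) *v ?c = ?c"
    unfolding sphere_proj_kernel[symmetric] by (simp add: mat2_mult_diff rank_one_idem[OF r])
  ultimately have "?c = 0" using sphere_proj_eqI[of y ?c "- x"] 3(2) by auto
  then show ?case by simp
qed simp

lemma shift_delta0: "shift (delta 0 a) = (%_. 0)"
  by (simp add: shift_def delta_def)

definition unshift :: "cseq => cseq" where "unshift w = (%i. if i = 0 then 0 else w (i - 1))"

lemma shift_unshift [simp]: "shift (unshift w) = w"
  by (simp add: shift_def unshift_def)

lemma form_odd_delta0:
  "form_odd \<epsilon> (Suc r) (Suc k) (delta 0 a) w = \<epsilon> * ((-1) ^ r * (a $ 1 * w r $ 1)) + (-1) ^ k * (a $ 2 * w k $ 2)"
proof -
  have "(%i. delta 0 a i $ n) = (%i. if i = 0 then a $ n else 0)" for n by (auto simp: delta_def)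
  then show ?thesis unfolding form_odd_def using altsum_delta[of "(*)"] by simp
qed

lemma form_even_delta0: "form_even (Suc n) (delta 0 a) w = (-1) ^ n * area a (w n)"
  unfolding form_even_def delta_def by (rule altsum_delta) simp

text \<open>All \<open>delta 0 a\<close> lie in the kernel, and pairing with them kills the last
  entry of each block of every kernel element. A block of size one would contradict this for
  \<open>delta 0 a\<close> itself, whence the bounds on \<open>r\<close> and
  \<open>k\<close>.\<close>

lemma isotropic_odd_unshift:
  assumes iso: "isotropic r k (form_odd \<epsilon> r k) (%w. K (shift w))" and K: "linop K" and \<epsilon>: "\<epsilon> ~= 0" and rk: "1 <= r" "1 <= k"
  shows "2 <= r" "2 <= k" "isotropic (r - 2) (k - 2) (form_odd \<epsilon> (r - 2) (k - 2)) K"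
proof -
  note I = isotropicD[OF iso]
  obtain r' k' where r': "r = Suc r'" "k = Suc k'" using rk by (metis Suc_le_D One_nat_def)
  have d0: "K (shift (delta 0 a)) = (%_. 0)" for a by (simp add: shift_delta0 linop_zero[OF K])
  have w0: "w r' $ 1 = 0" "w k' $ 2 = 0" if "K (shift w) = (%_. 0)" for w
    using I(2)[OF d0[of "axis 1 1"] that] I(2)[OF d0[of "axis 2 1"] that] \<epsilon>
    unfolding r' form_odd_delta0 by (simp_all add: axis_def)
  have "r' ~= 0"
  proof
    assume "r' = 0"
    then show False using w0(1)[OF d0[of "axis 1 1"]] by (simp add: axis_def)
  qed
  then obtain r0 where r0: "r' = Suc r0" by (cases r') auto
  have "k' ~= 0"
  proof
    assume "k' = 0"
    then show False using w0(2)[OF d0[of "axis 2 1"]] by (simp add: axis_def)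
  qed
  then obtain k0 where k0: "k' = Suc k0" by (cases k') auto
  show "2 <= r" "2 <= k" using r' r0 k0 by simp_all
  have s: "supported (Suc r0) (Suc k0) w" if "K (shift w) = (%_. 0)" for w
  proof -
    have "w i $ 1 = 0" if "Suc r0 <= i" for i
      using I(1)[OF \<open>K (shift w) = _\<close>] w0(1)[OF \<open>K (shift w) = _\<close>] that r' r0 unfolding supported_def
      by (cases "i = Suc r0") simp_all
    moreover have "w i $ 2 = 0" if "Suc k0 <= i" for i
      using I(1)[OF \<open>K (shift w) = _\<close>] w0(2)[OF \<open>K (shift w) = _\<close>] that r' k0 unfolding supported_def
      by (cases "i = Suc k0") simp_all
    ultimately show ?thesis unfolding supported_def by simp
  qed
  have "isotropic r0 k0 (form_odd \<epsilon> r0 k0) K"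
    unfolding isotropic_def
  proof (intro conjI allI impI)
    fix w assume "K w = (%_. 0)"
    then have "supported (Suc r0) (Suc k0) (unshift w)" by (intro s) simp
    then have "unshift w (Suc i) $ 1 = 0" if "r0 <= i" for i using that unfolding supported_def by simp
    moreover have "unshift w (Suc i) $ 2 = 0" if "k0 <= i" for i
      using that \<open>supported (Suc r0) (Suc k0) (unshift w)\<close> unfolding supported_def by simp
    ultimately show "supported r0 k0 w" by (simp add: supported_def unshift_def)
  next
    fix v w assume *: "K v = (%_. 0)" "K w = (%_. 0)"
    then have **: "K (shift (unshift v)) = (%_. 0)" "K (shift (unshift w)) = (%_. 0)" by simp_all
    have "form_odd \<epsilon> (r0 + 2) (k0 + 2) (unshift v) (unshift w) = - form_odd \<epsilon> r0 k0 v w"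
      using form_odd_shift[OF s[OF **(1)] s[OF **(2)], of \<epsilon>] by simp
    moreover have "form_odd \<epsilon> (r0 + 2) (k0 + 2) (unshift v) (unshift w) = 0"
      using I(2)[OF **] r' r0 k0 by simp
    ultimately show "form_odd \<epsilon> r0 k0 v w = 0" by simp
  qed
  then show "isotropic (r - 2) (k - 2) (form_odd \<epsilon> (r - 2) (k - 2)) K" using r' r0 k0 by simp
qed

lemma area_axis: "area (axis 1 1) b = b $ 2" "area (axis 2 1) b = - b $ 1"
  by (simp_all add: area_def axis_def)

lemma isotropic_even_unshift:
  assumes iso: "isotropic (Suc n) (Suc n) (form_even (Suc n)) (%w. K (shift w))" and K: "linop K"
  shows "1 <= n" "isotropic (n - 1) (n - 1) (form_even (n - 1)) K"
proof -
  note I = isotropicD[OF iso]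
  have d0: "K (shift (delta 0 a)) = (%_. 0)" for a by (simp add: shift_delta0 linop_zero[OF K])
  have w0: "w n = 0" if "K (shift w) = (%_. 0)" for w
    using I(2)[OF d0[of "axis 1 1"] that] I(2)[OF d0[of "axis 2 1"] that]
    unfolding form_even_delta0 area_axis by (simp add: vec2_eq_iff)
  have "n ~= 0"
  proof
    assume "n = 0"
    then have "delta 0 (axis 1 1) 0 = 0" using w0[OF d0[of "axis 1 1"]] by simp
    then show False by (simp add: delta_def axis_eq_0_iff)
  qed
  then obtain n0 where n0: "n = Suc n0" by (cases n) auto
  have s: "w (Suc n0) = 0" if "K (shift w) = (%_. 0)" for w using w0[OF that] n0 by simp
  show "1 <= n" using n0 by simp
  have "isotropic n0 n0 (form_even n0) K"
    unfolding isotropic_def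
  proof (intro conjI allI impI)
    fix w assume w: "K w = (%_. 0)"
    then have w': "K (shift (unshift w)) = (%_. 0)" by simp
    have "w i = 0" if "n0 <= i" for i
    proof (cases "i = n0")
      case True
      then show ?thesis using s[OF w'] by (simp add: unshift_def)
    next
      case False
      then have "Suc n <= Suc i" using that n0 by simp
      then have "unshift w (Suc i) = 0" using I(1)[OF w'] unfolding supported_vanish by blast
      then show ?thesis by (simp add: unshift_def)
    qed
    then show "supported n0 n0 w" unfolding supported_vanish by simp
  next
    fix v w assume *: "K v = (%_. 0)" "K w = (%_. 0)"
    then have **: "K (shift (unshift v)) = (%_. 0)" "K (shift (unshift w)) = (%_. 0)" by simp_all
    have "form_even (n0 + 2) (unshift v) (unshift w) = - form_even n0 v w"
      using form_even_shift[of "unshift v" n0 "unshift w"] s[OF **(1)] s[OF **(2)] by simp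
    moreover have "form_even (n0 + 2) (unshift v) (unshift w) = 0"
      using I(2)[OF **] n0 by simp
    ultimately show "form_even n0 v w = 0" by simp
  qed
  then show "isotropic (n - 1) (n - 1) (form_even (n - 1)) K" using n0 by simp
qed

text \<open>Here only the first axis at position 0 is known to lie in the kernel; pairing with it
  kills the last entry of the first block, which is all that \<open>form_odd_qmat\<close> asks
  for.\<close>

lemma isotropic_odd_qmat_converse:
  assumes iso: "isotropic (r + 2) (Suc k) (form_odd \<epsilon> (r + 2) (Suc k)) (%w. K (Qop qmat w))" and K: "linop K" and \<epsilon>: "\<epsilon> ~= 0"
  shows "isotropic r (Suc k) (form_odd (- \<epsilon>) r (Suc k)) K"
proof -
  note I = isotropicD[OF iso]
  have "qmat *v axis 1 1 = axis 1 1" by (simp add: vec2_eq_iff qmat_mult axis_def)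
  then have d0: "K (Qop qmat (delta 0 (axis 1 1))) = (%_. 0)" by (simp add: Qop_delta linop_zero[OF K])
  have w0: "w (Suc r) $ 1 = 0" if "K (Qop qmat w) = (%_. 0)" for w
    using I(2)[OF d0 that] \<epsilon> form_odd_delta0[of \<epsilon> "Suc r" k "axis 1 1" w] by (simp add: axis_def)
  have s: "supported (Suc r) (Suc k) w" if "K (Qop qmat w) = (%_. 0)" for w
  proof -
    have "w i $ 1 = 0" if "Suc r <= i" for i
      using I(1)[OF \<open>K (Qop qmat w) = _\<close>] w0[OF \<open>K (Qop qmat w) = _\<close>] that unfolding supported_def
      by (cases "i = Suc r") simp_all
    then show ?thesis using I(1)[OF that] unfolding supported_def by simp
  qed
  have P: "Qop qmat (Pop qmat w) = w" for w by (rule Qop_Pop[OF rank_one_qmat])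
  show ?thesis
    unfolding isotropic_def
  proof (intro conjI allI impI)
    fix w assume w: "K w = (%_. 0)"
    then have sw: "supported (Suc r) (Suc k) (Pop qmat w)" by (intro s) (simp add: P)
    have "w i $ 1 = 0" if "r <= i" for i
    proof -
      have "w i $ 1 = Pop qmat w (Suc i) $ 1" using Qop_qmat(1)[of "Pop qmat w" i] by (simp add: P)
      then show ?thesis using sw that unfolding supported_def by simp
    qed
    moreover have "w i $ 2 = 0" if "Suc k <= i" for i
    proof -
      have "w i $ 2 = Pop qmat w i $ 2" using Qop_qmat(2)[of "Pop qmat w" i] by (simp add: P)
      then show ?thesis using sw that unfolding supported_def by simp
    qed
    ultimately show "supported r (Suc k) w" by (simp add: supported_def)
  next
    fix v w assume *: "K v = (%_. 0)" "K w = (%_. 0)"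
    then have **: "K (Qop qmat (Pop qmat v)) = (%_. 0)" "K (Qop qmat (Pop qmat w)) = (%_. 0)" by (simp_all add: P)
    show "form_odd (- \<epsilon>) r (Suc k) v w = 0"
      using form_odd_qmat[OF s[OF **(1)] s[OF **(2)], of \<epsilon>] I(2)[OF **] by (simp add: P)
  qed
qed

text \<open>Every kernel element of \<open>K\<close> is the image under \<open>Qop\<close> of its
  \<open>Pop\<close> lift, so isotropy comes back along the form identity. The support bound is a
  separate input, obtained later from the number of factors.\<close>

lemma isotropic_pmat_converse:
  assumes iso: "isotropic (Suc n) (Suc n) (form_odd 1 (Suc n) (Suc n)) (%w. K (Qop (pmat \<sigma>) w))" and \<sigma>: "\<sigma> * \<sigma> = 1"
    and van: "\<And>w i. K w = (%_. 0) ==> n <= i ==> w i = 0"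
  shows "isotropic n n (form_even n) K"
  unfolding isotropic_def
proof (intro conjI allI impI)
  show "supported n n w" if "K w = (%_. 0)" for w using van[OF that] unfolding supported_vanish by simp
next
  note P = Qop_Pop[OF rank_one_pmat[OF \<sigma>]]
  fix v w assume *: "K v = (%_. 0)" "K w = (%_. 0)"
  have "form_odd 1 (Suc n) (Suc n) (Pop (pmat \<sigma>) v) (Pop (pmat \<sigma>) w) = \<i> * \<sigma> * form_even n v w"
    using form_odd_pmat[OF \<sigma>, of "Pop (pmat \<sigma>) v" n "Pop (pmat \<sigma>) w"] van[OF *(1)] van[OF *(2)] by (simp add: P)
  moreover have "form_odd 1 (Suc n) (Suc n) (Pop (pmat \<sigma>) v) (Pop (pmat \<sigma>) w) = 0"
    by (rule isotropicD(2)[OF iso]) (simp_all add: P *)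
  ultimately show "form_even n v w = 0" using \<sigma> by auto
qed

lemma isotropic_Aop_converse:
  assumes iso: "isotropic (n + 2) (n + 2) (form_even (n + 2)) (%w. K (Aop p w))" and p: "rank_one p"
    and van: "\<And>w i. K w = (%_. 0) ==> n <= i ==> w i = 0"
  shows "isotropic n n (form_even n) K"
  unfolding isotropic_def
proof (intro conjI allI impI)
  show "supported n n w" if "K w = (%_. 0)" for w using van[OF that] unfolding supported_vanish by simp
next
  have P: "Aop p (Pop p (Pop p w)) = w" for w by (simp add: Qop_Qop[OF p, symmetric] Qop_Pop[OF p])
  fix v w assume *: "K v = (%_. 0)" "K w = (%_. 0)"
  have "form_even (n + 2) (Pop p (Pop p v)) (Pop p (Pop p w)) = form_even n v w"
    using form_even_Aop[OF p, of "Pop p (Pop p v)" n "Pop p (Pop p w)"] van[OF *(1)] van[OF *(2)] by (simp add: P)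
  moreover have "form_even (n + 2) (Pop p (Pop p v)) (Pop p (Pop p w)) = 0"
    by (rule isotropicD(2)[OF iso]) (simp_all add: P *)
  ultimately show "form_even n v w = 0" by simp
qed

abbreviation doubled :: "'a list => 'a list" where "doubled ys \<equiv> concat (map (%y. [y, y]) ys)"

lemma Kop_vanish:
  assumes "set xs \<subseteq> sphere 0 1" "Kop xs w = (%_. 0)" "length xs <= i"
  shows "w i = 0"
proof (rule fold_Qop_vanish[OF _ assms(2)])
  show "rank_one p" if "p \<in> set (map sphere_proj xs)" for p
    using that assms(1) by (auto intro!: rank_one_sphere_proj)
qed (use assms(3) in simp)

text \<open>For a generator \<open>v\<close> of the kernel, the shifted sequence \<open>u\<close>
  has only the entries \<open>v n\<close> and \<open>v (Suc n)\<close>, and its pairing with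
  \<open>v\<close> reduces to their area. Both entries therefore lie on the line of
  \<open>x1\<close>, so the first operator leaves \<open>delta 0 (v (Suc n))\<close> in the kernel
  of the remaining word; this forces \<open>x2 = x1\<close>, and the pair is removed as an
  \<open>Aop\<close>.\<close>

lemma isotropic_even_pairs:
  assumes "no_antipodal xs" "set xs \<subseteq> sphere 0 1" "even (length xs)"
    "isotropic (length xs) (length xs) (form_even (length xs)) (Kop xs)"
  shows "\<exists>ys. set ys \<subseteq> sphere 0 1 & xs = doubled ys"
  using assms
proof (induction "length xs" arbitrary: xs rule: less_induct)
  case less
  show ?case
  proof (cases xs)
    case Nil
    then show ?thesis by (intro exI[of _ "[]"]) simp
  next
    case (Cons x1 xs1)
    then obtain x2 bs where xs: "xs = x1 # x2 # bs" using less.prems(3) by (cases xs1) auto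
    define n where "n = length bs"
    have len: "length xs = Suc (Suc n)" by (simp add: xs n_def)
    note I = isotropicD[OF less.prems(4)]
    have S: "set xs \<subseteq> sphere 0 1" by (rule less.prems(2))
    have r1: "rank_one (sphere_proj x1)" using S xs by (intro rank_one_sphere_proj) simp
    obtain v where v: "Kop xs v = (%_. 0)" "v (Suc n) ~= 0" "sphere_proj x1 *v v (Suc n) = v (Suc n)"
      using kernel_cyclic[OF less.prems(1) S] xs len by auto
    have vv: "v i = 0" if "Suc (Suc n) <= i" for i using Kop_vanish[OF S v(1)] that len by simp
    define u where "u = (shift ^^ n) v"
    have u_nth: "u i = v (i + n)" for i
      unfolding u_def by (induction n arbitrary: i) (simp_all add: shift_def)
    have "Kop xs ((shift ^^ j) v) = (%_. 0)" for j
      by (induction j) (simp_all add: v(1) shift_fold[symmetric], simp add: shift_def)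
    then have Ku: "Kop xs u = (%_. 0)" by (simp add: u_def)
    have u0: "u 0 = v n" "u (Suc 0) = v (Suc n)" "\<And>i. u (Suc (Suc i)) = 0"
      using vv by (simp_all add: u_nth)
    have "form_even (Suc (Suc n)) u v = 0" using I(2)[OF Ku v(1)] len by simp
    moreover have "form_even (Suc (Suc n)) u v = (-1) ^ n * area (v (Suc n)) (v n) + (-1) ^ Suc n * area (v n) (v (Suc n))"
    proof -
      have "(\<Sum>i<n. (-1) ^ i * area (u (Suc n - i)) (v i)) = 0"
      proof (rule sum.neutral, rule ballI)
        fix i assume "i \<in> {..<n}"
        then obtain j where "Suc n - i = Suc (Suc j)" by (metis Suc_diff_Suc Suc_diff_le lessThan_iff less_imp_le_nat)
        then show "(-1) ^ i * area (u (Suc n - i)) (v i) = 0" using u0(3)[of j] by simp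
      qed
      then show ?thesis unfolding form_even_def altsum_def by (simp add: u0)
    qed
    moreover have "area (v n) (v (Suc n)) = - area (v (Suc n)) (v n)" by (simp add: area_def)
    ultimately have "area (v n) (v (Suc n)) = 0" by simp
    then obtain c where c: "v n = c *s v (Suc n)" using v(2) by (rule area_eq_0)
    have pc: "sphere_proj x1 *v v n = v n" unfolding c mat2_mult_scale v(3) ..
    have "Qop (sphere_proj x1) u = delta 0 (v (Suc n))"
    proof
      fix i
      consider "i = 0" | "i = Suc 0" | j where "i = Suc (Suc j)" by (metis not0_implies_Suc)
      then show "Qop (sphere_proj x1) u i = delta 0 (v (Suc n)) i"
        by cases (simp_all add: Qop_def delta_def u0 v(3) pc)
    qed
    then have "Kop (x2 # bs) (delta 0 (v (Suc n))) = (%_. 0)" using Ku by (simp add: xs)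
    then have "sphere_proj x2 *v v (Suc n) = v (Suc n)"
      using kernel_delta0[of "x2 # bs"] less.prems(1) S xs by simp
    then have x12: "x2 = x1" using sphere_proj_eqI[OF _ v(3,2)] by blast
    have K: "Kop xs = (%w. Kop bs (Aop (sphere_proj x1) w))"
      by (simp add: fun_eq_iff xs x12 Qop_Qop[OF r1])
    have "isotropic n n (form_even n) (Kop bs)"
    proof (rule isotropic_Aop_converse[OF _ r1])
      show "isotropic (n + 2) (n + 2) (form_even (n + 2)) (%w. Kop bs (Aop (sphere_proj x1) w))"
        using less.prems(4) unfolding K len by simp
      show "w i = 0" if "Kop bs w = (%_. 0)" "n <= i" for w i
        using Kop_vanish[of bs w i] that S xs n_def by simp
    qed
    moreover have "no_antipodal bs" using less.prems(1) xs by (cases bs) auto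
    ultimately have "\<exists>ys. set ys \<subseteq> sphere 0 1 & bs = doubled ys"
      using less.hyps[of bs] S xs less.prems(3) n_def by simp
    then obtain ys where "set ys \<subseteq> sphere 0 1" "bs = doubled ys" by blast
    then show ?thesis using xs x12 S by (intro exI[of _ "x1 # ys"]) simp
  qed
qed

text \<open>While more than \<open>k\<close> points remain, the support bound puts the top entry of
  the generator on the first axis, so the point is q. With exactly \<open>k\<close> left, pairing
  the generator with \<open>delta 0\<close> of its top entry makes this entry isotropic for the dot
  product, so the point is one of the poles; what remains is isotropic for the even form.\<close>

lemma isotropic_odd_shape:
  assumes "no_antipodal xs" "set xs \<subseteq> sphere 0 1" "odd k" "k <= length xs"
    "isotropic (2 * length xs - k) k (form_odd ((-1) ^ (length xs - k)) (2 * length xs - k) k) (Kop xs)"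
  shows "\<exists>t e ys. xs = replicate t pole_q @ [e] @ doubled ys & (e = pole_p \<or> e = - pole_p) &
    set ys \<subseteq> sphere 0 1 & k = Suc (2 * length ys)"
  using assms
proof (induction xs)
  case Nil
  then show ?case by simp
next
  case (Cons x xs)
  obtain k' where k': "k = Suc k'" using Cons.prems(3) by (cases k) auto
  define n where "n = length xs"
  note I = isotropicD[OF Cons.prems(5)]
  note S = Cons.prems(2)
  have na: "no_antipodal xs" using Cons.prems(1) by (cases xs) auto
  obtain v where v: "Kop (x # xs) v = (%_. 0)" "v n ~= 0" "sphere_proj x *v v n = v n"
    using kernel_cyclic[OF Cons.prems(1) S] n_def by auto
  show ?case
  proof (cases "k <= n")
    case True
    have "v n $ 2 = 0" using I(1)[OF v(1)] True unfolding supported_def by simp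
    then have "sphere_proj pole_q *v v n = v n" by (simp add: sphere_proj_poles vec2_eq_iff qmat_mult)
    then have x: "x = pole_q" using sphere_proj_eqI[OF v(3) _ v(2)] by blast
    have len: "2 * length (x # xs) - k = (2 * n - k) + 2" "length (x # xs) - k = Suc (n - k)"
      using True by (simp_all add: n_def)
    have K: "Kop (x # xs) = (%w. Kop xs (Qop qmat w))" by (simp add: fun_eq_iff x sphere_proj_poles)
    have "isotropic ((2 * n - k) + 2) (Suc k') (form_odd ((-1) ^ Suc (n - k)) ((2 * n - k) + 2) (Suc k')) (%w. Kop xs (Qop qmat w))"
      using Cons.prems(5)[unfolded len K] unfolding k' .
    then have "isotropic (2 * n - k) (Suc k') (form_odd (- ((-1) ^ Suc (n - k))) (2 * n - k) (Suc k')) (Kop xs)"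
      by (rule isotropic_odd_qmat_converse) (simp_all add: linop_fold)
    then have "isotropic (2 * length xs - k) k (form_odd ((-1) ^ (length xs - k)) (2 * length xs - k) k) (Kop xs)"
      by (simp add: n_def k')
    then obtain t e ys where *: "xs = replicate t pole_q @ [e] @ doubled ys" "e = pole_p \<or> e = - pole_p"
      "set ys \<subseteq> sphere 0 1" "k = Suc (2 * length ys)"
      using Cons.IH[OF na] S Cons.prems(3) True n_def by auto
    have "x # xs = replicate (Suc t) pole_q @ [e] @ doubled ys" using * x by simp
    then show ?thesis using *(2-4) by blast
  next
    case False
    then have kn: "k = Suc n" using Cons.prems(4) n_def by simp
    have iso: "isotropic (Suc n) (Suc n) (form_odd 1 (Suc n) (Suc n)) (Kop (x # xs))"
      using Cons.prems(5) kn by (simp add: n_def comp_def)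
    have "Kop (x # xs) (delta 0 (v n)) = (%_. 0)" by (simp add: Qop_delta[OF v(3)] linop_zero[OF linop_fold])
    from isotropicD(2)[OF iso this v(1)] have "v n $ 1 * v n $ 1 + v n $ 2 * v n $ 2 = 0"
      unfolding form_odd_delta0 by (simp flip: distrib_left)
    then have "(v n $ 2 - \<i> * v n $ 1) * (v n $ 2 + \<i> * v n $ 1) = 0" by (simp add: algebra_simps)
    then have "v n $ 2 = \<i> * v n $ 1 \<or> v n $ 2 = - (\<i> * v n $ 1)"
      unfolding mult_eq_0_iff eq_neg_iff_add_eq_0 by simp
    then have "v n $ 2 = \<i> * 1 * v n $ 1 \<or> v n $ 2 = \<i> * (-1) * v n $ 1" by simp
    then obtain \<sigma> where \<sigma>: "\<sigma> = 1 \<or> \<sigma> = - 1" "v n $ 2 = \<i> * \<sigma> * v n $ 1" by blast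
    have \<sigma>2: "\<sigma> * \<sigma> = 1" using \<sigma> by auto
    have "\<i> * \<sigma> * (\<i> * \<sigma> * z) = - (\<sigma> * \<sigma>) * z" for z by (simp add: algebra_simps)
    then have "pmat \<sigma> *v v n = v n"
      unfolding vec2_eq_iff pmat_mult \<sigma>(2) \<sigma>2 by simp
    moreover define e where "e = (if \<sigma> = 1 then pole_p else - pole_p)"
    have e: "sphere_proj e = pmat \<sigma>" "e = pole_p \<or> e = - pole_p"
      using \<sigma>(1) by (auto simp: e_def sphere_proj_poles)
    ultimately have x: "x = e" using sphere_proj_eqI[OF v(3) _ v(2), of e] by simp
    have "isotropic n n (form_even n) (Kop xs)"
    proof (rule isotropic_pmat_converse[OF _ \<sigma>2])
      show "isotropic (Suc n) (Suc n) (form_odd 1 (Suc n) (Suc n)) (%w. Kop xs (Qop (pmat \<sigma>) w))"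
        using iso by (simp add: x e comp_def)
      show "w i = 0" if "Kop xs w = (%_. 0)" "n <= i" for w i
        using Kop_vanish[of xs w i] that S n_def by simp
    qed
    then obtain ys where ys: "set ys \<subseteq> sphere 0 1" "xs = doubled ys"
      using isotropic_even_pairs[OF na] S Cons.prems(3) kn n_def by auto
    have "length (doubled zs) = 2 * length zs" for zs :: "(real ^ 3) list" by (induction zs) simp_all
    then have "k = Suc (2 * length ys)" using kn n_def ys(2) by simp
    moreover have "x # xs = replicate 0 pole_q @ [e] @ doubled ys" using x ys by simp
    ultimately show ?thesis using e(2) ys(1) by blast
  qed
qed

lemma good_word_append_doubled:
  assumes "good_word c xs" "set ys \<subseteq> sphere 0 1"
  shows "good_word (c + length ys) (xs @ doubled ys)"
  using assms
proof (induction ys arbitrary: c xs)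
  case (Cons y ys)
  have "good_word (Suc c) (xs @ [y, y])" by (rule good_word.dotted) (use Cons.prems in auto)
  then have "good_word (Suc c + length ys) ((xs @ [y, y]) @ doubled ys)" by (rule Cons.IH) (use Cons.prems in auto)
  then show ?case by simp
qed simp

lemma length_doubled: "length (doubled ys) = 2 * length ys" by (induction ys) simp_all

lemma Kop_antipodal:
  assumes "y \<in> sphere 0 1"
  shows "Kop (as @ [y, - y] @ bs) = (%w. Kop (as @ bs) (shift w))"
  by (simp add: fun_eq_iff sphere_proj_uminus Qop_compl[OF rank_one_sphere_proj[OF assms]] shift_fold)

lemma isotropic_even_good_word:
  assumes "set xs \<subseteq> sphere 0 1" "even (length xs)"
    "isotropic (length xs) (length xs) (form_even (length xs)) (Kop xs)"
  shows "good_word (length xs div 2) xs"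
  using assms
proof (induction "length xs" arbitrary: xs rule: less_induct)
  case less
  show ?case
  proof (cases "no_antipodal xs")
    case True
    then obtain ys where ys: "set ys \<subseteq> sphere 0 1" "xs = doubled ys"
      using isotropic_even_pairs less.prems by blast
    have "length xs div 2 = length ys" unfolding ys(2) length_doubled by simp
    then show ?thesis using good_word_append_doubled[OF good_word.empty ys(1)] ys(2) by simp
  next
    case False
    then obtain as y bs where xs: "xs = as @ [y, - y] @ bs" using not_no_antipodal by blast
    have y: "y \<in> sphere 0 1" using less.prems(1) xs by simp
    define n where "n = length (as @ bs)"
    have len: "length xs = Suc (Suc n)" by (simp add: xs n_def)
    have "isotropic (Suc (Suc n)) (Suc (Suc n)) (form_even (Suc (Suc n))) (%w. Kop (as @ bs) (shift w))"
      using less.prems(3) unfolding len unfolding xs Kop_antipodal[OF y] .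
    from isotropic_even_unshift(2)[OF this linop_fold] have "isotropic n n (form_even n) (Kop (as @ bs))" by simp
    then have "good_word (n div 2) (as @ bs)"
      unfolding n_def using less.prems len n_def by (intro less.hyps) (auto simp: xs)
    then have "good_word (Suc (n div 2)) (as @ [y, - y] @ bs)" using y by (rule good_word.undotted)
    then show ?thesis using len xs by simp
  qed
qed

lemma isotropic_odd_good_word:
  assumes "set xs \<subseteq> sphere 0 1" "odd k" "k <= length xs"
    "isotropic (2 * length xs - k) k (form_odd ((-1) ^ (length xs - k)) (2 * length xs - k) k) (Kop xs)"
  shows "good_word (k div 2) xs"
  using assms
proof (induction "length xs" arbitrary: xs k rule: less_induct)
  case less
  show ?case
  proof (cases "no_antipodal xs")
    case True
    then obtain t e ys where *: "xs = replicate t pole_q @ [e] @ doubled ys" "e = pole_p \<or> e = - pole_p"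
      "set ys \<subseteq> sphere 0 1" "k = Suc (2 * length ys)"
      using isotropic_odd_shape less.prems by blast
    have "k div 2 = 0 + length ys" using *(4) by simp
    then show ?thesis using good_word_append_doubled[OF good_word.rays[OF *(2), of t] *(3)] *(1) by simp
  next
    case False
    then obtain as y bs where xs: "xs = as @ [y, - y] @ bs" using not_no_antipodal by blast
    have y: "y \<in> sphere 0 1" using less.prems(1) xs by simp
    define n where "n = length (as @ bs)"
    have len: "length xs = Suc (Suc n)" by (simp add: xs n_def)
    have k1: "1 <= k" using less.prems(2) by (cases k) auto
    let ?r = "2 * length xs - k"
    have "isotropic ?r k (form_odd ((-1) ^ (length xs - k)) ?r k) (%w. Kop (as @ bs) (shift w))"
      using less.prems(4) unfolding Kop_antipodal[OF y, of as bs, folded xs] .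
    note U = isotropic_odd_unshift[OF this linop_fold _ _ k1]
    have "1 <= ?r" using less.prems(3) k1 by simp
    then have k2: "2 <= k" and iso: "isotropic (?r - 2) (k - 2) (form_odd ((-1) ^ (length xs - k)) (?r - 2) (k - 2)) (Kop (as @ bs))"
      using U by simp_all
    \<comment> \<open>Length and \<open>k\<close> both drop by two: the two block sizes drop by two
      as well, and the exponent of the sign stays the same.\<close>
    have eq: "?r - 2 = 2 * n - (k - 2)" "length xs - k = n - (k - 2)" using k2 less.prems(3) by (simp_all add: len)
    have "good_word ((k - 2) div 2) (as @ bs)"
    proof (rule less.hyps)
      show "length (as @ bs) < length xs" using len n_def by simp
      show "set (as @ bs) \<subseteq> sphere 0 1" using less.prems(1) xs by auto
      show "odd (k - 2)" using less.prems(2) k2 by simp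
      show "k - 2 <= length (as @ bs)" using less.prems(3) len n_def by simp
      show "isotropic (2 * length (as @ bs) - (k - 2)) (k - 2)
          (form_odd ((-1) ^ (length (as @ bs) - (k - 2))) (2 * length (as @ bs) - (k - 2)) (k - 2)) (Kop (as @ bs))"
        using iso unfolding eq n_def .
    qed
    then have "good_word (Suc ((k - 2) div 2)) (as @ [y, - y] @ bs)" using y by (rule good_word.undotted)
    moreover have "Suc ((k - 2) div 2) = k div 2" using k2 by simp
    ultimately show ?thesis using xs by simp
  qed
qed

section \<open>From cup diagrams to isotropic kernels\<close>

definition ray_label :: "cup_diagram => nat => complex ^ 2 ^ 2" where
  "ray_label a i = (if Ray i \<in> dotted a then pmat 1 else if \<forall>j. Ray j \<in> strands a --> j <= i then pmat (-1) else qmat)"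

text \<open>The relation of a cup is solved for its right end, so that labels can be assigned from
  left to right; below \<open>b\<close> only strands that end before \<open>b\<close> impose a
  condition.\<close>

definition labelled_below :: "cup_diagram => nat => (nat => complex ^ 2 ^ 2) => bool" where
  "labelled_below a b \<pi> \<longleftrightarrow>
     (\<forall>i j. Cup i j \<in> strands a --> j < b --> \<pi> j = (if Cup i j \<in> dotted a then \<pi> i else compl_proj (\<pi> i))) &
     (\<forall>i. Ray i \<in> strands a --> i < b --> \<pi> i = ray_label a i)"

lemma labelled_imp_below:
  assumes "labelled compl_proj (pmat 1) (pmat (-1)) qmat a \<pi>"
  shows "labelled_below a b \<pi>"
proof -
  have "\<pi> j = (if Cup i j \<in> dotted a then \<pi> i else compl_proj (\<pi> i))" if "Cup i j \<in> strands a" for i j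
  proof -
    have "\<pi> i = (if Cup i j \<in> dotted a then \<pi> j else compl_proj (\<pi> j))"
      using assms that unfolding labelled_def by blast
    then show ?thesis by simp
  qed
  moreover have "\<pi> i = ray_label a i" if "Ray i \<in> strands a" for i
    using assms that unfolding labelled_def ray_label_def by blast
  ultimately show ?thesis unfolding labelled_below_def by blast
qed

abbreviation Kpi :: "(nat => complex ^ 2 ^ 2) => nat => nat => cseq => cseq" where
  "Kpi \<pi> c b \<equiv> fold Qop (map \<pi> [c..<b])"

lemma funpow_shift_Qop: "(shift ^^ n) (Qop p w) = Qop p ((shift ^^ n) w)"
  by (induction n) (simp_all add: shift_Qop)

lemma funpow_shift_fold: "(shift ^^ n) (fold Qop ps w) = fold Qop ps ((shift ^^ n) w)"
  by (induction n) (simp_all add: shift_fold)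

lemma shift_Aop: "shift (Aop p w) = Aop p (shift w)"
  by (simp add: shift_def Aop_def)

lemma shift_fold_Aop: "shift (fold Aop ps w) = fold Aop ps (shift w)"
  by (induction ps arbitrary: w) (simp_all add: shift_Aop)

lemma funpow_shift_fold_Aop: "(shift ^^ n) (fold Aop ps w) = fold Aop ps ((shift ^^ n) w)"
  by (induction n) (simp_all add: shift_fold_Aop)

lemma funpow_shift_Aop: "(shift ^^ n) (Aop p w) = Aop p ((shift ^^ n) w)"
  by (induction n) (simp_all add: shift_Aop)

lemma Kpi_split: "c <= d ==> d <= b ==> Kpi \<pi> c b w = Kpi \<pi> d b (Kpi \<pi> c d w)"
proof -
  assume "c <= d" "d <= b"
  then have "[c..<b] = [c..<d] @ [d..<b]" using upt_add_eq_append[of c d "b - d"] by simp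
  then show ?thesis by simp
qed

lemma Kpi_Suc: "c <= b ==> Kpi \<pi> c (Suc b) w = Qop (\<pi> b) (Kpi \<pi> c b w)"
  by simp

lemma Kpi_first: "c < b ==> Kpi \<pi> c b w = Kpi \<pi> (Suc c) b (Qop (\<pi> c) w)"
  by (simp add: upt_conv_Cons)

lemma Kpi_cup: "i < j ==> Kpi \<pi> c (Suc j) w = Qop (\<pi> j) (Kpi \<pi> (Suc i) j (Qop (\<pi> i) (Kpi \<pi> c i w)))" if "c <= i"
  using that by (simp add: Kpi_split[of c i j] Kpi_first[of i j])

text \<open>A gap just before vertex \<open>b\<close> that no cup spans. Only at such gaps does the
  composition of the preceding operators simplify.\<close>

definition is_cut :: "cup_diagram => nat => nat => bool" where
  "is_cut a m b \<longleftrightarrow> 1 <= b & b <= Suc m & (\<forall>i j. Cup i j \<in> strands a --> \<not> (i < b & b <= j))"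

definition ray_list :: "cup_diagram => nat => (complex ^ 2 ^ 2) list" where
  "ray_list a b = map (ray_label a) (filter (%i. Ray i \<in> strands a) [1..<b])"

definition dots :: "cup_diagram => nat => nat" where
  "dots a b = length (filter (%j. \<exists>i. Cup i j \<in> dotted a) [1..<b])"

context
  fixes a :: cup_diagram and m :: nat and \<pi> :: "nat => complex ^ 2 ^ 2"
  assumes a: "combinatorial_diagram m a" and rank_all: "\<forall>i. 1 <= i --> i <= m --> rank_one (\<pi> i)"
begin

lemma rank: "1 <= i ==> i <= m ==> rank_one (\<pi> i)" using rank_all by blast

lemmas diagramD = combinatorial_diagramD[OF a]

text \<open>The composition inside the first cup is a power of the shift, which commutes with every
  \<open>Qop\<close>; so the complementary operators at the two ends of the cup become adjacent and
  contribute one more shift.\<close>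

lemma closed_undotted_interval:
  assumes "1 <= c" "c <= b" "b <= Suc m" "labelled_below a b \<pi>"
    and "\<And>e. c <= e ==> e < b ==> \<exists>i j. Cup i j \<in> strands a & Cup i j \<notin> dotted a & (e = i \<or> e = j) & c <= i & j < b"
  shows "even (b - c) & (\<forall>w. Kpi \<pi> c b w = (shift ^^ ((b - c) div 2)) w)"
  using assms
proof (induction "b - c" arbitrary: c b rule: less_induct)
  case less
  show ?case
  proof (cases "c = b")
    case True
    then show ?thesis by simp
  next
    case False
    then have cb: "c < b" using less.prems(2) by simp
    obtain i j where ij: "Cup i j \<in> strands a" "Cup i j \<notin> dotted a" "c = i \<or> c = j" "c <= i" "j < b"
      using less.prems(5)[OF order_refl cb] by blast
    have lt: "i < j" using diagramD(2)[OF ij(1)] .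
    have ic: "i = c" using ij(3,4) lt by auto
    have inner: "\<exists>i' j'. Cup i' j' \<in> strands a & Cup i' j' \<notin> dotted a & (e = i' \<or> e = j') &
        (if e < j then Suc c <= i' & j' < j else Suc j <= i' & j' < b)" if e: "c < e" "e < b" "e ~= j" for e
    proof -
      obtain i' j' where *: "Cup i' j' \<in> strands a" "Cup i' j' \<notin> dotted a" "e = i' \<or> e = j'" "c <= i'" "j' < b"
        using less.prems(5)[of e] e by auto
      have lt': "i' < j'" using diagramD(2)[OF *(1)] .
      have ne: "Cup i' j' ~= Cup i j" using *(3) e ic by auto
      have n1: "x ~= i'" "x ~= j'" if "x = i \<or> x = j" for x
        using diagramD(3)[OF ij(1) *(1), of x] ne that by auto
      have n: "i' ~= c" "i' ~= j" "j' ~= j" using n1[of i] n1[of j] ic by auto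
      have nc: "\<not> (i' < j & j < j')" using diagramD(5)[OF ij(1) *(1)] *(4) n(1) ic by auto
      show ?thesis
      proof (cases "e < j")
        case True
        then have "i' < j" using *(3) lt' by auto
        then have "j' < j" using nc n by auto
        then show ?thesis using * n True by (intro exI[of _ i'] exI[of _ j']) simp
      next
        case False
        then have "j < j'" using *(3) lt' e(3) by auto
        then have "j < i'" using nc n by auto
        then show ?thesis using * n False by (intro exI[of _ i'] exI[of _ j']) simp
      qed
    qed
    have below: "labelled_below a j \<pi>" using less.prems(4) ij(5) unfolding labelled_below_def by auto
    have I1: "even (j - Suc c) & (\<forall>w. Kpi \<pi> (Suc c) j w = (shift ^^ ((j - Suc c) div 2)) w)"
    proof (rule less.hyps)
      show "j - Suc c < b - c" "Suc c <= j" "j <= Suc m" "1 <= Suc c" using lt ic ij(5) less.prems(3) by auto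
      show "\<exists>i j'. Cup i j' \<in> strands a & Cup i j' \<notin> dotted a & (e = i \<or> e = j') & Suc c <= i & j' < j"
        if "Suc c <= e" "e < j" for e using inner[of e] that ij(5) by simp
    qed (rule below)
    have I2: "even (b - Suc j) & (\<forall>w. Kpi \<pi> (Suc j) b w = (shift ^^ ((b - Suc j) div 2)) w)"
    proof (rule less.hyps)
      show "b - Suc j < b - c" "Suc j <= b" "b <= Suc m" "1 <= Suc j" using lt ic ij(5) less.prems(3) by auto
      show "\<exists>i j'. Cup i j' \<in> strands a & Cup i j' \<notin> dotted a & (e = i \<or> e = j') & Suc j <= i & j' < b"
        if "Suc j <= e" "e < b" for e using inner[of e] that lt ic by simp
    qed (rule less.prems(4))
    have \<pi>j: "\<pi> j = compl_proj (\<pi> c)" using less.prems(4) ij ic unfolding labelled_below_def by auto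
    have r: "rank_one (\<pi> c)" by (rule rank) (use less.prems cb in auto)
    obtain s t where s: "j - Suc c = 2 * s" and t: "b - Suc j = 2 * t" using I1 I2 by (elim conjE evenE)
    have K1: "Kpi \<pi> (Suc c) j w = (shift ^^ s) w" and K2: "Kpi \<pi> (Suc j) b w = (shift ^^ t) w" for w
      using I1 I2 s t by simp_all
    have bc: "b - c = 2 * (s + t + 1)" using s t lt ic ij(5) by simp
    have "Kpi \<pi> c b w = (shift ^^ (s + t + 1)) w" for w
    proof -
      have "Kpi \<pi> c b w = Kpi \<pi> (Suc j) b (Kpi \<pi> c (Suc j) w)" by (rule Kpi_split) (use lt ic ij(5) in auto)
      also have "Kpi \<pi> c (Suc j) w = Qop (\<pi> j) (Kpi \<pi> (Suc c) j (Qop (\<pi> c) w))"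
        using Kpi_cup[of c c j \<pi> w] lt ic by simp
      also have "\<dots> = (shift ^^ s) (shift w)" unfolding K1 \<pi>j funpow_shift_Qop[symmetric] Qop_compl[OF r] ..
      finally show ?thesis unfolding K2 by (simp add: funpow_add funpow_swap1 add.commute[of s t])
    qed
    then show ?thesis using bc by simp
  qed
qed

text \<open>Below a cup there are neither rays nor dots, so its interior is matched by undotted
  cups.\<close>

lemma cup_interior:
  assumes C: "Cup i j \<in> strands a" and below: "labelled_below a j \<pi>"
  obtains r where "j - Suc i = 2 * r" "\<And>w. Kpi \<pi> (Suc i) j w = (shift ^^ r) w"
proof -
  have lt: "i < j" and b: "1 <= i" "j <= m" using diagramD(2)[OF C] diagramD(1)[OF C] by auto
  have "even (j - Suc i) & (\<forall>w. Kpi \<pi> (Suc i) j w = (shift ^^ ((j - Suc i) div 2)) w)"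
  proof (rule closed_undotted_interval[OF _ _ _ below])
    fix e assume e: "Suc i <= e" "e < j"
    then obtain s where s: "s \<in> strands a" "e \<in> ends s" using diagramD(4)[of e] b by auto
    have nd: "s \<notin> dotted a" using diagramD(9)[OF _ s(2) C] e by auto
    show "\<exists>i' j'. Cup i' j' \<in> strands a & Cup i' j' \<notin> dotted a & (e = i' \<or> e = j') & Suc i <= i' & j' < j"
    proof (cases s)
      case (Ray l)
      then show ?thesis using diagramD(6)[OF C, of l] s e by auto
    next
      case (Cup i' j')
      have C': "Cup i' j' \<in> strands a" and e': "e = i' \<or> e = j'" using s Cup by auto
      have ne: "Cup i' j' ~= Cup i j" using e' e by auto
      have n1: "x ~= i'" "x ~= j'" if "x = i \<or> x = j" for x
        using diagramD(3)[OF C C', of x] ne that by auto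
      have n: "i' ~= i" "i' ~= j" "j' ~= j" "j' ~= i" using n1[of i] n1[of j] by auto
      have lt': "i' < j'" using diagramD(2)[OF C'] .
      have "i < i'"
      proof (rule ccontr)
        assume "\<not> i < i'"
        then have "i' < i" using n by simp
        moreover from this have "e = j'" using e' e by auto
        ultimately show False using diagramD(5)[OF C' C] e by auto
      qed
      moreover have "j' < j"
      proof (rule ccontr)
        assume "\<not> j' < j"
        then have "j < j'" using n by simp
        moreover from this have "e = i'" using e' e by auto
        ultimately show False using diagramD(5)[OF C C'] e by auto
      qed
      ultimately show ?thesis using C' nd Cup e' by (intro exI[of _ i'] exI[of _ j']) simp
    qed
  qed (use lt b in auto)
  then show ?thesis using that[of "(j - Suc i) div 2"] by auto
qed

lemma cut_left_end:
  assumes C: "Cup i j \<in> strands a" and cut: "is_cut a m (Suc j)"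
  shows "is_cut a m i"
  unfolding is_cut_def
proof (intro conjI allI impI notI)
  have lt: "i < j" and b: "1 <= i" "j <= m" using diagramD(2)[OF C] diagramD(1)[OF C] by auto
  show "1 <= i" "i <= Suc m" using b lt by auto
  fix u w assume U: "Cup u w \<in> strands a" and uw: "u < i & i <= w"
  have ne: "Cup u w ~= Cup i j" using uw by auto
  have "x ~= w" if "x = i \<or> x = j" for x using diagramD(3)[OF C U, of x] ne that by auto
  then have n: "i ~= w" "j ~= w" by auto
  have "\<not> (u < Suc j & Suc j <= w)" using cut U unfolding is_cut_def by blast
  then have "w < j" using uw lt n by auto
  then show False using diagramD(5)[OF U C] uw n by auto
qed

lemma cut_before_ray:
  assumes R: "Ray l \<in> strands a"
  shows "is_cut a m l" "is_cut a m (Suc l)"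
proof -
  have b: "1 <= l" "l <= m" using diagramD(1)[OF R] by auto
  have "\<not> (u < l & l <= w) & \<not> (u < Suc l & Suc l <= w)" if U: "Cup u w \<in> strands a" for u w
  proof -
    have "u ~= l" "w ~= l" using diagramD(3)[OF R U, of l] by auto
    then show ?thesis using diagramD(6)[OF U R] by auto
  qed
  then show "is_cut a m l" "is_cut a m (Suc l)" unfolding is_cut_def using b by auto
qed

lemma cut_cases:
  assumes "is_cut a m b"
  obtains "b = 1" | l where "b = Suc l" "Ray l \<in> strands a" | i j where "b = Suc j" "Cup i j \<in> strands a"
proof (cases "b = 1")
  case False
  then obtain e where e: "b = Suc e" "1 <= e" "e <= m" using assms unfolding is_cut_def by (cases b) auto
  obtain s where s: "s \<in> strands a" "e \<in> ends s" using diagramD(4)[OF e(2,3)] by blast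
  show ?thesis
  proof (cases s)
    case (Ray l)
    then show ?thesis using that(2)[of l] s e by simp
  next
    case (Cup i j)
    have C: "Cup i j \<in> strands a" using s Cup by simp
    have "e ~= i"
    proof
      assume "e = i"
      then have "i < b & b <= j" using e diagramD(2)[OF C] by auto
      then show False using assms C unfolding is_cut_def by blast
    qed
    then show ?thesis using that(3)[of j i] s e Cup by simp
  qed
qed (rule that(1))

lemma ray_list_ray: "1 <= l ==> Ray l \<in> strands a ==> ray_list a (Suc l) = ray_list a l @ [ray_label a l]"
  by (simp add: ray_list_def)

lemma upt_split: "1 <= i ==> i < j ==> [1..<Suc j] = [1..<i] @ [i..<j] @ [j]"
  using upt_add_eq_append[of 1 i "j - i"] by simp

lemma ray_list_cup:
  assumes C: "Cup i j \<in> strands a"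
  shows "ray_list a (Suc j) = ray_list a i"
proof -
  have lt: "i < j" and b: "1 <= i" "j <= m" using diagramD(2)[OF C] diagramD(1)[OF C] by auto
  have "Ray e \<notin> strands a" if "i <= e" "e <= j" for e
  proof
    assume R: "Ray e \<in> strands a"
    have "e ~= i" "e ~= j" using diagramD(3)[OF R C, of e] by auto
    then show False using diagramD(6)[OF C R] that by auto
  qed
  then have "filter (%i. Ray i \<in> strands a) ([i..<j] @ [j]) = []"
    using lt by (auto simp: filter_empty_conv)
  then show ?thesis unfolding ray_list_def upt_split[OF b(1) lt] by (simp only: filter_append append_Nil2)
qed

lemma dots_ray:
  assumes R: "Ray l \<in> strands a"
  shows "dots a l = 0" "dots a (Suc l) = 0"
proof -
  have "\<not> (\<exists>i. Cup i j \<in> dotted a)" if "j <= l" for j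
  proof
    assume "\<exists>i. Cup i j \<in> dotted a"
    then obtain i where i: "Cup i j \<in> dotted a" ..
    have "j ~= l" using diagramD(3)[OF diagramD(7)[OF i] R, of l] by auto
    then show False using diagramD(8)[OF i, of j l] R that by auto
  qed
  then show "dots a l = 0" "dots a (Suc l) = 0" unfolding dots_def by (auto simp: filter_empty_conv)
qed

lemma dots_cup:
  assumes C: "Cup i j \<in> strands a"
  shows "dots a (Suc j) = (if Cup i j \<in> dotted a then Suc (dots a i) else dots a i)"
proof -
  have lt: "i < j" and b: "1 <= i" "j <= m" using diagramD(2)[OF C] diagramD(1)[OF C] by auto
  have no: "\<not> (\<exists>u. Cup u e \<in> dotted a)" if "i <= e" "e < j" for e
  proof
    assume "\<exists>u. Cup u e \<in> dotted a"
    then obtain u where u: "Cup u e \<in> dotted a" ..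
    have "e ~= i" using diagramD(3)[OF diagramD(7)[OF u] C, of e] diagramD(2)[OF diagramD(7)[OF u]] by auto
    then show False using diagramD(9)[OF u _ C, of e] that by auto
  qed
  have 1: "filter (%j. \<exists>i. Cup i j \<in> dotted a) [i..<j] = []"
    using no by (auto simp: filter_empty_conv)
  have "(\<exists>u. Cup u j \<in> dotted a) \<longleftrightarrow> Cup i j \<in> dotted a"
  proof
    assume "\<exists>u. Cup u j \<in> dotted a"
    then obtain u where u: "Cup u j \<in> dotted a" ..
    then have "Cup u j = Cup i j" using diagramD(3)[OF diagramD(7)[OF u] C, of j] by simp
    then show "Cup i j \<in> dotted a" using u by simp
  qed blast
  then show ?thesis unfolding dots_def upt_split[OF b(1) lt] filter_append 1 by simp
qed

text \<open>The last strand before the cut is split off. An undotted cup gives a shift, which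
  commutes past everything; a dotted cup gives one \<open>Aop\<close>; a ray has no dotted cup on
  its left, so its \<open>Qop\<close> always acts before all \<open>Aop\<close>.\<close>

lemma structure_at_cut:
  assumes "is_cut a m b" "labelled_below a b \<pi>"
  shows "\<exists>s ys. (\<forall>w. Kpi \<pi> 1 b w = fold Aop ys (fold Qop (ray_list a b) ((shift ^^ s) w))) &
    (\<forall>y\<in>set ys. rank_one y) & length ys = dots a b & 2 * s + 2 * length ys + length (ray_list a b) = b - 1"
  using assms
proof (induction b rule: less_induct)
  case (less b)
  from less.prems(1) show ?case
  proof (cases rule: cut_cases)
    case 1
    then show ?thesis by (intro exI[of _ 0] exI[of _ "[]"]) (simp add: ray_list_def dots_def)
  next
    case (2 l)
    have l: "1 <= l" using diagramD(1)[OF 2(2)] by simp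
    have "labelled_below a l \<pi>" using less.prems(2) 2(1) unfolding labelled_below_def by auto
    then obtain s ys where *: "\<And>w. Kpi \<pi> 1 l w = fold Aop ys (fold Qop (ray_list a l) ((shift ^^ s) w))"
      "length ys = dots a l" "2 * s + 2 * length ys + length (ray_list a l) = l - 1"
      using less.IH[of l] 2(1) cut_before_ray(1)[OF 2(2)] by blast
    have ys: "ys = []" using *(2) dots_ray(1)[OF 2(2)] by simp
    have \<pi>l: "\<pi> l = ray_label a l" using less.prems(2) 2 unfolding labelled_below_def by simp
    have "Kpi \<pi> 1 b w = fold Qop (ray_list a b) ((shift ^^ s) w)" for w
      unfolding 2(1) ray_list_ray[OF l 2(2)] Kpi_Suc[OF l] \<pi>l *(1) ys by simp
    moreover have "2 * s + length (ray_list a b) = b - 1"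
      using *(3) l unfolding 2(1) ray_list_ray[OF l 2(2)] ys by simp
    ultimately show ?thesis
      using dots_ray(2)[OF 2(2)] 2(1) by (intro exI[of _ s] exI[of _ "[]"]) simp
  next
    case (3 i j)
    note C = 3(2)
    have lt: "i < j" and b: "1 <= i" "j <= m" using diagramD(2)[OF C] diagramD(1)[OF C] by auto
    have below: "labelled_below a i \<pi>" "labelled_below a j \<pi>"
      using less.prems(2) 3(1) lt unfolding labelled_below_def by auto
    obtain s ys where *: "\<And>w. Kpi \<pi> 1 i w = fold Aop ys (fold Qop (ray_list a i) ((shift ^^ s) w))"
      "\<forall>y\<in>set ys. rank_one y" "length ys = dots a i" "2 * s + 2 * length ys + length (ray_list a i) = i - 1"
      using less.IH[of i] 3(1) lt cut_left_end[OF C] less.prems(1) below(1) by auto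
    obtain r where r: "j - Suc i = 2 * r" "\<And>w. Kpi \<pi> (Suc i) j w = (shift ^^ r) w"
      using cup_interior[OF C below(2)] by blast
    have ro: "rank_one (\<pi> i)" by (rule rank) (use b lt in auto)
    have K: "Kpi \<pi> 1 b w = Qop (\<pi> j) ((shift ^^ r) (Qop (\<pi> i) (Kpi \<pi> 1 i w)))" for w
      unfolding 3(1) Kpi_cup[OF b(1) lt] r(2) ..
    have \<pi>j: "\<pi> j = (if Cup i j \<in> dotted a then \<pi> i else compl_proj (\<pi> i))"
      using less.prems(2) 3 unfolding labelled_below_def by simp
    have j: "b - 1 = i - 1 + 2 * r + 2" using r(1) lt b 3(1) by simp
    show ?thesis
    proof (cases "Cup i j \<in> dotted a")
      case True
      have "Kpi \<pi> 1 b w = fold Aop (ys @ [\<pi> i]) (fold Qop (ray_list a b) ((shift ^^ (r + s)) w))" for w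
      proof -
        have "Kpi \<pi> 1 b w = (shift ^^ r) (Aop (\<pi> i) (Kpi \<pi> 1 i w))"
          unfolding K using \<pi>j True by (simp add: funpow_shift_Qop[symmetric] Qop_Qop[OF ro])
        also have "\<dots> = Aop (\<pi> i) (fold Aop ys (fold Qop (ray_list a i) ((shift ^^ r) ((shift ^^ s) w))))"
          unfolding *(1) by (simp add: funpow_shift_Aop funpow_shift_fold_Aop funpow_shift_fold)
        finally show ?thesis unfolding 3(1) ray_list_cup[OF C] by (simp add: funpow_add)
      qed
      moreover have "\<forall>y\<in>set (ys @ [\<pi> i]). rank_one y" using *(2) ro by simp
      moreover have "length (ys @ [\<pi> i]) = dots a b" using *(3) dots_cup[OF C] True 3(1) by simp
      moreover have "2 * (r + s) + 2 * length (ys @ [\<pi> i]) + length (ray_list a b) = b - 1"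
        unfolding j unfolding 3(1) ray_list_cup[OF C] using *(4) by simp
      ultimately show ?thesis by blast
    next
      case False
      have "Kpi \<pi> 1 b w = fold Aop ys (fold Qop (ray_list a b) ((shift ^^ (Suc (r + s))) w))" for w
      proof -
        have "Kpi \<pi> 1 b w = (shift ^^ r) (shift (Kpi \<pi> 1 i w))"
          unfolding K using \<pi>j False by (simp add: funpow_shift_Qop[symmetric] Qop_compl[OF ro])
        also have "\<dots> = fold Aop ys (fold Qop (ray_list a i) ((shift ^^ r) (shift ((shift ^^ s) w))))"
          unfolding *(1) by (simp add: shift_fold_Aop shift_fold funpow_shift_fold_Aop funpow_shift_fold)
        finally show ?thesis unfolding 3(1) ray_list_cup[OF C] by (simp add: funpow_add funpow_swap1)
      qed
      moreover have "length ys = dots a b" using *(3) dots_cup[OF C] False 3(1) by simp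
      moreover have "2 * (Suc (r + s)) + 2 * length ys + length (ray_list a b) = b - 1"
        unfolding j unfolding 3(1) ray_list_cup[OF C] using *(4) by simp
      ultimately show ?thesis using *(2) by blast
    qed
  qed
qed

lemma card_rays: "card {i. Ray i \<in> strands a} + 2 * card {s \<in> strands a. is_Cup s} = m"
proof -
  have fin: "finite (strands a)" by (rule finite_strands[OF a])
  have "{1..m} = (\<Union>s\<in>strands a. ends s)"
  proof (intro equalityI subsetI)
    fix e assume "e \<in> {1..m}"
    then obtain s where "s \<in> strands a" "e \<in> ends s" using diagramD(4)[of e] by auto
    then show "e \<in> (\<Union>s\<in>strands a. ends s)" by (rule UN_I)
  next
    fix e assume "e \<in> (\<Union>s\<in>strands a. ends s)"
    then obtain s where "s \<in> strands a" "e \<in> ends s" by (rule UN_E)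
    from diagramD(1)[OF this] show "e \<in> {1..m}" by simp
  qed
  then have "m = card (\<Union>s\<in>strands a. ends s)" by (metis card_atLeastAtMost diff_Suc_1)
  also have "\<dots> = (\<Sum>s\<in>strands a. card (ends s))"
  proof (rule card_UN_disjoint[OF fin])
    show "\<forall>s\<in>strands a. finite (ends s)"
    proof
      fix s show "finite (ends s)" by (cases s) simp_all
    qed
    show "\<forall>s\<in>strands a. \<forall>t\<in>strands a. s ~= t --> ends s \<inter> ends t = {}" using diagramD(3) by blast
  qed
  also have "\<dots> = (\<Sum>s\<in>strands a. if is_Cup s then 2 else 1)"
  proof (rule sum.cong[OF refl])
    fix s assume "s \<in> strands a"
    then show "card (ends s) = (if is_Cup s then 2 else 1)"
    proof (cases s)
      case (Cup i j)
      then have "i < j" using diagramD(2) \<open>s \<in> strands a\<close> by simp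
      then show ?thesis using Cup by simp
    qed simp
  qed
  also have "\<dots> = 2 * card {s \<in> strands a. is_Cup s} + card {s \<in> strands a. \<not> is_Cup s}"
    by (simp add: sum.If_cases[OF fin] Int_def conj_commute)
  also have "{s \<in> strands a. \<not> is_Cup s} = Ray ` {i. Ray i \<in> strands a}"
  proof (rule Set.set_eqI)
    fix s show "s \<in> {s \<in> strands a. \<not> is_Cup s} \<longleftrightarrow> s \<in> Ray ` {i. Ray i \<in> strands a}" by (cases s) auto
  qed
  also have "card (Ray ` {i. Ray i \<in> strands a}) = card {i. Ray i \<in> strands a}"
    by (rule card_image) (simp add: inj_on_def)
  finally show ?thesis by simp
qed

lemma length_ray_list: "length (ray_list a (Suc m)) = card {i. Ray i \<in> strands a}"
proof -
  have "length (ray_list a (Suc m)) = card (set (filter (%i. Ray i \<in> strands a) [1..<Suc m]))"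
    unfolding ray_list_def length_map by (rule distinct_card[symmetric]) simp
  also have "set (filter (%i. Ray i \<in> strands a) [1..<Suc m]) = {i. Ray i \<in> strands a}"
  proof (intro equalityI subsetI)
    fix e assume "e \<in> {i. Ray i \<in> strands a}"
    then have "Ray e \<in> strands a" by simp
    then show "e \<in> set (filter (%i. Ray i \<in> strands a) [1..<Suc m])" using diagramD(1)[of "Ray e" e] by (simp del: upt_Suc)
  qed simp
  finally show ?thesis .
qed

text \<open>A ray with another ray to its right is neither dotted nor rightmost, hence carries
  \<open>qmat\<close>.\<close>

lemma ray_list_full:
  assumes "ray_list a (Suc m) ~= []"
  shows "\<exists>t \<sigma>. ray_list a (Suc m) = replicate t qmat @ [pmat \<sigma>] & (\<sigma> = 1 \<or> \<sigma> = - 1)"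
proof -
  let ?l = "filter (%i. Ray i \<in> strands a) [1..<Suc m]"
  have ne: "?l ~= []" using assms unfolding ray_list_def by simp
  have mem: "Ray i \<in> strands a \<longleftrightarrow> i \<in> set ?l" for i using diagramD(1)[of "Ray i" i] by auto
  define l0 z where "l0 = butlast ?l" and "z = last ?l"
  have l: "?l = l0 @ [z]" unfolding l0_def z_def by (rule append_butlast_last_id[OF ne, symmetric])
  have sorted: "sorted_wrt (<) (l0 @ [z])" unfolding l[symmetric] by (rule sorted_wrt_filter[OF sorted_wrt_upt])
  then have lt: "i < z" if "i \<in> set l0" for i using that by (simp add: sorted_wrt_append)
  have "z \<in> set ?l" unfolding l by simp
  then have z: "Ray z \<in> strands a" by (rule mem[THEN iffD2])
  have "ray_label a i = qmat" if i: "i \<in> set l0" for i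
  proof -
    have "Ray i \<notin> dotted a" using diagramD(8)[of "Ray i" i z] z lt[OF i] by auto
    moreover have "\<not> (\<forall>j. Ray j \<in> strands a --> j <= i)"
    proof
      assume "\<forall>j. Ray j \<in> strands a --> j <= i"
      then have "z <= i" using z by blast
      then show False using lt[OF i] by simp
    qed
    ultimately show ?thesis unfolding ray_label_def by (simp only: if_False)
  qed
  then have "map (ray_label a) l0 = replicate (length l0) qmat"
    by (intro replicate_eqI) auto
  moreover have "ray_label a z = pmat 1 \<or> ray_label a z = pmat (-1)"
  proof -
    have "j <= z" if "Ray j \<in> strands a" for j
    proof -
      have "j \<in> set (l0 @ [z])" using that[THEN mem[THEN iffD1]] unfolding l .
      then show ?thesis using lt[of j] by auto
    qed
    then have "\<forall>j. Ray j \<in> strands a --> j <= z" by (intro allI impI)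
    then show ?thesis unfolding ray_label_def by (simp only: if_True split: if_split) simp
  qed
  moreover have "ray_list a (Suc m) = map (ray_label a) l0 @ [ray_label a z]" unfolding ray_list_def l by simp
  ultimately show ?thesis
    by (elim disjE) (rule exI[of _ "length l0"], rule exI[of _ "1"], simp, rule exI[of _ "length l0"], rule exI[of _ "-1"], simp)
qed

end

lemma isotropic_fold_Aop:
  "\<forall>y\<in>set ys. rank_one y ==> isotropic (2 * length ys) (2 * length ys) (form_even (2 * length ys)) (fold Aop ys)"
proof (induction ys)
  case Nil
  then show ?case by (simp add: isotropic_def supported_def form_even_def altsum_def)
next
  case (Cons y ys)
  then show ?case using isotropic_Aop[of "2 * length ys" "fold Aop ys" y] by (simp add: comp_def)
qed

lemma isotropic_even_funpow:
  "isotropic n n (form_even n) K ==> isotropic (n + 2 * s) (n + 2 * s) (form_even (n + 2 * s)) (%w. K ((shift ^^ s) w))"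
proof (induction s)
  case (Suc s)
  then show ?case using isotropic_even_shift[of "n + 2 * s" "%w. K ((shift ^^ s) w)"] by (simp add: funpow_swap1)
qed simp

lemma isotropic_odd_funpow:
  "isotropic r k (form_odd \<epsilon> r k) K ==>
   isotropic (r + 2 * s) (k + 2 * s) (form_odd \<epsilon> (r + 2 * s) (k + 2 * s)) (%w. K ((shift ^^ s) w))"
proof (induction s)
  case (Suc s)
  then show ?case using isotropic_odd_shift[of "r + 2 * s" "k + 2 * s" \<epsilon> "%w. K ((shift ^^ s) w)"] by (simp add: funpow_swap1)
qed simp

lemma isotropic_replicate_qmat:
  "isotropic r k (form_odd \<epsilon> r k) K ==>
   isotropic (r + 2 * t) k (form_odd ((-1) ^ t * \<epsilon>) (r + 2 * t) k) (%w. K (fold Qop (replicate t qmat) w))"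
proof (induction t)
  case (Suc t)
  have *: "fold Qop (replicate n qmat) (Qop qmat w) = Qop qmat (fold Qop (replicate n qmat) w)" for n w
    by (induction n arbitrary: w) simp_all
  show ?case using isotropic_qmat[of "r + 2 * t" k "- ((-1) ^ t * \<epsilon>)"  "%w. K (fold Qop (replicate t qmat) w)"] Suc
    by simp
qed simp

text \<open>The sign is chosen so that after the \<open>m - k\<close> rays labelled by q the
  coefficient has become 1, as \<open>form_odd_pmat\<close> requires. An even \<open>k\<close>
  occurs only together with \<open>k = m\<close>.\<close>

definition springer_form :: "nat => nat => cseq => cseq => complex" where
  "springer_form m k = (if odd k then form_odd ((-1) ^ (m - k)) (2 * m - k) k else form_even m)"

text \<open>There are \<open>m - 2 * (k div 2)\<close> rays: none for even \<open>k\<close>, and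
  \<open>m - k + 1\<close> for odd \<open>k\<close>. Isotropy is built up from the operator applied
  last to the one applied first: all \<open>Aop\<close>, the pole, the q-labels, the shifts.\<close>

lemma labelled_isotropic:
  assumes a: "combinatorial_diagram m a" and c: "card {s \<in> strands a. is_Cup s} = k div 2"
    and k: "1 <= k" "k <= m" "k = m \<or> odd k"
    and r: "\<forall>i. 1 <= i --> i <= m --> rank_one (\<pi> i)" and \<pi>: "labelled_below a (Suc m) \<pi>"
  shows "isotropic (2 * m - k) k (springer_form m k) (Kpi \<pi> 1 (Suc m))"
proof -
  have ct: "is_cut a m (Suc m)"
  proof -
    have "\<not> Suc m <= j" if "Cup i j \<in> strands a" for i j using combinatorial_diagramD(1)[OF a that, of j] by simp
    then show ?thesis unfolding is_cut_def by simp
  qed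
  obtain s ys where S: "(\<forall>w. Kpi \<pi> 1 (Suc m) w = fold Aop ys (fold Qop (ray_list a (Suc m)) ((shift ^^ s) w))) &
    (\<forall>y\<in>set ys. rank_one y) & length ys = dots a (Suc m) & 2 * s + 2 * length ys + length (ray_list a (Suc m)) = Suc m - 1"
    using structure_at_cut[OF a r ct \<pi>] by (elim exE) (rule that)
  have K: "Kpi \<pi> 1 (Suc m) = (%w. fold Aop ys (fold Qop (ray_list a (Suc m)) ((shift ^^ s) w)))"
    by (rule ext) (rule S[THEN conjunct1, THEN spec])
  note * = S[THEN conjunct2, THEN conjunct1]
  have len: "2 * s + 2 * length ys + length (ray_list a (Suc m)) = m"
    using S[THEN conjunct2, THEN conjunct2, THEN conjunct2] by simp
  have rays: "length (ray_list a (Suc m)) + 2 * (k div 2) = m"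
    using card_rays[OF a r] length_ray_list[OF a r] c by simp
  note A = isotropic_fold_Aop[OF *]
  show ?thesis
  proof (cases "odd k")
    case False
    have "k = m" using k(3) False by blast
    have "2 * (k div 2) = k" using False by (intro even_two_times_div_two) simp
    then have "length (ray_list a (Suc m)) = 0" using rays \<open>k = m\<close> by linarith
    then have "ray_list a (Suc m) = []" "2 * length ys + 2 * s = m" using len by simp_all
    then show ?thesis
      using isotropic_even_funpow[OF A, of s] False \<open>k = m\<close>
      unfolding springer_form_def K by simp
  next
    case True
    then have k2: "2 * (k div 2) + 1 = k" by (metis odd_two_times_div_two_succ)
    then have "length (ray_list a (Suc m)) ~= 0" using rays k(1,2) by linarith
    then have ne: "ray_list a (Suc m) ~= []" by simp
    obtain t \<sigma> where t: "ray_list a (Suc m) = replicate t qmat @ [pmat \<sigma>]" "\<sigma> = 1 \<or> \<sigma> = - 1"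
      using ray_list_full[OF a r ne] by (elim exE conjE) (rule that)
    have \<sigma>: "\<sigma> * \<sigma> = 1" using t(2) by auto
    define n where "n = 2 * length ys"
    have tm: "t = m - k" using rays t(1) k2 by simp
    have nk: "Suc n + 2 * s = k" using len rays t(1) k2 n_def by simp
    have nr: "Suc n + 2 * t + 2 * s = 2 * m - k" using nk tm k by simp
    have "isotropic (Suc n + 2 * t) (Suc n) (form_odd ((-1) ^ t * 1) (Suc n + 2 * t) (Suc n))
        (%w. fold Aop ys (Qop (pmat \<sigma>) (fold Qop (replicate t qmat) w)))"
      by (rule isotropic_replicate_qmat[OF isotropic_pmat[OF A \<sigma>, folded n_def]])
    from isotropic_odd_funpow[OF this, of s]
    have "isotropic (2 * m - k) k (form_odd ((-1) ^ t) (2 * m - k) k)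
        (%w. fold Aop ys (Qop (pmat \<sigma>) (fold Qop (replicate t qmat) ((shift ^^ s) w))))"
      unfolding nk nr mult_1_right .
    moreover have "Kpi \<pi> 1 (Suc m) = (%w. fold Aop ys (Qop (pmat \<sigma>) (fold Qop (replicate t qmat) ((shift ^^ s) w))))"
      unfolding K t(1) by simp
    ultimately show ?thesis using True tm unfolding springer_form_def by simp
  qed
qed

section \<open>Normal form of the nilpotent endomorphism\<close>

lemma independent_family:
  fixes g :: "nat => complex ^ 'n"
  assumes ind: "\<And>c. (\<Sum>j<n. c j *s g j) = 0 ==> \<forall>j<n. c j = 0"
  shows "inj_on g {..<n}" "vec.independent (g ` {..<n})"
proof -
  show inj: "inj_on g {..<n}"
  proof (rule inj_onI)
    fix i j assume ij: "i \<in> {..<n}" "j \<in> {..<n}" "g i = g j"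
    show "i = j"
    proof (rule ccontr)
      assume ne: "i ~= j"
      let ?c = "%l. if l = i then 1 else if l = j then -1 else (0 :: complex)"
      have "(\<Sum>l<n. ?c l *s g l) = (\<Sum>l\<in>{i, j}. ?c l *s g l)"
        by (rule sum.mono_neutral_right) (use ij in auto)
      also have "\<dots> = 0" using ne ij(3) by simp
      finally have "?c i = 0" using ind[of ?c] ij(1) by blast
      then show False by simp
    qed
  qed
  show "vec.independent (g ` {..<n})"
  proof
    assume "vec.dependent (g ` {..<n})"
    then obtain u where u: "(\<Sum>w\<in>g ` {..<n}. u w *s w) = 0" "\<exists>w\<in>g ` {..<n}. u w ~= 0"
      unfolding vec.dependent_finite[OF finite_imageI[OF finite_lessThan]] by blast
    have "(\<Sum>j<n. u (g j) *s g j) = 0" using u(1) by (simp add: sum.reindex[OF inj])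
    then have "\<forall>j<n. u (g j) = 0" by (rule ind[of "%j. u (g j)"])
    then show False using u(2) by auto
  qed
qed

lemma spanning_family:
  fixes g :: "nat => complex ^ 'n"
  assumes n: "n = CARD('n)" and ind: "\<And>c. (\<Sum>j<n. c j *s g j) = 0 ==> \<forall>j<n. c j = 0"
  shows "\<exists>c. v = (\<Sum>j<n. c j *s g j)"
proof -
  have inj: "inj_on g {..<n}" by (rule independent_family(1)[OF ind])
  have card: "card (g ` {..<n}) = n" using card_image[OF inj] by simp
  have "vec.independent (g ` {..<n})" by (rule independent_family(2)[OF ind])
  moreover have "vec.dim (UNIV :: (complex ^ 'n) set) <= card (g ` {..<n})"
    unfolding card by (simp add: n vec.dim_UNIV vec.dimension_def card_cart_basis)
  ultimately have "UNIV \<subseteq> vec.span (g ` {..<n})"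
    by (intro vec.card_ge_dim_independent) simp_all
  then have "v \<in> vec.span (g ` {..<n})" by blast
  then have "v \<in> range (%u. \<Sum>w\<in>g ` {..<n}. u w *s w)"
    by (simp only: vec.span_finite[OF finite_imageI[OF finite_lessThan]])
  then obtain u where "v = (\<Sum>w\<in>g ` {..<n}. u w *s w)" by blast
  then have "v = (\<Sum>j<n. u (g j) *s g j)" by (simp add: sum.reindex[OF inj])
  then show ?thesis by (rule exI[of _ "%j. u (g j)"])
qed

context skew_form
begin

lemma form_sub: "\<beta> (u - v) w = \<beta> u w - \<beta> v w" "\<beta> w (u - v) = \<beta> w u - \<beta> w v"
proof -
  have m: "u - v = u + (-1) *s v" by (simp add: Finite_Cartesian_Product.vec_eq_iff)
  show "\<beta> (u - v) w = \<beta> u w - \<beta> v w" "\<beta> w (u - v) = \<beta> w u - \<beta> w v"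
    unfolding m form_add form_scale by simp_all
qed

text \<open>Coordinates are read off by pairing the powers \<open>x ^^ i\<close> of a vector with
  two dual vectors. In the odd case these are the block generators themselves; in the even case each
  block is read off by the generator of the other.\<close>

definition coords :: "complex => complex ^ 'n => complex => complex ^ 'n => complex ^ 'n => cseq" where
  "coords c1 d1 c2 d2 v = (%i. vector [c1 * \<beta> ((x ^^ i) v) d1, c2 * \<beta> ((x ^^ i) v) d2])"

definition realize :: "nat => nat => complex ^ 'n => complex ^ 'n => cseq => complex ^ 'n" where
  "realize r k E F w = (\<Sum>i<r. w i $ 1 *s (x ^^ (r - 1 - i)) E) + (\<Sum>i<k. w i $ 2 *s (x ^^ (k - 1 - i)) F)"

lemma coords_nth:
  "coords c1 d1 c2 d2 v i $ 1 = c1 * \<beta> ((x ^^ i) v) d1" "coords c1 d1 c2 d2 v i $ 2 = c2 * \<beta> ((x ^^ i) v) d2"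
  by (simp_all add: coords_def vector_2)

lemma coords_linear: "coords c1 d1 c2 d2 (\<alpha> *s v + w) i = \<alpha> *s coords c1 d1 c2 d2 v i + coords c1 d1 c2 d2 w i"
  by (simp add: vec2_eq_iff coords_nth pow_add pow_scale form_add form_scale algebra_simps)

lemma coords_x: "coords c1 d1 c2 d2 (x v) = shift (coords c1 d1 c2 d2 v)"
  by (simp add: fun_eq_iff vec2_eq_iff coords_nth shift_def funpow_swap1)

text \<open>The relations \<open>G\<close> say that \<open>d1\<close>, \<open>d2\<close> are dual to
  \<open>E\<close>, \<open>F\<close>, which makes \<open>coords\<close> a left inverse of
  \<open>realize\<close> on supported sequences. The \<open>r + k\<close> vectors are then
  independent, span by dimension, and the other inverse follows.\<close>

lemma coords_realize:
  assumes rk: "r + k = CARD('n)" and d: "(x ^^ r) d1 = 0" "(x ^^ k) d2 = 0" "(x ^^ r) E = 0" "(x ^^ k) F = 0"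
    and G: "\<And>i. c1 * \<beta> ((x ^^ i) E) d1 = (if Suc i = r then 1 else 0)" "\<And>i. c1 * \<beta> ((x ^^ i) F) d1 = 0"
      "\<And>i. c2 * \<beta> ((x ^^ i) F) d2 = (if Suc i = k then 1 else 0)" "\<And>i. c2 * \<beta> ((x ^^ i) E) d2 = 0"
  shows "supported r k (coords c1 d1 c2 d2 v)"
    and "supported r k w ==> coords c1 d1 c2 d2 (realize r k E F w) = w"
    and "realize r k E F (coords c1 d1 c2 d2 v) = v"
proof -
  have z1: "\<beta> ((x ^^ i) v) d1 = 0" if "r <= i" for i v
    using pow_skew[of i v d1] pow_vanish[OF d(1) that] by simp
  have z2: "\<beta> ((x ^^ i) v) d2 = 0" if "k <= i" for i v
    using pow_skew[of i v d2] pow_vanish[OF d(2) that] by simp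
  show sup: "supported r k (coords c1 d1 c2 d2 v)" for v
    by (simp add: supported_def coords_nth z1 z2)
  have c1: "c1 * \<beta> ((x ^^ j) (realize r k E F w)) d1 = (if j < r then w j $ 1 else 0)" for j w
  proof -
    have "c1 * \<beta> ((x ^^ j) (realize r k E F w)) d1 = (\<Sum>i<r. w i $ 1 * (c1 * \<beta> ((x ^^ (j + (r - 1 - i))) E) d1)) +
        (\<Sum>i<k. w i $ 2 * (c1 * \<beta> ((x ^^ (j + (k - 1 - i))) F) d1))"
      by (simp add: realize_def pow_add pow_sum pow_scale pow_pow form_add form_sum form_scale
          distrib_left sum_distrib_left mult_ac)
    also have "\<dots> = (\<Sum>i<r. w i $ 1 * (if Suc (j + (r - 1 - i)) = r then 1 else 0))"
      unfolding G by simp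
    also have "\<dots> = (\<Sum>i<r. if i = j then w i $ 1 else 0)"
      by (rule sum.cong) auto
    also have "\<dots> = (if j < r then w j $ 1 else 0)" by simp
    finally show ?thesis .
  qed
  have c2: "c2 * \<beta> ((x ^^ j) (realize r k E F w)) d2 = (if j < k then w j $ 2 else 0)" for j w
  proof -
    have "c2 * \<beta> ((x ^^ j) (realize r k E F w)) d2 = (\<Sum>i<r. w i $ 1 * (c2 * \<beta> ((x ^^ (j + (r - 1 - i))) E) d2)) +
        (\<Sum>i<k. w i $ 2 * (c2 * \<beta> ((x ^^ (j + (k - 1 - i))) F) d2))"
      by (simp add: realize_def pow_add pow_sum pow_scale pow_pow form_add form_sum form_scale
          distrib_left sum_distrib_left mult_ac)
    also have "\<dots> = (\<Sum>i<k. w i $ 2 * (if Suc (j + (k - 1 - i)) = k then 1 else 0))"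
      unfolding G by simp
    also have "\<dots> = (\<Sum>i<k. if i = j then w i $ 2 else 0)"
      by (rule sum.cong) auto
    also have "\<dots> = (if j < k then w j $ 2 else 0)" by simp
    finally show ?thesis .
  qed
  show inv: "coords c1 d1 c2 d2 (realize r k E F w) = w" if "supported r k w" for w
    using that by (auto simp: fun_eq_iff vec2_eq_iff coords_nth c1 c2 supported_def)
  define g where "g j = (if j < r then (x ^^ (r - 1 - j)) E else (x ^^ (k - 1 - (j - r))) F)" for j
  have gs: "(\<Sum>j<r + k. c j *s g j) = realize r k E F (%i. vector [c i, c (r + i)])" for c
  proof -
    have "(\<Sum>j<r + k. c j *s g j) = (\<Sum>j<r. c j *s g j) + (\<Sum>j<k. c (r + j) *s g (r + j))"
      by (induction k) (simp_all add: add.assoc)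
    also have "\<dots> = realize r k E F (%i. vector [c i, c (r + i)])"
      unfolding realize_def by (intro arg_cong2[of _ _ _ _ "(+)"] sum.cong) (simp_all add: g_def vector_2)
    finally show ?thesis .
  qed
  have "\<forall>j<r + k. c j = 0" if "(\<Sum>j<r + k. c j *s g j) = 0" for c
  proof (intro allI impI)
    fix j assume j: "j < r + k"
    have 0: "realize r k E F (%i. vector [c i, c (r + i)]) = 0" using that by (simp add: gs)
    show "c j = 0"
    proof (cases "j < r")
      case True
      then show ?thesis using c1[of j "%i. vector [c i, c (r + i)]"] unfolding 0 by (simp add: vector_2)
    next
      case False
      then have "j - r < k" "r + (j - r) = j" using j by simp_all
      then show ?thesis using c2[of "j - r" "%i. vector [c i, c (r + i)]"] unfolding 0 by (simp add: vector_2)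
    qed
  qed
  from spanning_family[OF rk this, where v = v] obtain c where "v = (\<Sum>j<r + k. c j *s g j)" by (rule exE)
  then have v: "v = realize r k E F (%i. vector [c i, c (r + i)])" by (simp only: gs)
  \<comment> \<open>Entries beyond the block sizes do not enter \<open>realize\<close>, so the
    coefficient sequence may be cut down to a supported one, to which the first inverse
    applies.\<close>
  have trunc: "realize r k E F w = realize r k E F (%i. vector [if i < r then w i $ 1 else 0, if i < k then w i $ 2 else 0])" for w
    unfolding realize_def by (intro arg_cong2[of _ _ _ _ "(+)"] sum.cong) (simp_all add: vector_2)
  let ?w = "%i. vector [c i, c (r + i)] :: complex ^ 2"
  have "supported r k (%i. vector [if i < r then ?w i $ 1 else 0, if i < k then ?w i $ 2 else 0])"
    by (simp add: supported_def vector_2)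
  from inv[OF this] show "realize r k E F (coords c1 d1 c2 d2 v) = v"
    unfolding v[unfolded trunc[of ?w], symmetric] by (simp only: v[unfolded trunc[of ?w], symmetric])
qed

text \<open>The generator is corrected by its own images under powers of \<open>x\<close>, that is
  \<open>correct'\<close> with \<open>u\<close> and \<open>g\<close> both equal to
  \<open>e0\<close>, and then rescaled by a square root. All corrections stay in the stable subspace
  \<open>W\<close>.\<close>

lemma normalize:
  assumes inv: "\<And>v. v \<in> W ==> x v \<in> W" and sub: "vec.subspace W"
    and e0: "e0 \<in> W" "(x ^^ Suc N) e0 = 0" "\<beta> ((x ^^ N) e0) e0 ~= 0" and \<epsilon>: "\<epsilon> ~= 0"
  obtains e where "e \<in> W" "(x ^^ Suc N) e = 0" "\<And>i. \<beta> ((x ^^ i) e) e = (if i = N then \<epsilon> else 0)"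
proof -
  obtain c where c: "\<And>i. i < N ==> \<beta> ((x ^^ i) (e0 + (\<Sum>j=1..N. c j *s (x ^^ j) e0))) (e0 + (\<Sum>j=1..N. c j *s (x ^^ j) e0)) = 0"
    "\<beta> ((x ^^ N) (e0 + (\<Sum>j=1..N. c j *s (x ^^ j) e0))) (e0 + (\<Sum>j=1..N. c j *s (x ^^ j) e0)) = \<beta> ((x ^^ N) e0) e0"
    using correct'[OF e0(2) e0(2,3)] by blast
  define e1 where "e1 = e0 + (\<Sum>j=1..N. c j *s (x ^^ j) e0)"
  define s where "s = csqrt (\<epsilon> / \<beta> ((x ^^ N) e0) e0)"
  have s: "s * s = \<epsilon> / \<beta> ((x ^^ N) e0) e0" by (simp add: s_def power2_eq_square[symmetric])
  have xW: "(x ^^ j) e0 \<in> W" for j by (induction j) (simp_all add: e0(1) inv)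
  have e1W: "e1 \<in> W"
    unfolding e1_def by (intro vec.subspace_add[OF sub] e0(1) vec.subspace_sum[OF sub] vec.subspace_scale[OF sub] xW)
  have e1v: "(x ^^ i) e1 = 0" if "N < i" for i
  proof -
    have "(x ^^ (i + j)) e0 = 0" for j by (rule pow_vanish[OF e0(2)]) (use that in simp)
    then show ?thesis unfolding e1_def pow_add pow_sum pow_scale pow_pow
      using pow_vanish[OF e0(2), of i] that by simp
  qed
  show ?thesis
  proof (rule that[of "s *s e1"])
    show "s *s e1 \<in> W" by (rule vec.subspace_scale[OF sub e1W])
    show "(x ^^ Suc N) (s *s e1) = 0" unfolding pow_scale e1v[OF lessI] by simp
    fix i
    have "\<beta> ((x ^^ i) (s *s e1)) (s *s e1) = (s * s) * \<beta> ((x ^^ i) e1) e1"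
      unfolding pow_scale form_scale by simp
    moreover consider "i < N" | "i = N" | "N < i" by linarith
    then have "(s * s) * \<beta> ((x ^^ i) e1) e1 = (if i = N then \<epsilon> else 0)"
    proof cases
      case 1
      then show ?thesis using c(1)[OF 1] unfolding e1_def[symmetric] by simp
    next
      case 2
      then show ?thesis using c(2) e0(3) unfolding e1_def[symmetric] s by simp
    next
      case 3
      then show ?thesis using e1v[OF 3] by simp
    qed
    ultimately show "\<beta> ((x ^^ i) (s *s e1)) (s *s e1) = (if i = N then \<epsilon> else 0)" by simp
  qed
qed

text \<open>The clause that writes \<rho> as an explicit linear combination is the source of
  continuity and of polynomial dependence for the frames built from it.\<close>

definition model :: "nat => nat => (cseq => cseq => complex) => (complex ^ 'n => cseq) => (cseq => complex ^ 'n) => bool" where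
  "model r k B \<iota> \<rho> \<longleftrightarrow>
     (\<forall>\<alpha> v w i. \<iota> (\<alpha> *s v + w) i = \<alpha> *s \<iota> v i + \<iota> w i) & (\<forall>v. \<iota> (x v) = shift (\<iota> v)) &
     (\<forall>v. supported r k (\<iota> v)) & (\<forall>w. supported r k w --> \<iota> (\<rho> w) = w) & (\<forall>v. \<rho> (\<iota> v) = v) &
     (\<exists>E F. \<forall>w. \<rho> w = (\<Sum>i<r. w i $ 1 *s E i) + (\<Sum>i<k. w i $ 2 *s F i)) &
     (\<forall>v w. \<beta> v w = B (\<iota> v) (\<iota> w))"

lemma modelI:
  assumes rk: "r + k = CARD('n)" and d: "(x ^^ r) d1 = 0" "(x ^^ k) d2 = 0" "(x ^^ r) E = 0" "(x ^^ k) F = 0"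
    and G: "\<And>i. c1 * \<beta> ((x ^^ i) E) d1 = (if Suc i = r then 1 else 0)" "\<And>i. c1 * \<beta> ((x ^^ i) F) d1 = 0"
      "\<And>i. c2 * \<beta> ((x ^^ i) F) d2 = (if Suc i = k then 1 else 0)" "\<And>i. c2 * \<beta> ((x ^^ i) E) d2 = 0"
    and B: "\<And>v w. (\<Sum>i<r. coords c1 d1 c2 d2 v i $ 1 * \<beta> ((x ^^ (r - 1 - i)) E) w) +
        (\<Sum>i<k. coords c1 d1 c2 d2 v i $ 2 * \<beta> ((x ^^ (k - 1 - i)) F) w) = B (coords c1 d1 c2 d2 w) (coords c1 d1 c2 d2 v)"
  shows "model r k B (coords c1 d1 c2 d2) (realize r k E F)"
proof -
  note cr = coords_realize[OF rk d G]
  have "\<beta> v w = B (coords c1 d1 c2 d2 v) (coords c1 d1 c2 d2 w)" for v w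
  proof -
    have "\<beta> v w = \<beta> (realize r k E F (coords c1 d1 c2 d2 w)) v" unfolding cr(3) by (rule form_sym)
    also have "\<dots> = B (coords c1 d1 c2 d2 v) (coords c1 d1 c2 d2 w)"
      unfolding B[of w v, symmetric] realize_def by (simp add: form_add form_sum form_scale)
    finally show ?thesis .
  qed
  moreover have "\<exists>E' F'. \<forall>w. realize r k E F w = (\<Sum>i<r. w i $ 1 *s E' i) + (\<Sum>i<k. w i $ 2 *s F' i)"
    unfolding realize_def by (intro exI[of _ "%i. (x ^^ (r - 1 - i)) E"] exI[of _ "%i. (x ^^ (k - 1 - i)) F"]) simp
  ultimately show ?thesis
    unfolding model_def using coords_linear coords_x cr by simp
qed

end

context skew_form
begin

lemma jordan_basis:
  assumes J: "nilpotent_two_blocks x r k" and kr: "k <= r"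
  obtains b where "inj_on b {..<r + k}" "vec.independent (b ` {..<r + k})"
    "\<And>v. \<exists>c. v = (\<Sum>j<r + k. c j *s b j)"
    "\<And>i j. i < r ==> (x ^^ j) (b i) = (if j <= i then b (i - j) else 0)"
    "\<And>i j. i < k ==> (x ^^ j) (b (r + i)) = (if j <= i then b (r + i - j) else 0)"
proof -
  obtain b where b: "inj_on b {..<r + k}" "vec.independent (b ` {..<r + k})" "vec.span (b ` {..<r + k}) = UNIV"
    "\<And>i. i < r + k ==> x (b i) = (if i = 0 \<or> i = r then 0 else b (i - 1))"
    using J unfolding nilpotent_two_blocks_def by blast
  have x0: "x 0 = 0" using pow_zero[of 1] by simp
  have ex: "\<exists>c. v = (\<Sum>j<r + k. c j *s b j)" for v
  proof -
    have "v \<in> vec.span (b ` {..<r + k})" unfolding b(3) ..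
    then have "v \<in> range (%u. \<Sum>w\<in>b ` {..<r + k}. u w *s w)"
      by (simp only: vec.span_finite[OF finite_imageI[OF finite_lessThan]])
    then obtain u where "v = (\<Sum>w\<in>b ` {..<r + k}. u w *s w)" by blast
    then have "v = (\<Sum>j<r + k. u (b j) *s b j)" by (simp add: sum.reindex[OF b(1)])
    then show ?thesis by (rule exI[of _ "%j. u (b j)"])
  qed
  have 1: "(x ^^ j) (b i) = (if j <= i then b (i - j) else 0)" if "i < r" for i j
  proof (induction j)
    case (Suc j)
    show ?case
    proof (cases "j <= i")
      case True
      then have "(x ^^ Suc j) (b i) = x (b (i - j))" using Suc by simp
      also have "\<dots> = (if Suc j <= i then b (i - Suc j) else 0)"
        using b(4)[of "i - j"] that True by auto
      finally show ?thesis .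
    qed (use Suc x0 in simp)
  qed simp
  have 2: "(x ^^ j) (b (r + i)) = (if j <= i then b (r + i - j) else 0)" if "i < k" for i j
  proof (induction j)
    case (Suc j)
    show ?case
    proof (cases "j <= i")
      case True
      then have "(x ^^ Suc j) (b (r + i)) = x (b (r + i - j))" using Suc by simp
      also have "\<dots> = (if Suc j <= i then b (r + i - Suc j) else 0)"
        using b(4)[of "r + i - j"] that True kr by auto
      finally show ?thesis .
    qed (use Suc x0 in simp)
  qed simp
  show ?thesis by (rule that[OF b(1,2) ex 1 2])
qed

text \<open>For even \<open>N\<close> the pairing of \<open>(x ^^ N) v\<close> with \<open>w\<close>
  is symmetric in \<open>v\<close> and \<open>w\<close>, so polarization finds a vector whose square
  is nonzero.\<close>

lemma even_form_nonzero:
  assumes sub: "vec.subspace W" and N: "even N" and v: "v \<in> W" and w: "w \<in> W" "\<beta> ((x ^^ N) v) w ~= 0"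
  obtains e where "e \<in> W" "\<beta> ((x ^^ N) e) e ~= 0"
proof -
  have eq: "\<beta> ((x ^^ N) (v + w)) (v + w) = \<beta> ((x ^^ N) v) v + \<beta> ((x ^^ N) w) w + 2 * \<beta> ((x ^^ N) v) w"
    using pow_form_sym[of N w v] N by (simp add: pow_add form_add)
  consider "\<beta> ((x ^^ N) v) v ~= 0" | "\<beta> ((x ^^ N) w) w ~= 0" | "\<beta> ((x ^^ N) (v + w)) (v + w) ~= 0"
    using w(2) unfolding eq by fastforce
  then show ?thesis
  proof cases
    case 3
    then show ?thesis using vec.subspace_add[OF sub v w(1)] that by blast
  qed (use that v w in blast)+
qed

lemma sign_even_diff: "even N ==> i <= N ==> (-1 :: complex) ^ (N - i) = (-1) ^ i"
  by (simp add: minus_one_power_iff)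

text \<open>A generator \<open>e\<close> of a block of length \<open>r\<close> is normalized and its
  orthogonal complement \<open>W\<close> is stable under \<open>x\<close>. Comparison with the
  Jordan basis shows that \<open>x ^^ k\<close> kills \<open>W\<close> while
  \<open>x ^^ (k - 1)\<close> does not, so \<open>W\<close> contains a generator for the second
  block.\<close>

lemma model_exists_odd:
  assumes J: "nilpotent_two_blocks x r k" and rk: "r + k = CARD('n)" and k: "1 <= k" "k <= r" "odd k" "odd r"
    and \<epsilon>: "\<epsilon> * \<epsilon> = 1"
  shows "\<exists>\<iota> \<rho>. model r k (form_odd \<epsilon> r k) \<iota> \<rho>"
proof -
  obtain b where b: "inj_on b {..<r + k}" "vec.independent (b ` {..<r + k})"
    "\<And>v. \<exists>c. v = (\<Sum>j<r + k. c j *s b j)"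
    "\<And>i j. i < r ==> (x ^^ j) (b i) = (if j <= i then b (i - j) else 0)"
    "\<And>i j. i < k ==> (x ^^ j) (b (r + i)) = (if j <= i then b (r + i - j) else 0)"
    using jordan_basis[OF J k(2)] by blast
  have powb: "(x ^^ j) v = (\<Sum>l<r + k. c l *s (x ^^ j) (b l))" if "v = (\<Sum>l<r + k. c l *s b l)" for v c j
    unfolding that by (simp add: pow_sum pow_scale)
  have bnz: "b i ~= 0" if "i < r + k" for i
    using b(2) that vec.dependent_zero by (metis imageI lessThan_iff)
  have rN: "Suc (r - 1) = r" and kN: "Suc (k - 1) = k" and ev: "even (r - 1)" "even (k - 1)" using k by auto
  have bcase: "P l" if "\<And>i. i < r ==> P i" "\<And>i. i < k ==> P (r + i)" "l < r + k" for P l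
  proof (cases "l < r")
    case False
    then have "P (r + (l - r))" using that(3) by (intro that(2)) simp
    then show ?thesis using False by simp
  qed (rule that(1))
  have xr: "(x ^^ r) v = 0" for v
  proof -
    obtain c where c: "v = (\<Sum>j<r + k. c j *s b j)" using b(3) by blast
    have "(x ^^ r) (b l) = 0" if "l < r + k" for l
      using that by (rule bcase[rotated 2]) (use b(4,5) k(2) in auto)
    then show ?thesis unfolding powb[OF c] by (intro sum.neutral) simp
  qed
  have img: "(x ^^ k) v \<in> vec.span (b ` {..<r - k})" for v
  proof -
    obtain c where c: "v = (\<Sum>j<r + k. c j *s b j)" using b(3) by blast
    have "(x ^^ k) (b l) \<in> vec.span (b ` {..<r - k})" if "l < r + k" for l
    proof (rule bcase[OF _ _ that])
      show "(x ^^ k) (b i) \<in> vec.span (b ` {..<r - k})" if "i < r" for i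
        using b(4)[OF that, of k] that by (auto intro: vec.span_base vec.span_zero)
      show "(x ^^ k) (b (r + i)) \<in> vec.span (b ` {..<r - k})" if "i < k" for i
        using b(5)[OF that, of k] that by (auto intro: vec.span_zero)
    qed
    then show ?thesis unfolding powb[OF c] by (intro vec.span_sum vec.span_scale) simp
  qed
  have "(x ^^ (r - 1)) (b (r - 1)) = b 0" using b(4)[of "r - 1" "r - 1"] k by simp
  then have "(x ^^ (r - 1)) (b (r - 1)) ~= 0" using bnz[of 0] k by simp
  then obtain w where "\<beta> ((x ^^ (r - 1)) (b (r - 1))) w ~= 0" using nondegenerate by blast
  then obtain e0 where e0: "\<beta> ((x ^^ (r - 1)) e0) e0 ~= 0"
    using even_form_nonzero[OF vec.subspace_UNIV ev(1)] by blast
  have \<epsilon>0: "\<epsilon> ~= 0" using \<epsilon> by auto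
  obtain e where e: "(x ^^ r) e = 0" "\<And>i. \<beta> ((x ^^ i) e) e = (if i = r - 1 then \<epsilon> else 0)"
    using normalize[of UNIV e0 "r - 1" \<epsilon>, OF _ vec.subspace_UNIV _ _ e0 \<epsilon>0] xr unfolding rN by auto
  define W where "W = {v. \<forall>j. \<beta> ((x ^^ j) v) e = 0}"
  have subW: "vec.subspace W"
    unfolding W_def vec.subspace_def by (auto simp: pow_add pow_scale form_add form_scale)
  have xW: "x v \<in> W" if "v \<in> W" for v
  proof -
    have "\<beta> ((x ^^ Suc j) v) e = 0" for j using that unfolding W_def by blast
    then show ?thesis unfolding W_def by (simp add: funpow_swap1)
  qed
  have powW: "(x ^^ j) v \<in> W" if "v \<in> W" for v j by (induction j) (simp_all add: that xW)
  \<comment> \<open>The orthogonal projection onto the block of \<open>e\<close>; the factor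
    \<epsilon> inverts the Gram value, since \<epsilon> is its own inverse.\<close>
  define pr where "pr v = (\<Sum>i<r. (\<epsilon> * \<beta> ((x ^^ i) v) e) *s (x ^^ (r - 1 - i)) e)" for v
  have pr: "v - pr v \<in> W" for v
  proof -
    have "\<beta> ((x ^^ j) (pr v)) e = \<beta> ((x ^^ j) v) e" for j
    proof -
      have "\<beta> ((x ^^ j) (pr v)) e = (\<Sum>i<r. \<epsilon> * \<beta> ((x ^^ i) v) e * \<beta> ((x ^^ (j + (r - 1 - i))) e) e)"
        unfolding pr_def by (simp add: pow_sum pow_scale pow_pow form_sum form_scale)
      also have "\<dots> = (\<Sum>i<r. if i = j then (\<epsilon> * \<epsilon>) * \<beta> ((x ^^ i) v) e else 0)"
        unfolding e(2) by (rule sum.cong) auto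
      also have "\<dots> = (if j < r then \<beta> ((x ^^ j) v) e else 0)" unfolding \<epsilon> by simp
      also have "\<dots> = \<beta> ((x ^^ j) v) e" using pow_vanish[OF xr, of j v] by auto
      finally show ?thesis .
    qed
    moreover have "(x ^^ j) (v - pr v) = (x ^^ j) v - (x ^^ j) (pr v)" for j
    proof -
      have e: "v - w = v + (-1) *s w" for v w :: "complex ^ 'n"
        by (simp add: Finite_Cartesian_Product.vec_eq_iff)
      show ?thesis unfolding e pow_add pow_scale ..
    qed
    ultimately show ?thesis unfolding W_def by (simp add: form_sub)
  qed
  let ?g = "%j. (x ^^ j) e"
  have WS: "\<beta> w u = 0" if "w \<in> W" "u \<in> vec.span (?g ` A)" for w u A
    using that(2)
  proof (rule vec.span_induct)
    show "vec.subspace {u. \<beta> w u = 0}" unfolding vec.subspace_def by (auto simp: form_add form_scale)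
    fix u assume "u \<in> ?g ` A"
    then obtain j where "u = ?g j" by blast
    then have "\<beta> u w = (-1) ^ j * \<beta> ((x ^^ j) w) e" using pow_form_sym[of j e w] by simp
    then show "\<beta> w u = 0" using that(1) form_sym[of w u] unfolding W_def by simp
  qed
  have prS: "(x ^^ l) (pr v) \<in> vec.span (?g ` {l..<r})" for v l
  proof -
    have "(x ^^ (l + j)) e \<in> vec.span (?g ` {l..<r})" for j
      using pow_vanish[OF e(1), of "l + j"] by (cases "l + j < r") (auto intro: vec.span_base vec.span_zero)
    then show ?thesis unfolding pr_def pow_sum pow_scale pow_pow by (intro vec.span_sum vec.span_scale)
  qed
  have disj: "w = 0" if "w \<in> W" "w \<in> vec.span (?g ` A)" for w A
  proof (rule nondegenerate)
    fix u
    have "\<beta> w u = \<beta> w (u - pr u) + \<beta> w (pr u)" by (simp add: form_sub)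
    moreover have "\<beta> w (pr u) = 0" using WS[OF that(1), of "pr u" "{0..<r}"] prS[of 0 u] by simp
    moreover have "\<beta> w (u - pr u) = 0" using WS[OF pr that(2), of u] form_sym[of w "u - pr u"] by simp
    ultimately show "\<beta> w u = 0" by simp
  qed
  \<comment> \<open>The \<open>r - k\<close> vectors \<open>(x ^^ (k + l)) e\<close> are independent
    and lie in the span of \<open>r - k\<close> Jordan vectors, so they span it. Hence the image of
    \<open>x ^^ k\<close> lies in the block of \<open>e\<close>, which meets \<open>W\<close> only
    in 0.\<close>
  have sub1: "vec.span (b ` {..<r - k}) \<subseteq> vec.span (?g ` {k..<r})"
  proof -
    let ?h = "%l. ?g (k + l)"
    have ind: "\<forall>j<r - k. c j = 0" if "(\<Sum>j<r - k. c j *s ?h j) = 0" for c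
    proof (intro allI impI)
      fix l assume l: "l < r - k"
      have "0 = \<beta> ((x ^^ (r - 1 - k - l)) (\<Sum>j<r - k. c j *s ?h j)) e" using that by simp
      also have "\<dots> = (\<Sum>j<r - k. c j * \<beta> ((x ^^ (r - 1 - k - l + (k + j))) e) e)"
        by (simp add: pow_sum pow_scale pow_pow form_sum form_scale)
      also have "\<dots> = (\<Sum>j<r - k. if j = l then c j * \<epsilon> else 0)"
        unfolding e(2) using l by (intro sum.cong) auto
      also have "\<dots> = c l * \<epsilon>" using l by simp
      finally show "c l = 0" using \<epsilon>0 by simp
    qed
    have inj: "inj_on ?h {..<r - k}" by (rule independent_family(1)[OF ind])
    have "?h ` {..<r - k} \<subseteq> vec.span (b ` {..<r - k})"
      using img by (auto simp: funpow_add)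
    moreover have "vec.independent (?h ` {..<r - k})" by (rule independent_family(2)[OF ind])
    moreover have "vec.dim (vec.span (b ` {..<r - k})) <= card (?h ` {..<r - k})"
    proof -
      have "vec.dim (vec.span (b ` {..<r - k})) <= card (b ` {..<r - k})"
        by (rule vec.dim_le_card) simp_all
      also have "\<dots> <= r - k" using card_image_le[of "{..<r - k}" b] by simp
      finally show ?thesis using card_image[OF inj] by simp
    qed
    ultimately have "vec.span (b ` {..<r - k}) \<subseteq> vec.span (?h ` {..<r - k})"
      by (rule vec.card_ge_dim_independent)
    also have "\<dots> \<subseteq> vec.span (?g ` {k..<r})" by (intro vec.span_mono) auto
    finally show ?thesis .
  qed
  have xkW: "(x ^^ k) v = 0" if "v \<in> W" for v
    by (rule disj[OF powW[OF that]]) (use img sub1 in blast)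
  have "\<exists>v\<in>W. (x ^^ (k - 1)) v ~= 0"
  proof (rule ccontr)
    assume "\<not> ?thesis"
    then have 0: "(x ^^ (k - 1)) v = 0" if "v \<in> W" for v using that by blast
    have all: "(x ^^ (k - 1)) v \<in> vec.span (?g ` {k - 1..<r})" for v
    proof -
      have "v = pr v + (v - pr v)" by simp
      then have "(x ^^ (k - 1)) v = (x ^^ (k - 1)) (pr v) + (x ^^ (k - 1)) (v - pr v)" using pow_add by metis
      then show ?thesis using 0[OF pr] prS by simp
    qed
    \<comment> \<open>A dimension count: if \<open>x ^^ (k - 1)\<close> killed \<open>W\<close>, its
      image would lie in the span of \<open>r - k + 1\<close> vectors, yet it contains these
      \<open>r - k + 2\<close> independent Jordan vectors.\<close>
    let ?I = "insert r {..r - k}"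
    have "b ` ?I \<subseteq> vec.span (?g ` {k - 1..<r})"
    proof
      fix u assume "u \<in> b ` ?I"
      then consider "u = b r" | i where "i <= r - k" "u = b i" by auto
      then show "u \<in> vec.span (?g ` {k - 1..<r})"
      proof cases
        case 1
        then have "u = (x ^^ (k - 1)) (b (r + (k - 1)))" using b(5)[of "k - 1" "k - 1"] k by simp
        then show ?thesis using all by simp
      next
        case 2
        then have "u = (x ^^ (k - 1)) (b (i + (k - 1)))" using b(4)[of "i + (k - 1)" "k - 1"] k by simp
        then show ?thesis using all by simp
      qed
    qed
    moreover have I: "?I \<subseteq> {..<r + k}" using k by auto
    then have "vec.independent (b ` ?I)" by (intro vec.independent_mono[OF b(2)] image_mono)
    ultimately have "card (b ` ?I) <= card (?g ` {k - 1..<r})"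
      using vec.independent_span_bound[of "?g ` {k - 1..<r}" "b ` ?I"] by simp
    also have "\<dots> <= r - (k - 1)" using card_image_le[of "{k - 1..<r}" ?g] by simp
    finally have "card ?I <= r - (k - 1)" using card_image[OF inj_on_subset[OF b(1) I]] by simp
    moreover have "card ?I = r - k + 2" using k by simp
    ultimately show False using k by simp
  qed
  then obtain v where v: "v \<in> W" "(x ^^ (k - 1)) v ~= 0" by blast
  obtain w where w: "\<beta> ((x ^^ (k - 1)) v) w ~= 0" using v(2) nondegenerate by blast
  have "\<beta> ((x ^^ (k - 1)) v) (w - pr w) ~= 0"
    using w WS[OF powW[OF v(1)], of "pr w" "{0..<r}"] prS[of 0 w] by (simp add: form_sub)
  then obtain f0 where f0: "f0 \<in> W" "\<beta> ((x ^^ (k - 1)) f0) f0 ~= 0"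
    using even_form_nonzero[OF subW ev(2) v(1) pr] by blast
  have "(x ^^ Suc (k - 1)) f0 = 0" unfolding kN by (rule xkW[OF f0(1)])
  then obtain f where f: "f \<in> W" "(x ^^ k) f = 0" "\<And>i. \<beta> ((x ^^ i) f) f = (if i = k - 1 then 1 else 0)"
    using normalize[OF xW subW f0(1) _ f0(2), of 1] unfolding kN by auto
  have fe: "\<beta> ((x ^^ i) f) e = 0" for i using f(1) unfolding W_def by simp
  have ef: "\<beta> ((x ^^ i) e) f = 0" for i using pow_form_sym[of i e f] fe by simp
  have "model r k (form_odd \<epsilon> r k) (coords \<epsilon> e 1 f) (realize r k e f)"
  proof (rule modelI[OF rk e(1) f(2) e(1) f(2)])
    show "\<epsilon> * \<beta> ((x ^^ i) e) e = (if Suc i = r then 1 else 0)" for i using e(2) \<epsilon> rN by auto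
    show "\<epsilon> * \<beta> ((x ^^ i) f) e = 0" "1 * \<beta> ((x ^^ i) e) f = 0" for i using fe ef by simp_all
    show "1 * \<beta> ((x ^^ i) f) f = (if Suc i = k then 1 else 0)" for i using f(3) kN by auto
    fix v w
    have 1: "\<epsilon> * ((-1) ^ i * (\<epsilon> * \<beta> ((x ^^ (r - 1 - i)) w) e * (\<epsilon> * \<beta> ((x ^^ i) v) e))) =
        \<epsilon> * \<beta> ((x ^^ i) v) e * \<beta> ((x ^^ (r - 1 - i)) e) w" if "i < r" for i
    proof -
      have "\<beta> ((x ^^ (r - 1 - i)) e) w = (-1) ^ i * \<beta> ((x ^^ (r - 1 - i)) w) e"
        using pow_form_sym[of "r - 1 - i" e w] sign_even_diff[OF ev(1), of i] that by simp
      moreover have "\<epsilon> * (\<epsilon> * z) = z" for z using \<epsilon> by (simp flip: mult.assoc)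
      ultimately show ?thesis by (simp add: mult_ac)
    qed
    have 2: "(-1) ^ i * (\<beta> ((x ^^ (k - 1 - i)) w) f * \<beta> ((x ^^ i) v) f) =
        \<beta> ((x ^^ i) v) f * \<beta> ((x ^^ (k - 1 - i)) f) w" if "i < k" for i
      using pow_form_sym[of "k - 1 - i" f w] sign_even_diff[OF ev(2), of i] that by simp
    show "(\<Sum>i<r. coords \<epsilon> e 1 f v i $ 1 * \<beta> ((x ^^ (r - 1 - i)) e) w) +
        (\<Sum>i<k. coords \<epsilon> e 1 f v i $ 2 * \<beta> ((x ^^ (k - 1 - i)) f) w) =
        form_odd \<epsilon> r k (coords \<epsilon> e 1 f w) (coords \<epsilon> e 1 f v)"
      unfolding form_odd_def altsum_def coords_nth sum_distrib_left
      by (intro arg_cong2[of _ _ _ _ "(+)"] sum.cong refl)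
        (simp_all only: lessThan_iff mult_1_left 1[symmetric] 2[symmetric])
  qed
  then show ?thesis by blast
qed

text \<open>As in the correction of generators, multiples of \<open>(x ^^ j) f\<close> are added
  from the top downwards, now to cancel the products with \<open>e\<close>.\<close>

lemma dual_vector:
  assumes N: "(x ^^ Suc N) e = 0" and g: "\<beta> ((x ^^ N) e) g = -1"
  shows "\<exists>f. \<beta> ((x ^^ N) e) f = -1 & (\<forall>i. i < N --> N <= i + n --> \<beta> ((x ^^ i) e) f = 0)"
proof (induction n)
  case 0
  then show ?case using g by (intro exI[of _ g]) simp
next
  case (Suc n)
  then obtain f where f: "\<beta> ((x ^^ N) e) f = -1" "\<And>i. i < N ==> N <= i + n ==> \<beta> ((x ^^ i) e) f = 0" by blast
  have ev: "\<beta> ((x ^^ i) e) ((x ^^ Suc n) f) = (-1) ^ Suc n * \<beta> ((x ^^ (i + Suc n)) e) f" for i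
  proof -
    have "\<beta> ((x ^^ Suc n) ((x ^^ i) e)) f = (-1) ^ Suc n * \<beta> ((x ^^ i) e) ((x ^^ Suc n) f)" by (rule pow_skew)
    moreover have "(x ^^ Suc n) ((x ^^ i) e) = (x ^^ (i + Suc n)) e" by (simp only: pow_pow add.commute)
    moreover have "(-1 :: complex) ^ Suc n * ((-1) ^ Suc n * z) = z" for z
      by (simp add: mult.assoc[symmetric] power_mult_distrib[symmetric])
    ultimately show ?thesis by simp
  qed
  have van: "(x ^^ i) e = 0" if "N < i" for i using pow_vanish[OF N] that by simp
  define t where "t = (-1) ^ Suc n * \<beta> ((x ^^ (N - Suc n)) e) f"
  have val: "\<beta> ((x ^^ i) e) (f + t *s (x ^^ Suc n) f) = \<beta> ((x ^^ i) e) f + t * ((-1) ^ Suc n * \<beta> ((x ^^ (i + Suc n)) e) f)" for i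
    unfolding form_add form_scale ev ..
  have "\<beta> ((x ^^ N) e) (f + t *s (x ^^ Suc n) f) = -1"
    unfolding val using f(1) van[of "N + Suc n"] by (simp del: funpow.simps)
  moreover have "\<beta> ((x ^^ i) e) (f + t *s (x ^^ Suc n) f) = 0" if i: "i < N" "N <= i + Suc n" for i
  proof (cases "N = i + Suc n")
    case True
    then have "N - Suc n = i" by simp
    moreover have "(-1 :: complex) ^ Suc n * z * ((-1) ^ Suc n * (-1)) = - z" for z
      by (simp add: mult_ac flip: power_mult_distrib)
    ultimately show ?thesis unfolding val unfolding True[symmetric] f(1) t_def by (simp only: add.right_inverse)
  next
    case False
    then show ?thesis unfolding val using f(2)[of i] van[of "i + Suc n"] i by (simp del: funpow.simps)
  qed
  ultimately show ?case by blast
qed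

text \<open>For even \<open>m\<close> the top pairing through \<open>x ^^ (m - 1)\<close> is
  alternating, so no single vector generates a nondegenerate block. Instead two self-orthogonal
  generators \<open>e\<close> and \<open>f\<close> are made dual to each other.\<close>

lemma model_exists_even:
  assumes J: "nilpotent_two_blocks x m m" and rk: "m + m = CARD('n)" and m: "1 <= m" "even m"
  shows "\<exists>\<iota> \<rho>. model m m (form_even m) \<iota> \<rho>"
proof -
  obtain b where b: "inj_on b {..<m + m}" "vec.independent (b ` {..<m + m})"
    "\<And>v. \<exists>c. v = (\<Sum>j<m + m. c j *s b j)"
    "\<And>i j. i < m ==> (x ^^ j) (b i) = (if j <= i then b (i - j) else 0)"
    "\<And>i j. i < m ==> (x ^^ j) (b (m + i)) = (if j <= i then b (m + i - j) else 0)"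
    using jordan_basis[OF J order_refl] by blast
  define N where "N = m - 1"
  have N: "Suc N = m" "odd N" using m by (auto simp: N_def)
  have xm: "(x ^^ m) v = 0" for v
  proof -
    obtain c where c: "v = (\<Sum>j<m + m. c j *s b j)" using b(3) by blast
    have "(x ^^ m) (b l) = 0" if l: "l < m + m" for l
    proof (cases "l < m")
      case True
      then show ?thesis using b(4)[of l m] by simp
    next
      case False
      then obtain i where "l = m + i" "i < m" using l le_Suc_ex[of m l] by auto
      then show ?thesis using b(5)[of i m] by simp
    qed
    then show ?thesis unfolding c pow_sum pow_scale by (intro sum.neutral) simp
  qed
  have xN: "(x ^^ Suc N) v = 0" for v unfolding N(1) by (rule xm)
  have "0 \<notin> b ` {..<m + m}" using b(2) vec.dependent_zero[of "b ` {..<m + m}"] by blast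
  moreover have "b 0 \<in> b ` {..<m + m}" using m by simp
  ultimately have "b 0 ~= 0" by metis
  moreover have "(x ^^ N) (b N) = b 0" using b(4)[of N N] N(1) by simp
  ultimately have "(x ^^ N) (b N) ~= 0" by simp
  then obtain u where u: "\<beta> ((x ^^ N) (b N)) u ~= 0" using nondegenerate by blast
  define g where "g = b N"
  have big: "\<beta> ((x ^^ i) v) w = 0" if "N < i" for i v w
    using pow_vanish[OF xN, of i v] that by simp
  obtain c where c: "\<And>i. i < N ==> \<beta> ((x ^^ i) (u + (\<Sum>j=1..N. c j *s (x ^^ j) g))) (u + (\<Sum>j=1..N. c j *s (x ^^ j) g)) = 0"
    using correct'[OF xN xN u[folded g_def]] by blast
  define e where "e = u + (\<Sum>j=1..N. c j *s (x ^^ j) g)"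
  have ee: "\<beta> ((x ^^ i) e) e = 0" for i
  proof -
    consider "i < N" | "i = N" | "N < i" by linarith
    then show ?thesis
      by cases (use c odd_vanish[OF N(2)] big in \<open>simp_all add: e_def\<close>)
  qed
  have pairz: "\<beta> v ((x ^^ j) ((x ^^ N) w)) = 0" if "1 <= j" for j v w
    using pow_vanish[OF xN, of "j + N" w] that by (simp add: pow_pow)
  have "\<beta> ((x ^^ N) e) g ~= 0"
  proof -
    have "\<beta> (\<Sum>j=1..N. c j *s (x ^^ j) g) ((x ^^ N) g) = 0"
      unfolding form_sum
    proof (rule sum.neutral, rule ballI)
      fix j assume j: "j \<in> {1..N}"
      have "\<beta> ((x ^^ j) g) ((x ^^ N) g) = (-1) ^ j * \<beta> g ((x ^^ j) ((x ^^ N) g))" by (rule pow_skew)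
      then show "\<beta> (c j *s (x ^^ j) g) ((x ^^ N) g) = 0" using pairz[of j g g] j by (simp add: form_scale)
    qed
    then have "\<beta> e ((x ^^ N) g) = \<beta> u ((x ^^ N) g)" by (simp add: e_def form_add)
    then have "\<beta> ((x ^^ N) g) e ~= 0" using u form_sym unfolding g_def by metis
    then show ?thesis using pow_form_sym[of N e g] by auto
  qed
  \<comment> \<open>Scaling the top product to -1 fixes the sign with which the two blocks are
    paired in \<open>form_even\<close>.\<close>
  define g' where "g' = (- 1 / \<beta> ((x ^^ N) e) g) *s g"
  have "\<beta> ((x ^^ N) e) g' = -1" unfolding g'_def form_scale using \<open>\<beta> ((x ^^ N) e) g ~= 0\<close> by simp
  from dual_vector[OF xN this, of N] obtain f1 where f1: "\<beta> ((x ^^ N) e) f1 = -1" "\<And>i. i < N ==> \<beta> ((x ^^ i) e) f1 = 0"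
    by auto
  have "\<beta> ((x ^^ N) e) f1 ~= 0" using f1(1) by simp
  then obtain d where d: "\<And>i. i < N ==> \<beta> ((x ^^ i) (f1 + (\<Sum>j=1..N. d j *s (x ^^ j) e))) (f1 + (\<Sum>j=1..N. d j *s (x ^^ j) e)) = 0"
    using correct'[OF xN xN, of e f1] by blast
  define f where "f = f1 + (\<Sum>j=1..N. d j *s (x ^^ j) e)"
  have ff: "\<beta> ((x ^^ i) f) f = 0" for i
  proof -
    consider "i < N" | "i = N" | "N < i" by linarith
    then show ?thesis
      by cases (use d odd_vanish[OF N(2)] big in \<open>simp_all add: f_def\<close>)
  qed
  have ef: "\<beta> ((x ^^ i) e) f = (if i = N then -1 else 0)" for i
  proof -
    have "\<beta> (\<Sum>j=1..N. d j *s (x ^^ j) e) ((x ^^ i) e) = 0"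
      unfolding form_sum
    proof (rule sum.neutral, rule ballI)
      fix j
      have "\<beta> ((x ^^ i) ((x ^^ j) e)) e = (-1) ^ i * \<beta> ((x ^^ j) e) ((x ^^ i) e)" by (rule pow_skew)
      then have "\<beta> ((x ^^ j) e) ((x ^^ i) e) = 0" using ee[of "i + j"] by (simp add: pow_pow)
      then show "\<beta> (d j *s (x ^^ j) e) ((x ^^ i) e) = 0" by (simp add: form_scale)
    qed
    then have "\<beta> ((x ^^ i) e) (\<Sum>j=1..N. d j *s (x ^^ j) e) = 0"
      using form_sym[of "(x ^^ i) e" "\<Sum>j=1..N. d j *s (x ^^ j) e"] by (rule trans[rotated])
    then have "\<beta> ((x ^^ i) e) f = \<beta> ((x ^^ i) e) f1" by (simp add: f_def form_add)
    moreover consider "i < N" | "i = N" | "N < i" by linarith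
    then have "\<beta> ((x ^^ i) e) f1 = (if i = N then -1 else 0)"
      by cases (use f1 big in simp_all)
    ultimately show ?thesis by simp
  qed
  have fe: "\<beta> ((x ^^ i) f) e = (if i = N then 1 else 0)" for i
    using pow_form_sym[of i f e] ef N(2) by simp
  have "model m m (form_even m) (coords (-1) f 1 e) (realize m m e f)"
  proof (rule modelI[OF rk xm xm xm xm])
    show "-1 * \<beta> ((x ^^ i) e) f = (if Suc i = m then 1 else 0)" for i using ef N by auto
    show "-1 * \<beta> ((x ^^ i) f) f = 0" "1 * \<beta> ((x ^^ i) e) e = 0" for i using ff ee by simp_all
    show "1 * \<beta> ((x ^^ i) f) e = (if Suc i = m then 1 else 0)" for i using fe N by auto
    fix v w
    have sgn: "(-1 :: complex) ^ (m - 1 - i) = - ((-1) ^ i)" if "i < m" for i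
    proof -
      have "even (m - 1 - i) \<longleftrightarrow> odd i" using that m by presburger
      then show ?thesis by (simp add: minus_one_power_iff)
    qed
    have 2: "\<beta> ((x ^^ (m - 1 - i)) u') w = - ((-1) ^ i * \<beta> ((x ^^ (m - 1 - i)) w) u')" if "i < m" for i u'
      unfolding pow_form_sym[of "m - 1 - i" u' w] sgn[OF that] by (rule mult_minus_left)
    show "(\<Sum>i<m. coords (-1) f 1 e v i $ 1 * \<beta> ((x ^^ (m - 1 - i)) e) w) +
        (\<Sum>i<m. coords (-1) f 1 e v i $ 2 * \<beta> ((x ^^ (m - 1 - i)) f) w) =
        form_even m (coords (-1) f 1 e w) (coords (-1) f 1 e v)"
    proof -
      have 4: "coords (-1) f 1 e v i $ 1 * \<beta> ((x ^^ (m - 1 - i)) e) w + coords (-1) f 1 e v i $ 2 * \<beta> ((x ^^ (m - 1 - i)) f) w =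
        (- 1) ^ i * area (coords (-1) f 1 e w (m - 1 - i)) (coords (-1) f 1 e v i)" if "i < m" for i
      proof -
        note e = 2[OF that, of e] and f = 2[OF that, of f]
        show ?thesis unfolding area_def coords_nth e f by (simp add: algebra_simps)
      qed
      show ?thesis
        unfolding form_even_def altsum_def sum.distrib[symmetric]
        by (rule sum.cong[OF refl]) (simp only: 4 lessThan_iff)
    qed
  qed
  then show ?thesis by blast
qed

end

section \<open>The parametrization of the Springer fiber\<close>

declare upt_Suc [simp del] One_nat_def [simp del]

lemma delta_zero: "delta n 0 = (%_. 0)"
  by (simp add: delta_def)

locale springer_model =
  fixes m k :: nat and \<beta> :: "complex ^ 'n => complex ^ 'n => complex" and x :: "complex ^ 'n => complex ^ 'n"
    and \<iota> :: "complex ^ 'n => cseq" and \<rho> :: "cseq => complex ^ 'n"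
  assumes k1: "1 <= k" and km: "k <= m" and kodd: "k = m \<or> odd k"
    and iota_lin: "\<iota> (\<alpha> *s v + w) i = \<alpha> *s \<iota> v i + \<iota> w i"
    and iota_x: "\<iota> (x v) = shift (\<iota> v)"
    and iota_rho: "supported (2 * m - k) k y ==> \<iota> (\<rho> y) = y"
    and rho_iota: "\<rho> (\<iota> v) = v"
    and iota_supported: "supported (2 * m - k) k (\<iota> v)"
    and rho_sum: "\<exists>E F. \<forall>y. \<rho> y = (\<Sum>i<2 * m - k. y i $ 1 *s E i) + (\<Sum>i<k. y i $ 2 *s F i)"
    and form_iota: "\<beta> v w = springer_form m k (\<iota> v) (\<iota> w)"
begin

lemma iota_zero [simp]: "\<iota> 0 = (%_. 0)"
proof
  fix i show "\<iota> 0 i = 0" using iota_lin[of "-1" 0 0 i] by (simp add: vec2_eq_iff)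
qed

lemma iota_eq_zero: "\<iota> v = (%_. 0) ==> v = 0"
  using rho_iota[of v] rho_iota[of 0] by simp

lemma iota_diff_scale: "\<iota> (v - c *s w) = (%i. \<iota> v i - c *s \<iota> w i)"
proof
  fix i
  have "v - c *s w = (- c) *s w + v" by (simp add: Finite_Cartesian_Product.vec_eq_iff)
  then show "\<iota> (v - c *s w) i = \<iota> v i - c *s \<iota> w i"
    using iota_lin[of "- c" w v i] by (simp add: vec2_eq_iff)
qed

definition ker_flag :: "(nat => complex ^ 2 ^ 2) => nat => (complex ^ 'n) set" where
  "ker_flag \<pi> = (\<lambda>i\<in>{0..m}. {v. Kpi \<pi> 1 (Suc i) (\<iota> v) = (%_. 0)})"

text \<open>\<open>v\<close> is a frame of the flag of kernels of \<open>Qop (\<pi> i) \<circ> \<dots> \<circ> Qop (\<pi> 1)\<close>.\<close>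

definition adapted :: "nat => (nat => complex ^ 2 ^ 2) => (nat => complex ^ 2) => (nat => complex ^ 'n) => bool" where
  "adapted n \<pi> u v \<longleftrightarrow> (\<forall>i\<in>{1..n}. rank_one (\<pi> i) & u i ~= 0 & \<pi> i *v u i = u i &
     Kpi \<pi> 1 i (\<iota> (v i)) = delta 0 (u i))"

lemma linop_Kpi: "linop (Kpi \<pi> c b)" by (rule linop_fold)

lemma Kpi_last: "1 <= i ==> Kpi \<pi> 1 (Suc i) w = Qop (\<pi> i) (Kpi \<pi> 1 i w)"
  by (rule Kpi_Suc)

text \<open>One more operator adds one dimension to the kernel, since the kernel of
  \<open>Qop\<close> is the line at position 0. The last clause says that the kernel among all
  sequences already comes from the original space; so isotropy of the top subspace is isotropy of
  the whole kernel.\<close>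

lemma adapted_span_aux:
  "adapted n \<pi> u v ==> vec.span (v ` {1..n}) = {w. Kpi \<pi> 1 (Suc n) (\<iota> w) = (%_. 0)} &
    inj_on v {1..n} & vec.independent (v ` {1..n}) &
    (\<forall>w. Kpi \<pi> 1 (Suc n) w = (%_. 0) --> w \<in> range \<iota>)"
proof (induction n)
  case 0
  have "w \<in> range \<iota>" if "w = (%_. 0)" for w using that iota_zero by (metis rangeI)
  then show ?case
    using iota_eq_zero by (auto simp: vec.independent_empty upt_conv_Nil)
next
  case (Suc n)
  have ad: "adapted n \<pi> u v" using Suc.prems unfolding adapted_def by auto
  have last: "rank_one (\<pi> (Suc n))" "u (Suc n) ~= 0" "\<pi> (Suc n) *v u (Suc n) = u (Suc n)"
    "Kpi \<pi> 1 (Suc n) (\<iota> (v (Suc n))) = delta 0 (u (Suc n))"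
    using Suc.prems unfolding adapted_def by auto
  have IH: "vec.span (v ` {1..n}) = {w. Kpi \<pi> 1 (Suc n) (\<iota> w) = (%_. 0)}" "inj_on v {1..n}"
    "vec.independent (v ` {1..n})" "Kpi \<pi> 1 (Suc n) w = (%_. 0) ==> w \<in> range \<iota>" for w
    using Suc.IH[OF ad] by blast+
  have im: "v ` {1..Suc n} = insert (v (Suc n)) (v ` {1..n})" by (simp add: atLeastAtMostSuc_conv)
  have nin: "v (Suc n) \<notin> vec.span (v ` {1..n})"
  proof
    assume "v (Suc n) \<in> vec.span (v ` {1..n})"
    then have "delta 0 (u (Suc n)) 0 = 0" unfolding IH(1) using last(4) by simp
    then show False using last(2) by simp
  qed
  then have nin': "v (Suc n) \<notin> v ` {1..n}" using vec.span_base by blast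
  have 1: "inj_on v {1..Suc n}" using IH(2) nin' by (simp add: atLeastAtMostSuc_conv)
  have 2: "vec.independent (v ` {1..Suc n})" unfolding im by (rule vec.independent_insertI[OF nin IH(3)])
  have step: "\<exists>c. Kpi \<pi> 1 (Suc n) (%i. w i - c *s \<iota> (v (Suc n)) i) = (%_. 0)"
    if "Kpi \<pi> 1 (Suc (Suc n)) w = (%_. 0)" for w
  proof -
    have "Qop (\<pi> (Suc n)) (Kpi \<pi> 1 (Suc n) w) = (%_. 0)" using that Kpi_last[of "Suc n"] by simp
    from Qop_eq_0[OF last(1) this] obtain a where a: "Kpi \<pi> 1 (Suc n) w = delta 0 a" "\<pi> (Suc n) *v a = a" by blast
    obtain c where c: "a = c *s u (Suc n)" using rank_one_image_line[OF last(1) a(2) last(3,2)] by blast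
    have "Kpi \<pi> 1 (Suc n) (%i. w i - c *s \<iota> (v (Suc n)) i) = (%_. 0)"
      unfolding linop_diff[OF linop_Kpi] linop_scale[OF linop_Kpi] a(1) last(4) c by (auto simp: delta_def vec2_eq_iff)
    then show ?thesis ..
  qed
  have conv: "Kpi \<pi> 1 (Suc (Suc n)) (\<iota> w) = (%_. 0)" if "Kpi \<pi> 1 (Suc n) (\<iota> (w - c *s v (Suc n))) = (%_. 0)" for w c
  proof -
    have "Kpi \<pi> 1 (Suc n) (\<iota> w) = delta 0 (c *s u (Suc n))"
      using that unfolding iota_diff_scale linop_diff[OF linop_Kpi] linop_scale[OF linop_Kpi] last(4)
      by (auto simp: fun_eq_iff delta_def)
    then show ?thesis using Qop_delta[of "\<pi> (Suc n)" "c *s u (Suc n)"] last(3) Kpi_last[of "Suc n"]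
      by (simp add: mat2_mult_scale)
  qed
  have 3: "vec.span (v ` {1..Suc n}) = {w. Kpi \<pi> 1 (Suc (Suc n)) (\<iota> w) = (%_. 0)}"
    unfolding im vec.span_insert IH(1) using step conv by (auto simp: iota_diff_scale)
  have 4: "w \<in> range \<iota>" if w: "Kpi \<pi> 1 (Suc (Suc n)) w = (%_. 0)" for w
  proof -
    obtain c where "Kpi \<pi> 1 (Suc n) (%i. w i - c *s \<iota> (v (Suc n)) i) = (%_. 0)" using step[OF w] ..
    then obtain v' where v': "(%i. w i - c *s \<iota> (v (Suc n)) i) = \<iota> v'" using IH(4) by blast
    have "w = \<iota> (c *s v (Suc n) + v')"
      unfolding fun_eq_iff iota_lin v'[symmetric] by simp
    then show ?thesis by blast
  qed
  show ?case using 1 2 3 4 by blast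
qed

lemma adapted_span:
  assumes "adapted n \<pi> u v"
  shows "vec.span (v ` {1..n}) = {w. Kpi \<pi> 1 (Suc n) (\<iota> w) = (%_. 0)}"
    and "inj_on v {1..n}" and "vec.independent (v ` {1..n})"
    and "Kpi \<pi> 1 (Suc n) w = (%_. 0) ==> w \<in> range \<iota>"
  using adapted_span_aux[OF assms] by blast+

lemma adapted_mono: "adapted n \<pi> u v ==> j <= n ==> adapted j \<pi> u v"
  unfolding adapted_def by auto

lemma adapted_flag:
  assumes "adapted m \<pi> u v" "v \<in> extensional {1..m}"
  shows "v \<in> frames m" "flag_of m v = ker_flag \<pi>"
proof -
  show "v \<in> frames m" using adapted_span(2,3)[OF assms(1)] assms(2) unfolding frames_def by simp
  show "flag_of m v = ker_flag \<pi>"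
  proof
    fix i show "flag_of m v i = ker_flag \<pi> i"
    proof (cases "i <= m")
      case True
      then show ?thesis using adapted_span(1)[OF adapted_mono[OF assms(1) True]] by (simp add: flag_of_def ker_flag_def)
    next
      case False
      then show ?thesis by (simp add: flag_of_def ker_flag_def)
    qed
  qed
qed

abbreviation isotropic_label :: "(nat => complex ^ 2 ^ 2) => bool" where
  "isotropic_label \<pi> \<equiv> isotropic (2 * m - k) k (springer_form m k) (Kpi \<pi> 1 (Suc m))"

text \<open>The vectors spanning the lines are lifted through the explicit right inverses
  \<open>Pop\<close>, so the frame depends continuously, and even polynomially, on the labels and
  these vectors.\<close>

definition frame_vec :: "(nat => complex ^ 2 ^ 2) => (nat => complex ^ 2) => nat => complex ^ 'n" where
  "frame_vec \<pi> u = (\<lambda>i\<in>{1..m}. \<rho> (foldr Pop (map \<pi> [1..<i]) (delta 0 (u i))))"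

lemma fold_Qop_foldr_Pop: "(\<And>p. p \<in> set ps ==> rank_one p) ==> fold Qop ps (foldr Pop ps w) = w"
  by (induction ps) (simp_all add: Qop_Pop)

text \<open>The lifted sequences lie in the last kernel, and its support clause is what makes
  \<iota> undo \<rho> on them.\<close>

lemma adapted_frame_vec:
  assumes rank: "\<And>i. 1 <= i ==> i <= m ==> rank_one (\<pi> i)"
    and u: "\<And>i. 1 <= i ==> i <= m ==> u i ~= 0 & \<pi> i *v u i = u i" and iso: "isotropic_label \<pi>"
  shows "adapted m \<pi> u (frame_vec \<pi> u)" "frame_vec \<pi> u \<in> extensional {1..m}"
proof -
  show "frame_vec \<pi> u \<in> extensional {1..m}" by (simp add: frame_vec_def)
  show "adapted m \<pi> u (frame_vec \<pi> u)"
    unfolding adapted_def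
  proof
    fix i assume "i \<in> {1..m}"
    then have i: "1 <= i" "i <= m" by simp_all
    let ?w = "foldr Pop (map \<pi> [1..<i]) (delta 0 (u i))"
    have Kw: "Kpi \<pi> 1 i ?w = delta 0 (u i)"
      by (rule fold_Qop_foldr_Pop) (use rank i in auto)
    have "Kpi \<pi> 1 (Suc i) ?w = (%_. 0)"
      unfolding Kpi_last[OF i(1)] Kw using Qop_delta u[OF i] by blast
    then have "Kpi \<pi> 1 (Suc m) ?w = (%_. 0)"
      using Kpi_split[of 1 "Suc i" "Suc m" \<pi> ?w] i linop_zero[OF linop_Kpi] by simp
    then have "supported (2 * m - k) k ?w" by (rule isotropicD(1)[OF iso])
    then have "\<iota> (frame_vec \<pi> u i) = ?w" using iota_rho i by (simp add: frame_vec_def)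
    then show "rank_one (\<pi> i) & u i ~= 0 & \<pi> i *v u i = u i & Kpi \<pi> 1 i (\<iota> (frame_vec \<pi> u i)) = delta 0 (u i)"
      using rank[OF i] u[OF i] Kw by simp
  qed
qed

lemma ker_flag_x:
  assumes "rank_one (\<pi> i)" "1 <= i" "i <= m" "v \<in> ker_flag \<pi> i"
  shows "x v \<in> ker_flag \<pi> (i - 1)"
proof -
  have "Qop (\<pi> i) (Kpi \<pi> 1 i (\<iota> v)) = (%_. 0)" using assms(4) Kpi_last[OF assms(2)] assms(3) by (simp add: ker_flag_def)
  from Qop_eq_0(1)[OF assms(1) this] obtain a where "Kpi \<pi> 1 i (\<iota> v) = delta 0 a" by blast
  then have "shift (Kpi \<pi> 1 i (\<iota> v)) = (%_. 0)" by (simp add: shift_delta0)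
  then have "Kpi \<pi> 1 i (\<iota> (x v)) = (%_. 0)" unfolding iota_x shift_fold .
  moreover have "i - 1 <= m" "Suc (i - 1) = i" using assms(2,3) by simp_all
  ultimately show ?thesis by (simp add: ker_flag_def)
qed

lemma ker_flag_springer:
  assumes rank: "\<And>i. 1 <= i ==> i <= m ==> rank_one (\<pi> i)" and iso: "isotropic_label \<pi>"
  shows "ker_flag \<pi> \<in> springer_fiber m \<beta> x"
proof -
  have "\<forall>i. \<exists>u. 1 <= i --> i <= m --> u ~= 0 & \<pi> i *v u = u" using rank_one_image_nonzero rank by metis
  then obtain u where u: "\<And>i. 1 <= i ==> i <= m ==> u i ~= 0 & \<pi> i *v u i = u i" by metis
  note F = adapted_flag[OF adapted_frame_vec[OF rank u iso]]
  have "ker_flag \<pi> \<in> flags m" using flag_of_in_flags[OF F(1)] F(2) by simp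
  moreover have "\<beta> v w = 0" if "v \<in> ker_flag \<pi> m" "w \<in> ker_flag \<pi> m" for v w
    unfolding form_iota by (rule isotropicD(2)[OF iso]) (use that in \<open>simp_all add: ker_flag_def\<close>)
  moreover have "x ` ker_flag \<pi> i \<subseteq> ker_flag \<pi> (i - 1)" if "i \<in> {1..m}" for i
    using ker_flag_x[of \<pi> i] rank[of i] that by auto
  ultimately show ?thesis unfolding springer_fiber_def by blast
qed

text \<open>Reconstruction from left to right: the operators of the points found so far move the
  next frame vector to position 0, where it spans the next line.\<close>

primrec points :: "(nat => complex ^ 'n) => nat => (real ^ 3) list" where
  "points v 0 = []"
| "points v (Suc i) = points v i @ [hopf (Kop (points v i) (\<iota> (v (Suc i))) 0)]"

definition point :: "(nat => complex ^ 'n) => nat => real ^ 3" where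
  "point v i = hopf (Kop (points v (i - 1)) (\<iota> (v i)) 0)"

lemma points_eq: "points v n = map (point v) [1..<Suc n]"
  by (induction n) (simp_all add: point_def upt_Suc_append)

lemma Kop_points: "Kop (points v n) = Kpi (%i. sphere_proj (point v i)) 1 (Suc n)"
  unfolding points_eq map_map comp_def ..

text \<open>\<open>x\<close> sends the new vector into the preceding kernel, so the shift kills its
  image, which therefore sits at position 0. It is nonzero because the new vector is outside the
  preceding span.\<close>

lemma adapted_next:
  assumes v: "v \<in> frames m" and F: "\<And>i. i \<in> {1..m} ==> x ` flag_of m v i \<subseteq> flag_of m v (i - 1)"
    and ad: "adapted n \<pi> u v" and n: "Suc n <= m"
  shows "\<exists>a. a ~= 0 & Kpi \<pi> 1 (Suc n) (\<iota> (v (Suc n))) = delta 0 a"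
proof -
  note sp = adapted_span(1)[OF ad]
  let ?y = "Kpi \<pi> 1 (Suc n) (\<iota> (v (Suc n)))"
  have "Suc n \<in> {1..m}" using n by simp
  then have "x ` flag_of m v (Suc n) \<subseteq> flag_of m v (Suc n - 1)"
    by (rule F)
  moreover have "v (Suc n) \<in> flag_of m v (Suc n)"
    using n by (simp add: flag_of_def vec.span_base)
  ultimately have "x (v (Suc n)) \<in> flag_of m v (Suc n - 1)" by blast
  then have "x (v (Suc n)) \<in> vec.span (v ` {1..n})" using n by (simp add: flag_of_def)
  then have "Kpi \<pi> 1 (Suc n) (\<iota> (x (v (Suc n)))) = (%_. 0)" unfolding sp by simp
  then have "shift ?y = (%_. 0)" unfolding iota_x shift_fold .
  from fun_cong[OF this] have y': "?y (Suc i) = 0" for i unfolding shift_def .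
  have y: "?y = delta 0 (?y 0)"
  proof
    fix i show "?y i = delta 0 (?y 0) i" by (cases i) (simp_all add: delta_def y')
  qed
  have "v (Suc n) \<notin> vec.span (v ` {1..n})"
  proof
    assume *: "v (Suc n) \<in> vec.span (v ` {1..n})"
    have "v ` {1..n} \<subseteq> v ` {1..m} - {v (Suc n)}"
    proof
      fix w assume "w \<in> v ` {1..n}"
      then obtain i where i: "i \<in> {1..n}" "w = v i" by blast
      have "inj_on v {1..m}" using v unfolding frames_def by blast
      then have "v i ~= v (Suc n)"
        using inj_onD[of v "{1..m}" i "Suc n"] i(1) n by auto
      then show "w \<in> v ` {1..m} - {v (Suc n)}" using i n by auto
    qed
    from subsetD[OF vec.span_mono[OF this] *] have "v (Suc n) \<in> vec.span (v ` {1..m} - {v (Suc n)})" .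
    moreover have "v (Suc n) \<in> v ` {1..m}" using n by auto
    ultimately have "vec.dependent (v ` {1..m})" unfolding vec.dependent_def by blast
    then show False using v unfolding frames_def by blast
  qed
  then have "?y ~= (%_. 0)" unfolding sp by simp
  then have y0: "?y 0 ~= 0" using delta_zero y by metis
  show ?thesis using y y0 by blast
qed

lemma springer_adapted:
  assumes v: "v \<in> frames m" and F: "\<And>i. i \<in> {1..m} ==> x ` flag_of m v i \<subseteq> flag_of m v (i - 1)" and n: "n <= m"
  shows "adapted n (%i. sphere_proj (point v i)) (%i. Kop (points v (i - 1)) (\<iota> (v i)) 0) v &
    (\<forall>i\<in>{1..n}. point v i \<in> sphere 0 1)"
  using n
proof (induction n)
  case 0
  then show ?case by (simp add: adapted_def)
next
  case (Suc n)
  let ?\<pi> = "%i. sphere_proj (point v i)" and ?u = "%i. Kop (points v (i - 1)) (\<iota> (v i)) 0"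
  from Suc have ad: "adapted n ?\<pi> ?u v" and S: "\<forall>i\<in>{1..n}. point v i \<in> sphere 0 1" by auto
  let ?y = "Kpi ?\<pi> 1 (Suc n) (\<iota> (v (Suc n)))"
  obtain a where a: "a ~= 0" "?y = delta 0 a"
    using adapted_next[OF v F ad Suc.prems] by blast
  then have y: "?y = delta 0 (?y 0)" and y0: "?y 0 ~= 0" by (simp_all add: delta_def)
  have "point v (Suc n) = hopf (Kop (points v n) (\<iota> (v (Suc n))) 0)" by (simp add: point_def)
  then have pt: "point v (Suc n) = hopf (?y 0)" by (simp only: Kop_points)
  have "adapted (Suc n) ?\<pi> ?u v"
    unfolding adapted_def
  proof
    fix i assume "i \<in> {1..Suc n}"
    then have "i \<in> {1..n} \<or> i = Suc n" by auto
    then consider "i \<in> {1..n}" | "i = Suc n" by blast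
    then show "rank_one (?\<pi> i) & ?u i ~= 0 & ?\<pi> i *v ?u i = ?u i & Kpi ?\<pi> 1 i (\<iota> (v i)) = delta 0 (?u i)"
    proof cases
      case 1
      then show ?thesis using ad unfolding adapted_def by blast
    next
      case 2
      have u: "?u (Suc n) = ?y 0" by (simp add: Kop_points)
      have "rank_one (?\<pi> (Suc n))" unfolding pt by (rule rank_one_sphere_proj[OF hopf_sphere[OF y0]])
      moreover have "?\<pi> (Suc n) *v ?y 0 = ?y 0" unfolding pt by (rule hopf_proj[OF y0])
      ultimately show ?thesis unfolding 2 u using y0 y by blast
    qed
  qed
  moreover have "point v (Suc n) \<in> sphere 0 1" unfolding pt by (rule hopf_sphere[OF y0])
  ultimately show ?case using S by (auto simp: le_Suc_eq)
qed

text \<open>\<open>labels X\<close> are the orthogonal projections onto the lines encoded by the points \<open>X i\<close>.\<close>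

abbreviation labels :: "(nat => real ^ 3) => nat => complex ^ 2 ^ 2" where
  "labels X \<equiv> %i. sphere_proj (X i)"

lemma Kpi_cong: "(\<And>i. c <= i ==> i < b ==> \<pi> i = \<pi>' i) ==> Kpi \<pi> c b = Kpi \<pi>' c b"
  by (rule arg_cong[of _ _ "fold Qop"], rule map_cong) auto

text \<open>With equal earlier labels, the \<open>i\<close>-th frame vector becomes the same
  \<open>delta 0 (u i)\<close> for both; so \<open>u i\<close> lies on both lines, and a common line
  means a common point.\<close>

lemma adapted_determines_point:
  assumes ad: "adapted n (labels X) u v" and i: "1 <= i" "i <= n" "i <= m"
    and Y: "v i \<in> ker_flag (labels Y) i" "\<And>j. 1 <= j ==> j < i ==> X j = Y j"
  shows "X i = Y i"
proof -
  have u: "u i ~= 0" "sphere_proj (X i) *v u i = u i" "Kpi (labels X) 1 i (\<iota> (v i)) = delta 0 (u i)"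
    using ad i unfolding adapted_def by auto
  have "Kpi (labels X) 1 i = Kpi (labels Y) 1 i" by (rule Kpi_cong) (simp add: Y(2))
  then have "Qop (sphere_proj (Y i)) (delta 0 (u i)) = (%_. 0)"
    using Y(1) Kpi_last[OF i(1)] i u(3) by (simp add: ker_flag_def)
  then have "delta 0 (u i - sphere_proj (Y i) *v u i) 0 = 0" unfolding Qop_delta' by simp
  then have "sphere_proj (Y i) *v u i = u i" by simp
  then show ?thesis using sphere_proj_eqI u(1,2) by blast
qed

lemma flag_determines_points:
  assumes ad: "adapted n (labels X) u v" "n <= m"
    and eq: "\<And>i. i <= n ==> ker_flag (labels X) i = ker_flag (labels Y) i" and i: "1 <= i" "i <= n"
  shows "X i = Y i"
  using i
proof (induction i rule: less_induct)
  case (less i)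
  have "v i \<in> vec.span (v ` {1..i})" using less.prems by (auto intro: vec.span_base)
  then have "v i \<in> ker_flag (labels X) i"
    unfolding adapted_span(1)[OF adapted_mono[OF ad(1) less.prems(2)]] using less.prems ad(2) by (simp add: ker_flag_def)
  then have "v i \<in> ker_flag (labels Y) i" using eq less.prems by simp
  from adapted_determines_point[OF ad(1) less.prems _ this] show ?case
    using less ad(2) by simp
qed

lemma springer_fiber_point:
  assumes v: "v \<in> frames m" and F: "flag_of m v \<in> springer_fiber m \<beta> x"
  shows "flag_of m v = ker_flag (labels (point v))" "\<forall>i\<in>{1..m}. point v i \<in> sphere 0 1"
    "isotropic_label (labels (point v))"
proof -
  have ad: "adapted m (labels (point v)) (%i. Kop (points v (i - 1)) (\<iota> (v i)) 0) v"
    and S: "\<forall>i\<in>{1..m}. point v i \<in> sphere 0 1"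
    using springer_adapted[OF v _ order_refl] F unfolding springer_fiber_def by auto
  have "v \<in> extensional {1..m}" using v unfolding frames_def by blast
  then show fl: "flag_of m v = ker_flag (labels (point v))" by (rule adapted_flag(2)[OF ad])
  show "\<forall>i\<in>{1..m}. point v i \<in> sphere 0 1" by (rule S)
  show "isotropic_label (labels (point v))"
    unfolding isotropic_def
  proof (intro conjI allI impI)
    fix w assume "Kpi (labels (point v)) 1 (Suc m) w = (%_. 0)"
    then obtain w' where "w = \<iota> w'" using adapted_span(4)[OF ad] by blast
    then show "supported (2 * m - k) k w" using iota_supported by simp
  next
    fix w1 w2 assume *: "Kpi (labels (point v)) 1 (Suc m) w1 = (%_. 0)" "Kpi (labels (point v)) 1 (Suc m) w2 = (%_. 0)"
    obtain v1 where v1: "w1 = \<iota> v1" using adapted_span(4)[OF ad *(1)] by blast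
    obtain v2 where v2: "w2 = \<iota> v2" using adapted_span(4)[OF ad *(2)] by blast
    have "v1 \<in> flag_of m v m" "v2 \<in> flag_of m v m" unfolding fl using * v1 v2 by (simp_all add: ker_flag_def)
    then show "springer_form m k w1 w2 = 0" using F form_iota unfolding springer_fiber_def v1 v2 by auto
  qed
qed

lemma labelled_cong:
  assumes "combinatorial_diagram m a" "\<And>i. 1 <= i ==> i <= m ==> X i = Y i" "labelled ng p p' q a X"
  shows "labelled ng p p' q a Y"
proof -
  have E: "X e = Y e" if "s \<in> strands a" "e \<in> ends s" for s e
    using assms(2) combinatorial_diagramD(1)[OF assms(1) that] by blast
  have C: "X i = Y i & X j = Y j" if "Cup i j \<in> strands a" for i j
    using E[OF that] by simp
  have R: "X i = Y i" if "Ray i \<in> strands a" for i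
    using E[OF that] by simp
  have "Y i = (if Cup i j \<in> dotted a then Y j else ng (Y j))" if c: "Cup i j \<in> strands a" for i j
  proof -
    have "X i = (if Cup i j \<in> dotted a then X j else ng (X j))" using assms(3) c unfolding labelled_def by blast
    then show ?thesis using C[OF c] by simp
  qed
  moreover have "Y i = (if Ray i \<in> dotted a then p else if \<forall>j. Ray j \<in> strands a --> j <= i then p' else q)"
    if c: "Ray i \<in> strands a" for i
    using assms(3) c R[OF c] unfolding labelled_def by metis
  ultimately show ?thesis unfolding labelled_def by blast
qed

lemma labelled_sphere_proj:
  assumes "labelled uminus pole_p (- pole_p) pole_q a X"
  shows "labelled compl_proj (pmat 1) (pmat (-1)) qmat a (labels X)"
proof -
  have "labels X i = (if Cup i j \<in> dotted a then labels X j else compl_proj (labels X j))"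
    if c: "Cup i j \<in> strands a" for i j
  proof -
    have "X i = (if Cup i j \<in> dotted a then X j else - X j)" using assms c unfolding labelled_def by blast
    from arg_cong[OF this, of sphere_proj] show ?thesis unfolding if_distrib sphere_proj_uminus .
  qed
  moreover have "labels X i = (if Ray i \<in> dotted a then pmat 1 else if \<forall>j. Ray j \<in> strands a --> j <= i then pmat (-1) else qmat)"
    if c: "Ray i \<in> strands a" for i
  proof -
    have "X i = (if Ray i \<in> dotted a then pole_p else if \<forall>j. Ray j \<in> strands a --> j <= i then - pole_p else pole_q)"
      using assms c unfolding labelled_def by blast
    show ?thesis unfolding \<open>X i = _\<close> by (simp only: if_distrib[of sphere_proj] sphere_proj_poles)
  qed
  ultimately show ?thesis unfolding labelled_def by blast
qed

lemma cup_diagramsD: "a \<in> cup_diagrams m k ==> combinatorial_diagram m a"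
  "a \<in> cup_diagrams m k ==> card {s \<in> strands a. is_Cup s} = k div 2"
  by (simp_all add: cup_diagrams_def is_cup_diagram_iff)

lemma labelled_isotropic_label:
  assumes "a \<in> cup_diagrams m k" "\<And>i. 1 <= i ==> i <= m ==> rank_one (\<pi> i)"
    "labelled compl_proj (pmat 1) (pmat (-1)) qmat a \<pi>"
  shows "isotropic_label \<pi>"
proof (rule labelled_isotropic[OF cup_diagramsD[OF assms(1)] k1 km kodd])
  show "\<forall>i. 1 <= i --> i <= m --> rank_one (\<pi> i)" using assms(2) by blast
  show "labelled_below a (Suc m) \<pi>" by (rule labelled_imp_below[OF assms(3)])
qed

text \<open>One direction uses the structure of a diagram at its cuts, the other the good words.
  From here on the union of the S_a is accessible through isotropy alone.\<close>

lemma topological_springer_fiber_iff: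
  "X \<in> topological_springer_fiber m k \<longleftrightarrow> X \<in> {1..m} \<rightarrow>\<^sub>E sphere 0 1 & isotropic_label (labels X)"
proof
  assume "X \<in> topological_springer_fiber m k"
  then obtain a where a: "a \<in> cup_diagrams m k" "X \<in> sphere_component m a"
    unfolding topological_springer_fiber_def by blast
  then have X: "X \<in> {1..m} \<rightarrow>\<^sub>E sphere 0 1" "labelled uminus pole_p (- pole_p) pole_q a X"
    unfolding sphere_component_labelled by auto
  have "isotropic_label (labels X)"
  proof (rule labelled_isotropic_label[OF a(1) _ labelled_sphere_proj[OF X(2)]])
    show "rank_one (labels X i)" if "1 <= i" "i <= m" for i
      by (rule rank_one_sphere_proj, rule PiE_mem[OF X(1)]) (use that in simp)
  qed
  then show "X \<in> {1..m} \<rightarrow>\<^sub>E sphere 0 1 & isotropic_label (labels X)" using X(1) by blast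
next
  assume *: "X \<in> {1..m} \<rightarrow>\<^sub>E sphere 0 1 & isotropic_label (labels X)"
  define xs where "xs = map X [1..<Suc m]"
  have len: "length xs = m" by (simp add: xs_def)
  have S: "set xs \<subseteq> sphere 0 1" using * unfolding xs_def by (auto simp del: upt_Suc)
  have K: "Kop xs = Kpi (labels X) 1 (Suc m)" unfolding xs_def map_map comp_def ..
  have "good_word (k div 2) xs"
  proof (cases "odd k")
    case True
    then show ?thesis
      using * S km by (intro isotropic_odd_good_word) (simp_all add: len K springer_form_def)
  next
    case False
    then have "k = m" using kodd by blast
    then have "isotropic (length xs) (length xs) (form_even (length xs)) (Kop xs)"
      using * False unfolding len K springer_form_def by simp
    from isotropic_even_good_word[OF S _ this] show ?thesis using False \<open>k = m\<close> len by simp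
  qed
  from good_word_diagram[OF this] obtain a where a: "combinatorial_diagram m a"
    "card {s \<in> strands a. is_Cup s} = k div 2" "labelled uminus pole_p (- pole_p) pole_q a (%l. xs ! (l - 1))"
    unfolding len by blast
  have "labelled uminus pole_p (- pole_p) pole_q a X"
    by (rule labelled_cong[OF a(1) _ a(3)]) (simp add: xs_def del: upt_Suc)
  then have "X \<in> sphere_component m a" using * unfolding sphere_component_labelled by blast
  moreover have "a \<in> cup_diagrams m k" using a by (simp add: cup_diagrams_def is_cup_diagram_iff)
  ultimately show "X \<in> topological_springer_fiber m k" unfolding topological_springer_fiber_def by blast
qed

end

section \<open>Continuity of the parametrization and of its inverse\<close>

lemma tendsto_mat_mult:
  fixes p :: "'a => complex ^ 'c ^ 'd"
  shows "(p \<longlongrightarrow> P) F ==> (a \<longlongrightarrow> A) F ==> ((%x. p x *v a x) \<longlongrightarrow> P *v A) F"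
  unfolding matrix_vector_mult_def by (intro tendsto_vec_lambda tendsto_sum tendsto_mult tendsto_vec_nth)

lemma tendsto_scale:
  fixes a :: "'a => complex ^ 'c"
  shows "(c \<longlongrightarrow> C) F ==> (a \<longlongrightarrow> A) F ==> ((%x. c x *s a x) \<longlongrightarrow> C *s A) F"
  unfolding vector_scalar_mult_def by (intro tendsto_vec_lambda tendsto_mult tendsto_vec_nth)

lemma tendsto_if_const:
  "(c ==> (f \<longlongrightarrow> l) F) ==> (\<not> c ==> (g \<longlongrightarrow> l') F) ==>
    ((%x. if c then f x else g x) \<longlongrightarrow> (if c then l else l')) F"
  by (cases c) simp_all

lemma tendsto_sphere_proj:
  assumes "(f \<longlongrightarrow> l) F"
  shows "((%x. sphere_proj (f x)) \<longlongrightarrow> sphere_proj l) F"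
proof -
  have 1: "((%x. f x $ i) \<longlongrightarrow> l $ i) F" for i by (rule tendsto_vec_nth[OF assms])
  have 2: "((%x. Complex (f x $ 2) (f x $ 3)) \<longlongrightarrow> Complex (l $ 2) (l $ 3)) F"
    by (rule tendsto_Complex[OF 1 1])
  have 3: "((%x. of_real (1 + f x $ 1) / 2 :: complex) \<longlongrightarrow> of_real (1 + l $ 1) / 2) F"
    "((%x. of_real (1 - f x $ 1) / 2 :: complex) \<longlongrightarrow> of_real (1 - l $ 1) / 2) F"
    by (intro tendsto_intros 1; simp)+
  have 4: "((%x. cnj (Complex (f x $ 2) (f x $ 3)) / 2) \<longlongrightarrow> cnj (Complex (l $ 2) (l $ 3)) / 2) F"
    "((%x. Complex (f x $ 2) (f x $ 3) / 2) \<longlongrightarrow> Complex (l $ 2) (l $ 3) / 2) F"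
    by (intro tendsto_divide tendsto_cnj 2 tendsto_const; simp)+
  show ?thesis unfolding sphere_proj_def
  proof (intro tendsto_vec_lambda)
    fix i j :: 2
    show "((%x. if i = 1 & j = 1 then of_real (1 + f x $ 1) / 2
     else if i = 2 & j = 2 then of_real (1 - f x $ 1) / 2
     else if i = 1 then cnj (Complex (f x $ 2) (f x $ 3)) / 2 else Complex (f x $ 2) (f x $ 3) / 2) \<longlongrightarrow>
     (if i = 1 & j = 1 then of_real (1 + l $ 1) / 2
     else if i = 2 & j = 2 then of_real (1 - l $ 1) / 2
     else if i = 1 then cnj (Complex (l $ 2) (l $ 3)) / 2 else Complex (l $ 2) (l $ 3) / 2)) F"
      by (intro tendsto_if_const 3 4)
  qed
qed

lemma tendsto_hopf:
  assumes "(a \<longlongrightarrow> A) F" "A ~= 0"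
  shows "((%x. hopf (a x)) \<longlongrightarrow> hopf A) F"
proof -
  have 1: "((%x. a x $ i) \<longlongrightarrow> A $ i) F" for i by (rule tendsto_vec_nth[OF assms(1)])
  have "((%x. hopf (a x) $ i) \<longlongrightarrow> hopf A $ i) F" for i
  proof -
    have "\<forall>i. ((%x. hopf (a x) $ i) \<longlongrightarrow> hopf A $ i) F"
      unfolding forall_3 hopf_nth using norm2_pos[OF assms(2)]
      by (intro conjI tendsto_divide tendsto_diff tendsto_add tendsto_power tendsto_norm tendsto_Re tendsto_Im
          tendsto_mult tendsto_const tendsto_cnj 1) auto
    then show ?thesis ..
  qed
  then have "((%x. \<chi> i. hopf (a x) $ i) \<longlongrightarrow> (\<chi> i. hopf A $ i)) F" by (rule tendsto_vec_lambda)
  then show ?thesis by simp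
qed

lemma tendsto_fold_Qop:
  assumes "\<And>l. l \<in> set ls ==> ((%x. \<pi> x l) \<longlongrightarrow> P l) F" "\<And>i. ((%x. w x i) \<longlongrightarrow> W i) F"
  shows "((%x. fold Qop (map (\<pi> x) ls) (w x) i) \<longlongrightarrow> fold Qop (map P ls) W i) F"
  using assms
proof (induction ls arbitrary: w W i)
  case (Cons l ls)
  have "((%x. Qop (\<pi> x l) (w x) i) \<longlongrightarrow> Qop (P l) W i) F" for i
    unfolding Qop_def by (intro tendsto_add tendsto_diff tendsto_mat_mult Cons.prems) simp_all
  from Cons.IH[OF _ this] Cons.prems(1) show ?case by simp
qed simp

lemma tendsto_Pop:
  assumes "(p \<longlongrightarrow> P) F" "\<And>i. ((%x. w x i) \<longlongrightarrow> W i) F"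
  shows "((%x. Pop (p x) (w x) i) \<longlongrightarrow> Pop P W i) F"
  unfolding Pop_def by (intro tendsto_add tendsto_diff tendsto_mat_mult tendsto_if_const tendsto_const assms)

lemma tendsto_foldr_Pop:
  assumes "\<And>l. l \<in> set ls ==> ((%x. \<pi> x l) \<longlongrightarrow> P l) F" "\<And>i. ((%x. w x i) \<longlongrightarrow> W i) F"
  shows "((%x. foldr Pop (map (\<pi> x) ls) (w x) i) \<longlongrightarrow> foldr Pop (map P ls) W i) F"
  using assms(1)
proof (induction ls arbitrary: i)
  case (Cons l ls)
  let ?f = "%x. foldr Pop (map (\<pi> x) ls) (w x)"
  have IH: "((%x. ?f x i) \<longlongrightarrow> foldr Pop (map P ls) W i) F" for i by (rule Cons.IH) (use Cons.prems in simp)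
  have "((%x. Pop (\<pi> x l) (?f x) i) \<longlongrightarrow> Pop (P l) (foldr Pop (map P ls) W) i) F"
    by (intro tendsto_Pop IH Cons.prems) simp
  then show ?case by simp
qed (simp add: assms(2))

lemma linear_expand:
  fixes f :: "complex ^ 'n => complex ^ 'c"
  assumes "\<And>\<alpha> v w. f (\<alpha> *s v + w) = \<alpha> *s f v + f w"
  shows "f v = (\<Sum>a\<in>UNIV. v $ a *s f (axis a 1))"
proof -
  have 0: "f 0 = 0" using assms[of "-1" 0 0] by simp
  have "f (\<Sum>a\<in>A. v $ a *s axis a 1) = (\<Sum>a\<in>A. v $ a *s f (axis a 1))" for A :: "'n set"
    by (induction A rule: infinite_finite_induct) (simp_all add: 0 assms)
  from this[of UNIV] show ?thesis by (simp add: basis_expansion)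
qed

lemma continuous_map_tendsto:
  fixes f :: "'a => 'b :: topological_space"
  shows "continuous_map T euclidean f \<longleftrightarrow> (\<forall>x\<in>topspace T. (f \<longlongrightarrow> f x) (atin T x))"
  by (simp add: continuous_map_atin)

lemma frame_proj_continuous:
  "i \<in> {1..m} ==> continuous_map (frame_topology m :: (nat => complex ^ 'n) topology) euclidean (%v. v i)"
  unfolding frame_topology_def by (intro continuous_map_from_subtopology continuous_map_product_projection)

lemma plucker_tendsto:
  assumes v: "\<And>i. i \<in> {1..m} ==> ((%x. v x i) \<longlongrightarrow> V i) F"
  shows "((%x. plucker m (v x) J) \<longlongrightarrow> plucker m V J) F"
proof (cases "length J <= m")
  case True
  have "((%x. v x (Suc (\<sigma> i)) $ a) \<longlongrightarrow> V (Suc (\<sigma> i)) $ a) F"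
    if "\<sigma> permutes {..<length J}" "i < length J" for \<sigma> i a
  proof (intro tendsto_vec_nth v)
    have "\<sigma> i \<in> {..<length J}" using permutes_in_image[OF that(1)] that(2) by blast
    then show "Suc (\<sigma> i) \<in> {1..m}" using True by simp
  qed
  then show ?thesis
    unfolding plucker_def using True by (auto intro!: tendsto_sum tendsto_mult tendsto_prod tendsto_const)
qed (simp add: plucker_def)

lemma quotient_map_flag_of:
  "quotient_map (frame_topology m) (flag_topology m) (flag_of m :: _ => nat => (complex ^ 'n) set)"
proof -
  have "flag_of m ` frames m = (flags m :: (nat => (complex ^ 'n) set) set)"
  proof
    show "(flags m :: (nat => (complex ^ 'n) set) set) \<subseteq> flag_of m ` frames m"
    proof
      fix F :: "nat => (complex ^ 'n) set" assume "F \<in> flags m"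
      from flag_of_surj[OF this] show "F \<in> flag_of m ` frames m" by blast
    qed
  qed (use flag_of_in_flags in blast)
  then show ?thesis unfolding quotient_map_def by (simp add: openin_flag_topology)
qed

context springer_model
begin

lemma x_eq: "x v = \<rho> (shift (\<iota> v))"
  unfolding iota_x[symmetric] rho_iota ..

lemma x_lin: "x (\<alpha> *s v + w) = \<alpha> *s x v + x w"
proof -
  have "\<iota> (\<alpha> *s x v + x w) = shift (\<iota> (\<alpha> *s v + w))"
    by (rule ext) (simp add: iota_lin iota_x shift_def)
  then have "\<rho> (\<iota> (\<alpha> *s x v + x w)) = x (\<alpha> *s v + w)" unfolding x_eq by simp
  then show ?thesis unfolding rho_iota ..
qed

lemma tendsto_iota:
  assumes "(v \<longlongrightarrow> V) F"
  shows "((%y. \<iota> (v y) i) \<longlongrightarrow> \<iota> V i) F"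
proof -
  note e = linear_expand[of "%v. \<iota> v i", OF iota_lin]
  show ?thesis
    unfolding e[of "v _"] e[of V] by (intro tendsto_sum tendsto_scale tendsto_vec_nth assms tendsto_const)
qed

lemma tendsto_rho:
  assumes "\<And>i. ((%y. w y i) \<longlongrightarrow> W i) F"
  shows "((%y. \<rho> (w y)) \<longlongrightarrow> \<rho> W) F"
proof -
  obtain E E' where E: "\<And>y. \<rho> y = (\<Sum>i<2 * m - k. y i $ 1 *s E i) + (\<Sum>i<k. y i $ 2 *s E' i)"
    using rho_sum by blast
  show ?thesis unfolding E by (intro tendsto_add tendsto_sum tendsto_scale tendsto_vec_nth assms tendsto_const)
qed

lemma tendsto_x: "(v \<longlongrightarrow> V) F ==> ((%y. x (v y)) \<longlongrightarrow> x V) F"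
  unfolding x_eq shift_def by (intro tendsto_rho tendsto_iota)

text \<open>The \<open>i\<close>-th point is \<open>hopf\<close> of an expression in the earlier
  points and the frame; \<open>hopf\<close> is continuous only off 0, hence the nonvanishing
  hypothesis at the limit.\<close>

lemma tendsto_point:
  assumes v: "\<And>i. i \<in> {1..m} ==> ((%y. v y i) \<longlongrightarrow> V i) F"
    and nz: "\<And>i. i \<in> {1..m} ==> Kop (points V (i - 1)) (\<iota> (V i)) 0 ~= 0" and i: "i \<in> {1..m}"
  shows "((%y. point (v y) i) \<longlongrightarrow> point V i) F"
  using i
proof (induction i rule: less_induct)
  case (less i)
  have K: "Kop (points v' (i - 1)) = fold Qop (map (%l. sphere_proj (point v' l)) [1..<i])" for v'
    using Kop_points[of v' "i - 1"] less.prems by simp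
  have "((%y. Kop (points (v y) (i - 1)) (\<iota> (v y i)) 0) \<longlongrightarrow> Kop (points V (i - 1)) (\<iota> (V i)) 0) F"
    unfolding K
  proof (rule tendsto_fold_Qop)
    fix l assume "l \<in> set [1..<i]"
    then have "l < i" "l \<in> {1..m}" using less.prems by auto
    then show "((%y. sphere_proj (point (v y) l)) \<longlongrightarrow> sphere_proj (point V l)) F"
      by (intro tendsto_sphere_proj less.IH)
  qed (rule tendsto_iota[OF v[OF less.prems]])
  then show ?case unfolding point_def by (rule tendsto_hopf[OF _ nz[OF less.prems]])
qed

text \<open>Isotropy is left out: points can be reconstructed from the incidences alone, and this
  larger set is closed by simple equations.\<close>

definition incident_flags :: "(nat => (complex ^ 'n) set) set" where
  "incident_flags = {F \<in> flags m. \<forall>i\<in>{1..m}. x ` F i \<subseteq> F (i - 1)}"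

lemma incident_iff:
  assumes v: "v \<in> frames m"
  shows "flag_of m v \<in> incident_flags \<longleftrightarrow> (\<forall>i\<in>{1..m}. x (v i) \<in> flag_of m v (i - 1))"
proof
  assume F: "flag_of m v \<in> incident_flags"
  show "\<forall>i\<in>{1..m}. x (v i) \<in> flag_of m v (i - 1)"
  proof
    fix i assume i: "i \<in> {1..m}"
    then have "v i \<in> flag_of m v i" by (simp add: flag_of_def vec.span_base)
    then show "x (v i) \<in> flag_of m v (i - 1)" using F i unfolding incident_flags_def by blast
  qed
next
  assume *: "\<forall>i\<in>{1..m}. x (v i) \<in> flag_of m v (i - 1)"
  have "x u \<in> flag_of m v (i - 1)" if i: "i \<in> {1..m}" and u: "u \<in> flag_of m v i" for i u
  proof -
    have u': "u \<in> vec.span (v ` {1..i})" using u i by (simp add: flag_of_def)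
    have fl: "flag_of m v (i - 1) = vec.span (v ` {1..i - 1})" using i by (intro flag_of_apply) (simp add: le_diff_conv)
    show ?thesis unfolding fl using u'
    proof (rule vec.span_induct)
      have x0: "x 0 = 0" using x_lin[of "-1" 0 0] by simp
      show "vec.subspace {u. x u \<in> vec.span (v ` {1..i - 1})}"
        unfolding vec.subspace_def
      proof (intro conjI ballI allI)
        show "0 \<in> {u. x u \<in> vec.span (v ` {1..i - 1})}" by (simp add: x0 vec.span_zero)
        show "a + b \<in> {u. x u \<in> vec.span (v ` {1..i - 1})}"
          if "a \<in> {u. x u \<in> vec.span (v ` {1..i - 1})}" "b \<in> {u. x u \<in> vec.span (v ` {1..i - 1})}" for a b
          using x_lin[of 1 a b] that by (simp add: vec.span_add)
        show "c *s a \<in> {u. x u \<in> vec.span (v ` {1..i - 1})}" if "a \<in> {u. x u \<in> vec.span (v ` {1..i - 1})}" for c a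
          using x_lin[of c a 0] x0 that by (simp add: vec.span_scale)
      qed
      fix w assume "w \<in> v ` {1..i}"
      then obtain l where l: "l \<in> {1..i}" "w = v l" by blast
      then have l': "l \<in> {1..m}" using i by auto
      have "flag_of m v (l - 1) = vec.span (v ` {1..l - 1})" using l' by (intro flag_of_apply) (simp add: le_diff_conv)
      then have "x w \<in> vec.span (v ` {1..l - 1})" using * l' l(2) by blast
      moreover have "vec.span (v ` {1..l - 1}) \<subseteq> vec.span (v ` {1..i - 1})"
        using l by (intro vec.span_mono image_mono) auto
      ultimately show "x w \<in> vec.span (v ` {1..i - 1})" by blast
    qed
  qed
  then show "flag_of m v \<in> incident_flags"
    unfolding incident_flags_def using flag_of_in_flags[OF v] by blast
qed

text \<open>Cramer's relations express the incidences by vanishing of continuous functions of a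
  frame. Closedness is what permits restricting the quotient map from frames to flags.\<close>

lemma closedin_incident_flags: "closedin (flag_topology m) incident_flags"
proof -
  let ?f = "%i J b v. x (v i) $ b * plucker m v J - (\<Sum>l<i - 1. x (v i) $ (J ! l) * plucker m v (J[l := b]))"
  let ?Z = "\<lambda>(i, J, b). {v \<in> topspace (frame_topology m). ?f i J b v \<in> {0}}"
  have cont: "continuous_map (frame_topology m) euclidean (?f i J b)" if i: "i \<in> {1..m}" for i J b
    unfolding continuous_map_tendsto
  proof
    fix V :: "nat => complex ^ 'n" assume V: "V \<in> topspace (frame_topology m)"
    have p: "((%v. v i) \<longlongrightarrow> V i) (atin (frame_topology m) V)" if "i \<in> {1..m}" for i
      using frame_proj_continuous[OF that] V unfolding continuous_map_tendsto by blast
    show "(?f i J b \<longlongrightarrow> ?f i J b V) (atin (frame_topology m) V)"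
      by (intro tendsto_diff tendsto_mult tendsto_sum tendsto_vec_nth tendsto_x plucker_tendsto p i)
  qed
  have "{v \<in> frames m. flag_of m v \<in> incident_flags} =
      \<Inter> (insert (topspace (frame_topology m)) (?Z ` {(i, J, b). i \<in> {1..m} & length J = i - 1}))"
  proof (intro subset_antisym subsetI)
    fix v assume "v \<in> {v \<in> frames m. flag_of m v \<in> incident_flags}"
    then have v: "v \<in> frames m" "flag_of m v \<in> incident_flags" by blast+
    have f0: "?f i J b v = 0" if "i \<in> {1..m}" "length J = i - 1" for i J b
    proof -
      have le: "i - 1 <= m" using that(1) by (simp add: le_diff_conv)
      have mem: "x (v i) \<in> flag_of m v (i - 1)" using incident_iff[OF v(1)] v(2) that(1) by blast
      show ?thesis by (rule iffD1[OF flag_of_member_iff[OF v(1) le] mem, rule_format, OF that(2)])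
    qed
    show "v \<in> \<Inter> (insert (topspace (frame_topology m)) (?Z ` {(i, J, b). i \<in> {1..m} & length J = i - 1}))"
    proof (rule InterI)
      fix S assume "S \<in> insert (topspace (frame_topology m)) (?Z ` {(i, J, b). i \<in> {1..m} & length J = i - 1})"
      then consider "S = topspace (frame_topology m)"
        | i J b where "i \<in> {1..m}" "length J = i - 1" "S = ?Z (i, J, b)" by blast
      then show "v \<in> S"
      proof cases
        case 1
        then show ?thesis using v(1) by simp
      next
        case 2
        then show ?thesis using f0[OF 2(1,2), of b] v(1) by simp
      qed
    qed
  next
    fix v assume *: "v \<in> \<Inter> (insert (topspace (frame_topology m)) (?Z ` {(i, J, b). i \<in> {1..m} & length J = i - 1}))"
    then have v: "v \<in> frames m" by simp
    have "x (v i) \<in> flag_of m v (i - 1)" if i: "i \<in> {1..m}" for i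
    proof -
      have le: "i - 1 <= m" using i by (simp add: le_diff_conv)
      have f0: "?f i J b v = 0" if "length J = i - 1" for J b
      proof -
        have "v \<in> ?Z (i, J, b)" using * i that by blast
        then show ?thesis by simp
      qed
      show ?thesis by (rule iffD2[OF flag_of_member_iff[OF v le]]) (intro allI impI f0)
    qed
    then show "v \<in> {v \<in> frames m. flag_of m v \<in> incident_flags}" using v incident_iff[OF v] by blast
  qed
  moreover have "closedin (frame_topology m)
      (\<Inter> (insert (topspace (frame_topology m)) (?Z ` {(i, J, b). i \<in> {1..m} & length J = i - 1})))"
  proof (rule closedin_Inter)
    fix S assume "S \<in> insert (topspace (frame_topology m)) (?Z ` {(i, J, b). i \<in> {1..m} & length J = i - 1})"
    then consider "S = topspace (frame_topology m)" | i J b where "i \<in> {1..m}" "S = ?Z (i, J, b)" by blast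
    then show "closedin (frame_topology m) S"
    proof cases
      case 1
      show ?thesis unfolding 1 by (rule closedin_topspace)
    next
      case 2
      have "closedin (frame_topology m) {v \<in> topspace (frame_topology m). ?f i J b v \<in> {0}}"
        by (rule closedin_continuous_map_preimage[OF cont[OF 2(1)]]) simp
      then show ?thesis using 2(2) by simp
    qed
  qed simp
  ultimately have "closedin (frame_topology m) {v \<in> frames m. flag_of m v \<in> incident_flags}" by metis
  then have "openin (frame_topology m) (frames m - {v \<in> frames m. flag_of m v \<in> incident_flags})"
    unfolding closedin_def by simp
  moreover have "frames m - {v \<in> frames m. flag_of m v \<in> incident_flags} =
      {v \<in> frames m. flag_of m v \<in> flags m - incident_flags}"
    using flag_of_in_flags by blast
  ultimately have "openin (flag_topology m) (flags m - incident_flags)"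
    unfolding openin_flag_topology by simp
  then show ?thesis unfolding closedin_def incident_flags_def by auto
qed

text \<open>The chosen frame does not matter on incident flags, because equal flags have equal
  points there.\<close>

definition point_of :: "(nat => (complex ^ 'n) set) => nat => real ^ 3" where
  "point_of F = restrict (point (SOME v. v \<in> frames m & flag_of m v = F)) {1..m}"

lemma incident_adapted:
  assumes v: "v \<in> frames m" and F: "flag_of m v \<in> incident_flags"
  shows "adapted m (labels (point v)) (%i. Kop (points v (i - 1)) (\<iota> (v i)) 0) v"
    "\<forall>i\<in>{1..m}. point v i \<in> sphere 0 1" "ker_flag (labels (point v)) = flag_of m v"
proof -
  show ad: "adapted m (labels (point v)) (%i. Kop (points v (i - 1)) (\<iota> (v i)) 0) v"
    and "\<forall>i\<in>{1..m}. point v i \<in> sphere 0 1"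
    using springer_adapted[OF v _ order_refl] F unfolding incident_flags_def by blast+
  have "v \<in> extensional {1..m}" using v unfolding frames_def by blast
  from adapted_flag(2)[OF ad this] show "ker_flag (labels (point v)) = flag_of m v" ..
qed

lemma point_of_flag_of:
  assumes v: "v \<in> frames m" and F: "flag_of m v \<in> incident_flags"
  shows "point_of (flag_of m v) = restrict (point v) {1..m}"
proof -
  define v' where "v' = (SOME v'. v' \<in> frames m & flag_of m v' = flag_of m v)"
  have "v' \<in> frames m & flag_of m v' = flag_of m v"
    unfolding v'_def by (rule someI[of _ v]) (simp add: v)
  then have v': "v' \<in> frames m" "flag_of m v' = flag_of m v" by blast+
  note A' = incident_adapted[OF v'(1), unfolded v'(2), OF F]
  have "point v' i = point v i" if "i \<in> {1..m}" for i
    by (rule flag_determines_points[OF A'(1) order_refl]) (use that A'(3) incident_adapted(3)[OF v F] in auto)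
  then show ?thesis unfolding point_of_def v'_def[symmetric] by (rule restrict_ext)
qed

text \<open>The quotient property reduces continuity on flags to continuity on frames, where the
  points are given by continuous formulas.\<close>

lemma continuous_point_of:
  "continuous_map (subtopology (flag_topology m) incident_flags) (sphere_product m) point_of"
proof (rule continuous_compose_quotient_map[OF quotient_map_restriction[OF quotient_map_flag_of refl disjI2[OF closedin_incident_flags]]])
  let ?U = "{v \<in> topspace (frame_topology m). flag_of m v \<in> incident_flags}"
  let ?T = "subtopology (frame_topology m) ?U"
  have top: "topspace ?T = ?U" by auto
  have U: "v \<in> frames m" "flag_of m v \<in> incident_flags" if "v \<in> ?U" for v using that by simp_all
  show "continuous_map ?T (sphere_product m) (point_of \<circ> flag_of m)"
  proof (rule continuous_map_eq)
    show "restrict (point v) {1..m} = (point_of \<circ> flag_of m) v" if "v \<in> topspace ?T" for v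
      using that point_of_flag_of[OF U] unfolding top by simp
    show "continuous_map ?T (sphere_product m) (%v. restrict (point v) {1..m})"
      unfolding sphere_product_def continuous_map_componentwise
    proof (intro conjI ballI)
      show "(%v. restrict (point v) {1..m}) ` topspace ?T \<subseteq> extensional {1..m}" by auto
      fix i assume i: "i \<in> {1..m}"
      have "continuous_map ?T euclidean (%v. point v i)"
        unfolding continuous_map_tendsto
      proof
        fix V assume V: "V \<in> topspace ?T"
        have p: "((%v. v i) \<longlongrightarrow> V i) (atin ?T V)" if "i \<in> {1..m}" for i
          using continuous_map_from_subtopology[OF frame_proj_continuous[OF that], of ?U] V
          unfolding continuous_map_tendsto by blast
        have "Kop (points V (i - 1)) (\<iota> (V i)) 0 ~= 0" if "i \<in> {1..m}" for i
          using incident_adapted(1)[OF U] V that unfolding top adapted_def by blast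
        from tendsto_point[OF p this i] show "((%v. point v i) \<longlongrightarrow> point V i) (atin ?T V)" .
      qed
      moreover have "point v i \<in> sphere 0 1" if "v \<in> topspace ?T" for v
        using incident_adapted(2)[OF U] that i unfolding top by blast
      ultimately show "continuous_map ?T (top_of_set (sphere 0 1)) (%v. restrict (point v) {1..m} i)"
        using i by (auto simp: continuous_map_in_subtopology)
    qed
  qed
qed

definition flag_map :: "(nat => real ^ 3) => nat => (complex ^ 'n) set" where
  "flag_map X = ker_flag (labels X)"

lemma fiberD:
  assumes "X \<in> topological_springer_fiber m k"
  shows "\<And>i. 1 <= i ==> i <= m ==> X i \<in> sphere 0 1" "\<And>i. 1 <= i ==> i <= m ==> rank_one (labels X i)"
    "isotropic_label (labels X)" "X \<in> extensional {1..m}"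
proof -
  have X: "X \<in> {1..m} \<rightarrow>\<^sub>E sphere 0 1" "isotropic_label (labels X)"
    using assms unfolding topological_springer_fiber_iff by blast+
  show "isotropic_label (labels X)" by (rule X)
  show "X \<in> extensional {1..m}" using X(1) unfolding PiE_def by blast
  show "X i \<in> sphere 0 1" if "1 <= i" "i <= m" for i by (rule PiE_mem[OF X(1)]) (use that in simp)
  then show "rank_one (labels X i)" if "1 <= i" "i <= m" for i by (intro rank_one_sphere_proj) (use that in blast)
qed

lemma flag_map_springer: "X \<in> topological_springer_fiber m k ==> flag_map X \<in> springer_fiber m \<beta> x"
  unfolding flag_map_def using fiberD by (intro ker_flag_springer) auto

lemma springer_subset_incident: "springer_fiber m \<beta> x \<subseteq> incident_flags"
  unfolding springer_fiber_def incident_flags_def by blast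

lemma flag_map_point_of:
  assumes "F \<in> springer_fiber m \<beta> x"
  shows "point_of F \<in> topological_springer_fiber m k" "flag_map (point_of F) = F"
proof -
  have "F \<in> flags m" using assms unfolding springer_fiber_def by blast
  then obtain v where v: "v \<in> frames m" "flag_of m v = F" by (rule flag_of_surj)
  note P = springer_fiber_point[OF v(1), unfolded v(2), OF assms]
  have pt: "point_of F = restrict (point v) {1..m}"
    using point_of_flag_of[OF v(1)] springer_subset_incident assms v(2) by blast
  have K: "Kpi (labels (point_of F)) 1 b = Kpi (labels (point v)) 1 b" if "b <= Suc m" for b
    by (rule Kpi_cong) (use that in \<open>simp add: pt\<close>)
  have "isotropic_label (labels (point_of F))" unfolding K[OF order_refl] by (rule P(3))
  moreover have "point_of F \<in> {1..m} \<rightarrow>\<^sub>E sphere 0 1" using P(2) unfolding pt by auto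
  ultimately show "point_of F \<in> topological_springer_fiber m k" unfolding topological_springer_fiber_iff by blast
  have E: "ker_flag (labels (point_of F)) = ker_flag (labels (point v))"
    unfolding ker_flag_def by (rule restrict_ext) (simp only: K Suc_le_mono atLeastAtMost_iff)
  show "flag_map (point_of F) = F" unfolding flag_map_def E by (rule P(1)[symmetric])
qed

lemma fiber_adapted:
  assumes X: "X \<in> topological_springer_fiber m k"
    and u: "\<And>i. 1 <= i ==> i <= m ==> u i ~= 0 & sphere_proj (X i) *v u i = u i"
  shows "adapted m (labels X) u (frame_vec (labels X) u)" "frame_vec (labels X) u \<in> frames m"
    "flag_of m (frame_vec (labels X) u) = flag_map X"
proof -
  show A1: "adapted m (labels X) u (frame_vec (labels X) u)"
    by (rule adapted_frame_vec(1)) (use fiberD(2,3)[OF X] u in auto)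
  have A2: "frame_vec (labels X) u \<in> extensional {1..m}" by (simp add: frame_vec_def)
  show "frame_vec (labels X) u \<in> frames m" by (rule adapted_flag(1)[OF A1 A2])
  show "flag_of m (frame_vec (labels X) u) = flag_map X" unfolding flag_map_def by (rule adapted_flag(2)[OF A1 A2])
qed

lemma fiber_image_vectors:
  assumes X: "X \<in> topological_springer_fiber m k"
  shows "\<exists>u. \<forall>i. 1 <= i --> i <= m --> u i ~= 0 & sphere_proj (X i) *v u i = u i"
proof -
  have "\<exists>u. 1 <= i --> i <= m --> u ~= 0 & sphere_proj (X i) *v u = u" for i
  proof (cases "1 <= i & i <= m")
    case True
    then have "rank_one (sphere_proj (X i))" using fiberD(2)[OF X] by blast
    from rank_one_image_nonzero[OF this] show ?thesis by blast
  qed auto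
  then have "\<forall>i. \<exists>u. 1 <= i --> i <= m --> u ~= 0 & sphere_proj (X i) *v u = u" ..
  from choice[OF this] show ?thesis .
qed

lemma point_of_flag_map:
  assumes X: "X \<in> topological_springer_fiber m k"
  shows "point_of (flag_map X) = X"
proof -
  obtain u where u': "\<forall>i. 1 <= i --> i <= m --> u i ~= 0 & sphere_proj (X i) *v u i = u i"
    using fiber_image_vectors[OF X] ..
  note u = u'[rule_format]
  have A: "adapted m (labels X) u (frame_vec (labels X) u)" "frame_vec (labels X) u \<in> frames m"
    "flag_of m (frame_vec (labels X) u) = flag_map X"
    by (rule fiber_adapted(1)[OF X], erule u, assumption)
      (rule fiber_adapted(2)[OF X], erule u, assumption, rule fiber_adapted(3)[OF X], erule u, assumption)
  let ?v = "frame_vec (labels X) u"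
  have F: "flag_of m ?v \<in> incident_flags" unfolding A(3) using springer_subset_incident flag_map_springer[OF X] by blast
  have E: "ker_flag (labels X) = ker_flag (labels (point ?v))"
    using A(3) incident_adapted(3)[OF A(2) F] by (simp add: flag_map_def)
  have "X i = point ?v i" if "i \<in> {1..m}" for i
    by (rule flag_determines_points[OF A(1) order_refl]) (use that E in simp_all)
  then have "restrict (point ?v) {1..m} = X" using fiberD(4)[OF X] by (intro extensionalityI) auto
  then show ?thesis using point_of_flag_of[OF A(2) F] A(3) by simp
qed

abbreviation "fiber_topology \<equiv> subtopology (sphere_product m) (topological_springer_fiber m k)"

lemma topspace_fiber: "topspace fiber_topology = topological_springer_fiber m k"
proof -
  have "topspace (sphere_product m) = {1..m} \<rightarrow>\<^sub>E sphere 0 1" by (simp add: sphere_product_def)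
  then show ?thesis using topological_springer_fiber_iff by auto
qed

lemma fiber_coordinate_continuous: "i \<in> {1..m} ==> continuous_map fiber_topology euclidean (%X. X i)"
  unfolding sphere_product_def
  by (intro continuous_map_from_subtopology) (metis continuous_map_into_fulltopology continuous_map_product_projection)

text \<open>A spanning vector of a line cannot be chosen continuously over the whole sphere. Near
  \<open>X0\<close>, however, projecting fixed vectors \<open>c i\<close> keeps them nonzero, and
  this gives a local continuous lift \<phi> of the map to frames.\<close>

lemma continuous_flag_map: "continuous_map fiber_topology (flag_topology m) flag_map"
  unfolding continuous_map_def
proof (intro conjI allI impI funcsetI)
  show "flag_map X \<in> topspace (flag_topology m)" if "X \<in> topspace fiber_topology" for X
    using flag_map_springer that unfolding topspace_fiber springer_fiber_def by auto
  fix U :: "(nat => (complex ^ 'n) set) set" assume U: "openin (flag_topology m) U"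
  then obtain V where V: "openin (product_topology (%_. euclidean) {1..m}) V"
    "{v \<in> frames m. flag_of m v \<in> U} = V \<inter> frames m"
    unfolding openin_flag_topology frame_topology_def openin_subtopology by blast
  show "openin fiber_topology {X \<in> topspace fiber_topology. flag_map X \<in> U}"
    unfolding openin_subopen[of _ "{X \<in> topspace fiber_topology. flag_map X \<in> U}"]
  proof
    fix X0 assume "X0 \<in> {X \<in> topspace fiber_topology. flag_map X \<in> U}"
    then have X0: "X0 \<in> topological_springer_fiber m k" "flag_map X0 \<in> U" unfolding topspace_fiber by blast+
    obtain c where c'': "\<forall>i. 1 <= i --> i <= m --> c i ~= 0 & sphere_proj (X0 i) *v c i = c i"
      using fiber_image_vectors[OF X0(1)] ..
    note c' = c''[rule_format]
    have c: "sphere_proj (X0 i) *v c i ~= 0" if "1 <= i" "i <= m" for i using c'[OF that] by simp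
    define u where "u X i = sphere_proj (X i) *v c i" for X i
    define \<phi> where "\<phi> X = frame_vec (labels X) (u X)" for X
    have lim: "((%X. labels X i) \<longlongrightarrow> labels Y i) (atin fiber_topology Y)"
      if "i \<in> {1..m}" "Y \<in> topspace fiber_topology" for i Y
      using fiber_coordinate_continuous[OF that(1)] that(2) unfolding continuous_map_tendsto
      by (intro tendsto_sphere_proj) blast
    have limu: "((%X. u X i) \<longlongrightarrow> u Y i) (atin fiber_topology Y)"
      if "i \<in> {1..m}" "Y \<in> topspace fiber_topology" for i Y
      unfolding u_def by (intro tendsto_mat_mult lim that tendsto_const)
    have cu: "continuous_map fiber_topology euclidean (%X. u X i)" if "i \<in> {1..m}" for i
      unfolding continuous_map_tendsto using limu that by blast
    have c\<phi>: "continuous_map fiber_topology (product_topology (%_. euclidean) {1..m}) \<phi>"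
      unfolding continuous_map_componentwise
    proof (intro conjI ballI)
      show "\<phi> ` topspace fiber_topology \<subseteq> extensional {1..m}" by (auto simp: \<phi>_def frame_vec_def)
      fix i assume i: "i \<in> {1..m}"
      show "continuous_map fiber_topology euclidean (%X. \<phi> X i)"
        unfolding continuous_map_tendsto
      proof
        fix Y assume Y: "Y \<in> topspace fiber_topology"
        have "((%X. delta 0 (u X i) l) \<longlongrightarrow> delta 0 (u Y i) l) (atin fiber_topology Y)" for l
          unfolding delta_def using limu[OF i Y] by simp
        then have "((%X. \<rho> (foldr Pop (map (labels X) [1..<i]) (delta 0 (u X i)))) \<longlongrightarrow>
            \<rho> (foldr Pop (map (labels Y) [1..<i]) (delta 0 (u Y i)))) (atin fiber_topology Y)"
          by (intro tendsto_rho tendsto_foldr_Pop lim) (use i Y in auto)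
        then show "((%X. \<phi> X i) \<longlongrightarrow> \<phi> Y i) (atin fiber_topology Y)"
          unfolding \<phi>_def frame_vec_def using i by simp
      qed
    qed
    define N where "N = \<Inter> (insert (topspace fiber_topology) ((%i. {X \<in> topspace fiber_topology. u X i \<in> - {0}}) ` {1..m}))"
    have "openin fiber_topology N"
      unfolding N_def
    proof (rule openin_Inter)
      fix S assume "S \<in> insert (topspace fiber_topology) ((%i. {X \<in> topspace fiber_topology. u X i \<in> - {0}}) ` {1..m})"
      then consider "S = topspace fiber_topology" | i where "i \<in> {1..m}" "S = {X \<in> topspace fiber_topology. u X i \<in> - {0}}" by blast
      then show "openin fiber_topology S"
      proof cases
        case 1
        show ?thesis unfolding 1 by (rule openin_topspace)
      next
        case 2
        show ?thesis unfolding 2(2) by (rule openin_continuous_map_preimage[OF cu[OF 2(1)]]) (simp add: open_Compl)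
      qed
    qed simp_all
    moreover have "openin fiber_topology {X \<in> topspace fiber_topology. \<phi> X \<in> V}"
      by (rule openin_continuous_map_preimage[OF c\<phi> V(1)])
    ultimately have opn: "openin fiber_topology (N \<inter> {X \<in> topspace fiber_topology. \<phi> X \<in> V})" by (rule openin_Int)
    have good: "X \<in> topological_springer_fiber m k & (\<phi> X \<in> V \<longleftrightarrow> flag_map X \<in> U)" if "X \<in> N" for X
    proof -
      have X: "X \<in> topological_springer_fiber m k" using that unfolding N_def topspace_fiber by blast
      have u: "u X i ~= 0 & sphere_proj (X i) *v u X i = u X i" if i: "1 <= i" "i <= m" for i
      proof
        have "i \<in> {1..m}" using i by simp
        then show "u X i ~= 0" using \<open>X \<in> N\<close> unfolding N_def by blast
        show "sphere_proj (X i) *v u X i = u X i" unfolding u_def by (rule rank_one_idem[OF fiberD(2)[OF X i]])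
      qed
      have "\<phi> X \<in> frames m" unfolding \<phi>_def by (rule fiber_adapted(2)[OF X], erule u, assumption)
      moreover have "flag_of m (\<phi> X) = flag_map X" unfolding \<phi>_def by (rule fiber_adapted(3)[OF X], erule u, assumption)
      moreover have "\<phi> X \<in> V \<inter> frames m \<longleftrightarrow> \<phi> X \<in> {v \<in> frames m. flag_of m v \<in> U}" unfolding V(2) ..
      ultimately show ?thesis using X by simp
    qed
    have "X0 \<in> {X \<in> topspace fiber_topology. u X i \<in> - {0}}" if "i \<in> {1..m}" for i
      unfolding topspace_fiber u_def using X0(1) c[of i] that by simp
    then have X0N: "X0 \<in> N" unfolding N_def using X0(1) topspace_fiber by blast
    show "\<exists>T. openin fiber_topology T & X0 \<in> T & T \<subseteq> {X \<in> topspace fiber_topology. flag_map X \<in> U}"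
    proof (intro exI conjI)
      show "openin fiber_topology (N \<inter> {X \<in> topspace fiber_topology. \<phi> X \<in> V})" by (rule opn)
      show "X0 \<in> N \<inter> {X \<in> topspace fiber_topology. \<phi> X \<in> V}"
        using X0 X0N good[OF X0N] unfolding topspace_fiber by simp
      show "N \<inter> {X \<in> topspace fiber_topology. \<phi> X \<in> V} \<subseteq> {X \<in> topspace fiber_topology. flag_map X \<in> U}"
      proof
        fix X assume "X \<in> N \<inter> {X \<in> topspace fiber_topology. \<phi> X \<in> V}"
        then have "X \<in> N" "\<phi> X \<in> V" by simp_all
        with good[OF this(1)] show "X \<in> {X \<in> topspace fiber_topology. flag_map X \<in> U}"
          unfolding topspace_fiber by simp
      qed
    qed
  qed
qed

lemma homeomorphic_flag_map:
  "homeomorphic_map fiber_topology (subtopology (flag_topology m) (springer_fiber m \<beta> x)) flag_map"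
proof -
  let ?Y = "subtopology (flag_topology m) (springer_fiber m \<beta> x)"
  have tY: "F \<in> springer_fiber m \<beta> x" if "F \<in> topspace ?Y" for F
    using that unfolding topspace_subtopology by (rule IntD2)
  have tX: "X \<in> topological_springer_fiber m k" if "X \<in> topspace fiber_topology" for X
    using that unfolding topspace_fiber .
  have 1: "continuous_map fiber_topology ?Y flag_map"
    by (rule continuous_map_into_subtopology[OF continuous_flag_map]) (rule funcsetI, rule flag_map_springer[OF tX])
  have 2: "continuous_map ?Y fiber_topology point_of"
    by (rule continuous_map_into_subtopology[OF continuous_map_from_subtopology_mono[OF continuous_point_of springer_subset_incident]])
      (rule funcsetI, rule flag_map_point_of(1)[OF tY])
  have 3: "\<forall>X\<in>topspace fiber_topology. point_of (flag_map X) = X" by (rule ballI, rule point_of_flag_map[OF tX])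
  have 4: "\<forall>F\<in>topspace ?Y. flag_map (point_of F) = F" by (rule ballI, rule flag_map_point_of(2)[OF tY])
  show ?thesis unfolding homeomorphic_map_maps homeomorphic_maps_def by (intro exI[of _ point_of] conjI 1 2 3 4)
qed

end

section \<open>Zariski closedness of the components\<close>

text \<open>\<open>T\<close> acts diagonalizably on the kernel of \<open>K\<close>, which has dimension \<open>n\<close>, with determinant \<open>c\<close>.\<close>

definition eigen_kernel :: "nat => complex => (cseq => cseq) => (cseq => cseq) => bool" where
  "eigen_kernel n c T K \<longleftrightarrow> (\<exists>u \<mu>. (\<forall>b<n. T (u b) = (%i. \<mu> b *s u b i) & K (u b) = (%_. 0)) &
    (\<forall>w. K w = (%_. 0) --> (\<exists>\<alpha>. w = (%i. \<Sum>b<n. \<alpha> b *s u b i))) & (\<Prod>b<n. \<mu> b) = c)"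

lemma linop_sum:
  assumes K: "linop K"
  shows "K (%i. \<Sum>b<(n::nat). \<alpha> b *s u b i) = (%i. \<Sum>b<n. \<alpha> b *s K (u b) i)"
proof (induction n)
  case (Suc n)
  have "(%i. \<Sum>b<Suc n. \<alpha> b *s u b i) = (%i. \<alpha> n *s u n i + (\<Sum>b<n. \<alpha> b *s u b i))"
    by (simp add: add.commute)
  then show ?case unfolding linopD[OF K] Suc by (simp add: linopD[OF K] Suc add.commute)
qed (simp add: linop_zero[OF K])

lemma sum_lessThan_add: "(\<Sum>b<n0 + n. f b) = (\<Sum>b<n0. f b) + (\<Sum>b<n. f (n0 + b))" for f :: "nat => 'a::comm_monoid_add"
  by (induction n) (simp_all add: add.assoc)

lemma prod_lessThan_add: "(\<Prod>b<n0 + n. f b) = (\<Prod>b<n0. f b) * (\<Prod>b<n. f (n0 + b))" for f :: "nat => complex"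
  by (induction n) (simp_all add: mult.assoc)

text \<open>The kernel of the composite is an extension of the kernel of \<open>K\<close> by that of
  \<open>A\<close>. The section \<open>S\<close> intertwines \<open>T\<close> with \<open>T'\<close>
  and so lifts eigenvectors: dimensions add and determinants multiply.\<close>

lemma eigen_kernel_comp:
  assumes K: "eigen_kernel n c T K" "linop K" and A: "eigen_kernel n0 c0 T' A" "linop A"
    and S: "linop S" "\<And>w. A (S w) = w" and T: "\<And>w. T' (S w) = S (T w)"
  shows "eigen_kernel (n0 + n) (c0 * c) T' (%w. K (A w))"
proof -
  from K(1) obtain u \<mu> where u: "\<And>b. b < n ==> T (u b) = (%i. \<mu> b *s u b i) & K (u b) = (%_. 0)"
    "\<And>w. K w = (%_. 0) ==> \<exists>\<alpha>. w = (%i. \<Sum>b<n. \<alpha> b *s u b i)" "(\<Prod>b<n. \<mu> b) = c"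
    unfolding eigen_kernel_def by blast
  from A(1) obtain u0 \<mu>0 where u0: "\<And>b. b < n0 ==> T' (u0 b) = (%i. \<mu>0 b *s u0 b i) & A (u0 b) = (%_. 0)"
    "\<And>w. A w = (%_. 0) ==> \<exists>\<alpha>. w = (%i. \<Sum>b<n0. \<alpha> b *s u0 b i)" "(\<Prod>b<n0. \<mu>0 b) = c0"
    unfolding eigen_kernel_def by blast
  define U where "U b = (if b < n0 then u0 b else S (u (b - n0)))" for b
  define M where "M b = (if b < n0 then \<mu>0 b else \<mu> (b - n0))" for b
  have 1: "T' (U b) = (%i. M b *s U b i) & K (A (U b)) = (%_. 0)" if "b < n0 + n" for b
  proof (cases "b < n0")
    case True
    then show ?thesis using u0(1)[OF True] by (simp add: U_def M_def linop_zero[OF K(2)])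
  next
    case False
    then have "b - n0 < n" using that by simp
    then show ?thesis using u(1)[of "b - n0"] False by (simp add: U_def M_def T S(2) linop_scale[OF S(1)])
  qed
  have 2: "\<exists>\<gamma>. w = (%i. \<Sum>b<n0 + n. \<gamma> b *s U b i)" if w: "K (A w) = (%_. 0)" for w
  proof -
    obtain \<alpha> where \<alpha>: "A w = (%i. \<Sum>b<n. \<alpha> b *s u b i)" using u(2)[OF w] ..
    have "A (%i. w i - S (A w) i) = (%_. 0)" unfolding linop_diff[OF A(2)] S(2) by simp
    then obtain \<beta>' where \<beta>': "(%i. w i - S (A w) i) = (%i. \<Sum>b<n0. \<beta>' b *s u0 b i)" using u0(2) by blast
    have S': "S (A w) i = (\<Sum>b<n. \<alpha> b *s S (u b) i)" for i
      unfolding \<alpha> linop_sum[OF S(1)] ..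
    have "w i = (\<Sum>b<n0 + n. (if b < n0 then \<beta>' b else \<alpha> (b - n0)) *s U b i)" for i
    proof -
      have e: "w i - S (A w) i = (\<Sum>b<n0. \<beta>' b *s u0 b i)" by (rule fun_cong[OF \<beta>'])
      have "w i = (w i - S (A w) i) + S (A w) i" by simp
      also have "\<dots> = (\<Sum>b<n0. \<beta>' b *s u0 b i) + (\<Sum>b<n. \<alpha> b *s S (u b) i)" unfolding e unfolding S' ..
      finally have "w i = (\<Sum>b<n0. \<beta>' b *s u0 b i) + (\<Sum>b<n. \<alpha> b *s S (u b) i)" .
      then show ?thesis unfolding sum_lessThan_add by (simp add: U_def)
    qed
    then show ?thesis by (intro exI[of _ "%b. if b < n0 then \<beta>' b else \<alpha> (b - n0)"]) (rule ext)
  qed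
  have "(\<Prod>b<n0 + n. M b) = c0 * c" unfolding prod_lessThan_add using u(3) u0(3) by (simp add: M_def)
  with 1 2 show ?thesis unfolding eigen_kernel_def by (intro exI[of _ U] exI[of _ M]) blast
qed

lemma eigen_kernel_id: "eigen_kernel 0 1 T (%w. w)"
  unfolding eigen_kernel_def by auto

lemma eigen_kernel_shift:
  assumes "\<And>a. T (delta 0 a) = delta 0 a"
  shows "eigen_kernel 2 1 T shift"
proof -
  define u :: "nat => cseq" where "u b = delta 0 (if b = 0 then axis 1 1 else axis 2 1)" for b
  have "\<exists>\<alpha>. w = (%i. \<Sum>b<2. \<alpha> b *s u b i)" if w: "shift w = (%_. 0)" for w
  proof -
    have 0: "w (Suc i) = 0" for i using fun_cong[OF w, of i] by (simp add: shift_def)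
    have "w i = (\<Sum>b<2. (if b = 0 then w 0 $ 1 else w 0 $ 2) *s u b i)" for i
      by (cases i) (simp_all add: 0 numeral_2_eq_2 u_def delta_def vec2_eq_iff axis_def)
    then show ?thesis by (intro exI[of _ "%b. if b = 0 then w 0 $ 1 else w 0 $ 2"]) (rule ext)
  qed
  moreover have "T (u b) = (%i. 1 *s u b i) & shift (u b) = (%_. 0)" for b
    by (simp add: u_def assms shift_delta0)
  ultimately show ?thesis unfolding eigen_kernel_def by (intro exI[of _ u] exI[of _ "%_. 1"]) simp
qed

lemma eigen_kernel_Qop:
  assumes p: "rank_one p" and T: "\<And>a. T (delta 0 a) = delta 0 a"
  shows "eigen_kernel (Suc 0) 1 T (Qop p)"
proof -
  obtain e where e: "e ~= 0" "p *v e = e" using rank_one_image_nonzero[OF p] .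
  have "\<exists>\<alpha>. w = (%i. \<Sum>b<Suc 0. \<alpha> b *s delta 0 e i)" if w: "Qop p w = (%_. 0)" for w
  proof -
    obtain c where c: "w 0 = c *s e" using rank_one_image_line[OF p Qop_eq_0(2)[OF p w] e(2,1)] .
    have "w i = c *s delta 0 e i" for i
      using fun_cong[OF Qop_eq_0(1)[OF p w], of i] unfolding c by (simp add: delta_def split: if_splits)
    then show ?thesis by (intro exI[of _ "%_. c"] ext) simp
  qed
  moreover have "T (delta 0 e) = (%i. 1 *s delta 0 e i) & Qop p (delta 0 e) = (%_. 0)"
    using T Qop_delta[OF e(2)] by simp
  ultimately show ?thesis
    unfolding eigen_kernel_def by (intro exI[of _ "%_. delta 0 e"] exI[of _ "%_. 1"]) simp
qed

text \<open>It weights positions by parity, so it commutes with moves by two positions but not with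
  the shift. On the kernel of \<open>Aop p\<close>, the line of \<open>p\<close> at positions 0 and
  1, its eigenvalues are 1 and 2.\<close>

definition theta :: "cseq => cseq" where "theta w = (%i. (if even i then 1 else 2) *s w i)"

text \<open>The analogue of \<open>Pop\<close> for \<open>Aop\<close>. It moves entries by two
  positions, hence commutes with \<open>theta\<close>, which the square of \<open>Pop p\<close>
  taken factor by factor would not show.\<close>

definition Asec :: "complex ^ 2 ^ 2 => cseq => cseq" where
  "Asec p w = (%i. (if i < 2 then 0 else p *v w (i - 2)) + (w i - p *v w i))"

lemma linop_theta: "linop theta"
  by (simp add: linop_def theta_def vec2_eq_iff fun_eq_iff algebra_simps)

lemma linop_Aop: "linop (Aop p)"
  by (simp add: linop_def Aop_def fun_eq_iff mat2_mult_add mat2_mult_scale vec2_eq_iff algebra_simps)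

lemma linop_Asec: "linop (Asec p)"
  by (simp add: linop_def Asec_def fun_eq_iff mat2_mult_add mat2_mult_scale vec2_eq_iff algebra_simps)

lemma Aop_Asec: "rank_one p ==> Aop p (Asec p w) = w"
  by (simp add: fun_eq_iff Aop_def Asec_def mat2_mult_add mat2_mult_diff rank_one_idem)

lemma theta_Asec: "theta (Asec p w) = Asec p (theta w)"
  by (simp add: fun_eq_iff theta_def Asec_def mat2_mult_scale vec2_eq_iff algebra_simps)

lemma theta_zero [simp]: "theta (%_. 0) = (%_. 0)"
  by (simp add: theta_def)

lemma theta_delta0: "theta (delta 0 a) = delta 0 a"
  by (simp add: theta_def delta_def fun_eq_iff)

lemma theta_delta1: "theta (delta 1 a) = (%i. 2 *s delta 1 a i)"
  by (simp add: theta_def delta_def fun_eq_iff)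

lemma eigen_kernel_Aop:
  assumes p: "rank_one p"
  shows "eigen_kernel 2 2 theta (Aop p)"
proof -
  obtain e where e: "e ~= 0" "p *v e = e" using rank_one_image_nonzero[OF p] .
  define u where "u b = (if b = 0 then delta 0 e else delta 1 e)" for b :: nat
  have "\<exists>\<alpha>. w = (%i. \<Sum>b<2. \<alpha> b *s u b i)" if w: "Aop p w = (%_. 0)" for w
  proof -
    have s: "p *v w (Suc (Suc i)) = 0" "w i = p *v w i" for i
      using rank_one_split[OF p, of "w (Suc (Suc i))" "w i"] fun_cong[OF w, of i] unfolding Aop_def by auto
    have 0: "w (Suc (Suc i)) = 0" for i using s(1)[of i] s(2)[of "Suc (Suc i)"] by simp
    obtain c where c: "w 0 = c *s e" using rank_one_image_line[OF p s(2)[of 0, symmetric] e(2,1)] .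
    obtain d where d: "w 1 = d *s e" using rank_one_image_line[OF p s(2)[of 1, symmetric] e(2,1)] .
    have "w i = (\<Sum>b<2. (if b = 0 then c else d) *s u b i)" for i
    proof -
      consider "i = 0" | "i = 1" | l where "i = Suc (Suc l)" by (metis One_nat_def not0_implies_Suc)
      then show ?thesis by cases (use 0 c d in \<open>simp_all add: numeral_2_eq_2 u_def delta_def One_nat_def\<close>)
    qed
    then show ?thesis by (intro exI[of _ "%b. if b = 0 then c else d"]) (rule ext)
  qed
  moreover have "Aop p (delta 0 e) = (%_. 0)" "Aop p (delta 1 e) = (%_. 0)"
    using e(2) by (auto simp: Aop_def delta_def fun_eq_iff)
  then have "theta (u b) = (%i. (if b = 0 then 1 else 2) *s u b i) & Aop p (u b) = (%_. 0)" for b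
    by (simp add: u_def theta_delta0 theta_delta1)
  moreover have "(\<Prod>b<(2::nat). if b = 0 then 1 else 2) = (2 :: complex)" by (simp add: numeral_2_eq_2)
  ultimately show ?thesis
    unfolding eigen_kernel_def by (intro exI[of _ u] exI[of _ "%b. if b = 0 then 1 else 2"]) blast
qed

lemma linop_fold_Aop: "linop (fold Aop ys)"
proof (induction ys)
  case Nil
  show ?case using linop_id by (simp add: linop_def)
next
  case (Cons y ys)
  from linop_comp[OF Cons linop_Aop] show ?case by (simp add: comp_def)
qed

lemma eigen_kernel_fold_Aop:
  assumes "\<forall>y\<in>set ys. rank_one y" and K: "eigen_kernel n c theta K" "linop K"
  shows "eigen_kernel (2 * length ys + n) (2 ^ length ys * c) theta (%w. K (fold Aop ys w))"
  using assms(1)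
proof (induction ys)
  case Nil
  then show ?case using K(1) by simp
next
  case (Cons y ys)
  then have y: "rank_one y" and IH: "eigen_kernel (2 * length ys + n) (2 ^ length ys * c) theta (%w. K (fold Aop ys w))"
    by simp_all
  from eigen_kernel_comp[OF IH linop_comp[OF K(2) linop_fold_Aop] eigen_kernel_Aop[OF y] linop_Aop linop_Asec Aop_Asec[OF y] theta_Asec]
  show ?case by (simp add: mult.assoc)
qed

lemma fold_Aop_section:
  "\<forall>y\<in>set ys. rank_one y ==> \<exists>B. \<forall>w. fold Aop ys (B w) = w & theta (B w) = B (theta w)"
proof (induction ys)
  case Nil
  show ?case by (intro exI[of _ "%w. w"]) simp
next
  case (Cons y ys)
  then obtain B where B: "\<forall>w. fold Aop ys (B w) = w & theta (B w) = B (theta w)" by auto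
  have y: "rank_one y" using Cons.prems by simp
  show ?case
  proof (intro exI[of _ "%w. Asec y (B w)"] allI conjI)
    fix w
    show "fold Aop (y # ys) (Asec y (B w)) = w" using B Aop_Asec[OF y] by simp
    show "theta (Asec y (B w)) = Asec y (B (theta w))" unfolding theta_Asec using B by simp
  qed
qed

definition pad_front :: "cseq => cseq" where "pad_front w = (%i. if i = 0 then 0 else w (i - 1))"

lemma linop_pad_front: "linop pad_front"
  by (simp add: linop_def pad_front_def fun_eq_iff)

lemma shift_pad_front: "shift (pad_front w) = w"
  by (simp add: shift_def pad_front_def)

text \<open>Meant for the shifts and ray operators, which act before every \<open>Aop\<close>: on
  their kernel the lifted operator will be the identity, so they contribute only dimension.\<close>

definition split_op :: "nat => (cseq => cseq) => bool" where
  "split_op n K \<longleftrightarrow> linop K & eigen_kernel n 1 (%w. w) K & (\<exists>S. linop S & (\<forall>w. K (S w) = w))"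

lemma split_op_id: "split_op 0 (%w. w)"
  unfolding split_op_def using eigen_kernel_id linop_id by blast

lemma split_op_comp:
  assumes "split_op n K" "split_op n0 A"
  shows "split_op (n0 + n) (%w. K (A w))"
proof -
  obtain S S' where S: "linop S" "\<And>w. K (S w) = w" and S': "linop S'" "\<And>w. A (S' w) = w"
    using assms unfolding split_op_def by blast
  have K: "linop K" "eigen_kernel n 1 (%w. w) K" and A: "linop A" "eigen_kernel n0 1 (%w. w) A"
    using assms unfolding split_op_def by blast+
  have "eigen_kernel (n0 + n) (1 * 1) (%w. w) (%w. K (A w))"
    by (rule eigen_kernel_comp[OF K(2,1) A(2,1) S' refl])
  moreover have "linop (%w. K (A w))" by (rule linop_comp[OF K(1) A(1)])
  moreover have "linop (%w. S' (S w))" by (rule linop_comp[OF S'(1) S(1)])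
  moreover have "\<forall>w. K (A (S' (S w))) = w" unfolding S'(2) S(2) by simp
  ultimately show ?thesis unfolding split_op_def by (intro conjI exI[of _ "%w. S' (S w)"]) simp_all
qed

lemma split_op_rays:
  assumes "\<forall>p\<in>set ps. rank_one p"
  shows "split_op (2 * s + length ps) (%w. fold Qop ps ((shift ^^ s) w))"
proof (induction s)
  case 0
  have "split_op (length ps) (%w. fold Qop ps w)"
    using assms
  proof (induction ps)
    case Nil
    show ?case using split_op_id by simp
  next
    case (Cons p ps)
    then have p: "rank_one p" and IH: "split_op (length ps) (%w. fold Qop ps w)" by simp_all
    have "split_op (Suc 0) (Qop p)"
      unfolding split_op_def
      by (intro conjI linop_Qop eigen_kernel_Qop[OF p] exI[of _ "Pop p"] linop_Pop allI Qop_Pop[OF p] refl)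
    from split_op_comp[OF IH this] show ?case by simp
  qed
  then show ?case by simp
next
  case (Suc s)
  have "split_op 2 shift"
    unfolding split_op_def
    by (intro conjI linop_shift eigen_kernel_shift exI[of _ pad_front] linop_pad_front allI shift_pad_front refl)
  from split_op_comp[OF Suc this] show ?case by (simp add: funpow_swap1)
qed

lemma split_op_lift:
  assumes "split_op n0 \<Phi>"
  shows "\<exists>T. linop T & (\<forall>n c L. eigen_kernel n c theta L --> linop L --> eigen_kernel (n0 + n) c T (%w. L (\<Phi> w))) &
    (\<exists>S. \<forall>w. \<Phi> (S w) = w & T (S w) = S (theta w))"
proof -
  obtain S where S: "linop S" "\<And>w. \<Phi> (S w) = w" using assms unfolding split_op_def by blast
  have P: "linop \<Phi>" "eigen_kernel n0 1 (%w. w) \<Phi>" using assms unfolding split_op_def by blast+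
  \<comment> \<open>\<open>theta\<close> is transported to the image of the section
    \<open>S\<close>, and the kernel of \<Phi> is fixed. Hence on the kernel of \<open>L\<close>
    after \<Phi> the determinant is that of \<open>theta\<close> on the kernel of
    \<open>L\<close>.\<close>
  define T where "T w = (%i. S (theta (\<Phi> w)) i + (w i - S (\<Phi> w) i))" for w
  have TS: "T (S w) = S (theta w)" for w by (simp add: T_def S(2))
  have lT: "linop T"
    unfolding linop_def T_def linopD[OF P(1)] linopD[OF linop_theta] linopD[OF S(1)]
    by (simp add: fun_eq_iff vec2_eq_iff algebra_simps)
  have TK: "T w = w" if "\<Phi> w = (%_. 0)" for w
    unfolding T_def that by (simp add: linop_zero[OF S(1)])
  have E0: "eigen_kernel n0 1 T \<Phi>"
  proof -
    from P(2) obtain u \<mu> where u: "\<And>b. b < n0 ==> u b = (%i. \<mu> b *s u b i) & \<Phi> (u b) = (%_. 0)"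
      "\<And>w. \<Phi> w = (%_. 0) ==> \<exists>\<alpha>. w = (%i. \<Sum>b<n0. \<alpha> b *s u b i)" "(\<Prod>b<n0. \<mu> b) = 1"
      unfolding eigen_kernel_def by blast
    have "T (u b) = (%i. \<mu> b *s u b i)" if "b < n0" for b
    proof -
      have "T (u b) = u b" using TK u(1)[OF that] by blast
      then show ?thesis using u(1)[OF that] by (rule trans[OF _ conjunct1])
    qed
    then show ?thesis unfolding eigen_kernel_def using u by (intro exI[of _ u] exI[of _ \<mu>]) blast
  qed
  have "eigen_kernel (n0 + n) c T (%w. L (\<Phi> w))" if "eigen_kernel n c theta L" "linop L" for n c L
    using eigen_kernel_comp[OF that E0 P(1) S TS] by simp
  then show ?thesis using lT TS S(2) by blast
qed

text \<open>Expanded in the eigenbasis, a family and its image under \<open>T\<close> have the same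
  coefficient determinant; the images of the basis differ from it by the product of the
  eigenvalues.\<close>

lemma eigen_kernel_minor:
  assumes E: "eigen_kernel n c T K" and T: "linop T" and w: "\<And>d. d < n ==> K (w d) = (%_. 0)"
  shows "minor n (%d a. T (w d) (fst a) $ (snd a :: 2)) I = c * minor n (%d a. w d (fst a) $ snd a) I"
proof -
  from E obtain u \<mu> where u: "\<And>b. b < n ==> T (u b) = (%i. \<mu> b *s u b i) & K (u b) = (%_. 0)"
    "\<And>w. K w = (%_. 0) ==> \<exists>\<alpha>. w = (%i. \<Sum>b<n. \<alpha> b *s u b i)" "(\<Prod>b<n. \<mu> b) = c"
    unfolding eigen_kernel_def by blast
  have "\<forall>d. \<exists>\<alpha>. d < n --> w d = (%i. \<Sum>b<n. \<alpha> b *s u b i)" using u(2)[OF w] by blast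
  from choice[OF this] obtain A where A: "\<forall>d. d < n --> w d = (%i. \<Sum>b<n. A d b *s u b i)" ..
  have 1: "w d (fst a) $ snd a = (\<Sum>b<n. A d b * u b (fst a) $ snd a)" if "d < n" for d a
  proof -
    have "w d (fst a) = (\<Sum>b<n. A d b *s u b (fst a))" using A that by (metis (no_types))
    then show ?thesis by simp
  qed
  have 2: "T (w d) (fst a) $ snd a = (\<Sum>b<n. A d b * (\<mu> b * u b (fst a) $ snd a))" if "d < n" for d a
  proof -
    have "T (w d) = (%i. \<Sum>b<n. A d b *s T (u b) i)" using A that linop_sum[OF T, of "A d" u n] by simp
    then have "T (w d) (fst a) = (\<Sum>b<n. A d b *s T (u b) (fst a))" by (rule fun_cong)
    also have "\<dots> = (\<Sum>b<n. A d b *s (\<mu> b *s u b (fst a)))" by (rule sum.cong) (simp_all add: u(1))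
    finally show ?thesis by (simp add: mult.assoc)
  qed
  let ?D = "Determinant.det (Matrix.mat n n (\<lambda>(b, d). A d b))"
  have 3: "minor n (%d a. T (w d) (fst a) $ snd a) I = ?D * minor n (%b a. \<mu> b * u b (fst a) $ snd a) I"
    by (rule minor_lincomb) (rule 2)
  have 4: "minor n (%d a. w d (fst a) $ snd a) I = ?D * minor n (%b a. u b (fst a) $ snd a) I"
    by (rule minor_lincomb) (rule 1)
  show ?thesis unfolding 3 4 minor_diag u(3) by simp
qed

lemma linear_coeffsI:
  fixes g :: "complex ^ 'n => 'i => complex"
  assumes "\<And>\<alpha> v w b. g (\<alpha> *s v + w) b = \<alpha> * g v b + g w b"
  shows "linear_coeffs g"
proof -
  have "g v b = (\<Sum>a\<in>UNIV. g (axis a 1) b * v $ a)" for v b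
  proof -
    have "(\<chi> i. g v b) = (\<Sum>a\<in>UNIV. v $ a *s (\<chi> i. g (axis a 1) b) :: complex ^ 1)"
      by (rule linear_expand[of "%v. \<chi> i. g v b"]) (simp add: assms Finite_Cartesian_Product.vec_eq_iff)
    then have "(\<chi> i. g v b :: complex ^ 1) $ 1 = (\<Sum>a\<in>UNIV. v $ a *s (\<chi> i. g (axis a 1) b) :: complex ^ 1) $ 1"
      by (rule arg_cong)
    then show ?thesis by (simp add: mult.commute)
  qed
  then show ?thesis unfolding linear_coeffs_def by (intro exI[of _ "%b a. g (axis a 1) b"] allI)
qed

section \<open>The closed condition imposed by a strand\<close>

fun right_end :: "strand => nat" where
  "right_end (Cup i j) = j"
| "right_end (Ray i) = i"

fun forced :: "cup_diagram => (nat => complex ^ 2 ^ 2) => strand => complex ^ 2 ^ 2" where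
  "forced a \<pi> (Cup i j) = (if Cup i j \<in> dotted a then \<pi> i else compl_proj (\<pi> i))"
| "forced a \<pi> (Ray i) = ray_label a i"

lemma ray_label_pole: "ray_label a i \<in> sphere_proj ` {pole_p, - pole_p, pole_q}"
  by (simp add: ray_label_def sphere_proj_poles)

lemma rank_one_ray_label: "rank_one (ray_label a i)"
proof -
  have "{pole_p, - pole_p, pole_q} \<subseteq> sphere 0 1" using pole_sphere by simp
  moreover obtain y where y: "y \<in> {pole_p, - pole_p, pole_q}" "ray_label a i = sphere_proj y"
    using ray_label_pole[of a i] by blast
  ultimately have "y \<in> sphere 0 1" by blast
  from rank_one_sphere_proj[OF this] show ?thesis unfolding y(2) .
qed

context springer_model
begin

lemma iota_pow: "\<iota> ((x ^^ n) v) = (shift ^^ n) (\<iota> v)"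
  by (induction n) (simp_all add: iota_x)

lemma pow_lin: "(x ^^ n) (\<alpha> *s v + w) = \<alpha> *s (x ^^ n) v + (x ^^ n) w"
  by (induction n) (simp_all add: x_lin)

text \<open>The flags in \<open>Z\<close> satisfy the condition that the strand \<open>s\<close> imposes, and this condition determines
  the line of the right end of \<open>s\<close> once the earlier lines obey the diagram.\<close>

definition strand_variety :: "cup_diagram => strand => (nat => (complex ^ 'n) set) set => bool" where
  "strand_variety a s Z \<longleftrightarrow> closedin (zariski_flag_topology m) Z &
     (\<forall>\<pi>. (\<forall>i. 1 <= i --> i <= m --> rank_one (\<pi> i)) --> labelled_below a (Suc m) \<pi> --> ker_flag \<pi> \<in> flags m --> ker_flag \<pi> \<in> Z) &
     (\<forall>\<pi> u v. (\<forall>i. 1 <= i --> i <= m --> rank_one (\<pi> i)) --> labelled_below a (right_end s) \<pi> -->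
        v \<in> frames m --> flag_of m v \<in> Z --> adapted (right_end s) \<pi> u v -->
        forced a \<pi> s *v u (right_end s) = u (right_end s))"

lemma labelled_below_mono: "labelled_below a b \<pi> ==> c <= b ==> labelled_below a c \<pi>"
  unfolding labelled_below_def by (meson less_le_trans)

lemma labelled_belowD:
  assumes "labelled_below a b \<pi>"
  shows "Cup i j \<in> strands a ==> j < b ==> \<pi> j = (if Cup i j \<in> dotted a then \<pi> i else compl_proj (\<pi> i))"
    "Ray i \<in> strands a ==> i < b ==> \<pi> i = ray_label a i"
  using assms unfolding labelled_below_def by blast+

lemma Kpi_cup_interior:
  assumes a: "combinatorial_diagram m a" and r: "\<forall>i. 1 <= i --> i <= m --> rank_one (\<pi> i)"
    and C: "Cup i j \<in> strands a" and below: "labelled_below a j \<pi>"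
  shows "j - Suc i = 2 * ((j - Suc i) div 2)"
    "Kpi \<pi> 1 j w = Qop (\<pi> i) (Kpi \<pi> 1 i ((shift ^^ ((j - Suc i) div 2)) w))"
proof -
  note D = combinatorial_diagramD[OF a]
  have ij: "i < j" "1 <= i" "j <= m" using D(2)[OF C] D(1)[OF C] by auto
  obtain r where r: "j - Suc i = 2 * r" "\<And>w. Kpi \<pi> (Suc i) j w = (shift ^^ r) w"
    using cup_interior[OF a r C below] by blast
  then have r': "(j - Suc i) div 2 = r" by simp
  show "j - Suc i = 2 * ((j - Suc i) div 2)" using r(1) r' by simp
  have "Kpi \<pi> 1 j w = Kpi \<pi> (Suc i) j (Qop (\<pi> i) (Kpi \<pi> 1 i w))"
    using Kpi_split[of 1 i j \<pi> w] Kpi_first[of i j \<pi>] ij by simp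
  also have "\<dots> = Qop (\<pi> i) (Kpi \<pi> 1 i ((shift ^^ r) w))"
    unfolding r(2) funpow_shift_Qop funpow_shift_fold ..
  finally show "Kpi \<pi> 1 j w = Qop (\<pi> i) (Kpi \<pi> 1 i ((shift ^^ ((j - Suc i) div 2)) w))" unfolding r' .
qed

text \<open>With complementary end labels the composition through \<open>j\<close> equals the one
  before \<open>i\<close> preceded by \<open>(j - Suc i) div 2 + 1\<close> shifts, which is the
  stated incidence. Conversely the incidence makes \<open>u j\<close> the image of some vector under
  \<open>1 - \<pi> i\<close>, so \<open>\<pi> i\<close> kills it.\<close>

lemma undotted_variety:
  assumes a: "combinatorial_diagram m a" and C: "Cup i j \<in> strands a" "Cup i j \<notin> dotted a"
  shows "strand_variety a (Cup i j) {F \<in> flags m. (x ^^ Suc ((j - Suc i) div 2)) ` F j \<subseteq> F (i - 1)}"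
  unfolding strand_variety_def
proof (intro conjI allI impI)
  note D = combinatorial_diagramD[OF a]
  have ij: "i < j" "1 <= i" "j <= m" using D(2)[OF C(1)] D(1)[OF C(1)] by auto
  have i1: "i - 1 <= m" "Suc (i - 1) = i" using ij by simp_all
  let ?r = "(j - Suc i) div 2"
  show "closedin (zariski_flag_topology m) {F \<in> flags m. (x ^^ Suc ?r) ` F j \<subseteq> F (i - 1)}"
    by (rule closedin_zariski_incidence[OF i1(1) ij(3)], rule linear_coeffsI) (simp only: pow_lin vector_add_component vector_smult_component)
  show "ker_flag \<pi> \<in> {F \<in> flags m. (x ^^ Suc ?r) ` F j \<subseteq> F (i - 1)}"
    if r: "\<forall>i. 1 <= i --> i <= m --> rank_one (\<pi> i)" and l: "labelled_below a (Suc m) \<pi>" and k: "ker_flag \<pi> \<in> flags m" for \<pi>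
  proof -
    have below: "labelled_below a j \<pi>" by (rule labelled_below_mono[OF l]) (use ij in simp)
    have pj: "\<pi> j = compl_proj (\<pi> i)" using labelled_belowD(1)[OF l C(1)] C(2) ij by simp
    have "(x ^^ Suc ?r) v \<in> ker_flag \<pi> (i - 1)" if v: "v \<in> ker_flag \<pi> j" for v
    proof -
      have "Qop (\<pi> j) (Kpi \<pi> 1 j (\<iota> v)) = (%_. 0)" using v ij Kpi_last[of j \<pi> "\<iota> v"] by (simp add: ker_flag_def)
      then have "shift (Kpi \<pi> 1 i ((shift ^^ ?r) (\<iota> v))) = (%_. 0)"
        unfolding Kpi_cup_interior(2)[OF a r C(1) below] pj using Qop_compl[of "\<pi> i"] r ij by simp
      then have "Kpi \<pi> 1 i (\<iota> ((x ^^ Suc ?r) v)) = (%_. 0)" unfolding iota_pow shift_fold by simp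
      then show ?thesis using i1 by (simp add: ker_flag_def)
    qed
    then show ?thesis using k by blast
  qed
  show "forced a \<pi> (Cup i j) *v u (right_end (Cup i j)) = u (right_end (Cup i j))"
    if r: "\<forall>i. 1 <= i --> i <= m --> rank_one (\<pi> i)" and "labelled_below a (right_end (Cup i j)) \<pi>"
      and v: "v \<in> frames m" "flag_of m v \<in> {F \<in> flags m. (x ^^ Suc ?r) ` F j \<subseteq> F (i - 1)}"
      and "adapted (right_end (Cup i j)) \<pi> u v" for \<pi> u v
  proof -
    have below: "labelled_below a j \<pi>" and ad: "adapted j \<pi> u v" using that by simp_all
    have K: "Kpi \<pi> 1 j (\<iota> (v j)) = delta 0 (u j)" using ad ij unfolding adapted_def by simp
    have "v j \<in> flag_of m v j" using ij by (simp add: flag_of_def vec.span_base)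
    then have "(x ^^ Suc ?r) (v j) \<in> flag_of m v (i - 1)" using v(2) by blast
    then have "Kpi \<pi> 1 i (\<iota> ((x ^^ Suc ?r) (v j))) = (%_. 0)"
      using adapted_span(1)[OF adapted_mono[OF ad, of "i - 1"]] flag_of_apply[OF i1(1), of v] i1 ij by simp
    then have "shift (Kpi \<pi> 1 i ((shift ^^ ?r) (\<iota> (v j)))) = (%_. 0)" unfolding iota_pow shift_fold by simp
    then have z: "Kpi \<pi> 1 i ((shift ^^ ?r) (\<iota> (v j))) (Suc l) = 0" for l
      unfolding shift_def by (rule fun_cong)
    define b where "b = Kpi \<pi> 1 i ((shift ^^ ?r) (\<iota> (v j))) 0"
    have "Kpi \<pi> 1 i ((shift ^^ ?r) (\<iota> (v j))) = delta 0 b"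
    proof
      fix l show "Kpi \<pi> 1 i ((shift ^^ ?r) (\<iota> (v j))) l = delta 0 b l"
        by (cases l) (simp_all add: z delta_def b_def)
    qed
    then have "delta 0 (b - \<pi> i *v b) = delta 0 (u j)"
      using K unfolding Kpi_cup_interior(2)[OF a r C(1) below] by (simp add: Qop_delta')
    from fun_cong[OF this, of 0] have u: "u j = b - \<pi> i *v b" by (simp add: delta_def)
    have "rank_one (\<pi> i)" using r ij by simp
    then have "\<pi> i *v u j = 0" unfolding u by (simp add: mat2_mult_diff rank_one_idem)
    then show ?thesis using C(2) by (simp add: compl_proj_mult)
  qed
qed

lemma dots_before_ray:
  assumes a: "combinatorial_diagram m a" and R: "Ray i \<in> strands a"
  shows "dots a i = 0"
proof -
  have "\<not> (\<exists>l. Cup l j \<in> dotted a)" if "j < i" for j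
    using combinatorial_diagramD(8)[OF a _ _ R that] by fastforce
  then show ?thesis by (simp add: dots_def filter_empty_conv)
qed

text \<open>No dotted cup lies to the left of a ray, so the composition through the ray depends on
  the diagram only and not on the labels. The condition thus says that a fixed linear map vanishes
  on \<open>F i\<close>.\<close>

lemma ray_variety:
  assumes a: "combinatorial_diagram m a" and R: "Ray i \<in> strands a"
  defines "D \<equiv> %w. Qop (ray_label a i) (fold Qop (ray_list a i) ((shift ^^ ((i - 1 - length (ray_list a i)) div 2)) w))"
  shows "strand_variety a (Ray i) {F \<in> flags m. \<forall>v\<in>F i. D (\<iota> v) = (%_. 0)}"
  unfolding strand_variety_def
proof (intro conjI allI impI)
  have i: "1 <= i" "i <= m" using combinatorial_diagramD(1)[OF a R] by auto
  have lS: "linop ((shift :: cseq => cseq) ^^ n)" for n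
  proof (induction n)
    case 0
    show ?case using linop_id by (simp add: linop_def)
  next
    case (Suc n)
    from linop_comp[OF linop_shift Suc] show ?case by (simp add: comp_def)
  qed
  have lD: "linop D"
    unfolding D_def by (intro linop_comp[OF linop_Qop] linop_comp[OF linop_fold] lS)
  have Dlin: "D (\<iota> (\<alpha> *s v + w)) = (%l. \<alpha> *s D (\<iota> v) l + D (\<iota> w) l)" for \<alpha> v w
  proof -
    have "\<iota> (\<alpha> *s v + w) = (%l. \<alpha> *s \<iota> v l + \<iota> w l)" by (rule ext) (rule iota_lin)
    then show ?thesis using linopD[OF lD] by simp
  qed
  \<comment> \<open>Each scalar coordinate is copied into all entries of a vector; its vanishing on
    \<open>F i\<close> then becomes an incidence with \<open>F 0\<close>, which is the zero
    space.\<close>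
  let ?g = "\<lambda>(n, c) v. \<chi> _. D (\<iota> v) n $ (c :: 2) :: complex ^ 'n"
  have eq: "{F \<in> flags m. \<forall>v\<in>F i. D (\<iota> v) = (%_. 0)} = (\<Inter>t. {F \<in> flags m. ?g t ` F i \<subseteq> F 0})" (is "?L = ?R")
  proof (intro subset_antisym subsetI)
    fix F assume F: "F \<in> ?L"
    then have "F 0 = {0}" unfolding flags_def by blast
    moreover have "?g t v = 0" if "v \<in> F i" for t v
    proof -
      have "D (\<iota> v) = (%_. 0)" using F that by blast
      then show ?thesis by (cases t) (simp add: Finite_Cartesian_Product.vec_eq_iff)
    qed
    ultimately show "F \<in> ?R" using F by auto
  next
    fix F assume F: "F \<in> ?R"
    then have fl: "F \<in> flags m" by blast
    then have F0: "F 0 = {0}" unfolding flags_def by blast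
    have "D (\<iota> v) = (%_. 0)" if v: "v \<in> F i" for v
    proof
      fix n
      have "D (\<iota> v) n $ c = 0" for c
      proof -
        have "?g (n, c) ` F i \<subseteq> F 0" using F by blast
        then have "?g (n, c) v = 0" using v F0 by blast
        then show ?thesis by (simp add: Finite_Cartesian_Product.vec_eq_iff)
      qed
      then show "D (\<iota> v) n = 0" by (simp add: Finite_Cartesian_Product.vec_eq_iff)
    qed
    then show "F \<in> ?L" using fl by blast
  qed
  show "closedin (zariski_flag_topology m) {F \<in> flags m. \<forall>v\<in>F i. D (\<iota> v) = (%_. 0)}"
    unfolding eq
  proof (rule closedin_INT)
    fix t :: "nat \<times> 2"
    show "closedin (zariski_flag_topology m) {F \<in> flags m. ?g t ` F i \<subseteq> F 0}"
      by (rule closedin_zariski_incidence[OF le0 i(2)], rule linear_coeffsI, cases t) (simp add: Dlin)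
  qed simp
  have K: "Kpi \<pi> 1 i w = fold Qop (ray_list a i) ((shift ^^ ((i - 1 - length (ray_list a i)) div 2)) w)"
    if r: "\<forall>i. 1 <= i --> i <= m --> rank_one (\<pi> i)" and l: "labelled_below a i \<pi>" for \<pi> w
  proof -
    obtain s ys where s: "\<And>w. Kpi \<pi> 1 i w = fold Aop ys (fold Qop (ray_list a i) ((shift ^^ s) w))"
      "length ys = dots a i" "2 * s + 2 * length ys + length (ray_list a i) = i - 1"
      using structure_at_cut[OF a r cut_before_ray(1)[OF a r R] l] by blast
    have "ys = []" using s(2) dots_before_ray[OF a R] by simp
    moreover have "s = (i - 1 - length (ray_list a i)) div 2" using s(3) \<open>ys = []\<close> by simp
    ultimately show ?thesis using s(1)[of w] by simp
  qed
  show "ker_flag \<pi> \<in> {F \<in> flags m. \<forall>v\<in>F i. D (\<iota> v) = (%_. 0)}"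
    if r: "\<forall>i. 1 <= i --> i <= m --> rank_one (\<pi> i)" and l: "labelled_below a (Suc m) \<pi>" and k: "ker_flag \<pi> \<in> flags m" for \<pi>
  proof -
    have below: "labelled_below a i \<pi>" by (rule labelled_below_mono[OF l]) (use i in simp)
    have p: "\<pi> i = ray_label a i" using labelled_belowD(2)[OF l R] i by simp
    have "D (\<iota> v) = (%_. 0)" if "v \<in> ker_flag \<pi> i" for v
      using that i Kpi_last[of i \<pi> "\<iota> v"] unfolding K[OF r below] p by (simp add: ker_flag_def D_def)
    then show ?thesis using k by blast
  qed
  show "forced a \<pi> (Ray i) *v u (right_end (Ray i)) = u (right_end (Ray i))"
    if r: "\<forall>i. 1 <= i --> i <= m --> rank_one (\<pi> i)" and "labelled_below a (right_end (Ray i)) \<pi>"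
      and v: "v \<in> frames m" "flag_of m v \<in> {F \<in> flags m. \<forall>v\<in>F i. D (\<iota> v) = (%_. 0)}"
      and "adapted (right_end (Ray i)) \<pi> u v" for \<pi> u v
  proof -
    have below: "labelled_below a i \<pi>" and ad: "adapted i \<pi> u v" using that by simp_all
    have Ki: "Kpi \<pi> 1 i (\<iota> (v i)) = delta 0 (u i)" using ad i unfolding adapted_def by simp
    have "v i \<in> flag_of m v i" using i by (simp add: flag_of_def vec.span_base)
    then have "D (\<iota> (v i)) = (%_. 0)" using v(2) by blast
    then have "delta 0 (u i - ray_label a i *v u i) = (%_. 0)"
      using Ki unfolding K[OF r below] D_def by (simp add: Qop_delta')
    from fun_cong[OF this, of 0] show ?thesis by (simp add: delta_def)
  qed
qed

text \<open>The condition is that the \<open>j\<close>-th exterior power of the lift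
  \<open>T\<close> of \<open>theta\<close> acts on \<open>F j\<close> by \<open>2 ^ Suc d\<close>.
  It makes \<open>F j\<close> stable under \<open>T\<close>, which forces the line at
  \<open>j\<close> to be the image or the kernel of the projection at \<open>i\<close>; the
  eigenvalue excludes the kernel.\<close>

lemma dotted_variety:
  assumes a: "combinatorial_diagram m a" and C: "Cup i j \<in> dotted a"
  shows "\<exists>Z. strand_variety a (Cup i j) Z"
proof -
  note D = combinatorial_diagramD[OF a]
  have S: "Cup i j \<in> strands a" by (rule D(7)[OF C])
  have ij: "i < j" "1 <= i" "j <= m" using D(2)[OF S] D(1)[OF S] by auto
  have cutj: "is_cut a m (Suc j)"
    unfolding is_cut_def
  proof (intro conjI allI impI notI)
    fix u w assume U: "Cup u w \<in> strands a" "u < Suc j & Suc j <= w"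
    have "u ~= j"
    proof
      assume "u = j"
      then have "Cup i j = Cup u w" by (intro D(3)[OF S U(1), of j]) simp_all
      then show False using \<open>u = j\<close> ij by simp
    qed
    then show False using D(9)[OF C _ U(1), of j] U(2) by simp
  qed (use ij in simp_all)
  have "\<forall>i. 1 <= i --> i <= m --> rank_one ((%_. qmat) i)" by (simp add: rank_one_qmat)
  from cut_left_end[OF a this S cutj] have cuti: "is_cut a m i" .
  define d where "d = dots a i"
  define rl where "rl = ray_list a i"
  \<comment> \<open>The vertices before \<open>i\<close> that belong neither to rays nor to dotted
    cups come in pairs, and so do those strictly under the cup; each pair is one shift.\<close>
  define e where "e = (i - 1 - length rl - 2 * d) div 2 + (j - Suc i) div 2"
  define \<Phi> where "\<Phi> w = fold Qop rl ((shift ^^ e) w)" for w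
  have "\<forall>p\<in>set rl. rank_one p" unfolding rl_def ray_list_def using rank_one_ray_label by auto
  then have "split_op (2 * e + length rl) \<Phi>" unfolding \<Phi>_def by (rule split_op_rays)
  from split_op_lift[OF this] obtain T Sc where T: "linop T"
    "\<And>n c L. eigen_kernel n c theta L ==> linop L ==> eigen_kernel (2 * e + length rl + n) c T (%w. L (\<Phi> w))"
    "\<And>w. \<Phi> (Sc w) = w" "\<And>w. T (Sc w) = Sc (theta w)" by blast
  have struct: "\<exists>ys. (\<forall>y\<in>set ys. rank_one y) & length ys = d & 2 * e + length rl + 2 * d + 2 = j &
      (\<forall>w. Kpi \<pi> 1 (Suc j) w = Qop (\<pi> j) (Qop (\<pi> i) (fold Aop ys (\<Phi> w))))"
    if r: "\<forall>i. 1 <= i --> i <= m --> rank_one (\<pi> i)" and l: "labelled_below a j \<pi>" for \<pi>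
  proof -
    have li: "labelled_below a i \<pi>" by (rule labelled_below_mono[OF l]) (use ij in simp)
    obtain s ys where s: "\<And>w. Kpi \<pi> 1 i w = fold Aop ys (fold Qop rl ((shift ^^ s) w))" "\<forall>y\<in>set ys. rank_one y"
      "length ys = d" "2 * s + 2 * length ys + length rl = i - 1"
      using structure_at_cut[OF a r cuti li] unfolding rl_def d_def by blast
    have s': "(i - 1 - length rl - 2 * d) div 2 = s" using s(3,4) by simp
    have K: "Kpi \<pi> 1 (Suc j) w = Qop (\<pi> j) (Qop (\<pi> i) (fold Aop ys (\<Phi> w)))" for w
    proof -
      have "(shift ^^ s) ((shift ^^ ((j - Suc i) div 2)) w) = (shift ^^ e) w"
        unfolding e_def s' by (simp add: funpow_add)
      then show ?thesis
        using Kpi_last[of j \<pi> w] ij unfolding Kpi_cup_interior(2)[OF a r S l] s(1) \<Phi>_def by simp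
    qed
    define r' where "r' = (j - Suc i) div 2"
    have "j - Suc i = 2 * r'" using Kpi_cup_interior(1)[OF a r S l] unfolding r'_def .
    then have "j = 2 * r' + Suc i" using ij(1) by linarith
    moreover have "i = Suc (2 * s + 2 * d + length rl)" using s(3,4) ij(2) by linarith
    ultimately have "2 * e + length rl + 2 * d + 2 = j" unfolding e_def s' r'_def[symmetric] by simp
    then show ?thesis using s(2,3) K by blast
  qed
  define M where "M w = (%c b. w c (fst b) $ (snd b :: 2))" for w :: "nat => cseq"
  define C' where "C' = (2 :: complex) ^ Suc d"
  \<comment> \<open>Quantifying over all families in \<open>F j\<close> makes this a condition on
    the flag instead of a frame; for dependent families both minors vanish.\<close>
  define P where "P F \<longleftrightarrow> (\<forall>w. (\<forall>c<j. w c \<in> F j) --> (\<forall>I. length I = j -->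
    minor j (M (%c. T (\<iota> (w c)))) I = C' * minor j (M (%c. \<iota> (w c))) I))" for F :: "nat => (complex ^ 'n) set"
  let ?S = "%v b. \<iota> v (fst b) $ (snd b :: 2)"
  let ?T = "%v b. T (\<iota> v) (fst b) $ (snd b :: 2)"
  have linS: "linear_coeffs ?S" by (rule linear_coeffsI) (simp add: iota_lin)
  have Tlin: "T (\<iota> (\<alpha> *s v + w)) = (%l. \<alpha> *s T (\<iota> v) l + T (\<iota> w) l)" for \<alpha> v w
  proof -
    have "\<iota> (\<alpha> *s v + w) = (%l. \<alpha> *s \<iota> v l + \<iota> w l)" by (rule ext) (rule iota_lin)
    then show ?thesis using linopD[OF T(1)] by simp
  qed
  have linT: "linear_coeffs ?T" by (rule linear_coeffsI) (simp add: Tlin)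
  have P_iff: "P (flag_of m v) \<longleftrightarrow> (\<forall>I. length I = j -->
      minor j (%c. ?T (v (Suc c))) I = C' * minor j (%c. ?S (v (Suc c))) I)" for v :: "nat => complex ^ 'n"
  proof
    assume P: "P (flag_of m v)"
    have "v (Suc c) \<in> flag_of m v j" if "c < j" for c
      using that ij by (simp add: flag_of_def vec.span_base)
    then show "\<forall>I. length I = j --> minor j (%c. ?T (v (Suc c))) I = C' * minor j (%c. ?S (v (Suc c))) I"
      using P[unfolded P_def M_def, rule_format, of "%c. v (Suc c)"] by simp
  next
    assume *: "\<forall>I. length I = j --> minor j (%c. ?T (v (Suc c))) I = C' * minor j (%c. ?S (v (Suc c))) I"
    show "P (flag_of m v)"
      unfolding P_def M_def
    proof (intro allI impI)
      fix w and I :: "(nat \<times> 2) list" assume w: "\<forall>c<j. w c \<in> flag_of m v j" and I: "length I = j"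
      have "\<forall>c. \<exists>\<alpha>. c < j --> w c = (\<Sum>b<j. \<alpha> b *s v (Suc b))"
        using w ij unfolding flag_of_apply[OF ij(3)] span_image_atLeastAtMost by blast
      from choice[OF this] obtain A where A: "\<forall>c. c < j --> w c = (\<Sum>b<j. A c b *s v (Suc b))" ..
      have 1: "?T (w c) b = (\<Sum>l<j. A c l * ?T (v (Suc l)) b)" if "c < j" for c b
        using A[rule_format, OF that] linear_coeffs_sum[OF linT, of "A c" "%l. v (Suc l)" "{..<j}" b] by simp
      have 2: "?S (w c) b = (\<Sum>l<j. A c l * ?S (v (Suc l)) b)" if "c < j" for c b
        using A[rule_format, OF that] linear_coeffs_sum[OF linS, of "A c" "%l. v (Suc l)" "{..<j}" b] by simp
      let ?D = "Determinant.det (Matrix.mat j j (\<lambda>(b, c). A c b))"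
      have 3: "minor j (%c. ?T (w c)) I = ?D * minor j (%c. ?T (v (Suc c))) I" by (rule minor_lincomb) (rule 1)
      have 4: "minor j (%c. ?S (w c)) I = ?D * minor j (%c. ?S (v (Suc c))) I" by (rule minor_lincomb) (rule 2)
      show "minor j (%c b. T (\<iota> (w c)) (fst b) $ snd b) I = C' * minor j (%c b. \<iota> (w c) (fst b) $ snd b) I"
        unfolding 3 4 using *[rule_format, OF I] by simp
    qed
  qed
  have "strand_variety a (Cup i j) {F \<in> flags m. P F}"
    unfolding strand_variety_def
  proof (intro conjI allI impI)
    show "closedin (zariski_flag_topology m) {F \<in> flags m. P F}"
      by (rule closedin_zariski_eigen[OF ij(3) linS linT P_iff])
    show "ker_flag \<pi> \<in> {F \<in> flags m. P F}"
      if r: "\<forall>i. 1 <= i --> i <= m --> rank_one (\<pi> i)" and l: "labelled_below a (Suc m) \<pi>" and k: "ker_flag \<pi> \<in> flags m" for \<pi>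
    proof -
      have below: "labelled_below a j \<pi>" by (rule labelled_below_mono[OF l]) (use ij in simp)
      obtain ys where ys: "\<forall>y\<in>set ys. rank_one y" "length ys = d" "2 * e + length rl + 2 * d + 2 = j"
        "\<And>w. Kpi \<pi> 1 (Suc j) w = Qop (\<pi> j) (Qop (\<pi> i) (fold Aop ys (\<Phi> w)))"
        using struct[OF r below] by blast
      have pj: "\<pi> j = \<pi> i" using labelled_belowD(1)[OF l S] C ij by simp
      have ri: "rank_one (\<pi> i)" using r ij by simp
      have K: "Kpi \<pi> 1 (Suc j) w = fold Aop (ys @ [\<pi> i]) (\<Phi> w)" for w
        unfolding ys(4) pj Qop_Qop[OF ri] by simp
      have "\<forall>y\<in>set (ys @ [\<pi> i]). rank_one y" using ys(1) ri by simp
      from eigen_kernel_fold_Aop[OF this eigen_kernel_id linop_id]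
      have "eigen_kernel (2 * d + 2) C' theta (fold Aop (ys @ [\<pi> i]))" using ys(2) by (simp add: C'_def comp_def)
      from T(2)[OF this linop_fold_Aop] have E: "eigen_kernel j C' T (Kpi \<pi> 1 (Suc j))"
        unfolding K[symmetric] ys(3)[symmetric] by (simp add: add.assoc)
      have "P (ker_flag \<pi>)"
        unfolding P_def M_def
      proof (intro allI impI)
        fix w and I :: "(nat \<times> 2) list" assume w: "\<forall>c<j. w c \<in> ker_flag \<pi> j" and I: "length I = j"
        have "Kpi \<pi> 1 (Suc j) (\<iota> (w c)) = (%_. 0)" if "c < j" for c
          using w that ij by (simp add: ker_flag_def)
        from eigen_kernel_minor[OF E T(1) this]
        show "minor j (%c b. T (\<iota> (w c)) (fst b) $ snd b) I = C' * minor j (%c b. \<iota> (w c) (fst b) $ snd b) I" .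
      qed
      then show ?thesis using k by blast
    qed
    show "forced a \<pi> (Cup i j) *v u (right_end (Cup i j)) = u (right_end (Cup i j))"
      if r: "\<forall>i. 1 <= i --> i <= m --> rank_one (\<pi> i)" and "labelled_below a (right_end (Cup i j)) \<pi>"
        and v: "v \<in> frames m" "flag_of m v \<in> {F \<in> flags m. P F}"
        and "adapted (right_end (Cup i j)) \<pi> u v" for \<pi> u v
    proof -
      have below: "labelled_below a j \<pi>" and ad: "adapted j \<pi> u v" using that by simp_all
      obtain ys where ys: "\<forall>y\<in>set ys. rank_one y" "length ys = d" "2 * e + length rl + 2 * d + 2 = j"
        "\<And>w. Kpi \<pi> 1 (Suc j) w = Qop (\<pi> j) (Qop (\<pi> i) (fold Aop ys (\<Phi> w)))"
        using struct[OF r below] by blast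
      let ?K = "Kpi \<pi> 1 (Suc j)"
      define p q \<alpha> where "p = \<pi> i" and "q = \<pi> j" and "\<alpha> = u j"
      have pq: "rank_one p" "rank_one q" and \<alpha>: "\<alpha> ~= 0" "q *v \<alpha> = \<alpha>"
        using r ij ad unfolding adapted_def p_def q_def \<alpha>_def by auto
      have K: "?K w = Qop q (Qop p (fold Aop ys (\<Phi> w)))" for w unfolding ys(4) p_def q_def ..
      have eq: "minor j (%c. ?T (v (Suc c))) I = C' * minor j (%c. ?S (v (Suc c))) I" if "length I = j" for I
        using v(2) P_iff that by blast
      have span: "vec.span (v ` {1..j}) = {w. ?K (\<iota> w) = (%_. 0)}" by (rule adapted_span(1)[OF ad])
      have Kv: "?K (\<iota> (v (Suc c))) = (%_. 0)" if "c < j" for c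
      proof -
        have "v (Suc c) \<in> vec.span (v ` {1..j})" using that by (intro vec.span_base) simp
        then show ?thesis unfolding span by simp
      qed
      have "\<exists>J. length J = j & minor j (%c. ?S (v (Suc c))) J ~= 0"
      proof (rule minor_nonzero_exists)
        fix \<gamma> assume g: "\<And>b. (\<Sum>c<j. \<gamma> c * ?S (v (Suc c)) b) = 0"
        have "\<iota> (\<Sum>c<j. \<gamma> c *s v (Suc c)) = (%_. 0)"
        proof
          fix l
          have "\<iota> (\<Sum>c<j. \<gamma> c *s v (Suc c)) l $ c' = 0" for c'
            using linear_coeffs_sum[OF linS, of \<gamma> "%c. v (Suc c)" "{..<j}" "(l, c')"] g[of "(l, c')"] by simp
          then show "\<iota> (\<Sum>c<j. \<gamma> c *s v (Suc c)) l = 0" by (simp add: Finite_Cartesian_Product.vec_eq_iff)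
        qed
        from frame_independent[OF v(1) ij(3) iota_eq_zero[OF this]] show "\<forall>c<j. \<gamma> c = 0" by blast
      qed
      then obtain J where J: "length J = j" "minor j (%c. ?S (v (Suc c))) J ~= 0" by blast
      have C0: "C' ~= 0" by (simp add: C'_def)
      \<comment> \<open>The minors of the images under \<open>T\<close> are a nonzero multiple of
        those of the originals, so Cramer's rule puts the images back into the same span: the kernel
        is stable under \<open>T\<close>.\<close>
      have KT: "?K (T (\<iota> (v (Suc c)))) = (%_. 0)" if c: "c < j" for c
      proof -
        have "?T (v (Suc c)) b * minor j (%c. ?S (v (Suc c))) J =
            (\<Sum>l<j. ?T (v (Suc c)) (J ! l) * minor j (%c. ?S (v (Suc c))) (J[l := b]))" for b
        proof -
          have "?T (v (Suc c)) b * minor j (%c. ?T (v (Suc c))) J =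
              (\<Sum>l<j. ?T (v (Suc c)) (J ! l) * minor j (%c. ?T (v (Suc c))) (J[l := b]))"
            by (rule minor_cramer[OF J(1), where \<alpha> = "%d. if d = c then 1 else 0"]) (use c in \<open>simp add: if_distrib[of "%z. z * _"] cong: if_cong\<close>)
          moreover have "minor j (%c. ?T (v (Suc c))) (J[l := b]) = C' * minor j (%c. ?S (v (Suc c))) (J[l := b])" for l
            by (rule eq) (simp add: J(1))
          ultimately have "C' * (?T (v (Suc c)) b * minor j (%c. ?S (v (Suc c))) J) =
              C' * (\<Sum>l<j. ?T (v (Suc c)) (J ! l) * minor j (%c. ?S (v (Suc c))) (J[l := b]))"
            unfolding eq[OF J(1)] by (simp add: sum_distrib_left mult_ac)
          then show ?thesis using C0 by simp
        qed
        from minor_cramer_converse[OF J this] obtain \<gamma> where \<gamma>: "\<forall>b. ?T (v (Suc c)) b = (\<Sum>d<j. \<gamma> d * ?S (v (Suc d)) b)" ..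
        have "T (\<iota> (v (Suc c))) = (%l. \<Sum>d<j. \<gamma> d *s \<iota> (v (Suc d)) l)"
        proof
          fix l
          have "T (\<iota> (v (Suc c))) l $ c' = (\<Sum>d<j. \<gamma> d *s \<iota> (v (Suc d)) l) $ c'" for c'
            using \<gamma>[rule_format, of "(l, c')"] by simp
          then show "T (\<iota> (v (Suc c))) l = (\<Sum>d<j. \<gamma> d *s \<iota> (v (Suc d)) l)" by (simp add: Finite_Cartesian_Product.vec_eq_iff)
        qed
        then have "?K (T (\<iota> (v (Suc c)))) = (%l. \<Sum>d<j. \<gamma> d *s ?K (\<iota> (v (Suc d))) l)"
          using linop_sum[OF linop_Kpi, of \<pi> 1 "Suc j" \<gamma> "%d. \<iota> (v (Suc d))" j] by simp
        also have "\<dots> = (%_. 0)" using Kv by simp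
        finally show ?thesis .
      qed
      have inv: "?K (T w) = (%_. 0)" if w: "?K w = (%_. 0)" for w
      proof -
        obtain w' where w': "w = \<iota> w'" using adapted_span(4)[OF ad w] by blast
        then have "w' \<in> vec.span (v ` {1..j})" using w unfolding span by simp
        then obtain \<gamma> where \<gamma>: "w' = (\<Sum>c<j. \<gamma> c *s v (Suc c))" unfolding span_image_atLeastAtMost by blast
        have "T w = (%l. \<Sum>c<j. \<gamma> c *s T (\<iota> (v (Suc c))) l)"
        proof
          fix l
          have "T w l $ c' = (\<Sum>c<j. \<gamma> c *s T (\<iota> (v (Suc c))) l) $ c'" for c'
            using linear_coeffs_sum[OF linT, of \<gamma> "%c. v (Suc c)" "{..<j}" "(l, c')"] unfolding w' \<gamma> by simp
          then show "T w l = (\<Sum>c<j. \<gamma> c *s T (\<iota> (v (Suc c))) l)" by (simp add: Finite_Cartesian_Product.vec_eq_iff)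
        qed
        then have "?K (T w) = (%l. \<Sum>c<j. \<gamma> c *s ?K (T (\<iota> (v (Suc c)))) l)"
          using linop_sum[OF linop_Kpi, of \<pi> 1 "Suc j" \<gamma> "%c. T (\<iota> (v (Suc c)))" j] by simp
        also have "\<dots> = (%_. 0)" using KT by simp
        finally show ?thesis .
      qed
      obtain B where B: "\<And>w. fold Aop ys (B w) = w" "\<And>w. theta (B w) = B (theta w)"
        using fold_Aop_section[OF ys(1)] by blast
      \<comment> \<open>A test element: the lift of \<open>z\<close> lies in the kernel, and
        \<open>theta\<close> doubles just the part of \<open>z\<close> at position 1, which is
        \<open>p *v \<alpha>\<close>. Stability then places \<open>p *v \<alpha>\<close> on the line
        of \<open>q\<close>.\<close>
      define z where "z = Pop p (delta 0 \<alpha>)"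
      have "?K (Sc (B z)) = (%_. 0)" unfolding K T(3) B(1) z_def Qop_Pop[OF pq(1)] by (rule Qop_delta[OF \<alpha>(2)])
      from inv[OF this] have "Qop q (Qop p (theta z)) = (%_. 0)" unfolding T(4) K T(3) B(2) B(1) .
      moreover have "Qop p (theta z) = delta 0 (\<alpha> + p *v \<alpha>)"
      proof
        fix l
        consider "l = 0" | "l = 1" | l' where "l = Suc (Suc l')" by (metis One_nat_def not0_implies_Suc)
        then show "Qop p (theta z) l = delta 0 (\<alpha> + p *v \<alpha>) l"
        proof cases
          case 1
          then show ?thesis
            by (simp add: Qop_def theta_def z_def Pop_def delta_def mat2_mult_scale mat2_mult_diff rank_one_idem[OF pq(1)] vec2_eq_iff)
        qed (simp_all add: Qop_def theta_def z_def Pop_def delta_def mat2_mult_scale mat2_mult_diff rank_one_idem[OF pq(1)] One_nat_def)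
      qed
      ultimately have "delta 0 (\<alpha> + p *v \<alpha> - q *v (\<alpha> + p *v \<alpha>)) = (%_. 0)" by (simp add: Qop_delta')
      from fun_cong[OF this, of 0] have "q *v (p *v \<alpha>) = p *v \<alpha>" by (simp add: delta_def mat2_mult_add \<alpha>(2))
      from rank_one_image_line[OF pq(2) this \<alpha>(2,1)] obtain c where c: "p *v \<alpha> = c *s \<alpha>" .
      have "c *s (c *s \<alpha>) = c *s \<alpha>" using rank_one_idem[OF pq(1), of \<alpha>] unfolding c mat2_mult_scale c .
      then have "c = 0 \<or> c = 1" using \<alpha>(1) by (auto simp: vec2_eq_iff)
      moreover have "c ~= 0"
      proof
        \<comment> \<open>In this case the kernel is killed already when the last two operators are
          replaced by a single shift; then \<open>theta\<close> contributes only the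
          \<open>d\<close> earlier dots, and the determinant would be \<open>2 ^ d\<close>.\<close>
        assume "c = 0"
        then have pz: "p *v \<alpha> = 0" using c by simp
        have L: "shift (fold Aop ys (\<Phi> (\<iota> (v (Suc c))))) = (%_. 0)" if "c < j" for c
        proof -
          have "Qop q (Qop p (fold Aop ys (\<Phi> (\<iota> (v (Suc c)))))) = (%_. 0)" using Kv[OF that] unfolding K .
          from Qop_eq_0[OF pq(2) this] obtain b where b: "Qop p (fold Aop ys (\<Phi> (\<iota> (v (Suc c))))) = delta 0 b" "q *v b = b" by blast
          obtain c' where c': "b = c' *s \<alpha>" using rank_one_image_line[OF pq(2) b(2) \<alpha>(2,1)] .
          have "compl_proj p *v b = b" unfolding c' compl_proj_mult mat2_mult_scale pz by simp
          from Qop_delta[OF this] show ?thesis unfolding Qop_compl[OF pq(1), symmetric] b(1) .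
        qed
        have "eigen_kernel (2 * d + 2) (2 ^ d) theta (%w. shift (fold Aop ys w))"
          using eigen_kernel_fold_Aop[OF ys(1) eigen_kernel_shift[OF theta_delta0] linop_shift] ys(2) by simp
        from T(2)[OF this linop_comp[OF linop_shift linop_fold_Aop]]
        have E: "eigen_kernel j (2 ^ d) T (%w. shift (fold Aop ys (\<Phi> w)))"
          unfolding ys(3)[symmetric] by (simp add: add.assoc)
        have "minor j (%c. ?T (v (Suc c))) J = 2 ^ d * minor j (%c. ?S (v (Suc c))) J"
          by (rule eigen_kernel_minor[OF E T(1) L])
        then have "(2 :: complex) ^ d = 2 ^ Suc d" using eq[OF J(1)] J(2) unfolding C'_def by simp
        then show False by simp
      qed
      ultimately have "p *v \<alpha> = \<alpha>" using c by simp
      then show ?thesis using C by (simp add: p_def \<alpha>_def)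
    qed
  qed
  then show ?thesis ..
qed

lemma strand_variety_exists:
  assumes "combinatorial_diagram m a" "s \<in> strands a"
  shows "\<exists>Z. strand_variety a s Z"
proof (cases s)
  case (Cup i j)
  then show ?thesis using undotted_variety dotted_variety assms by blast
next
  case (Ray i)
  then show ?thesis using ray_variety assms by blast
qed

end

section \<open>Irreducibility of the components\<close>

definition polyfun :: "(complex => complex) => bool" where
  "polyfun f \<longleftrightarrow> (\<exists>p. \<forall>s. f s = Polynomial.poly p s)"

lemma polyfun_const: "polyfun (%s. c)"
  unfolding polyfun_def by (intro exI[of _ "[:c:]"]) simp

lemma polyfun_id: "polyfun (%s. s)"
  unfolding polyfun_def by (intro exI[of _ "[:0, 1:]"]) simp

lemma polyfun_add:
  assumes "polyfun f" "polyfun g" shows "polyfun (%s. f s + g s)"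
proof -
  from assms obtain p q where "\<forall>s. f s = Polynomial.poly p s" "\<forall>s. g s = Polynomial.poly q s"
    unfolding polyfun_def by blast
  then show ?thesis unfolding polyfun_def by (intro exI[of _ "p + q"]) simp
qed

lemma polyfun_mult:
  assumes "polyfun f" "polyfun g" shows "polyfun (%s. f s * g s)"
proof -
  from assms obtain p q where "\<forall>s. f s = Polynomial.poly p s" "\<forall>s. g s = Polynomial.poly q s"
    unfolding polyfun_def by blast
  then show ?thesis unfolding polyfun_def by (intro exI[of _ "p * q"]) simp
qed

lemma polyfun_diff: "polyfun f ==> polyfun g ==> polyfun (%s. f s - g s)"
  using polyfun_add[OF _ polyfun_mult[OF polyfun_const[of "-1"]], of f g] by simp

lemma polyfun_sum: "(\<And>i. i \<in> A ==> polyfun (f i)) ==> polyfun (%s. \<Sum>i\<in>A. f i s)"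
  by (induction A rule: infinite_finite_induct) (simp_all add: polyfun_const polyfun_add)

lemma polyfun_prod: "(\<And>i. i \<in> A ==> polyfun (f i)) ==> polyfun (%s. \<Prod>i\<in>A. f i s)"
  by (induction A rule: infinite_finite_induct) (simp_all add: polyfun_const polyfun_mult)

lemmas polyfun_intros = polyfun_const polyfun_id polyfun_add polyfun_mult polyfun_diff polyfun_sum polyfun_prod

lemma polyfun_finite_zeros:
  assumes "polyfun f" "f s0 ~= 0"
  shows "finite {s. f s = 0}"
proof -
  obtain p where p: "\<forall>s. f s = Polynomial.poly p s" using assms(1) unfolding polyfun_def ..
  then have "p ~= 0" using assms(2) by auto
  from poly_roots_finite[OF this] show ?thesis using p by simp
qed

lemma polynomial_map_polyfun:
  "polynomial_map f ==> (\<And>i. polyfun (%s. g s i)) ==> polyfun (%s. f (g s))"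
  by (induction rule: polynomial_map.induct) (auto intro: polyfun_intros)

lemma polyfun_plucker:
  assumes "\<And>i a. i \<in> {1..m} ==> polyfun (%s. W s i $ a)"
  shows "polyfun (%s. plucker m (W s) J)"
proof (cases "length J <= m")
  case True
  have "polyfun (%s. W s (Suc (\<sigma> i)) $ b)" if "\<sigma> permutes {..<length J}" "i < length J" for \<sigma> i b
  proof (rule assms)
    have "\<sigma> i \<in> {..<length J}" using permutes_in_image[OF that(1)] that(2) by blast
    then show "Suc (\<sigma> i) \<in> {1..m}" using True by simp
  qed
  then show ?thesis unfolding plucker_def using True by (auto intro!: polyfun_intros)
qed (simp add: plucker_def polyfun_const)

lemma triangular_frame:
  fixes w :: "nat => complex ^ 'n"
  assumes w: "w \<in> frames m" and L: "\<And>i. i \<in> {1..m} ==> L i (i - 1) ~= 0"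
  defines "v \<equiv> \<lambda>i\<in>{1..m}. \<Sum>c<i. L i c *s w (Suc c)"
  shows "v \<in> frames m" "flag_of m v = flag_of m w"
proof -
  have v: "v i \<in> vec.span (w ` {1..n})" if "i \<in> {1..n}" "n <= m" for i n
  proof -
    have 1: "v i = (\<Sum>c<i. L i c *s w (Suc c))" using that by (simp add: v_def)
    have 2: "w (Suc c) \<in> w ` {1..n}" if "c \<in> {..<i}" for c using \<open>i \<in> {1..n}\<close> that by auto
    show ?thesis unfolding 1 by (intro vec.span_sum vec.span_scale vec.span_base 2)
  qed
  have w': "w i \<in> vec.span (v ` {1..i})" if "i \<in> {1..m}" for i
    using that
  proof (induction i rule: less_induct)
    case (less i)
    from less.prems obtain l where l: "i = Suc l" by (cases i) auto
    have "v i = (\<Sum>c<i. L i c *s w (Suc c))" using less.prems by (simp add: v_def)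
    then have "L i (i - 1) *s w i = v i - (\<Sum>c<i - 1. L i c *s w (Suc c))" by (simp add: l)
    also have "\<dots> \<in> vec.span (v ` {1..i})"
    proof (intro vec.span_diff vec.span_sum vec.span_scale)
      show "v i \<in> vec.span (v ` {1..i})" using less.prems by (intro vec.span_base) simp
      fix c assume c: "c \<in> {..<i - 1}"
      then have "w (Suc c) \<in> vec.span (v ` {1..Suc c})" using less.prems by (intro less.IH) auto
      moreover have "vec.span (v ` {1..Suc c}) \<subseteq> vec.span (v ` {1..i})" using c by (intro vec.span_mono image_mono) auto
      ultimately show "w (Suc c) \<in> vec.span (v ` {1..i})" by blast
    qed
    finally have "(1 / L i (i - 1)) *s (L i (i - 1) *s w i) \<in> vec.span (v ` {1..i})" by (rule vec.span_scale)
    then show ?case using L[OF less.prems] by simp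
  qed
  have sp: "vec.span (v ` {1..n}) = vec.span (w ` {1..n})" if n: "n <= m" for n
  proof (rule subset_antisym; rule vec.span_minimal[OF _ vec.subspace_span])
    show "v ` {1..n} \<subseteq> vec.span (w ` {1..n})" using v n by blast
    show "w ` {1..n} \<subseteq> vec.span (v ` {1..n})"
    proof
      fix y assume "y \<in> w ` {1..n}"
      then obtain i where i: "i \<in> {1..n}" "y = w i" by blast
      have "vec.span (v ` {1..i}) \<subseteq> vec.span (v ` {1..n})" using i by (intro vec.span_mono image_mono) auto
      then show "y \<in> vec.span (v ` {1..n})" using w'[of i] i n by auto
    qed
  qed
  show "flag_of m v = flag_of m w" unfolding flag_of_def by (rule restrict_ext) (simp add: sp)
  have wi: "inj_on w {1..m}" "vec.independent (w ` {1..m})" using w unfolding frames_def by blast+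
  have dm: "vec.dim (vec.span (w ` {1..m})) = m"
    using vec.dim_span_eq_card_independent[OF wi(2)] card_image[OF wi(1)] by simp
  have cv: "card (v ` {1..m}) <= m" using card_image_le[of "{1..m}" v] by simp
  have "vec.independent (v ` {1..m})"
    by (rule vec.card_le_dim_spanning[of _ "vec.span (w ` {1..m})"])
      (use cv dm sp[OF order_refl] in \<open>auto intro: vec.span_base\<close>)
  moreover have "card (v ` {1..m}) = m"
    using vec.dim_span_eq_card_independent[OF calculation] dm sp[OF order_refl] by simp
  then have "inj_on v {1..m}" by (intro eq_card_imp_inj_on) simp_all
  ultimately show "v \<in> frames m" unfolding frames_def v_def by simp
qed

lemma same_flag_triangular:
  fixes w v :: "nat => complex ^ 'n"
  assumes w: "w \<in> frames m" and v: "v \<in> frames m" and eq: "flag_of m v = flag_of m w"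
  shows "\<exists>L. (\<forall>i\<in>{1..m}. L i (i - 1) ~= 0) & v = (\<lambda>i\<in>{1..m}. \<Sum>c<i. L i c *s w (Suc c))"
proof -
  have sp: "vec.span (v ` {1..n}) = vec.span (w ` {1..n})" if "n <= m" for n
    using fun_cong[OF eq, of n] that by (simp add: flag_of_def)
  have "\<forall>i. \<exists>\<alpha>. i \<in> {1..m} --> v i = (\<Sum>c<i. \<alpha> c *s w (Suc c))"
  proof
    fix i
    show "\<exists>\<alpha>. i \<in> {1..m} --> v i = (\<Sum>c<i. \<alpha> c *s w (Suc c))"
    proof (cases "i \<in> {1..m}")
      case True
      then have "v i \<in> vec.span (v ` {1..i})" by (intro vec.span_base) simp
      then show ?thesis using sp[of i] True unfolding span_image_atLeastAtMost by auto
    qed blast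
  qed
  from choice[OF this] obtain L where L: "\<forall>i. i \<in> {1..m} --> v i = (\<Sum>c<i. L i c *s w (Suc c))" ..
  have "L i (i - 1) ~= 0" if i: "i \<in> {1..m}" for i
  proof
    assume 0: "L i (i - 1) = 0"
    from i obtain l where l: "i = Suc l" by (cases i) auto
    have lm: "i - 1 <= m" using i l by simp
    have "v i = (\<Sum>c<i. L i c *s w (Suc c))" using L i by blast
    then have "v i = (\<Sum>c<i - 1. L i c *s w (Suc c))" using 0 by (simp add: l)
    then have "v i \<in> vec.span (w ` {1..i - 1})" unfolding span_image_atLeastAtMost by blast
    then have "v i \<in> vec.span (v ` {1..i - 1})" unfolding sp[OF lm] .
    then obtain \<gamma> where \<gamma>: "v i = (\<Sum>c<i - 1. \<gamma> c *s v (Suc c))" unfolding span_image_atLeastAtMost by blast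
    have sum0: "(\<Sum>c<i. (if c = l then -1 else \<gamma> c) *s v (Suc c)) = 0"
      using \<gamma> by (simp add: l)
    have im: "i <= m" "l < i" using i l by auto
    from frame_independent[OF v im(1) sum0 im(2)] show False by simp
  qed
  moreover have "v = (\<lambda>i\<in>{1..m}. \<Sum>c<i. L i c *s w (Suc c))"
  proof (rule extensionalityI)
    show "v \<in> extensional {1..m}" using v unfolding frames_def by blast
    show "(\<lambda>i\<in>{1..m}. \<Sum>c<i. L i c *s w (Suc c)) \<in> extensional {1..m}" by simp
    fix i assume "i \<in> {1..m}"
    then show "v i = (\<lambda>i\<in>{1..m}. \<Sum>c<i. L i c *s w (Suc c)) i" using L by simp
  qed
  ultimately show ?thesis by blast
qed

text \<open>A frame of one flag of the curve that witnesses \<open>f \<noteq> 0\<close> is transported along the curve by a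
  constant triangular matrix, so that \<open>f\<close> becomes a polynomial in the parameter.\<close>

lemma zariski_curve:
  fixes W :: "complex => nat => complex ^ 'n"
  assumes W: "\<And>s. W s \<in> frames m" and poly: "\<And>i a. i \<in> {1..m} ==> polyfun (%s. W s i $ a)"
    and U: "openin (zariski_flag_topology m) U"
  shows "finite {s. flag_of m (W s) \<notin> U} \<or> (\<forall>s. flag_of m (W s) \<notin> U)"
proof -
  from U have "generate_topology_on {{F \<in> flags m. \<exists>v\<in>frames m. flag_of m v = F & f (plucker m v) ~= 0} | f. polynomial_map f} U"
    unfolding zariski_flag_topology_def openin_topology_generated_by_iff .
  then show ?thesis
  proof (induction rule: generate_topology_on.induct)
    case Empty
    show ?case by simp
  next
    case (Int A B)
    have "{s. flag_of m (W s) \<notin> A \<inter> B} = {s. flag_of m (W s) \<notin> A} \<union> {s. flag_of m (W s) \<notin> B}" by blast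
    then show ?case using Int by auto
  next
    case (UN K)
    show ?case
    proof (cases "\<exists>k\<in>K. \<exists>s. flag_of m (W s) \<in> k")
      case True
      then obtain k where k: "k \<in> K" "finite {s. flag_of m (W s) \<notin> k}" using UN.IH by blast
      have "{s. flag_of m (W s) \<notin> \<Union>K} \<subseteq> {s. flag_of m (W s) \<notin> k}" using k(1) by blast
      then show ?thesis using k(2) finite_subset by blast
    qed auto
  next
    case (Basis B)
    then obtain f where f: "polynomial_map f" "B = {F \<in> flags m. \<exists>v\<in>frames m. flag_of m v = F & f (plucker m v) ~= 0}" by blast
    show ?case
    proof (cases "\<exists>s. flag_of m (W s) \<in> B")
      case True
      then obtain s0 v where s0: "v \<in> frames m" "flag_of m v = flag_of m (W s0)" "f (plucker m v) ~= 0"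
        unfolding f(2) by blast
      obtain L where L: "\<forall>i\<in>{1..m}. L i (i - 1) ~= 0" "v = (\<lambda>i\<in>{1..m}. \<Sum>c<i. L i c *s W s0 (Suc c))"
        using same_flag_triangular[OF W s0(1,2)] by blast
      define V where "V s = (\<lambda>i\<in>{1..m}. \<Sum>c<i. L i c *s W s (Suc c))" for s
      have V: "V s \<in> frames m" "flag_of m (V s) = flag_of m (W s)" for s
        unfolding V_def using triangular_frame[OF W, of L s] L(1) by simp_all
      have "polyfun (%s. V s i $ b)" if i: "i \<in> {1..m}" for i b
      proof -
        have "polyfun (%s. \<Sum>c<i. L i c * W s (Suc c) $ b)" by (intro polyfun_intros poly) (use i in auto)
        then show ?thesis using i by (simp add: V_def)
      qed
      then have "polyfun (%s. f (plucker m (V s)))" by (intro polynomial_map_polyfun[OF f(1)] polyfun_plucker)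
      moreover have "f (plucker m (V s0)) ~= 0" using s0(3) unfolding V_def L(2)[symmetric] .
      ultimately have "finite {s. f (plucker m (V s)) = 0}" by (rule polyfun_finite_zeros)
      moreover have "{s. flag_of m (W s) \<notin> B} \<subseteq> {s. f (plucker m (V s)) = 0}"
      proof
        fix s assume "s \<in> {s. flag_of m (W s) \<notin> B}"
        then have "\<not> (\<exists>v\<in>frames m. flag_of m v = flag_of m (W s) & f (plucker m v) ~= 0)"
          using flag_of_in_flags[OF W] unfolding f(2) by blast
        then show "s \<in> {s. f (plucker m (V s)) = 0}" using V by blast
      qed
      ultimately show ?thesis using finite_subset by blast
    qed blast
  qed
qed

text \<open>The curve leaves \<open>A'\<close> at parameter 0 and \<open>B'\<close> at parameter 1,
  so it meets each of them in finitely many parameters only; some other parameter gives a point of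
  \<open>C\<close> outside both.\<close>

lemma irreducible_by_curves:
  fixes C S :: "(nat => (complex ^ 'n) set) set"
  assumes sub: "C \<subseteq> S" "S \<subseteq> flags m" and ne: "C ~= {}"
    and curve: "\<And>P Q. P \<in> C ==> Q \<in> C ==> \<exists>W. (\<forall>s. W s \<in> frames m) & (\<forall>i\<in>{1..m}. \<forall>a. polyfun (%s. W s i $ a)) &
      (\<forall>s. flag_of m (W s) \<in> C) & flag_of m (W 0) = P & flag_of m (W 1) = Q"
  shows "irreducible_in (subtopology (zariski_flag_topology m) S) C"
  unfolding irreducible_in_def
proof (intro conjI allI impI ne)
  show "C \<subseteq> topspace (subtopology (zariski_flag_topology m) S)" using sub by auto
  fix A B
  assume AB: "closedin (subtopology (zariski_flag_topology m) S) A & closedin (subtopology (zariski_flag_topology m) S) B & C \<subseteq> A \<union> B"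
  obtain A' where A': "closedin (zariski_flag_topology m) A'" "A = A' \<inter> S" using AB unfolding closedin_subtopology by blast
  obtain B' where B': "closedin (zariski_flag_topology m) B'" "B = B' \<inter> S" using AB unfolding closedin_subtopology by blast
  show "C \<subseteq> A \<or> C \<subseteq> B"
  proof (rule ccontr)
    assume "\<not> (C \<subseteq> A \<or> C \<subseteq> B)"
    then obtain P Q where PQ: "P \<in> C" "P \<notin> A" "Q \<in> C" "Q \<notin> B" by blast
    obtain W where W: "\<And>s. W s \<in> frames m" "\<And>i a. i \<in> {1..m} ==> polyfun (%s. W s i $ a)"
      "\<And>s. flag_of m (W s) \<in> C" "flag_of m (W 0) = P" "flag_of m (W 1) = Q"
      using curve[OF PQ(1,3)] by blast
    have open': "openin (zariski_flag_topology m) (flags m - D)" if "closedin (zariski_flag_topology m) D" for D :: "(nat => (complex ^ 'n) set) set"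
      using that unfolding closedin_def by simp
    have inf: "C \<subseteq> flags m" "C \<subseteq> S" using sub by blast+
    have "flag_of m (W 0) \<in> flags m - A'" "flag_of m (W 1) \<in> flags m - B'"
      unfolding W(4,5) using PQ inf A'(2) B'(2) by blast+
    then have "finite {s. flag_of m (W s) \<notin> flags m - A'}" "finite {s. flag_of m (W s) \<notin> flags m - B'}"
      using zariski_curve[OF W(1,2) open'[OF A'(1)]] zariski_curve[OF W(1,2) open'[OF B'(1)]] by blast+
    then have "finite ({s. flag_of m (W s) \<notin> flags m - A'} \<union> {s. flag_of m (W s) \<notin> flags m - B'})" by simp
    from ex_new_if_finite[OF infinite_UNIV_char_0 this] obtain s where
      "flag_of m (W s) \<in> flags m - A'" "flag_of m (W s) \<in> flags m - B'" by blast
    then show False using AB W(3)[of s] A'(2) B'(2) by blast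
  qed
qed

text \<open>An irreducible set containing \<open>C a\<close> lies in a single member of the finite
  closed cover, and by incomparability that member is \<open>C a\<close>.\<close>

lemma irreducible_component_finite_cover:
  assumes fin: "finite I" and cl: "\<And>b. b \<in> I ==> closedin T (C b)" and irr: "\<And>b. b \<in> I ==> irreducible_in T (C b)"
    and cover: "topspace T = (\<Union>b\<in>I. C b)" and anti: "\<And>a b. a \<in> I ==> b \<in> I ==> C a \<subseteq> C b ==> a = b" and a: "a \<in> I"
  shows "irreducible_component_of T (C a)"
  unfolding irreducible_component_of_def
proof (intro conjI allI impI)
  show "irreducible_in T (C a)" by (rule irr[OF a])
  fix D assume D: "irreducible_in T D & C a \<subseteq> D"
  have ne: "D ~= {}" and irrD: "\<And>A B. closedin T A ==> closedin T B ==> D \<subseteq> A \<union> B ==> D \<subseteq> A \<or> D \<subseteq> B"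
    and sub: "D \<subseteq> topspace T"
    using D unfolding irreducible_in_def by blast+
  have "\<exists>b\<in>J. D \<subseteq> C b" if "finite J" "J \<subseteq> I" "D \<subseteq> (\<Union>b\<in>J. C b)" for J
    using that
  proof (induction J rule: finite_induct)
    case empty
    then show ?case using ne by simp
  next
    case (insert b J)
    have "closedin T (\<Union>b\<in>J. C b)" using insert.hyps(1) insert.prems(1) cl by (intro closedin_Union) auto
    moreover have "closedin T (C b)" using cl insert.prems(1) by blast
    moreover have "D \<subseteq> C b \<union> (\<Union>b\<in>J. C b)" using insert.prems(2) by simp
    ultimately have "D \<subseteq> C b \<or> D \<subseteq> (\<Union>b\<in>J. C b)" using irrD by blast
    then show ?case using insert.IH insert.prems(1) by blast
  qed
  from this[OF fin order_refl] obtain b where b: "b \<in> I" "D \<subseteq> C b" using sub unfolding cover by blast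
  then have "a = b" using D anti[OF a b(1)] by blast
  then show "D = C a" using D b by blast
qed

text \<open>If the lines differ, the image moves along \<open>a + s (b - a)\<close> while the kernel
  stays spanned by \<open>b - a\<close>, which is never on the moving line. Spanning vectors of
  image and kernel are recorded because complementing exchanges the two.\<close>

lemma rank_one_path:
  assumes a: "a ~= 0" and b: "b ~= 0"
  shows "\<exists>p w w'. (\<forall>i j. polyfun (%s. p s $ i $ j)) & (\<forall>i. polyfun (%s. w s $ i)) & (\<forall>i. polyfun (%s. w' s $ i)) &
    (\<forall>s. rank_one (p s) & w s ~= 0 & p s *v w s = w s & w' s ~= 0 & p s *v w' s = 0) & p 0 *v a = a & p 1 *v b = b"
proof (cases "area a b = 0")
  case True
  define P where "P = sphere_proj (hopf a)"
  have P: "rank_one P" "P *v a = a"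
    unfolding P_def by (rule rank_one_sphere_proj[OF hopf_sphere[OF a]]) (rule hopf_proj[OF a])
  obtain d where d: "d ~= 0" "compl_proj P *v d = d" using rank_one_image_nonzero[OF rank_one_compl[OF P(1)]] .
  have d0: "P *v d = 0" using d(2) by (simp add: compl_proj_mult)
  have "\<exists>c. b = c *s a"
  proof (cases "a $ 1 = 0")
    case True
    then have a2: "a $ 2 ~= 0" using a by (simp add: vec2_eq_iff)
    then have "b $ 1 = 0" using \<open>area a b = 0\<close> True by (simp add: area_def)
    then show ?thesis using True a2 by (intro exI[of _ "b $ 2 / a $ 2"]) (simp add: vec2_eq_iff)
  next
    case False
    then show ?thesis using \<open>area a b = 0\<close>
      by (intro exI[of _ "b $ 1 / a $ 1"]) (simp add: vec2_eq_iff area_def field_simps)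
  qed
  then have "P *v b = b" using P(2) by (auto simp: mat2_mult_scale)
  then show ?thesis
    using P d d0 a by (intro exI[of _ "%_. P"] exI[of _ "%_. a"] exI[of _ "%_. d"]) (simp add: polyfun_const)
next
  case False
  define D d where "D = area a b" and "d = b - a"
  define e where "e s = a + s *s d" for s
  \<comment> \<open>The projection sends \<open>y\<close> to \<open>e s\<close> scaled by
    \<open>area y d / D\<close>. It is polynomial in \<open>s\<close> because
    \<open>area (e s) d\<close> is constantly \<open>D\<close>, so the denominator does not
    vary.\<close>
  define p :: "complex => complex ^ 2 ^ 2" where "p s = (\<chi> i j. (if j = 1 then d $ 2 / D else - d $ 1 / D) * e s $ i)" for s
  have D: "D ~= 0" using False by (simp add: D_def)
  have D': "a $ 1 * d $ 2 - a $ 2 * d $ 1 = D" by (simp add: D_def d_def area_def algebra_simps)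
  have De: "e s $ 1 * d $ 2 - e s $ 2 * d $ 1 = D" for s
    unfolding D'[symmetric] by (simp add: e_def algebra_simps)
  have pm: "p s *v y = ((y $ 1 * d $ 2 - y $ 2 * d $ 1) / D) *s e s" for s y
    by (simp add: vec2_eq_iff mat2_mult_nth p_def diff_divide_distrib algebra_simps)
  have "p s $ 1 $ 1 + p s $ 2 $ 2 = (e s $ 1 * d $ 2 - e s $ 2 * d $ 1) / D" for s
    by (simp add: p_def diff_divide_distrib algebra_simps)
  then have "rank_one (p s)" for s
    unfolding rank_one_def De using D by (simp add: p_def)
  moreover have "e s ~= 0" for s using De[of s] D by auto
  moreover have "p s *v e s = e s" for s unfolding pm De using D by simp
  moreover have "p s *v d = 0" for s unfolding pm by simp
  moreover have "d ~= 0" using D' D by auto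
  moreover have "p 0 *v a = a" unfolding pm D' using D by (simp add: e_def)
  moreover have "p 1 *v b = b"
  proof -
    have "e 1 = b" by (simp add: e_def d_def)
    then show ?thesis using \<open>\<And>s. p s *v e s = e s\<close>[of 1] by simp
  qed
  moreover have pe: "polyfun (%s. e s $ i)" for i unfolding e_def by (simp, intro polyfun_intros)
  moreover have "polyfun (%s. p s $ i $ j)" for i j
  proof -
    have "p s $ i $ j = (if j = 1 then d $ 2 / D else - d $ 1 / D) * e s $ i" for s by (simp add: p_def)
    then show ?thesis by (simp only:) (intro polyfun_mult polyfun_const pe)
  qed
  ultimately show ?thesis by (intro exI[of _ p] exI[of _ e] exI[of _ "%_. d"]) (simp add: polyfun_const)
qed

text \<open>The generic values on cups and the prescribed poles on rays are compatible with all
  conditions; the existence of such a point makes every component nonempty.\<close>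

lemma sphere_component_generic:
  assumes ca: "combinatorial_diagram m a"
  shows "\<exists>X\<in>sphere_component m a.
    (\<forall>i j. Cup i j \<in> strands a --> X j = generic_point j)"
proof -
  note A = combinatorial_diagramD[OF ca]
  define st where "st l = (SOME s. s \<in> strands a & l \<in> ends s)" for l
  have st: "st l \<in> strands a" "l \<in> ends (st l)" if "1 <= l" "l <= m" for l
    using someI_ex[of "%s. s \<in> strands a & l \<in> ends s"] A(4)[OF that] unfolding st_def by blast+
  have st_eq: "st l = s" if "s \<in> strands a" "l \<in> ends s" for l s
    using A(3)[OF st(1) that(1) st(2) that(2)] A(1)[OF that] by blast
  define val where "val s l = (case s of Cup i j => if l = i & s \<notin> dotted a then - generic_point j else generic_point j
     | Ray i => if s \<in> dotted a then pole_p else if \<forall>j. Ray j \<in> strands a --> j <= i then - pole_p else pole_q)" for s l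
  define X where "X = (\<lambda>l\<in>{1..m}. val (st l) l)"
  have X: "X l = val s l" if "s \<in> strands a" "l \<in> ends s" for l s
    using st_eq[OF that] A(1)[OF that] by (simp add: X_def)
  have XC: "X i = (if Cup i j \<in> dotted a then generic_point j else - generic_point j)" "X j = generic_point j"
    if "Cup i j \<in> strands a" for i j
    using X[OF that, of i] X[OF that, of j] A(2)[OF that] by (auto simp: val_def)
  have XR: "X i = (if Ray i \<in> dotted a then pole_p else if \<forall>j. Ray j \<in> strands a --> j <= i then - pole_p else pole_q)"
    if "Ray i \<in> strands a" for i
    using X[OF that, of i] by (simp add: val_def)
  have "labelled uminus pole_p (- pole_p) pole_q a X"
    unfolding labelled_def using XC XR by simp
  moreover have "X l \<in> sphere 0 1" if "l \<in> {1..m}" for l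
  proof -
    have l: "1 <= l" "l <= m" using that by auto
    show ?thesis
      using pole_sphere generic_point_sphere unfolding X[OF st[OF l]] by (cases "st l") (auto simp: val_def)
  qed
  ultimately have XS: "X \<in> sphere_component m a"
    unfolding sphere_component_labelled by (auto simp: X_def)
  show ?thesis by (rule bexI[OF _ XS]) (simp add: XC(2))
qed

section \<open>Polynomial families of labels obeying a diagram\<close>

context springer_model
begin

lemma strand_ends:
  assumes a: "combinatorial_diagram m a" and s: "s \<in> strands a"
  shows "1 <= right_end s" "right_end s <= m" "\<And>i j. s = Cup i j ==> i < j"
    "\<And>t. t \<in> strands a ==> right_end t = right_end s ==> t = s"
proof -
  note D = combinatorial_diagramD[OF a]
  have e: "right_end t \<in> ends t" for t by (cases t) auto
  show "1 <= right_end s" "right_end s <= m" using D(1)[OF s e] by auto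
  show "i < j" if "s = Cup i j" for i j using D(2) s that by blast
  show "t = s" if "t \<in> strands a" "right_end t = right_end s" for t
    by (rule D(3)[OF that(1) s e]) (simp add: that(2) e)
qed

lemma strand_varietyD:
  assumes "strand_variety a s Z"
  shows "closedin (zariski_flag_topology m) Z"
    and "\<forall>i. 1 <= i --> i <= m --> rank_one (\<pi> i) ==> labelled_below a (Suc m) \<pi> ==> ker_flag \<pi> \<in> flags m ==> ker_flag \<pi> \<in> Z"
    and "\<forall>i. 1 <= i --> i <= m --> rank_one (\<pi> i) ==> labelled_below a (right_end s) \<pi> ==> v \<in> frames m ==>
      flag_of m v \<in> Z ==> adapted (right_end s) \<pi> u v ==> forced a \<pi> s *v u (right_end s) = u (right_end s)"
  using assms unfolding strand_variety_def by blast+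

lemma forced_upd:
  assumes a: "combinatorial_diagram m a" and s: "s \<in> strands a" "right_end s = e"
  shows "forced a (\<pi>(e := p)) s = forced a \<pi> s"
proof (cases s)
  case (Cup i j)
  then have "i ~= e" using strand_ends(3)[OF a s(1) Cup] s(2) by simp
  then show ?thesis using Cup by simp
qed simp

lemma labelled_below_Suc:
  assumes a: "combinatorial_diagram m a" and l: "labelled_below a e \<pi>"
    and s: "\<And>s. s \<in> strands a ==> right_end s = e ==> \<pi> e = forced a \<pi> s"
  shows "labelled_below a (Suc e) \<pi>"
  unfolding labelled_below_def
proof (intro conjI allI impI)
  fix i j assume *: "Cup i j \<in> strands a" "j < Suc e"
  show "\<pi> j = (if Cup i j \<in> dotted a then \<pi> i else compl_proj (\<pi> i))"
  proof (cases "j = e")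
    case True
    then show ?thesis using s[OF *(1)] by simp
  next
    case False
    then show ?thesis using labelled_belowD(1)[OF l *(1)] *(2) by simp
  qed
next
  fix i assume *: "Ray i \<in> strands a" "i < Suc e"
  show "\<pi> i = ray_label a i"
  proof (cases "i = e")
    case True
    then show ?thesis using s[OF *(1)] by simp
  next
    case False
    then show ?thesis using labelled_belowD(2)[OF l *(1)] *(2) by simp
  qed
qed

lemma labelled_below_upd:
  assumes a: "combinatorial_diagram m a" and l: "labelled_below a e \<pi>"
  shows "labelled_below a e (\<pi>(e := p))"
  unfolding labelled_below_def
proof (intro conjI allI impI)
  fix i j assume *: "Cup i j \<in> strands a" "j < e"
  then have "i < e" "j ~= e" using strand_ends(3)[OF a *(1) refl] by simp_all
  then show "(\<pi>(e := p)) j = (if Cup i j \<in> dotted a then (\<pi>(e := p)) i else compl_proj ((\<pi>(e := p)) i))"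
    using labelled_belowD(1)[OF l *] by simp
next
  fix i assume *: "Ray i \<in> strands a" "i < e"
  then show "(\<pi>(e := p)) i = ray_label a i" using labelled_belowD(2)[OF l *] by simp
qed

lemma adapted_upd:
  assumes ad: "adapted n \<pi> u v" and K: "Kpi \<pi> 1 (Suc n) (\<iota> (v (Suc n))) = delta 0 \<alpha>"
    and p: "rank_one p" "\<alpha> ~= 0" "p *v \<alpha> = \<alpha>"
  shows "adapted (Suc n) (\<pi>(Suc n := p)) (u(Suc n := \<alpha>)) v"
  unfolding adapted_def
proof
  fix i assume i: "i \<in> {1..Suc n}"
  have Kc: "Kpi (\<pi>(Suc n := p)) 1 i = Kpi \<pi> 1 i" by (rule Kpi_cong) (use i in auto)
  show "rank_one ((\<pi>(Suc n := p)) i) & (u(Suc n := \<alpha>)) i ~= 0 &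
      (\<pi>(Suc n := p)) i *v (u(Suc n := \<alpha>)) i = (u(Suc n := \<alpha>)) i &
      Kpi (\<pi>(Suc n := p)) 1 i (\<iota> (v i)) = delta 0 ((u(Suc n := \<alpha>)) i)"
  proof (cases "i = Suc n")
    case True
    then show ?thesis unfolding Kc using p K by simp
  next
    case False
    then have "i \<in> {1..n}" using i by auto
    then show ?thesis unfolding Kc using ad False unfolding adapted_def by simp
  qed
qed

text \<open>The condition of the strand is stated for frames adapted through its right end. The
  orthogonal projection onto the line of \<alpha> serves as a provisional label there, and the
  forced label does not involve it.\<close>

lemma strand_forced:
  assumes a: "combinatorial_diagram m a" and s: "s \<in> strands a" "right_end s = Suc n" and Z: "strand_variety a s Z"
    and r: "\<And>i. rank_one (\<pi> i)" and l: "labelled_below a (Suc n) \<pi>"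
    and v: "v \<in> frames m" "flag_of m v \<in> Z" and ad: "adapted n \<pi> u v"
    and \<alpha>: "\<alpha> ~= 0" "Kpi \<pi> 1 (Suc n) (\<iota> (v (Suc n))) = delta 0 \<alpha>"
  shows "forced a \<pi> s *v \<alpha> = \<alpha>"
proof -
  let ?p = "sphere_proj (hopf \<alpha>)" and ?e = "Suc n"
  have p: "rank_one ?p" "?p *v \<alpha> = \<alpha>" by (rule rank_one_sphere_proj[OF hopf_sphere[OF \<alpha>(1)]]) (rule hopf_proj[OF \<alpha>(1)])
  have "\<forall>i. 1 <= i --> i <= m --> rank_one ((\<pi>(?e := ?p)) i)" using r p(1) by simp
  moreover have "labelled_below a (right_end s) (\<pi>(?e := ?p))" unfolding s(2) by (rule labelled_below_upd[OF a l])
  moreover have "adapted (right_end s) (\<pi>(?e := ?p)) (u(?e := \<alpha>)) v"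
    unfolding s(2) by (rule adapted_upd[OF ad \<alpha>(2) p(1) \<alpha>(1) p(2)])
  ultimately have "forced a (\<pi>(?e := ?p)) s *v (u(?e := \<alpha>)) (right_end s) = (u(?e := \<alpha>)) (right_end s)"
    using Z v unfolding strand_variety_def by blast
  then show ?thesis unfolding forced_upd[OF a s] s(2) by simp
qed

text \<open>Nowhere vanishing polynomial spanning vectors \<open>w\<close> of the image and
  \<open>w'\<close> of the kernel accompany the labels. Complementing a label swaps them, so every
  label that a strand can force has such vectors again.\<close>

definition good_path :: "cup_diagram => nat => (complex => nat => complex ^ 2 ^ 2) => (complex => nat => complex ^ 2) =>
    (complex => nat => complex ^ 2) => bool" where
  "good_path a n \<pi> w w' \<longleftrightarrow>
     (\<forall>i r c. polyfun (%s. \<pi> s i $ r $ c)) & (\<forall>i r. polyfun (%s. w s i $ r)) & (\<forall>i r. polyfun (%s. w' s i $ r)) &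
     (\<forall>s i. rank_one (\<pi> s i) & w s i ~= 0 & \<pi> s i *v w s i = w s i & w' s i ~= 0 & \<pi> s i *v w' s i = 0) &
     (\<forall>s. labelled_below a (Suc n) (\<pi> s))"

lemma good_pathD:
  assumes "good_path a n \<pi> w w'"
  shows "polyfun (%s. \<pi> s i $ r $ c)" "polyfun (%s. w s i $ r)" "polyfun (%s. w' s i $ r)" "rank_one (\<pi> s i)"
    "w s i ~= 0" "\<pi> s i *v w s i = w s i" "w' s i ~= 0" "\<pi> s i *v w' s i = 0" "labelled_below a (Suc n) (\<pi> s)"
  using assms unfolding good_path_def by blast+

lemma good_path_upd:
  assumes G: "good_path a n \<pi> w w'" and a: "combinatorial_diagram m a"
    and p: "\<And>r c. polyfun (%s. p s $ r $ c)" "\<And>r. polyfun (%s. y s $ r)" "\<And>r. polyfun (%s. y' s $ r)"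
      "\<And>s. rank_one (p s) & y s ~= 0 & p s *v y s = y s & y' s ~= 0 & p s *v y' s = 0"
    and f: "\<And>t s. t \<in> strands a ==> right_end t = Suc n ==> p s = forced a (\<pi> s) t"
  shows "good_path a (Suc n) (%s. (\<pi> s)(Suc n := p s)) (%s. (w s)(Suc n := y s)) (%s. (w' s)(Suc n := y' s))"
proof -
  have 1: "polyfun (%s. ((\<pi> s)(Suc n := p s)) i $ r $ c)" for i r c
    by (cases "i = Suc n") (simp_all add: p(1) good_pathD(1)[OF G])
  have 2: "polyfun (%s. ((w s)(Suc n := y s)) i $ r)" for i r
    by (cases "i = Suc n") (simp_all add: p(2) good_pathD(2)[OF G])
  have 3: "polyfun (%s. ((w' s)(Suc n := y' s)) i $ r)" for i r
    by (cases "i = Suc n") (simp_all add: p(3) good_pathD(3)[OF G])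
  have 4: "rank_one (((\<pi> s)(Suc n := p s)) i) & ((w s)(Suc n := y s)) i ~= 0 &
      ((\<pi> s)(Suc n := p s)) i *v ((w s)(Suc n := y s)) i = ((w s)(Suc n := y s)) i &
      ((w' s)(Suc n := y' s)) i ~= 0 & ((\<pi> s)(Suc n := p s)) i *v ((w' s)(Suc n := y' s)) i = 0" for s i
    by (cases "i = Suc n") (use p(4)[of s] good_pathD(4-8)[OF G] in simp_all)
  have 5: "labelled_below a (Suc (Suc n)) ((\<pi> s)(Suc n := p s))" for s
  proof (rule labelled_below_Suc[OF a labelled_below_upd[OF a good_pathD(9)[OF G]]])
    fix t assume t: "t \<in> strands a" "right_end t = Suc n"
    show "((\<pi> s)(Suc n := p s)) (Suc n) = forced a ((\<pi> s)(Suc n := p s)) t"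
      unfolding forced_upd[OF a t] using f[OF t] by simp
  qed
  show ?thesis unfolding good_path_def using 1 2 3 4 5 by blast
qed

lemma forced_path:
  assumes G: "good_path a n \<pi> w w'"
  shows "\<exists>y y'. (\<forall>r c. polyfun (%s. forced a (\<pi> s) t $ r $ c)) & (\<forall>r. polyfun (%s. y s $ r)) & (\<forall>r. polyfun (%s. y' s $ r)) &
    (\<forall>s. rank_one (forced a (\<pi> s) t) & y s ~= 0 & forced a (\<pi> s) t *v y s = y s & y' s ~= 0 & forced a (\<pi> s) t *v y' s = 0)"
proof (cases t)
  case (Cup i j)
  show ?thesis
  proof (cases "Cup i j \<in> dotted a")
    case True
    then show ?thesis unfolding Cup
      by (intro exI[of _ "%s. w s i"] exI[of _ "%s. w' s i"]) (simp add: good_pathD[OF G])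
  next
    case False
    have "polyfun (%s. compl_proj (\<pi> s i) $ r $ c)" for r c
      unfolding compl_proj_def vector_minus_component by (intro polyfun_diff polyfun_const good_pathD(1)[OF G])
    then show ?thesis unfolding Cup using False
      by (intro exI[of _ "%s. w' s i"] exI[of _ "%s. w s i"]) (simp add: good_pathD[OF G] rank_one_compl compl_proj_mult)
  qed
next
  case (Ray i)
  let ?p = "ray_label a i"
  obtain y where y: "y ~= 0" "?p *v y = y" using rank_one_image_nonzero[OF rank_one_ray_label] .
  obtain z where z: "z ~= 0" "compl_proj ?p *v z = z" using rank_one_image_nonzero[OF rank_one_compl[OF rank_one_ray_label]] .
  have "?p *v z = 0" using z(2) by (simp add: compl_proj_mult)
  then show ?thesis unfolding Ray using y z(1)
    by (intro exI[of _ "%_. y"] exI[of _ "%_. z"]) (simp add: polyfun_const rank_one_ray_label)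
qed

text \<open>Labels are chosen from left to right. At the right end of a strand the label is forced,
  and the varieties of the strand make it fit both flags; elsewhere \<open>rank_one_path\<close>
  joins the two lines. At the parameters 0 and 1 only the resulting flags matter, so the labels may
  be oblique there too.\<close>

lemma good_path_exists:
  assumes a: "combinatorial_diagram m a" and Z: "\<And>s. s \<in> strands a ==> strand_variety a s (Z s)"
    and v: "v \<in> frames m" "flag_of m v \<in> incident_flags" "\<And>s. s \<in> strands a ==> flag_of m v \<in> Z s"
    and v': "v' \<in> frames m" "flag_of m v' \<in> incident_flags" "\<And>s. s \<in> strands a ==> flag_of m v' \<in> Z s"
    and n: "n <= m"
  shows "\<exists>\<pi> w w' u u'. good_path a n \<pi> w w' & adapted n (\<pi> 0) u v & adapted n (\<pi> 1) u' v'"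
  using n
proof (induction n)
  case 0
  \<comment> \<open>\<open>qmat\<close> is a placeholder for all positions that have not received a
    label yet.\<close>
  have "qmat *v axis 1 1 = axis 1 1" "qmat *v axis 2 1 = 0" by (simp_all add: vec2_eq_iff qmat_mult axis_def)
  moreover have "labelled_below a (Suc 0) (%_. qmat)"
  proof -
    have "1 <= right_end s" if "s \<in> strands a" for s by (rule strand_ends(1)[OF a that])
    then have "j >= 1" if "Cup i j \<in> strands a \<or> Ray j \<in> strands a" for i j using that by fastforce
    then show ?thesis unfolding labelled_below_def by fastforce
  qed
  ultimately have "good_path a 0 (%_ _. qmat) (%_ _. axis 1 1) (%_ _. axis 2 1)"
    unfolding good_path_def by (simp add: polyfun_const rank_one_qmat axis_eq_0_iff)
  moreover have "adapted 0 \<pi> u y" for \<pi> u y unfolding adapted_def by simp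
  ultimately show ?case by blast
next
  case (Suc n)
  then obtain \<pi> w w' u u' where G: "good_path a n \<pi> w w'" and ad: "adapted n (\<pi> 0) u v" and ad': "adapted n (\<pi> 1) u' v'"
    by auto
  obtain \<alpha> where \<alpha>: "\<alpha> ~= 0" "Kpi (\<pi> 0) 1 (Suc n) (\<iota> (v (Suc n))) = delta 0 \<alpha>"
    using adapted_next[OF v(1) _ ad Suc.prems] v(2) unfolding incident_flags_def by blast
  obtain \<alpha>' where \<alpha>': "\<alpha>' ~= 0" "Kpi (\<pi> 1) 1 (Suc n) (\<iota> (v' (Suc n))) = delta 0 \<alpha>'"
    using adapted_next[OF v'(1) _ ad' Suc.prems] v'(2) unfolding incident_flags_def by blast
  have "\<exists>p y y'. (\<forall>r c. polyfun (%s. p s $ r $ c)) & (\<forall>r. polyfun (%s. y s $ r)) & (\<forall>r. polyfun (%s. y' s $ r)) &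
      (\<forall>s. rank_one (p s) & y s ~= 0 & p s *v y s = y s & y' s ~= 0 & p s *v y' s = 0) &
      p 0 *v \<alpha> = \<alpha> & p 1 *v \<alpha>' = \<alpha>' & (\<forall>t\<in>strands a. right_end t = Suc n --> (\<forall>s. p s = forced a (\<pi> s) t))"
  proof (cases "\<exists>t\<in>strands a. right_end t = Suc n")
    case True
    then obtain t where t: "t \<in> strands a" "right_end t = Suc n" by blast
    have "forced a (\<pi> 0) t *v \<alpha> = \<alpha>"
      by (rule strand_forced[OF a t Z[OF t(1)] good_pathD(4)[OF G] good_pathD(9)[OF G] v(1) v(3)[OF t(1)] ad \<alpha>])
    moreover have "forced a (\<pi> 1) t *v \<alpha>' = \<alpha>'"
      by (rule strand_forced[OF a t Z[OF t(1)] good_pathD(4)[OF G] good_pathD(9)[OF G] v'(1) v'(3)[OF t(1)] ad' \<alpha>'])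
    moreover have "t' = t" if "t' \<in> strands a" "right_end t' = Suc n" for t'
      using strand_ends(4)[OF a t(1) that(1)] that(2) t(2) by simp
    then have "\<forall>t'\<in>strands a. right_end t' = Suc n --> (\<forall>s. forced a (\<pi> s) t = forced a (\<pi> s) t')" by blast
    ultimately show ?thesis
      using forced_path[OF G, of t] by (intro exI[of _ "%s. forced a (\<pi> s) t"]) blast
  next
    case False
    from rank_one_path[OF \<alpha>(1) \<alpha>'(1)] obtain p y y' where P:
      "(\<forall>r c. polyfun (%s. p s $ r $ c)) & (\<forall>r. polyfun (%s. y s $ r)) & (\<forall>r. polyfun (%s. y' s $ r)) &
      (\<forall>s. rank_one (p s) & y s ~= 0 & p s *v y s = y s & y' s ~= 0 & p s *v y' s = 0) &
      p 0 *v \<alpha> = \<alpha> & p 1 *v \<alpha>' = \<alpha>'"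
      by (elim exE) (rule that)
    have "\<forall>t\<in>strands a. right_end t = Suc n --> (\<forall>s. p s = forced a (\<pi> s) t)" using False by blast
    with P show ?thesis
      by (elim conjE) (intro exI[of _ p] exI[of _ y] exI[of _ y'] conjI; assumption)
  qed
  then obtain p y y' where p: "\<And>r c. polyfun (%s. p s $ r $ c)" "\<And>r. polyfun (%s. y s $ r)" "\<And>r. polyfun (%s. y' s $ r)"
      "\<And>s. rank_one (p s) & y s ~= 0 & p s *v y s = y s & y' s ~= 0 & p s *v y' s = 0"
      "p 0 *v \<alpha> = \<alpha>" "p 1 *v \<alpha>' = \<alpha>'" "\<And>t s. t \<in> strands a ==> right_end t = Suc n ==> p s = forced a (\<pi> s) t"
    by blast
  have "good_path a (Suc n) (%s. (\<pi> s)(Suc n := p s)) (%s. (w s)(Suc n := y s)) (%s. (w' s)(Suc n := y' s))"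
    by (rule good_path_upd[OF G a p(1-4) p(7)])
  moreover have "adapted (Suc n) ((\<pi> 0)(Suc n := p 0)) (u(Suc n := \<alpha>)) v"
    by (rule adapted_upd[OF ad \<alpha>(2) _ \<alpha>(1) p(5)]) (simp add: p(4))
  moreover have "adapted (Suc n) ((\<pi> 1)(Suc n := p 1)) (u'(Suc n := \<alpha>')) v'"
    by (rule adapted_upd[OF ad' \<alpha>'(2) _ \<alpha>'(1) p(6)]) (simp add: p(4))
  ultimately show ?case by (intro exI conjI)
qed

lemma polyfun_mat_mult: "(\<And>r c. polyfun (%s. p s $ r $ c)) ==> (\<And>r. polyfun (%s. y s $ r)) ==> polyfun (%s. (p s *v y s) $ (r :: 2))"
  for p :: "complex => complex ^ 2 ^ 2"
  unfolding mat2_mult_nth by (intro polyfun_intros)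

lemma polyfun_foldr_Pop:
  assumes p: "\<And>l r c. polyfun (%s. \<pi> s l $ r $ c)" and y: "\<And>i r. polyfun (%s. y s i $ r)"
  shows "polyfun (%s. foldr Pop (map (\<pi> s) ls) (y s) i $ r)"
proof (induction ls arbitrary: i r)
  case (Cons l ls)
  show ?case
  proof (cases "i = 0")
    case True
    then show ?thesis by (simp add: Pop_def[of _ "foldr Pop _ _"], intro polyfun_diff polyfun_mat_mult Cons p)
  next
    case False
    then show ?thesis by (simp add: Pop_def[of _ "foldr Pop _ _"], intro polyfun_add polyfun_diff polyfun_mat_mult Cons p)
  qed
qed (simp add: y)

lemma polyfun_frame_vec:
  assumes p: "\<And>l r c. polyfun (%s. \<pi> s l $ r $ c)" and w: "\<And>i r. polyfun (%s. w s i $ r)" and i: "i \<in> {1..m}"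
  shows "polyfun (%s. frame_vec (\<pi> s) (w s) i $ b)"
proof -
  obtain E E' where E: "\<And>y. \<rho> y = (\<Sum>i<2 * m - k. y i $ 1 *s E i) + (\<Sum>i<k. y i $ 2 *s E' i)"
    using rho_sum by blast
  have "polyfun (%s. delta 0 (w s i) l $ r)" for l r by (cases "l = 0") (simp_all add: delta_def w polyfun_const)
  note q = polyfun_foldr_Pop[OF p this, where ls = "[1..<i]"]
  have "polyfun (%s. \<rho> (foldr Pop (map (\<pi> s) [1..<i]) (delta 0 (w s i))) $ b)"
    unfolding E vector_add_component sum_component vector_smult_component by (intro polyfun_intros q)
  then show ?thesis using i by (simp add: frame_vec_def)
qed

section \<open>The images of the S_a as closed irreducible sets\<close>

definition component_flags :: "cup_diagram => (nat => (complex ^ 'n) set) set" where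
  "component_flags a = flag_map ` sphere_component m a"

lemma forced_point:
  assumes "s \<in> strands a"
  shows "\<exists>y. sphere_proj y = forced a (labels X) s"
proof (cases s)
  case (Cup i j)
  then show ?thesis by (cases "Cup i j \<in> dotted a") (auto simp flip: sphere_proj_uminus)
next
  case (Ray i)
  then show ?thesis using ray_label_pole[of a i] by auto
qed

text \<open>From left to right, each strand condition fixes the line at the right end of the strand.
  The labels of a point and those forced by them are orthogonal projections, so equal lines give
  equal labels and the point obeys the diagram.\<close>

lemma component_flags_eq:
  assumes a: "a \<in> cup_diagrams m k" and Z: "\<And>s. s \<in> strands a ==> strand_variety a s (Z s)"
  shows "component_flags a = springer_fiber m \<beta> x \<inter> {F. \<forall>s\<in>strands a. F \<in> Z s}"
proof (intro subset_antisym subsetI)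
  note A = cup_diagramsD(1)[OF a]
  fix F assume "F \<in> component_flags a"
  then obtain X where X: "X \<in> sphere_component m a" "F = flag_map X" unfolding component_flags_def by blast
  have fib: "X \<in> topological_springer_fiber m k" using X(1) a unfolding topological_springer_fiber_def by blast
  have F: "F \<in> springer_fiber m \<beta> x" unfolding X(2) by (rule flag_map_springer[OF fib])
  have "labelled uminus pole_p (- pole_p) pole_q a X" using X(1) unfolding sphere_component_labelled by blast
  note l = labelled_imp_below[OF labelled_sphere_proj[OF this]]
  have "ker_flag (labels X) \<in> flags m" using F unfolding X(2) flag_map_def springer_fiber_def by blast
  note fl = this
  have rk: "\<forall>i. 1 <= i --> i <= m --> rank_one (labels X i)" using fiberD(2)[OF fib] by blast
  have "F \<in> Z s" if "s \<in> strands a" for s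
    unfolding X(2) flag_map_def by (rule strand_varietyD(2)[OF Z[OF that] rk l fl])
  then show "F \<in> springer_fiber m \<beta> x \<inter> {F. \<forall>s\<in>strands a. F \<in> Z s}" using F by blast
next
  note A = cup_diagramsD(1)[OF a]
  fix F assume F: "F \<in> springer_fiber m \<beta> x \<inter> {F. \<forall>s\<in>strands a. F \<in> Z s}"
  define X where "X = point_of F"
  have fib: "X \<in> topological_springer_fiber m k" and FX: "flag_map X = F"
    unfolding X_def using flag_map_point_of F by blast+
  obtain u where u': "\<forall>i. 1 <= i --> i <= m --> u i ~= 0 & sphere_proj (X i) *v u i = u i"
    using fiber_image_vectors[OF fib] ..
  note u = u'[rule_format]
  let ?v = "frame_vec (labels X) u"
  have ad: "adapted m (labels X) u ?v" by (rule fiber_adapted(1)[OF fib], erule u, assumption)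
  have v: "?v \<in> frames m" by (rule fiber_adapted(2)[OF fib], erule u, assumption)
  have fl: "flag_of m ?v = F" unfolding FX[symmetric] by (rule fiber_adapted(3)[OF fib], erule u, assumption)
  have r: "\<forall>i. 1 <= i --> i <= m --> rank_one (labels X i)" using fiberD(2)[OF fib] by blast
  have step: "labels X (right_end s) = forced a (labels X) s" if s: "s \<in> strands a" and l: "labelled_below a (right_end s) (labels X)" for s
  proof -
    note e = strand_ends(1,2)[OF A s]
    have "flag_of m ?v \<in> Z s" unfolding fl using F s by blast
    from strand_varietyD(3)[OF Z[OF s] r l v this adapted_mono[OF ad e(2)]]
    have "forced a (labels X) s *v u (right_end s) = u (right_end s)" .
    moreover obtain y where y: "sphere_proj y = forced a (labels X) s" using forced_point[OF s] ..
    ultimately have "sphere_proj y *v u (right_end s) = u (right_end s)" by simp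
    then have "X (right_end s) = y"
      using sphere_proj_eqI[of "X (right_end s)" "u (right_end s)" y] u[OF e] by blast
    then show ?thesis using y by simp
  qed
  have "labelled_below a e (labels X)" for e
  proof (induction e)
    case 0
    show ?case unfolding labelled_below_def by simp
  next
    case (Suc e)
    show ?case
    proof (rule labelled_below_Suc[OF A Suc])
      fix s assume "s \<in> strands a" "right_end s = e"
      then show "labels X e = forced a (labels X) s" using step[of s] Suc by simp
    qed
  qed
  then have f: "labels X (right_end s) = forced a (labels X) s" if "s \<in> strands a" for s using step that by blast
  have inj: "y = z" if eq: "sphere_proj y = sphere_proj z" and y: "y \<in> sphere 0 1" for y z
  proof -
    obtain b where b: "b ~= 0" "sphere_proj y *v b = b" by (rule rank_one_image_nonzero[OF rank_one_sphere_proj[OF y]])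
    show ?thesis by (rule sphere_proj_eqI[OF b(2) _ b(1)]) (use b(2) eq in simp)
  qed
  have S: "X i \<in> sphere 0 1" if "Cup i j \<in> strands a \<or> Cup j i \<in> strands a \<or> Ray i \<in> strands a" for i j
  proof -
    have "1 <= i & i <= m" using that combinatorial_diagramD(1)[OF A] by (elim disjE) force+
    then show ?thesis using fiberD(1)[OF fib] by blast
  qed
  have "labelled uminus pole_p (- pole_p) pole_q a X"
    unfolding labelled_def
  proof (intro conjI allI impI)
    fix i j assume C: "Cup i j \<in> strands a"
    have "sphere_proj (X j) = sphere_proj (if Cup i j \<in> dotted a then X i else - X i)"
      using f[OF C] by (simp add: sphere_proj_uminus)
    then have "X j = (if Cup i j \<in> dotted a then X i else - X i)" by (rule inj) (use S C in blast)
    then show "X i = (if Cup i j \<in> dotted a then X j else - X j)" by simp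
  next
    fix i assume R: "Ray i \<in> strands a"
    have "sphere_proj (X i) = sphere_proj (if Ray i \<in> dotted a then pole_p else if \<forall>j. Ray j \<in> strands a --> j <= i then - pole_p else pole_q)"
      using f[OF R] by (simp only: forced.simps right_end.simps ray_label_def if_distrib[of sphere_proj] sphere_proj_poles)
    then show "X i = (if Ray i \<in> dotted a then pole_p else if \<forall>j. Ray j \<in> strands a --> j <= i then - pole_p else pole_q)"
      by (rule inj) (use S R in blast)
  qed
  moreover have "X \<in> {1..m} \<rightarrow>\<^sub>E sphere 0 1" using fib unfolding topological_springer_fiber_iff by blast
  ultimately have "X \<in> sphere_component m a" unfolding sphere_component_labelled by blast
  then show "F \<in> component_flags a" unfolding component_flags_def using FX by blast
qed

lemma strand_varieties:
  assumes a: "a \<in> cup_diagrams m k"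
  obtains Z where "\<forall>s. s \<in> strands a --> strand_variety a s (Z s)"
proof -
  have "\<forall>s. \<exists>Z. s \<in> strands a --> strand_variety a s Z" using strand_variety_exists[OF cup_diagramsD(1)[OF a]] by blast
  from choice[OF this] show ?thesis using that by blast
qed

lemma component_closed:
  assumes a: "a \<in> cup_diagrams m k"
  shows "closedin (subtopology (zariski_flag_topology m) (springer_fiber m \<beta> x)) (component_flags a)"
proof -
  obtain Z where Z: "\<forall>s. s \<in> strands a --> strand_variety a s (Z s)" using strand_varieties[OF a] .
  let ?C = "\<Inter> (insert (topspace (zariski_flag_topology m)) (Z ` strands a))"
  have "closedin (zariski_flag_topology m) ?C"
  proof (rule closedin_Inter)
    fix S assume "S \<in> insert (topspace (zariski_flag_topology m)) (Z ` strands a)"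
    then show "closedin (zariski_flag_topology m) S"
      using Z closedin_topspace unfolding strand_variety_def by blast
  qed simp
  moreover have eq: "component_flags a = springer_fiber m \<beta> x \<inter> {F. \<forall>s\<in>strands a. F \<in> Z s}"
    by (rule component_flags_eq[OF a]) (erule Z[rule_format])
  have "component_flags a = ?C \<inter> springer_fiber m \<beta> x"
    unfolding eq by (auto simp: springer_fiber_def)
  ultimately show ?thesis unfolding closedin_subtopology by blast
qed

text \<open>The labels along a path obey the diagram, so their flags are isotropic and satisfy all
  strand conditions although the projections are oblique. The characterization by strand varieties
  then returns these flags to the component without naming their points.\<close>

lemma component_irreducible:
  assumes a: "a \<in> cup_diagrams m k"
  shows "irreducible_in (subtopology (zariski_flag_topology m) (springer_fiber m \<beta> x)) (component_flags a)"
proof (rule irreducible_by_curves)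
  obtain Z where Z': "\<forall>s. s \<in> strands a --> strand_variety a s (Z s)" using strand_varieties[OF a] .
  note Z = Z'[rule_format]
  note A = cup_diagramsD(1)[OF a]
  have eq: "component_flags a = springer_fiber m \<beta> x \<inter> {F. \<forall>s\<in>strands a. F \<in> Z s}"
    by (rule component_flags_eq[OF a]) (erule Z)
  show "component_flags a \<subseteq> springer_fiber m \<beta> x" unfolding eq by blast
  show "springer_fiber m \<beta> x \<subseteq> flags m" unfolding springer_fiber_def by blast
  show "component_flags a ~= {}" unfolding component_flags_def using sphere_component_generic[OF A] by blast
  fix P Q assume PQ: "P \<in> component_flags a" "Q \<in> component_flags a"
  have fl: "P \<in> flags m" "Q \<in> flags m" using PQ unfolding eq springer_fiber_def by blast+
  obtain v where v: "v \<in> frames m" "flag_of m v = P" using fl(1) by (rule flag_of_surj)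
  obtain v' where v': "v' \<in> frames m" "flag_of m v' = Q" using fl(2) by (rule flag_of_surj)
  have inc: "P \<in> incident_flags" "Q \<in> incident_flags" using PQ springer_subset_incident unfolding eq by blast+
  have PZ: "P \<in> Z s" "Q \<in> Z s" if "s \<in> strands a" for s using PQ that unfolding eq by blast+
  obtain \<pi> w w' u u' where G: "good_path a m \<pi> w w'" and ad: "adapted m (\<pi> 0) u v" "adapted m (\<pi> 1) u' v'"
    using good_path_exists[OF A Z v(1) _ _ v'(1) _ _ order_refl] inc PZ unfolding v(2) v'(2) by blast
  define W where "W s = frame_vec (\<pi> s) (w s)" for s
  have iso: "isotropic_label (\<pi> s)" for s
    by (rule labelled_isotropic[OF cup_diagramsD[OF a] k1 km kodd]) (simp_all add: good_pathD(4,9)[OF G])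
  have adW: "adapted m (\<pi> s) (w s) (W s)" for s
    unfolding W_def by (rule adapted_frame_vec(1)[OF _ _ iso]) (simp_all add: good_pathD[OF G])
  have ext: "W s \<in> extensional {1..m}" for s by (simp add: W_def frame_vec_def)
  have W: "W s \<in> frames m" "flag_of m (W s) = ker_flag (\<pi> s)" for s
    by (rule adapted_flag(1)[OF adW ext]) (rule adapted_flag(2)[OF adW ext])
  have "ker_flag (\<pi> s) \<in> component_flags a" for s
  proof -
    have S: "ker_flag (\<pi> s) \<in> springer_fiber m \<beta> x" by (rule ker_flag_springer[OF good_pathD(4)[OF G] iso])
    have "\<forall>i. 1 <= i --> i <= m --> rank_one (\<pi> s i)" using good_pathD(4)[OF G] by blast
    moreover have "ker_flag (\<pi> s) \<in> flags m" using S unfolding springer_fiber_def by blast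
    ultimately have "ker_flag (\<pi> s) \<in> Z t" if "t \<in> strands a" for t
      by (rule strand_varietyD(2)[OF Z[OF that] _ good_pathD(9)[OF G]])
    then show ?thesis using S unfolding eq by blast
  qed
  moreover have ext_v: "v \<in> extensional {1..m}" "v' \<in> extensional {1..m}" using v(1) v'(1) unfolding frames_def by blast+
  have "flag_of m (W 0) = P" "flag_of m (W 1) = Q"
    using W(2) adapted_flag(2)[OF ad(1) ext_v(1)] adapted_flag(2)[OF ad(2) ext_v(2)] v(2) v'(2) by simp_all
  moreover have "polyfun (%s. W s i $ b)" if "i \<in> {1..m}" for i b
    unfolding W_def by (rule polyfun_frame_vec[OF good_pathD(1)[OF G] good_pathD(2)[OF G] that])
  ultimately show "\<exists>W. (\<forall>s. W s \<in> frames m) & (\<forall>i\<in>{1..m}. \<forall>a. polyfun (%s. W s i $ a)) &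
      (\<forall>s. flag_of m (W s) \<in> component_flags a) & flag_of m (W 0) = P & flag_of m (W 1) = Q"
    using W by (intro exI[of _ W]) auto
qed

text \<open>\<open>flag_map\<close> is injective on the fiber, with inverse \<open>point_of\<close>,
  so an inclusion between images comes from one between the S_a, which only equal diagrams
  allow.\<close>

lemma component_flags_irreducible_component:
  assumes a: "a \<in> cup_diagrams m k"
  shows "irreducible_component_of (subtopology (zariski_flag_topology m) (springer_fiber m \<beta> x)) (component_flags a)"
proof (rule irreducible_component_finite_cover[OF finite_cup_diagrams component_closed component_irreducible _ _ a])
  let ?T = "subtopology (zariski_flag_topology m) (springer_fiber m \<beta> x)"
  have top: "topspace ?T = springer_fiber m \<beta> x" by (auto simp: springer_fiber_def)
  have "springer_fiber m \<beta> x = flag_map ` topological_springer_fiber m k"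
  proof (intro subset_antisym subsetI)
    fix F assume F: "F \<in> springer_fiber m \<beta> x"
    have "F = flag_map (point_of F)" by (rule flag_map_point_of(2)[OF F, symmetric])
    then show "F \<in> flag_map ` topological_springer_fiber m k" using flag_map_point_of(1)[OF F] by (rule image_eqI)
  qed (use flag_map_springer in blast)
  then show "topspace ?T = (\<Union>b\<in>cup_diagrams m k. component_flags b)"
    unfolding top topological_springer_fiber_def component_flags_def by blast
  fix a b assume ab: "a \<in> cup_diagrams m k" "b \<in> cup_diagrams m k" "component_flags a \<subseteq> component_flags b"
  have "sphere_component m a \<subseteq> sphere_component m b"
  proof
    fix X assume X: "X \<in> sphere_component m a"
    have "flag_map X \<in> component_flags b" using X ab(3) unfolding component_flags_def by blast
    then obtain Y where Y: "Y \<in> sphere_component m b" "flag_map X = flag_map Y" unfolding component_flags_def by blast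
    have "X \<in> topological_springer_fiber m k" "Y \<in> topological_springer_fiber m k"
      using X Y(1) ab unfolding topological_springer_fiber_def by blast+
    then have "X = Y" using point_of_flag_map Y(2) by metis
    then show "X \<in> sphere_component m b" using Y(1) by simp
  qed
  then show "a = b" by (rule sphere_component_antichain[OF ab(1,2)])
qed

end

theorem theorem1:
  fixes m k :: nat
    and \<beta> :: "complex ^ 'n \<Rightarrow> complex ^ 'n \<Rightarrow> complex"
    and x :: "complex ^ 'n \<Rightarrow> complex ^ 'n"
  assumes "CARD('n) = 2 * m"
    and "1 \<le> k" and "k \<le> m" and "k = m \<or> odd k"
    and "nondegenerate_symmetric_form \<beta>"
    and "nilpotent_two_blocks x (2 * m - k) k"
    and "\<And>v w. \<beta> (x v) w = - \<beta> v (x w)"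
  shows "\<exists>h. homeomorphic_map
               (subtopology (sphere_product m) (topological_springer_fiber m k))
               (subtopology (flag_topology m) (springer_fiber m \<beta> x)) h \<and>
             (\<forall>a\<in>cup_diagrams m k.
                irreducible_component_of
                  (subtopology (zariski_flag_topology m) (springer_fiber m \<beta> x))
                  (h ` sphere_component m a))"
proof -
  have lin: "Vector_Spaces.linear (*s) (*s) x"
    using assms(6) unfolding nilpotent_two_blocks_def by (rule conjunct1)
  interpret skew_form \<beta> x
    by (rule skew_form.intro[OF assms(5) lin assms(7)])
  have card: "(2 * m - k) + k = CARD('n)" using assms(1,3) by simp
  have "\<exists>\<iota> \<rho>. model (2 * m - k) k (springer_form m k) \<iota> \<rho>"
  proof (cases "odd k")
    case True
    have "k \<le> 2 * m - k" using assms(3) by linarith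
    moreover have "odd (2 * m - k)" using True assms(3) by presburger
    moreover have "(-1) ^ (m - k) * (-1) ^ (m - k) = (1 :: complex)" by (simp add: power_mult_distrib[symmetric])
    ultimately have "\<exists>\<iota> \<rho>. model (2 * m - k) k (form_odd ((-1) ^ (m - k)) (2 * m - k) k) \<iota> \<rho>"
      using model_exists_odd[OF assms(6) card assms(2)] True by blast
    then show ?thesis using True by (simp add: springer_form_def)
  next
    case False
    then have km: "k = m" using assms(4) by blast
    then have mk: "2 * m - k = m" by simp
    have "\<exists>\<iota> \<rho>. model m m (form_even m) \<iota> \<rho>"
      by (rule model_exists_even) (use assms(2,6) card False in \<open>simp_all add: mk km\<close>)
    then show ?thesis using False by (simp add: springer_form_def mk km)
  qed
  then obtain \<iota> \<rho> where M: "model (2 * m - k) k (springer_form m k) \<iota> \<rho>" by blast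
  note M' = M[unfolded model_def]
  note M1 = M'[THEN conjunct1] and M2 = M'[THEN conjunct2]
  note M2' = M2[THEN conjunct1] and M3 = M2[THEN conjunct2]
  note M3' = M3[THEN conjunct1] and M4 = M3[THEN conjunct2]
  note M4' = M4[THEN conjunct1] and M5 = M4[THEN conjunct2]
  note M5' = M5[THEN conjunct1] and M6 = M5[THEN conjunct2]
  note M6' = M6[THEN conjunct1] and M7 = M6[THEN conjunct2]
  interpret springer_model m k \<beta> x \<iota> \<rho>
    by unfold_locales (rule assms(2), rule assms(3), rule assms(4), rule M1[rule_format], rule M2'[rule_format],
      rule M4'[rule_format], assumption, rule M5'[rule_format], rule M3'[rule_format], rule M6', rule M7[rule_format])
  show ?thesis
  proof (intro exI[of _ flag_map] conjI ballI)
    show "homeomorphic_map (subtopology (sphere_product m) (topological_springer_fiber m k))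
        (subtopology (flag_topology m) (springer_fiber m \<beta> x)) flag_map"
      by (rule homeomorphic_flag_map)
    fix a assume "a \<in> cup_diagrams m k"
    from component_flags_irreducible_component[OF this]
    show "irreducible_component_of (subtopology (zariski_flag_topology m) (springer_fiber m \<beta> x))
        (flag_map ` sphere_component m a)"
      unfolding component_flags_def .
  qed
qed

end
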